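(* Let $\alpha\in\mathcal D$ and let $f$ be a roof function of Arnol'd type. Then the centralizer of the special flow $(X^f,(T^f_t)_{t\in\mathbb R},\mu^f)$ built over $R_\alpha$ and under $f$ consists exactly of the maps $T^f_{t_0}$ with $t_0\in\mathbb R$: every automorphism $\phi$ of $(X^f,\mu^f)$ such that $\phi\circ T^f_t=T^f_t\circ\phi$ for all $t\in\mathbb R$ (mod null sets) coincides $\mu^f$-a.e. with $T^f_{t_0}$ for some $t_0\in\mathbb R$.
   Context: Rotation. $\mathbb T=\mathbb R/\mathbb Z$ with Haar measure $\lambda$, $R_\alpha x=x+\alpha$; for irrational $\alpha\in(0,1)$, $(q_n)$ is the sequence of denominators of the continued fraction convergents of $\alpha$. Class $\mathcal D$. An irrational $\alpha\in(0,1)$ is in $\mathcal D$ if (conditions being imposed only for indices with $q_n\ge 2$): (1) with $K_\alpha=\{n: q_{n+1}<q_n\log^{7/8}q_n\}$ one has $\sum_{i\notin K_\alpha}\log^{-7/8}q_i<\infty$; (2) there is a constant $C_\alpha$ with $q_{n+1}<C_\alpha q_n\log^{3/2}q_n$ for every $n$; (3) there is an infinite strictly increasing sequence $(n_k)_{k\ge1}$ with $q_{n_k+1}\ge q_{n_k}\log q_{n_k}\log\log q_{n_k}$. Roof function of Arnol'd type. $f(x)=-A_-\log x-A_+\log(1-x)+g(x)$ for $x\in(0,1)$, where $A_->A_+\ge0$ and $g\in C^2(\mathbb T)$, such that $f\ge a$ for some constant $a>0$ and $\int_{\mathbb T}f\,d\lambda=1$ (the value at $0$ is immaterial). Special flow.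 $X^f=\{(x,s):x\in\mathbb T,\ 0\le s<f(x)\}$, $\mu^f$ is the (normalized) restriction of $\lambda\times$Lebesgue to $X^f$, and $T^f_t(x,s)=(R_\alpha^m x,\ s+t-f^{(m)}(x))$ where $m\in\mathbb Z$ is the unique integer with $f^{(m)}(x)\le s+t<f^{(m+1)}(x)$; here $f^{(m)}(x)=\sum_{j=0}^{m-1}f(R_\alpha^jx)$ for $m>0$, $f^{(0)}=0$, $f^{(m)}(x)=-\sum_{j=m}^{-1}f(R_\alpha^jx)$ for $m<0$. *)

theory Defs
  imports "HOL-Analysis.Analysis"
begin

(* The circle R/Z is represented by its fundamental domain {0..<1} with Lebesgue measure;
   functions on the circle are functions real => real of which only the values on {0..<1}
   matter, or, when regularity is required, 1-periodic functions on the line. *)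

definition rotation :: "real \<Rightarrow> real \<Rightarrow> real" where
  "rotation \<alpha> x = frac (x + \<alpha>)"

(* The j-th power of the rotation by \<alpha>, for every integer j, is the rotation by j * \<alpha>. *)
definition rotation_pow :: "real \<Rightarrow> int \<Rightarrow> real \<Rightarrow> real" where
  "rotation_pow \<alpha> j = rotation (of_int j * \<alpha>)"

(* For irrational \<alpha> in (0,1), \<alpha> = [0; a_1, a_2, ...]: cf_rem \<alpha> n is the n-th iterate of the
   Gauss map x |-> frac (1/x) at \<alpha>, and cf_digit \<alpha> n is the partial quotient a_(n+1). *)
fun cf_rem :: "real \<Rightarrow> nat \<Rightarrow> real" where
  "cf_rem \<alpha> 0 = \<alpha>"
| "cf_rem \<alpha> (Suc n) = frac (1 / cf_rem \<alpha> n)"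

definition cf_digit :: "real \<Rightarrow> nat \<Rightarrow> nat" where
  "cf_digit \<alpha> n = nat \<lfloor>1 / cf_rem \<alpha> n\<rfloor>"

fun cf_denom :: "real \<Rightarrow> nat \<Rightarrow> nat" where
  "cf_denom \<alpha> 0 = 1"
| "cf_denom \<alpha> (Suc 0) = cf_digit \<alpha> 0"
| "cf_denom \<alpha> (Suc (Suc n)) =
     cf_digit \<alpha> (Suc n) * cf_denom \<alpha> (Suc n) + cf_denom \<alpha> n"

definition K_set :: "real \<Rightarrow> nat set" where
  "K_set \<alpha> = {n. real (cf_denom \<alpha> (Suc n))
                 < real (cf_denom \<alpha> n) * ln (real (cf_denom \<alpha> n)) powr (7/8)}"

definition class_D :: "real set" where
  "class_D = {\<alpha>. \<alpha> \<in> {0<..<1} \<and> \<alpha> \<notin> \<rat> \<and>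
     (\<lambda>i. ln (real (cf_denom \<alpha> i)) powr (- 7/8)) summable_on
        {i. i \<notin> K_set \<alpha> \<and> 2 \<le> cf_denom \<alpha> i} \<and>
     (\<exists>C. \<forall>n. 2 \<le> cf_denom \<alpha> n \<longrightarrow>
        real (cf_denom \<alpha> (Suc n))
          < C * real (cf_denom \<alpha> n) * ln (real (cf_denom \<alpha> n)) powr (3/2)) \<and>
     (\<exists>nk :: nat \<Rightarrow> nat. strict_mono nk \<and> (\<forall>k. 2 \<le> cf_denom \<alpha> (nk k) \<longrightarrow>
        real (cf_denom \<alpha> (Suc (nk k)))
          \<ge> real (cf_denom \<alpha> (nk k)) * ln (real (cf_denom \<alpha> (nk k)))
              * ln (ln (real (cf_denom \<alpha> (nk k))))))}"

definition C2_circle :: "(real \<Rightarrow> real) \<Rightarrow> bool" where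
  "C2_circle g \<longleftrightarrow> (\<forall>x. g (x + 1) = g x) \<and>
     (\<exists>g' g''. (\<forall>x. (g has_real_derivative g' x) (at x)) \<and>
               (\<forall>x. (g' has_real_derivative g'' x) (at x)) \<and>
               continuous_on UNIV g'')"

(* The value f 0 is an arbitrary number bounded below by the same a > 0. The Bochner integral
   of a non-integrable function is 0, so the last clause includes integrability. *)
definition arnold_roof :: "(real \<Rightarrow> real) \<Rightarrow> bool" where
  "arnold_roof f \<longleftrightarrow>
     (\<exists>Aminus Aplus g. Aminus > Aplus \<and> Aplus \<ge> 0 \<and> C2_circle g \<and>
        (\<forall>x\<in>{0<..<1}. f x = - Aminus * ln x - Aplus * ln (1 - x) + g x)) \<and>
     (\<exists>a>0. \<forall>x\<in>{0..<1}. f x \<ge> a) \<and>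
     (LINT x:{0..<1}|lborel. f x) = 1"

definition birkhoff_sum :: "real \<Rightarrow> (real \<Rightarrow> real) \<Rightarrow> int \<Rightarrow> real \<Rightarrow> real" where
  "birkhoff_sum \<alpha> f m x =
     (if m \<ge> 0 then (\<Sum>j\<in>{0..m - 1}. f (rotation_pow \<alpha> j x))
      else - (\<Sum>j\<in>{m..-1}. f (rotation_pow \<alpha> j x)))"

definition special_flow_space :: "(real \<Rightarrow> real) \<Rightarrow> (real \<times> real) set" where
  "special_flow_space f = {(x, s). x \<in> {0..<1} \<and> 0 \<le> s \<and> s < f x}"

(* Two-dimensional Lebesgue measure (the completed product measure) on the flow space. It has
   total mass equal to the integral of f, which is 1 for an arnold_roof, so no normalizing
   factor is needed. *)
definition special_flow_measure :: "(real \<Rightarrow> real) \<Rightarrow> (real \<times> real) measure" where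
  "special_flow_measure f = lebesgue_on (special_flow_space f)"

definition special_flow :: "real \<Rightarrow> (real \<Rightarrow> real) \<Rightarrow> real \<Rightarrow> real \<times> real \<Rightarrow> real \<times> real" where
  "special_flow \<alpha> f t = (\<lambda>(x, s).
     let m = (THE m. birkhoff_sum \<alpha> f m x \<le> s + t \<and> s + t < birkhoff_sum \<alpha> f (m + 1) x)
     in (rotation_pow \<alpha> m x, s + t - birkhoff_sum \<alpha> f m x))"

(* Measure-preserving maps that are invertible modulo null sets. *)
definition automorphism :: "'a measure \<Rightarrow> ('a \<Rightarrow> 'a) \<Rightarrow> bool" where
  "automorphism M \<phi> \<longleftrightarrow> \<phi> \<in> measurable M M \<and> distr M M \<phi> = M \<and>
     (\<exists>\<psi>\<in>measurable M M. (AE p in M. \<psi> (\<phi> p) = p) \<and> (AE p in M. \<phi> (\<psi> p) = p))"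

definition centralizer :: "'a measure \<Rightarrow> (real \<Rightarrow> 'a \<Rightarrow> 'a) \<Rightarrow> ('a \<Rightarrow> 'a) set" where
  "centralizer M T = {\<phi>. automorphism M \<phi> \<and> (\<forall>t. AE p in M. \<phi> (T t p) = T t (\<phi> p))}"

end

theory Submission
  imports Defs
begin

text \<open>
  A map in the centralizer sends \<open>(x, 0)\<close> to a point \<open>(Y x, V x)\<close> and commutes with the flow, so that
  \<open>Y (x + m \<alpha>) = Y x + k \<alpha>\<close> with \<open>V (x + m \<alpha>) = V x + bs m x - bs k (Y x)\<close>, where \<open>bs\<close> denotes Birkhoff sums of the roof.

  Step 1. The discrepancies \<open>bs (q n) x - bs (q n) (Y x)\<close> tend to 0 in probability. Otherwise, by Lusin
  continuity of \<open>Y\<close> and \<open>V\<close>, many points of an orbit of intermediate length would carry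
  Birkhoff sums of nonzero length and nearly the same value; the convexity of these sums near their
  singularities forbids this along a separated set.

  Step 2. The asymmetry of the logarithms makes \<open>bs (q n)\<close> decrease with slope of order \<open>q n ln (q n)\<close>
  between consecutive singularities. If \<open>q (n + 1)\<close> is much larger than \<open>q n ln (q n)\<close>, then Step 1 at the
  levels \<open>n\<close> and \<open>n + 1\<close> forces \<open>Y x = x + i \<alpha> + \<delta>\<close> with \<open>i\<close> small against \<open>q (n + 1) / ln (q n)\<close> and \<open>\<delta>\<close> small
  against \<open>1 / (q (n + 1) ln (q n))\<close>.

  Step 3. Follow such a match along an orbit of length \<open>q (n + 1)\<close>. The shift \<open>i\<close> becomes a varying index
  whose Birkhoff sum is locally nearly constant, so the sparseness statement of Step 1 bounds this
  index on a positive proportion of the orbit, independently of \<open>n\<close>. In the limit \<open>Y x\<close> lies on the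
  orbit of \<open>x\<close> with positive probability, hence almost surely, and the elapsed time is an invariant
  function, hence a constant \<open>t0\<close>.
\<close>

section \<open>Continued fraction denominators\<close>

text \<open>\<open>Y\<close> is merely measurable, so every estimate holds off a small exceptional
  set and at no prescribed point. What turns information at one point into information at many is
  the identity \<open>bs_swap\<close>: passing from \<open>x\<close> to
  \<open>x + j * \<alpha>\<close> changes \<open>bs Q\<close> only by the change of
  \<open>bs j\<close> under a displacement by \<open>Q * \<alpha>\<close>. For
  \<open>Q = q n\<close> this displacement is \<open>err n\<close>, at most
  \<open>1 / q (Suc n)\<close>, so a discrepancy that is not small reappears at every point of a
  shorter orbit. The scales of the matching come from the logarithm in the derivative: sums of
  length \<open>q n\<close> have slope of order \<open>q n * ln (q n)\<close>, so displacements by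
  \<open>err n\<close> are harmless to them when \<open>q (Suc n)\<close> exceeds a large multiple
  of this. In the same way an index \<open>i\<close> is admissible at the next level when
  \<open>i * ln i\<close> is small against \<open>q (Suc n)\<close>, and the same bound keeps the
  drift argument within the sparseness estimate. The final threshold on the index is fixed before
  the precision of the match, which makes the passage to the limit possible.\<close>

fun cf_numer :: "real \<Rightarrow> nat \<Rightarrow> nat" where
  "cf_numer \<alpha> 0 = 0"
| "cf_numer \<alpha> (Suc 0) = 1"
| "cf_numer \<alpha> (Suc (Suc n)) =
     cf_digit \<alpha> (Suc n) * cf_numer \<alpha> (Suc n) + cf_numer \<alpha> n"

text \<open>The sign is kept: consecutive errors alternate in sign, which excludes cancellation in
  \<open>best_approximation\<close>.\<close>

definition cf_err :: "real \<Rightarrow> nat \<Rightarrow> real" where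
  "cf_err \<alpha> n = real (cf_denom \<alpha> n) * \<alpha> - real (cf_numer \<alpha> n)"

locale irrational_rotation =
  fixes \<alpha> :: real
  assumes alpha_pos: "0 < \<alpha>" and alpha_less1: "\<alpha> < 1" and alpha_irrational: "\<alpha> \<notin> \<rat>"
begin

abbreviation q :: "nat \<Rightarrow> nat" where "q n \<equiv> cf_denom \<alpha> n"
abbreviation p :: "nat \<Rightarrow> nat" where "p n \<equiv> cf_numer \<alpha> n"
abbreviation err :: "nat \<Rightarrow> real" where "err n \<equiv> cf_err \<alpha> n"

lemma cf_rem_irrational: "cf_rem \<alpha> n \<notin> \<rat>"
proof (induction n)
  case 0
  then show ?case using alpha_irrational by simp
next
  case (Suc n)
  show ?case
  proof
    assume "cf_rem \<alpha> (Suc n) \<in> \<rat>"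
    then have "1 / cf_rem \<alpha> n \<in> \<rat>"
      by (simp add: frac_def) (metis Rats_add Rats_of_int diff_add_cancel)
    then have "1 / (1 / cf_rem \<alpha> n) \<in> \<rat>"
      using Rats_divide Rats_1 by blast
    then show False using Suc by simp
  qed
qed

lemma cf_rem_range: "0 < cf_rem \<alpha> n \<and> cf_rem \<alpha> n < 1"
proof (cases n)
  case 0
  then show ?thesis using alpha_pos alpha_less1 by simp
next
  case (Suc m)
  have "cf_rem \<alpha> n \<noteq> 0" using cf_rem_irrational[of n] by auto
  then show ?thesis using Suc frac_ge_0[of "1 / cf_rem \<alpha> m"] frac_lt_1[of "1 / cf_rem \<alpha> m"]
    by (simp add: less_le)
qed

lemma cf_digit_pos: "1 \<le> cf_digit \<alpha> n"
proof -
  have "1 \<le> 1 / cf_rem \<alpha> n" using cf_rem_range[of n] by simp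
  then have "1 \<le> \<lfloor>1 / cf_rem \<alpha> n\<rfloor>" by (simp add: le_floor_iff)
  then show ?thesis unfolding cf_digit_def by linarith
qed

lemma cf_digit_eq: "real (cf_digit \<alpha> n) = 1 / cf_rem \<alpha> n - cf_rem \<alpha> (Suc n)"
proof -
  have "0 \<le> \<lfloor>1 / cf_rem \<alpha> n\<rfloor>" using cf_rem_range[of n] by simp
  then show ?thesis by (simp add: cf_digit_def frac_def)
qed

lemma q_pos: "1 \<le> q n"
proof (induction n rule: less_induct)
  case (less n)
  show ?case
  proof (cases n)
    case 0 then show ?thesis by simp
  next
    case (Suc m)
    then show ?thesis
    proof (cases m)
      case 0 then show ?thesis using Suc cf_digit_pos[of 0] by simp
    next
      case (Suc k)
      then show ?thesis using less[of k] \<open>n = Suc m\<close> by simp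
    qed
  qed
qed

lemma q_Suc_ge: "q n \<le> q (Suc n)"
proof (cases n)
  case 0 then show ?thesis using q_pos[of 1] by simp
next
  case (Suc m)
  then show ?thesis using cf_digit_pos[of n] by (simp add: trans_le_add1)
qed

lemma q_Suc_less: "q (Suc n) < q (Suc (Suc n))"
proof -
  have "q (Suc n) + q n \<le> q (Suc (Suc n))" using cf_digit_pos[of "Suc n"] by simp
  then show ?thesis using q_pos[of n] by linarith
qed

lemma q_ge: "n \<le> q n"
proof (induction n)
  case (Suc n)
  then show ?case
  proof (cases n)
    case 0 then show ?thesis using q_pos[of 1] by simp
  next
    case (Suc m)
    then show ?thesis using Suc.IH q_Suc_less[of m] by simp
  qed
qed simp

text \<open>Numerators and denominators obey the same recursion, hence so does the error, and
  \<open>cf_digit_eq\<close> solves it. Alternating signs and decrease of the errors are read off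
  from this one formula.\<close>

lemma err_Suc: "err (Suc n) = - cf_rem \<alpha> (Suc n) * err n"
proof (induction n)
  case 0
  then show ?case using alpha_pos cf_digit_eq[of 0]
    by (simp add: cf_err_def field_simps)
next
  case (Suc n)
  have r: "cf_rem \<alpha> (Suc n) > 0" using cf_rem_range by blast
  have "err (Suc (Suc n)) = real (cf_digit \<alpha> (Suc n)) * err (Suc n) + err n"
    by (simp add: cf_err_def algebra_simps)
  also have "err n = - err (Suc n) / cf_rem \<alpha> (Suc n)" using Suc r by simp
  finally show ?case using r by (simp only: cf_digit_eq) (simp add: field_simps)
qed

lemma err_nz: "err n \<noteq> 0"
proof (induction n)
  case 0 then show ?case using alpha_pos by (simp add: cf_err_def)
next
  case (Suc n)
  then show ?case using cf_rem_range[of "Suc n"] by (simp add: err_Suc del: cf_rem.simps)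
qed

lemma err_sgn: "err n * err (Suc n) < 0"
proof -
  have "err n * err (Suc n) = - (cf_rem \<alpha> (Suc n) * (err n)\<^sup>2)" by (simp add: err_Suc power2_eq_square del: cf_rem.simps)
  moreover have "0 < cf_rem \<alpha> (Suc n) * (err n)\<^sup>2" using err_nz[of n] cf_rem_range[of "Suc n"] by (simp del: cf_rem.simps)
  ultimately show ?thesis by linarith
qed

lemma err_decr: "\<bar>err (Suc n)\<bar> < \<bar>err n\<bar>"
  using cf_rem_range[of "Suc n"] err_nz[of n] by (simp add: err_Suc abs_mult del: cf_rem.simps)

lemma cf_det: "int (q (Suc n)) * int (p n) - int (q n) * int (p (Suc n)) = (- 1) ^ Suc n"
proof (induction n)
  case 0 then show ?case by simp
next
  case (Suc n)
  have "int (q (Suc (Suc n))) * int (p (Suc n)) - int (q (Suc n)) * int (p (Suc (Suc n)))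
     = - (int (q (Suc n)) * int (p n) - int (q n) * int (p (Suc n)))"
    by (simp add: algebra_simps)
  then show ?case using Suc by simp
qed

lemma p_q_coprime: "coprime (p n) (q n)"
proof -
  have "coprime (int (p n)) (int (q n))"
  proof (rule coprimeI)
    fix c assume "c dvd int (p n)" "c dvd int (q n)"
    then have "c dvd int (q (Suc n)) * int (p n) - int (q n) * int (p (Suc n))" by auto
    then have "c dvd (- 1) ^ Suc n" by (simp only: cf_det)
    then show "is_unit c" by (metis dvd_minus_iff is_unit_power_iff minus_one_mult_self dvd_mult_left dvd_triv_left power_mult_distrib dvd_trans)
  qed
  then show ?thesis by simp
qed

text \<open>By \<open>cf_det\<close> the combination
  \<open>q (Suc n) * err n - q n * err (Suc n)\<close> is plus or minus 1, and the opposite signs of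
  the errors turn it into a sum of absolute values. Both bounds \<open>err_le\<close> and
  \<open>err_ge\<close> follow.\<close>

lemma err_id: "real (q (Suc n)) * \<bar>err n\<bar> + real (q n) * \<bar>err (Suc n)\<bar> = 1"
proof -
  have "real (q (Suc n)) * err n - real (q n) * err (Suc n)
      = - of_int (int (q (Suc n)) * int (p n) - int (q n) * int (p (Suc n)))"
    by (simp add: cf_err_def algebra_simps)
  also have "\<dots> = (-1) ^ n" by (simp only: cf_det) simp
  finally have e: "\<bar>real (q (Suc n)) * err n - real (q n) * err (Suc n)\<bar> = 1" by (simp add: power_abs)
  have nn: "0 \<le> real (q n)" "0 \<le> real (q (Suc n))" by simp_all
  consider "err n > 0" "err (Suc n) < 0" | "err n < 0" "err (Suc n) > 0"
    using err_sgn[of n] by (auto simp: mult_less_0_iff)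
  then show ?thesis
  proof cases
    case 1
    then have "0 \<le> real (q (Suc n)) * err n" "real (q n) * err (Suc n) \<le> 0"
      by (simp_all add: mult_nonneg_nonpos)
    then show ?thesis using e by (simp only: abs_of_pos[OF 1(1)] abs_of_neg[OF 1(2)])
  next
    case 2
    then have "real (q (Suc n)) * err n \<le> 0" "0 \<le> real (q n) * err (Suc n)"
      by (simp_all add: mult_nonneg_nonpos)
    then show ?thesis using e by (simp only: abs_of_neg[OF 2(1)] abs_of_pos[OF 2(2)])
  qed
qed

lemma err_le: "\<bar>err n\<bar> \<le> 1 / real (q (Suc n))"
  using err_id[of n] q_pos[of "Suc n"] by (simp add: field_simps)
    (smt (verit) mult_nonneg_nonneg of_nat_0_le_iff abs_ge_zero)

lemma err_ge: "1 / (2 * real (q (Suc n))) \<le> \<bar>err n\<bar>"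
proof -
  have "real (q n) * \<bar>err (Suc n)\<bar> \<le> real (q (Suc n)) * \<bar>err n\<bar>"
    using err_decr[of n] q_Suc_ge[of n] by (intro mult_mono) auto
  then have "1 \<le> 2 * real (q (Suc n)) * \<bar>err n\<bar>" using err_id[of n] by linarith
  then show ?thesis using q_pos[of "Suc n"] by (simp add: field_simps)
qed

text \<open>The pairs \<open>(q n, p n)\<close> and \<open>(q (Suc n), p (Suc n))\<close> form a
  basis of the integer lattice. For the coordinates \<open>u\<close>, \<open>v\<close> of
  \<open>(k, m)\<close>, the bound on \<open>k\<close> forces \<open>u \<noteq> 0\<close> and
  \<open>u * v \<le> 0\<close>; since the errors have opposite signs, the two contributions cannot
  cancel.\<close>

lemma best_approximation:
  fixes k m :: int
  assumes k0: "k \<noteq> 0" and k: "\<bar>k\<bar> < int (q (Suc n))"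
  shows "\<bar>err n\<bar> \<le> \<bar>of_int k * \<alpha> - of_int m\<bar>"
proof -
  define s where "s = (- 1 :: int) ^ Suc n"
  have s2: "s * s = 1" by (simp add: s_def power_mult_distrib[symmetric])
  define u where "u = s * (m * int (q (Suc n)) - k * int (p (Suc n)))"
  define v where "v = s * (k * int (p n) - m * int (q n))"
  define d where "d = int (q (Suc n)) * int (p n) - int (q n) * int (p (Suc n))"
  have d: "d = s" unfolding d_def s_def by (rule cf_det)
  have "u * int (q n) + v * int (q (Suc n)) = s * (k * d)" by (simp add: u_def v_def d_def algebra_simps)
  then have uk: "u * int (q n) + v * int (q (Suc n)) = k" using s2 d by (simp add: algebra_simps)
  have "u * int (p n) + v * int (p (Suc n)) = s * (m * d)" by (simp add: u_def v_def d_def algebra_simps)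
  then have um: "u * int (p n) + v * int (p (Suc n)) = m" using s2 d by (simp add: algebra_simps)
  have val: "of_int k * \<alpha> - of_int m = of_int u * err n + of_int v * err (Suc n)"
    unfolding uk[symmetric] um[symmetric] by (simp add: cf_err_def algebra_simps)
  have u0: "u \<noteq> 0"
  proof
    assume "u = 0"
    then have "k = v * int (q (Suc n))" using uk by simp
    then show False using k k0
      by (metis abs_mult abs_of_nat int_one_le_iff_zero_less less_le_not_le mult_cancel_right1 mult_right_mono of_nat_0_le_iff zero_less_abs_iff mult_zero_left)
  qed
  have uv: "u * v \<le> 0"
  proof (rule ccontr)
    assume "\<not> u * v \<le> 0"
    then have "(u > 0 \<and> v > 0) \<or> (u < 0 \<and> v < 0)" by (simp add: not_le zero_less_mult_iff)
    then have "int (q (Suc n)) \<le> \<bar>k\<bar>"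
    proof
      assume "u > 0 \<and> v > 0"
      then have "int (q (Suc n)) \<le> v * int (q (Suc n))" "0 \<le> u * int (q n)"
        by (simp_all add: mult_le_cancel_right1)
      then show ?thesis using uk by linarith
    next
      assume "u < 0 \<and> v < 0"
      then have "v * int (q (Suc n)) \<le> (-1) * int (q (Suc n))" "u * int (q n) \<le> 0"
        by (intro mult_right_mono, auto simp: mult_nonpos_nonneg)
      then show ?thesis using uk by linarith
    qed
    then show False using k by simp
  qed
  have "(of_int u * err n) * (of_int v * err (Suc n)) = of_int (u * v) * (err n * err (Suc n))" by simp
  also have "\<dots> \<ge> 0" using uv err_sgn[of n] by (intro mult_nonpos_nonpos) (simp_all flip: of_int_mult)
  finally have "\<bar>of_int u * err n + of_int v * err (Suc n)\<bar> = \<bar>of_int u * err n\<bar> + \<bar>of_int v * err (Suc n)\<bar>"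
    by (smt (verit) mult_neg_pos mult_pos_neg)
  then have "\<bar>of_int u * err n\<bar> \<le> \<bar>of_int k * \<alpha> - of_int m\<bar>" using val by simp
  moreover have "1 * \<bar>err n\<bar> \<le> \<bar>of_int u\<bar> * \<bar>err n\<bar>"
    using u0 by (intro mult_right_mono) (simp_all add: int_one_le_iff_zero_less flip: of_int_abs)
  ultimately show ?thesis by (simp add: abs_mult)
qed

text \<open>Replacing \<open>\<alpha>\<close> by \<open>p n / q n\<close> makes the orbit a
  permutation of the arcs of length \<open>1 / q n\<close>, by coprimality. The replacement and the
  rounding of \<open>x\<close> move a point by less than one arc length to the left and less than
  two to the right; the first and the last arc are left out because there the point could wrap
  around.\<close>

lemma orbit_arcs:
  fixes x :: real
  shows "\<exists>\<sigma>. bij_betw \<sigma> {0..<q n} {0..<q n} \<and>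
    (\<forall>j<q n. 1 \<le> \<sigma> j \<and> \<sigma> j + 2 \<le> q n \<longrightarrow>
       (real (\<sigma> j) - 1) / q n < frac (x + real j * \<alpha>) \<and> frac (x + real j * \<alpha>) < (real (\<sigma> j) + 2) / q n)"
proof -
  define Q where "Q = q n"
  have Q: "Q \<ge> 1" using q_pos Q_def by simp
  define r where "r = \<lfloor>real Q * x\<rfloor>"
  define \<xi> where "\<xi> = real Q * x - of_int r"
  have xi: "0 \<le> \<xi>" "\<xi> < 1" unfolding \<xi>_def r_def by linarith+
  define \<sigma> where "\<sigma> j = nat ((r + int j * int (p n)) mod int Q)" for j :: nat
  have sint: "int (\<sigma> j) = (r + int j * int (p n)) mod int Q" for j
    using Q by (simp add: \<sigma>_def)
  have sless: "\<sigma> j < Q" for j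
  proof -
    have "int (\<sigma> j) < int Q" unfolding sint using Q by (intro pos_mod_bound) simp
    then show ?thesis by simp
  qed
  have inj: "inj_on \<sigma> {0..<Q}"
  proof (rule inj_onI)
    fix i j assume ij: "i \<in> {0..<Q}" "j \<in> {0..<Q}" "\<sigma> i = \<sigma> j"
    then have "(r + int i * int (p n)) mod int Q = (r + int j * int (p n)) mod int Q"
      using sint[of i] sint[of j] by simp
    then have "int Q dvd (r + int i * int (p n)) - (r + int j * int (p n))"
      by (simp add: mod_eq_dvd_iff)
    then have "int Q dvd (int i - int j) * int (p n)" by (simp add: algebra_simps)
    moreover have "coprime (int Q) (int (p n))" using p_q_coprime[of n] by (simp add: Q_def coprime_commute)
    ultimately have "int Q dvd int i - int j" by (simp add: coprime_dvd_mult_left_iff)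
    moreover have "\<bar>int i - int j\<bar> < int Q" using ij by auto
    ultimately have "int i - int j = 0" using zdvd_imp_le[of "int Q" "\<bar>int i - int j\<bar>"] by auto
    then show "i = j" by simp
  qed
  have bij: "bij_betw \<sigma> {0..<Q} {0..<Q}"
    unfolding bij_betw_def using inj sless by (intro conjI endo_inj_surj) auto
  have main: "(real (\<sigma> j) - 1) / Q < frac (x + real j * \<alpha>) \<and> frac (x + real j * \<alpha>) < (real (\<sigma> j) + 2) / Q"
    if j: "j < Q" "1 \<le> \<sigma> j" "\<sigma> j + 2 \<le> Q" for j
  proof -
    define z where "z = (r + int j * int (p n)) div int Q"
    have z: "r + int j * int (p n) = z * int Q + int (\<sigma> j)" unfolding z_def sint by simp
    define \<theta> where "\<theta> = \<xi> + real j * err n"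
    have je: "\<bar>real j * err n\<bar> < 1"
    proof -
      have "\<bar>real j * err n\<bar> \<le> real j * (1 / real (q (Suc n)))" unfolding abs_mult using err_le[of n] by (simp add: mult_left_mono del: times_divide_eq_right)
      also have "\<dots> < real Q * (1 / real Q)"
      proof -
        have "1 / real (q (Suc n)) \<le> 1 / real Q" using q_Suc_ge[of n] q_pos[of n] by (simp add: Q_def frac_le)
        then have "real j * (1 / real (q (Suc n))) \<le> real j * (1 / real Q)" by (intro mult_left_mono) auto
        also have "\<dots> < real Q * (1 / real Q)" using j Q by (intro mult_strict_right_mono) auto
        finally show ?thesis .
      qed
      finally show ?thesis using Q by simp
    qed
    then have th: "-1 < \<theta>" "\<theta> < 2" using xi by (auto simp: \<theta>_def)
    have "real Q * (x + real j * \<alpha>) = of_int (r + int j * int (p n)) + \<theta>"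
      by (simp add: \<theta>_def \<xi>_def cf_err_def Q_def algebra_simps)
    also have "\<dots> = of_int z * real Q + real (\<sigma> j) + \<theta>" unfolding z by simp
    finally have "x + real j * \<alpha> = of_int z + (real (\<sigma> j) + \<theta>) / Q"
      using Q by (simp add: field_simps)
    moreover have b: "0 \<le> (real (\<sigma> j) + \<theta>) / Q" "(real (\<sigma> j) + \<theta>) / Q < 1"
      using th j Q by (auto simp: field_simps)
    ultimately have "frac (x + real j * \<alpha>) = (real (\<sigma> j) + \<theta>) / Q"
      by (simp add: frac_unique_iff)
    then show ?thesis using th Q by (simp add: divide_strict_right_mono)
  qed
  show ?thesis using bij main unfolding Q_def by blast
qed

lemma alpha_mult_not_int:
  fixes k m :: int assumes "k \<noteq> 0" shows "of_int k * \<alpha> \<noteq> of_int m"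
proof
  assume "of_int k * \<alpha> = of_int m"
  then have "\<alpha> = of_int m / of_int k" using assms by (simp add: field_simps)
  then have "\<alpha> \<in> \<rat>" by auto
  then show False using alpha_irrational by simp
qed

end

section \<open>Birkhoff sums of the roof\<close>

lemma harm_le_ln: "n \<ge> 1 \<Longrightarrow> harm n \<le> ln (real n) + (1::real)"
proof -
  assume "n \<ge> 1"
  then obtain m where m: "n = Suc m" by (cases n) auto
  have "harm (Suc m) - ln (real (Suc m)) \<le> harm (Suc 0) - ln (real (Suc 0))"
    using decseqD[OF decseq_harm_diff_ln, of 0 m] by simp
  then show ?thesis using m by (simp add: harm_def)
qed

lemma frac_shift:
  assumes "0 \<le> frac x + t" "frac x + t < 1"
  shows "frac (x + t) = frac x + t"
proof -
  have "x + t = of_int \<lfloor>x\<rfloor> + (frac x + t)" by (simp add: frac_def)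
  then show ?thesis using assms by (simp add: frac_unique_iff) (simp add: frac_def)
qed

lemma frac_add_frac: "frac (frac x + y) = frac (x + y)"
  using frac_add_of_int_right[of "frac x + y" "\<lfloor>x\<rfloor>"] by (simp add: frac_def algebra_simps)

context irrational_rotation
begin

lemma exists_small_frac:
  fixes x :: real assumes "3 \<le> q n"
  shows "\<exists>j<q n. frac (x + real j * \<alpha>) < 3 / q n"
proof -
  obtain \<sigma> where s: "bij_betw \<sigma> {0..<q n} {0..<q n}"
    "\<forall>j<q n. 1 \<le> \<sigma> j \<and> \<sigma> j + 2 \<le> q n \<longrightarrow>
       (real (\<sigma> j) - 1) / q n < frac (x + real j * \<alpha>) \<and> frac (x + real j * \<alpha>) < (real (\<sigma> j) + 2) / q n"
    using orbit_arcs by blast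
  have "1 \<in> \<sigma> ` {0..<q n}" using s(1) assms by (auto simp: bij_betw_def)
  then obtain j where "j < q n" "\<sigma> j = 1" by auto
  then show ?thesis using s(2) assms by (intro exI[of _ j]) force
qed

end

text \<open>Up to the factor \<open>Cf\<close> this bounds the derivative of the roof; it at most
  doubles when the point moves by half its distance to either end.\<close>

definition recip_dist :: "real \<Rightarrow> real" where
  "recip_dist u = 1 / u + 1 / (1 - u)"

section \<open>The roof and its Birkhoff sums under small displacements\<close>

locale arnold_roof_flow = irrational_rotation \<alpha> for \<alpha> :: real +
  fixes f :: "real \<Rightarrow> real" and am ap G a :: real and g g1 g2 :: "real \<Rightarrow> real"
  assumes ap_nonneg: "0 \<le> ap" and ap_less_am: "ap < am"
    and f_eq: "\<And>x. 0 < x \<Longrightarrow> x < 1 \<Longrightarrow> f x = - am * ln x - ap * ln (1 - x) + g x"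
    and g_deriv: "\<And>x. 0 < x \<Longrightarrow> x < 1 \<Longrightarrow> (g has_real_derivative g1 x) (at x)"
    and g1_deriv: "\<And>x. 0 < x \<Longrightarrow> x < 1 \<Longrightarrow> (g1 has_real_derivative g2 x) (at x)"
    and g_bounded: "\<And>x. 0 < x \<Longrightarrow> x < 1 \<Longrightarrow> \<bar>g x\<bar> \<le> G"
    and g1_bounded: "\<And>x. 0 < x \<Longrightarrow> x < 1 \<Longrightarrow> \<bar>g1 x\<bar> \<le> G"
    and g2_bounded: "\<And>x. 0 < x \<Longrightarrow> x < 1 \<Longrightarrow> \<bar>g2 x\<bar> \<le> G"
    and a_pos: "0 < a" and f_ge: "\<And>x. 0 \<le> x \<Longrightarrow> x < 1 \<Longrightarrow> a \<le> f x"
begin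

lemma G_nonneg: "0 \<le> G"
  using g_bounded[of "1/2"] by linarith

lemma am_pos: "0 < am"
  using ap_nonneg ap_less_am by linarith

definition f1 :: "real \<Rightarrow> real" where "f1 u = - am / u + ap / (1 - u) + g1 u"
definition f2 :: "real \<Rightarrow> real" where "f2 u = am / u\<^sup>2 + ap / (1 - u)\<^sup>2 + g2 u"

lemma f_deriv:
  assumes "0 < x" "x < 1" shows "(f has_real_derivative f1 x) (at x)"
proof -
  have "((\<lambda>x. - am * ln x - ap * ln (1 - x) + g x) has_real_derivative f1 x) (at x)"
    using assms unfolding f1_def by (auto intro!: derivative_eq_intros g_deriv simp: divide_simps)
  moreover have "eventually (\<lambda>x. f x = - am * ln x - ap * ln (1 - x) + g x) (nhds x)"
    using eventually_nhds_in_open[of "{0<..<1}" x] assms by (auto elim!: eventually_mono simp: f_eq)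
  ultimately show ?thesis by (simp add: DERIV_cong_ev)
qed

lemma f1_deriv:
  assumes "0 < x" "x < 1" shows "(f1 has_real_derivative f2 x) (at x)"
  unfolding f1_def[abs_def] f2_def using assms
  by (auto intro!: derivative_eq_intros g1_deriv simp: power2_eq_square)

definition Cf :: real where "Cf = am + G"

lemma Cf_pos: "0 < Cf" using am_pos G_nonneg by (simp add: Cf_def)

lemma recip_dist_ge: "0 < u \<Longrightarrow> u < 1 \<Longrightarrow> 1 \<le> recip_dist u"
proof -
  assume u: "0 < u" "u < 1"
  have "1 \<le> 1 / u" "0 \<le> 1 / (1 - u)" using u by auto
  then show ?thesis unfolding recip_dist_def by linarith
qed

lemma f1_bound:
  assumes "0 < u" "u < 1" shows "\<bar>f1 u\<bar> \<le> Cf * recip_dist u"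
proof -
  have "\<bar>f1 u\<bar> \<le> am / u + ap / (1 - u) + G"
    using g1_bounded[OF assms] assms am_pos ap_nonneg unfolding f1_def
    by (smt (verit) divide_nonneg_nonneg minus_divide_left)
  also have "\<dots> \<le> am / u + am / (1 - u) + G"
    using assms ap_less_am by (simp add: divide_right_mono)
  also have "\<dots> \<le> am * recip_dist u + G * recip_dist u"
    using mult_left_mono[OF recip_dist_ge[OF assms] G_nonneg] by (simp add: recip_dist_def algebra_simps)
  finally show ?thesis by (simp add: Cf_def algebra_simps)
qed

lemma f_close:
  assumes u: "0 < u" "u < 1" and t: "\<bar>t\<bar> \<le> u / 2" "\<bar>t\<bar> \<le> (1 - u) / 2"
  shows "\<bar>f (u + t) - f u\<bar> \<le> 2 * Cf * recip_dist u * \<bar>t\<bar>"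
proof -
  have B: "norm (f1 x) \<le> 2 * Cf * recip_dist u" if "x \<in> {u - \<bar>t\<bar> .. u + \<bar>t\<bar>}" for x
  proof -
    have x: "u / 2 \<le> x" "(1 - u) / 2 \<le> 1 - x" using that t u by auto
    have x01: "0 < x" "x < 1" using x u by auto
    have "1 / x \<le> 1 / (u / 2)" "1 / (1 - x) \<le> 1 / ((1 - u) / 2)"
      using x x01 u by (intro divide_left_mono; simp)+
    then have "recip_dist x \<le> 2 * recip_dist u" by (simp add: recip_dist_def algebra_simps)
    then have "Cf * recip_dist x \<le> Cf * (2 * recip_dist u)" using Cf_pos by (intro mult_left_mono) auto
    then show ?thesis using f1_bound[OF x01] by (simp add: mult_ac)
  qed
  have "norm (f (u + t) - f u) \<le> 2 * Cf * recip_dist u * norm (u + t - u)"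
  proof (rule field_differentiable_bound[of "{u - \<bar>t\<bar> .. u + \<bar>t\<bar>}" f f1])
    fix x assume x: "x \<in> {u - \<bar>t\<bar> .. u + \<bar>t\<bar>}"
    then have "0 < x" "x < 1" using t u by auto
    then show "(f has_field_derivative f1 x) (at x within {u - \<bar>t\<bar>..u + \<bar>t\<bar>})"
      using f_deriv DERIV_subset by blast
  qed (use B in auto)
  then show ?thesis by simp
qed

text \<open>Every real base point and every integer index are allowed, so that displaced points
  \<open>x + t\<close> need no reduction modulo 1.\<close>

definition pt :: "real \<Rightarrow> int \<Rightarrow> real" where
  "pt x j = frac (x + of_int j * \<alpha>)"

definition GS :: "int set \<Rightarrow> real \<Rightarrow> real" where
  "GS S x = (\<Sum>j\<in>S. f (pt x j))"

text \<open>Up to the factor \<open>Cf\<close> it dominates the derivative of \<open>GS S\<close>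
  where that exists.\<close>

definition KS :: "int set \<Rightarrow> real \<Rightarrow> real" where
  "KS S x = (\<Sum>j\<in>S. recip_dist (pt x j))"

definition bs :: "int \<Rightarrow> real \<Rightarrow> real" where
  "bs m x = (if m \<ge> 0 then GS {0..m-1} x else - GS {m..-1} x)"

lemma bs_eq: "birkhoff_sum \<alpha> f m x = bs m x"
  by (simp add: birkhoff_sum_def bs_def GS_def rotation_pow_def rotation_def pt_def)

lemma pt_range: "0 \<le> pt x j" "pt x j < 1"
  by (simp_all add: pt_def frac_lt_1)

lemma pt_add: "pt (x + of_int k * \<alpha>) j = pt x (k + j)"
  by (simp add: pt_def algebra_simps)

lemma pt_frac: "pt (frac x) j = pt x j"
  by (simp add: pt_def frac_add_frac)

lemma pt_pt: "pt (pt x k) j = pt x (k + j)"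
  by (simp add: pt_def frac_add_frac) (simp add: algebra_simps)

lemma f_pt_ge: "a \<le> f (pt x j)"
  using f_ge pt_range by blast

lemma bs_frac: "bs m (frac x) = bs m x"
  by (simp add: bs_def GS_def pt_frac)

lemma bs_0: "bs 0 x = 0" by (simp add: bs_def GS_def)

lemma bs_Suc: "bs (m + 1) x = bs m x + f (pt x m)"
proof -
  consider "m \<ge> 0" | "m = -1" | "m < -1" by linarith
  then show ?thesis
  proof cases
    case 1
    have "{0..m} = insert m {0..m-1}" using 1 by auto
    then show ?thesis using 1 by (simp add: bs_def GS_def)
  next
    case 2
    then show ?thesis by (simp add: bs_def GS_def)
  next
    case 3
    have "{m..-1} = insert m {m+1..-1}" using 3 by auto
    then show ?thesis using 3 by (simp add: bs_def GS_def)
  qed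
qed

lemma bs_1: "bs 1 x = f (pt x 0)"
  using bs_Suc[of 0 x] by (simp add: bs_0)

lemma bs_cocycle: "bs (m + k) x = bs m x + bs k (x + of_int m * \<alpha>)"
proof (induction k rule: int_induct[where k = 0])
  case base then show ?case by (simp add: bs_0)
next
  case (step1 i)
  have "bs (m + (i + 1)) x = bs (m + i) x + f (pt x (m + i))"
    using bs_Suc[of "m + i" x] by (simp add: add.assoc)
  then show ?case using step1 bs_Suc[of i "x + of_int m * \<alpha>"] by (simp add: pt_add)
next
  case (step2 i)
  have "bs (m + i) x = bs (m + (i - 1)) x + f (pt x (m + (i - 1)))"
    using bs_Suc[of "m + (i - 1)" x] by (simp add: algebra_simps)
  then show ?case using step2 bs_Suc[of "i - 1" "x + of_int m * \<alpha>"] by (simp add: pt_add)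
qed

lemma bs_mono_diff:
  assumes "m \<le> k" shows "a * of_int (k - m) \<le> bs k x - bs m x"
  using assms
proof (induction k rule: int_ge_induct)
  case base then show ?case by simp
next
  case (step k)
  then show ?case using bs_Suc[of k x] f_pt_ge[of x k] by (simp add: algebra_simps)
qed

lemma bs_less_iff: "bs m x < bs k x \<longleftrightarrow> m < k"
proof -
  have *: "bs m x < bs k x" if "m < k" for m k
  proof -
    have "0 < a * of_int (k - m)" using that a_pos by simp
    then show ?thesis using bs_mono_diff[of m k x] that by linarith
  qed
  show ?thesis using *[of m k] *[of k m] by (cases m k rule: linorder_cases) auto
qed

lemma bs_le_iff: "bs m x \<le> bs k x \<longleftrightarrow> m \<le> k"
  using bs_less_iff[of k x m] by linarith

text \<open>Each orbit point moves by at most half its distance to the singularity, so none crosses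
  it and the derivative of the roof at most doubles on the way.\<close>

lemma GS_close:
  assumes S: "finite S" and u: "\<And>j. j \<in> S \<Longrightarrow> 0 < pt x j"
    and t: "\<And>j. j \<in> S \<Longrightarrow> \<bar>t\<bar> \<le> pt x j / 2 \<and> \<bar>t\<bar> \<le> (1 - pt x j) / 2"
  shows "\<bar>GS S (x + t) - GS S x\<bar> \<le> 2 * Cf * KS S x * \<bar>t\<bar>"
proof -
  have pt: "pt (x + t) j = pt x j + t" if "j \<in> S" for j
  proof -
    have "frac (x + of_int j * \<alpha> + t) = frac (x + of_int j * \<alpha>) + t"
      using t[OF that] u[OF that] pt_range(2)[of x j] unfolding pt_def by (intro frac_shift) (auto simp: abs_le_iff)
    then show ?thesis by (simp add: pt_def algebra_simps)
  qed
  have "\<bar>GS S (x + t) - GS S x\<bar> \<le> (\<Sum>j\<in>S. \<bar>f (pt x j + t) - f (pt x j)\<bar>)"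
    unfolding GS_def using pt by (simp add: sum_subtractf[symmetric] sum_abs)
  also have "\<dots> \<le> (\<Sum>j\<in>S. 2 * Cf * recip_dist (pt x j) * \<bar>t\<bar>)"
    using u t pt_range by (intro sum_mono f_close) auto
  also have "\<dots> = 2 * Cf * KS S x * \<bar>t\<bar>" by (simp add: KS_def sum_distrib_left sum_distrib_right mult_ac)
  finally show ?thesis .
qed

lemma KS_mono:
  assumes "finite T" "S \<subseteq> T" shows "KS S x \<le> KS T x"
  unfolding KS_def using assms pt_range
  by (intro sum_mono2) (auto simp: recip_dist_def less_imp_le)

lemma KS_nonneg: "0 \<le> KS S x"
  unfolding KS_def using pt_range by (intro sum_nonneg) (auto simp: recip_dist_def less_imp_le)

text \<open>One constant serves all lengths up to \<open>J\<close>, of either sign, because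
  \<open>KS\<close> grows with the index set.\<close>

lemma bs_close:
  assumes m: "\<bar>m\<bar> \<le> J" and u: "\<And>j. \<bar>j\<bar> \<le> J \<Longrightarrow> d \<le> pt x j \<and> d \<le> 1 - pt x j"
    and t: "\<bar>t\<bar> \<le> d / 2" and d: "0 < d"
  shows "\<bar>bs m (x + t) - bs m x\<bar> \<le> 2 * Cf * KS {-J..J} x * \<bar>t\<bar>"
proof -
  have *: "\<bar>GS S (x + t) - GS S x\<bar> \<le> 2 * Cf * KS {-J..J} x * \<bar>t\<bar>" if S: "S \<subseteq> {-J..J}" for S
  proof -
    have fin: "finite S" using S finite_subset by blast
    have "\<bar>GS S (x + t) - GS S x\<bar> \<le> 2 * Cf * KS S x * \<bar>t\<bar>"
    proof (rule GS_close[OF fin])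
      fix j assume "j \<in> S"
      then have "\<bar>j\<bar> \<le> J" using S by (auto simp: abs_le_iff dest!: subsetD)
      from u[OF this] show "0 < pt x j" "\<bar>t\<bar> \<le> pt x j / 2 \<and> \<bar>t\<bar> \<le> (1 - pt x j) / 2" using d t by auto
    qed
    also have "\<dots> \<le> 2 * Cf * KS {-J..J} x * \<bar>t\<bar>"
      using KS_mono[OF _ S, of x] Cf_pos by (intro mult_right_mono mult_left_mono) auto
    finally show ?thesis .
  qed
  show ?thesis
  proof (cases "m \<ge> 0")
    case True
    then show ?thesis using *[of "{0..m-1}"] m by (auto simp: bs_def)
  next
    case False
    then have "\<bar>GS {m..-1} (x + t) - GS {m..-1} x\<bar> \<le> 2 * Cf * KS {-J..J} x * \<bar>t\<bar>"
      using m by (intro *) auto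
    then show ?thesis using False by (simp add: bs_def)
  qed
qed

end

section \<open>Birkhoff sums of length \<open>q n\<close> and visits to the singularity\<close>

context arnold_roof_flow
begin

lemma orbit_arcs_inv:
  "\<exists>\<tau>. bij_betw \<tau> {0..<q n} {0..<int (q n)} \<and>
    (\<forall>k. 1 \<le> k \<longrightarrow> k + 2 \<le> q n \<longrightarrow>
       (real k - 1) / q n < pt x (\<tau> k) \<and> pt x (\<tau> k) < (real k + 2) / q n)"
proof -
  obtain \<sigma> where s: "bij_betw \<sigma> {0..<q n} {0..<q n}"
    "\<forall>j<q n. 1 \<le> \<sigma> j \<and> \<sigma> j + 2 \<le> q n \<longrightarrow>
       (real (\<sigma> j) - 1) / q n < frac (x + real j * \<alpha>) \<and> frac (x + real j * \<alpha>) < (real (\<sigma> j) + 2) / q n"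
    using orbit_arcs by blast
  define t where "t = inv_into {0..<q n} \<sigma>"
  have t: "bij_betw t {0..<q n} {0..<q n}" unfolding t_def using s(1) by (rule bij_betw_inv_into)
  have i: "bij_betw int {0..<q n} {0..<int (q n)}"
    by (rule bij_betw_byWitness[of _ nat]) auto
  have "bij_betw (\<lambda>k. int (t k)) {0..<q n} {0..<int (q n)}"
    using bij_betw_trans[OF t i] by (simp add: o_def)
  moreover have "(real k - 1) / q n < pt x (int (t k)) \<and> pt x (int (t k)) < (real k + 2) / q n"
    if k: "1 \<le> k" "k + 2 \<le> q n" for k
  proof -
    have kk: "k \<in> {0..<q n}" using k by auto
    have "t k < q n" using bij_betwE[OF t] kk by auto
    moreover have "\<sigma> (t k) = k" unfolding t_def
      using bij_betw_inv_into_right[OF s(1)] kk by blast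
    ultimately show ?thesis using s(2) k by (auto simp: pt_def)
  qed
  ultimately show ?thesis by blast
qed

definition C2 :: real where "C2 = 2 * am + 4 * ap + G"

text \<open>By equidistribution in arcs, \<open>1 / u\<close> and \<open>1 / (1 - u)\<close> both
  sum to about \<open>Q * ln Q\<close> over the orbit, so the logarithm survives with the
  coefficient \<open>am - ap\<close>. For this one-sided bound only the sum of
  \<open>1 / (1 - u)\<close> needs an upper estimate, and there the distance
  \<open>\<omega> / Q\<close> of the extreme points enters.\<close>

lemma f1_sum_upper:
  assumes q: "4 \<le> q n" and w: "0 < \<omega>" "\<omega> \<le> 1"
    and good: "\<And>j. 0 \<le> j \<Longrightarrow> j < int (q n) \<Longrightarrow> \<omega> / q n \<le> pt x j \<and> \<omega> / q n \<le> 1 - pt x j"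
  shows "(\<Sum>j\<in>{0..<int (q n)}. f1 (pt x j)) \<le> - ((am - ap) * q n * ln (q n) - C2 * q n / \<omega>)"
proof -
  define Q where "Q = q n"
  have Q4: "4 \<le> Q" using q Q_def by simp
  obtain \<tau> where t: "bij_betw \<tau> {0..<Q} {0..<int Q}"
    and arc: "\<And>k. 1 \<le> k \<Longrightarrow> k + 2 \<le> Q \<Longrightarrow> (real k - 1) / Q < pt x (\<tau> k) \<and> pt x (\<tau> k) < (real k + 2) / Q"
    using orbit_arcs_inv[of n x] unfolding Q_def by blast
  define u where "u k = pt x (\<tau> k)" for k
  have tr: "\<tau> k \<in> {0..<int Q}" if "k < Q" for k using bij_betwE[OF t] that by auto
  have u: "\<omega> / Q \<le> u k" "\<omega> / Q \<le> 1 - u k" if "k < Q" for k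
    using good[of "\<tau> k"] tr[OF that] by (auto simp: u_def Q_def)
  have wQ: "0 < \<omega> / Q" using w Q4 by simp
  have u01: "0 < u k" "u k < 1" if "k < Q" for k using u[OF that] wQ by linarith+
  have re: "(\<Sum>j\<in>{0..<int Q}. f1 (pt x j)) = (\<Sum>k\<in>{0..<Q}. f1 (u k))"
    unfolding u_def by (rule sum.reindex_bij_betw[OF t, symmetric])
  have low: "(\<Sum>k\<in>{0..<Q}. 1 / u k) \<ge> Q * (ln Q - 2)"
  proof -
    have "Q * (ln Q - 2) \<le> Q * (harm Q - 3/2)"
    proof -
      have "ln (real Q) \<le> ln (real Q + 1)" using Q4 by simp
      then have "ln (real Q) - 2 \<le> harm Q - 3 / 2" using harm_ge_ln[of Q] by linarith
      then show ?thesis by (intro mult_left_mono) auto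
    qed
    also have "harm Q - 3 / 2 = (\<Sum>k\<in>{3..Q}. 1 / real k)"
    proof -
      have "{1..Q} = {1,2} \<union> {3..Q}" using Q4 by auto
      then have "harm Q = (\<Sum>k\<in>{1,2}. 1 / real k) + (\<Sum>k\<in>{3..Q}. 1 / real k)"
        unfolding harm_def by (subst sum.union_disjoint[symmetric]) (auto simp: inverse_eq_divide)
      then show ?thesis by simp
    qed
    also have "(\<Sum>k\<in>{3..Q}. 1 / real k) = (\<Sum>k\<in>{1..Q-2}. 1 / (real k + 2))"
      by (rule sum.reindex_bij_witness[of _ "\<lambda>k. k + 2" "\<lambda>k. k - 2"]) auto
    also have "Q * \<dots> = (\<Sum>k\<in>{1..Q-2}. Q / (real k + 2))" by (simp add: sum_distrib_left)
    also have "\<dots> \<le> (\<Sum>k\<in>{1..Q-2}. 1 / u k)"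
    proof (rule sum_mono)
      fix k assume k: "k \<in> {1..Q-2}"
      then have k': "k < Q" "1 \<le> k" "k + 2 \<le> Q" using Q4 by auto
      have "1 / ((real k + 2) / Q) \<le> 1 / u k"
        using arc[OF k'(2,3)] u01[OF k'(1)] Q4 by (intro divide_left_mono) (auto simp: u_def)
      then show "Q / (real k + 2) \<le> 1 / u k" by simp
    qed
    also have "\<dots> \<le> (\<Sum>k\<in>{0..<Q}. 1 / u k)"
      using u01 Q4 by (intro sum_mono2) (auto simp: less_imp_le)
    finally show ?thesis .
  qed
  have up: "(\<Sum>k\<in>{0..<Q}. 1 / (1 - u k)) \<le> Q * (ln Q + 1) + 3 * Q / \<omega>"
  proof -
    \<comment> \<open>The arc of index \<open>Q - 2\<close> extends up to 1 and gives no lower bound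
      for \<open>1 - u k\<close>; like the indices 0 and \<open>Q - 1\<close>, whose arcs are
      unknown, it is handled by \<open>\<omega>\<close>.\<close>
    have split: "{0..<Q} = {1..Q-3} \<union> {0, Q-2, Q-1}" using Q4 by auto
    have "(\<Sum>k\<in>{0..<Q}. 1 / (1 - u k)) = (\<Sum>k\<in>{1..Q-3}. 1 / (1 - u k)) + (\<Sum>k\<in>{0, Q-2, Q-1}. 1 / (1 - u k))"
      unfolding split using Q4 by (intro sum.union_disjoint) auto
    moreover have "(\<Sum>k\<in>{0, Q-2, Q-1}. 1 / (1 - u k)) \<le> 3 * (Q / \<omega>)"
    proof -
      have "(\<Sum>k\<in>{0, Q-2, Q-1}. 1 / (1 - u k)) \<le> (\<Sum>k\<in>{0, Q-2, Q-1}. Q / \<omega>)"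
      proof (rule sum_mono)
        fix k assume "k \<in> {0, Q-2, Q-1}"
        then have "k < Q" using Q4 by auto
        from u(2)[OF this] have "1 / (1 - u k) \<le> 1 / (\<omega> / Q)" using wQ by (intro divide_left_mono mult_pos_pos; linarith)
        then show "1 / (1 - u k) \<le> Q / \<omega>" by simp
      qed
      also have "\<dots> \<le> 3 * (Q / \<omega>)"
      proof -
        have "card {0, Q-2, Q-1} \<le> 3" by (simp add: card_insert_if)
        then show ?thesis using w by (simp add: divide_right_mono mult_right_mono)
      qed
      finally show ?thesis .
    qed
    moreover have "(\<Sum>k\<in>{1..Q-3}. 1 / (1 - u k)) \<le> Q * (ln Q + 1)"
    proof -
      have "(\<Sum>k\<in>{1..Q-3}. 1 / (1 - u k)) \<le> (\<Sum>k\<in>{1..Q-3}. Q / real (Q - 2 - k))"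
      proof (rule sum_mono)
        fix k assume k: "k \<in> {1..Q-3}"
        then have k': "k < Q" "1 \<le> k" "k + 2 \<le> Q" "k + 3 \<le> Q" using Q4 by auto
        have "real (Q - 2 - k) / Q = 1 - (real k + 2) / Q" using k' by (simp add: field_simps of_nat_diff)
        also have "\<dots> \<le> 1 - u k" using arc[OF k'(2,3)] by (simp add: u_def)
        finally have "real (Q - 2 - k) / Q \<le> 1 - u k" .
        then have "1 / (1 - u k) \<le> 1 / (real (Q - 2 - k) / Q)"
          using k' u01[OF k'(1)] by (intro divide_left_mono) auto
        then show "1 / (1 - u k) \<le> Q / real (Q - 2 - k)" by simp
      qed
      also have "\<dots> = (\<Sum>k\<in>{1..Q-3}. Q / real k)"
        by (rule sum.reindex_bij_witness[of _ "\<lambda>k. Q - 2 - k" "\<lambda>k. Q - 2 - k"]) auto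
      also have "\<dots> = Q * harm (Q - 3)" by (simp add: harm_def sum_distrib_left inverse_eq_divide)
      also have "\<dots> \<le> Q * (ln (Q - 3) + 1)"
        using harm_le_ln[of "Q - 3"] Q4 by (intro mult_left_mono) auto
      also have "\<dots> \<le> Q * (ln Q + 1)" using Q4 by (intro mult_left_mono) auto
      finally show ?thesis .
    qed
    ultimately show ?thesis by simp
  qed
  have "(\<Sum>k\<in>{0..<Q}. f1 (u k)) \<le> (\<Sum>k\<in>{0..<Q}. - am * (1 / u k) + ap * (1 / (1 - u k)) + G)"
    using g1_bounded[OF u01] by (intro sum_mono) (auto simp: f1_def abs_le_iff)
  also have "\<dots> = - am * (\<Sum>k\<in>{0..<Q}. 1 / u k) + ap * (\<Sum>k\<in>{0..<Q}. 1 / (1 - u k)) + Q * G"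
    by (simp only: sum.distrib sum_distrib_left[symmetric]) simp
  also have "\<dots> \<le> - am * (Q * (ln Q - 2)) + ap * (Q * (ln Q + 1) + 3 * Q / \<omega>) + Q * G"
    using low up am_pos ap_nonneg by (intro add_mono mult_left_mono mult_left_mono_neg) auto
  also have "\<dots> = - ((am - ap) * Q * ln Q) + Q * (2 * am + ap + G) + 3 * ap * Q / \<omega>"
    by (simp add: algebra_simps)
  also have "\<dots> \<le> - ((am - ap) * Q * ln Q) + (Q / \<omega>) * (2 * am + ap + G) + 3 * ap * Q / \<omega>"
  proof -
    have "real Q \<le> Q / \<omega>" using w Q4 by (simp add: field_simps)
    then show ?thesis using am_pos ap_nonneg G_nonneg by (intro add_mono mult_right_mono) auto
  qed
  also have "\<dots> = - ((am - ap) * Q * ln Q - C2 * Q / \<omega>)" by (simp add: C2_def algebra_simps add_divide_distrib)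
  finally show ?thesis unfolding re[unfolded Q_def] by (simp add: Q_def)
qed

lemma f_pt_deriv:
  assumes "0 < pt w j"
  shows "((\<lambda>w. f (pt w j)) has_real_derivative f1 (pt w j)) (at w)"
proof -
  have d: "((\<lambda>w'. f (pt w j + (w' - w))) has_real_derivative f1 (pt w j)) (at w)"
  proof -
    have "((\<lambda>w'. pt w j + (w' - w)) has_real_derivative 1) (at w)" by (auto intro!: derivative_eq_intros)
    then show ?thesis
      using DERIV_chain2[where f = f and g = "\<lambda>w'. pt w j + (w' - w)" and Da = "f1 (pt w j)" and Db = 1 and x = w and s = UNIV]
        f_deriv[of "pt w j"] assms pt_range[of w j] by simp
  qed
  have "eventually (\<lambda>w'. w' \<in> {w - pt w j <..< w + (1 - pt w j)}) (nhds w)"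
    using assms pt_range[of w j] by (intro eventually_nhds_in_open) auto
  then have "eventually (\<lambda>w'. f (pt w' j) = f (pt w j + (w' - w))) (nhds w)"
  proof eventually_elim
    case (elim w')
    have "frac (w + of_int j * \<alpha> + (w' - w)) = frac (w + of_int j * \<alpha>) + (w' - w)"
      using elim by (intro frac_shift) (auto simp: pt_def)
    then have "pt w' j = pt w j + (w' - w)" by (simp add: pt_def algebra_simps)
    then show ?case by simp
  qed
  then show ?thesis using d by (subst DERIV_cong_ev[OF refl _ refl])
qed

lemma bs_nat: "bs (int m) x = (\<Sum>j\<in>{0..<int m}. f (pt x j))"
proof -
  have "{0..int m - 1} = {0..<int m}" by auto
  then show ?thesis by (simp add: bs_def GS_def)
qed

lemma pt_between:
  assumes "z \<le> w" "w \<le> y" "pt y j = pt z j + (y - z)"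
  shows "pt w j = pt z j + (w - z)"
proof -
  have "frac (z + of_int j * \<alpha> + (w - z)) = frac (z + of_int j * \<alpha>) + (w - z)"
    using assms pt_range[of z j] pt_range[of y j] by (intro frac_shift) (auto simp: pt_def)
  then show ?thesis by (simp add: pt_def algebra_simps)
qed

text \<open>Mean value theorem on an interval without singularities: \<open>good\<close> says that
  no orbit point wraps around between \<open>z\<close> and \<open>y\<close>, so
  \<open>f1_sum_upper\<close> applies at every intermediate point.\<close>

lemma bs_decrease:
  assumes q: "4 \<le> q n" and w: "0 < \<omega>" "\<omega> \<le> 1" and zy: "z \<le> y"
    and good: "\<And>j. 0 \<le> j \<Longrightarrow> j < int (q n) \<Longrightarrow>
       pt y j = pt z j + (y - z) \<and> \<omega> / q n \<le> pt z j \<and> \<omega> / q n \<le> 1 - pt y j"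
  shows "((am - ap) * q n * ln (q n) - C2 * q n / \<omega>) * (y - z) \<le> bs (int (q n)) z - bs (int (q n)) y"
proof (cases "z = y")
  case False
  then have zy': "z < y" using zy by simp
  have wq: "0 < \<omega> / q n" using w q by simp
  have gw: "\<omega> / q n \<le> pt w j \<and> \<omega> / q n \<le> 1 - pt w j"
    if "z \<le> w" "w \<le> y" "0 \<le> j" "j < int (q n)" for w j
    using pt_between[of z w y j] good[of j] that by auto
  have D: "(bs (int (q n)) has_real_derivative (\<Sum>j\<in>{0..<int (q n)}. f1 (pt w j))) (at w)"
    if "z \<le> w" "w \<le> y" for w
    unfolding bs_nat[abs_def]
  proof (rule DERIV_sum)
    fix j assume "j \<in> {0..<int (q n)}"
    then show "((\<lambda>x. f (pt x j)) has_real_derivative f1 (pt w j)) (at w)"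
      using gw[OF that, of j] wq by (intro f_pt_deriv) auto
  qed
  obtain w where wz: "z < w" "w < y"
    and e: "bs (int (q n)) y - bs (int (q n)) z = (y - z) * (\<Sum>j\<in>{0..<int (q n)}. f1 (pt w j))"
    using MVT2[OF zy', of "bs (int (q n))" "\<lambda>w. \<Sum>j\<in>{0..<int (q n)}. f1 (pt w j)"] D by blast
  have "(\<Sum>j\<in>{0..<int (q n)}. f1 (pt w j)) \<le> - ((am - ap) * q n * ln (q n) - C2 * q n / \<omega>)"
    using gw wz by (intro f1_sum_upper[OF q w]) auto
  then have "(y - z) * (\<Sum>j\<in>{0..<int (q n)}. f1 (pt w j)) \<le> (y - z) * - ((am - ap) * q n * ln (q n) - C2 * q n / \<omega>)"
    using zy by (intro mult_left_mono) auto
  then show ?thesis using e by (simp add: algebra_simps)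
qed simp

definition C4 :: real where "C4 = 12 * Cf + 20 * (am + ap) + 10 * G"

lemma f_abs_le:
  assumes "0 < d" "d \<le> u" "d \<le> 1 - u" shows "\<bar>f u\<bar> \<le> (am + ap) * ln (1 / d) + G"
proof -
  have u: "0 < u" "u < 1" using assms by auto
  have l: "\<bar>ln u\<bar> \<le> ln (1 / d)" "\<bar>ln (1 - u)\<bar> \<le> ln (1 / d)"
    using assms u by (auto simp: ln_div abs_if)
  have "\<bar>f u\<bar> \<le> am * \<bar>ln u\<bar> + ap * \<bar>ln (1 - u)\<bar> + \<bar>g u\<bar>"
  proof -
    have "\<bar>- am * ln u\<bar> = am * \<bar>ln u\<bar>" "\<bar>ap * ln (1 - u)\<bar> = ap * \<bar>ln (1 - u)\<bar>"
      using am_pos ap_nonneg by (simp_all add: abs_mult)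
    then show ?thesis unfolding f_eq[OF u] by linarith
  qed
  also have "\<dots> \<le> am * ln (1 / d) + ap * ln (1 / d) + G"
    using l am_pos ap_nonneg g_bounded[OF u] by (intro add_mono mult_left_mono) auto
  finally show ?thesis by (simp add: algebra_simps)
qed

text \<open>A comparison in the manner of Denjoy and Koksma: for each \<open>k\<close> both orbits
  have a point in the same arc of length \<open>3 / q n\<close>, where the derivative of the roof is
  of order \<open>q n\<close> divided by the rank of the arc counted from the nearer end. The
  pairing yields harmonic sums. On the five extreme arcs the roof itself is logarithmic, since all
  points stay \<open>1 / (q n)\<^sup>2\<close> away from the singularity.\<close>

lemma bs_diff_log:
  assumes q: "6 \<le> q n"
    and gx: "\<And>j. 0 \<le> j \<Longrightarrow> j < int (q n) \<Longrightarrow> 1 / (q n)\<^sup>2 \<le> pt x j \<and> 1 / (q n)\<^sup>2 \<le> 1 - pt x j"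
    and gy: "\<And>j. 0 \<le> j \<Longrightarrow> j < int (q n) \<Longrightarrow> 1 / (q n)\<^sup>2 \<le> pt y j \<and> 1 / (q n)\<^sup>2 \<le> 1 - pt y j"
  shows "\<bar>bs (int (q n)) x - bs (int (q n)) y\<bar> \<le> C4 * (ln (q n) + 1)"
proof -
  define Q where "Q = q n"
  have Q6: "6 \<le> Q" using q Q_def by simp
  have *: "\<exists>u. bs (int Q) z = (\<Sum>k\<in>{0..<Q}. f (u k)) \<and> (\<forall>k<Q. 1 / (real Q)\<^sup>2 \<le> u k \<and> 1 / (real Q)\<^sup>2 \<le> 1 - u k) \<and>
     (\<forall>k. 1 \<le> k \<longrightarrow> k + 2 \<le> Q \<longrightarrow> (real k - 1) / Q < u k \<and> u k < (real k + 2) / Q)"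
    if gz: "\<And>j. 0 \<le> j \<Longrightarrow> j < int (q n) \<Longrightarrow> 1 / (q n)\<^sup>2 \<le> pt z j \<and> 1 / (q n)\<^sup>2 \<le> 1 - pt z j" for z
  proof -
    obtain \<tau> where t: "bij_betw \<tau> {0..<Q} {0..<int Q}"
      and arc: "\<forall>k. 1 \<le> k \<longrightarrow> k + 2 \<le> Q \<longrightarrow> (real k - 1) / Q < pt z (\<tau> k) \<and> pt z (\<tau> k) < (real k + 2) / Q"
      using orbit_arcs_inv[of n z] unfolding Q_def by blast
    have tr: "\<tau> k \<in> {0..<int Q}" if "k < Q" for k using bij_betwE[OF t] that by auto
    have "bs (int Q) z = (\<Sum>k\<in>{0..<Q}. f (pt z (\<tau> k)))"
      unfolding bs_nat by (rule sum.reindex_bij_betw[OF t, symmetric])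
    then show ?thesis using arc gz tr by (intro exI[of _ "\<lambda>k. pt z (\<tau> k)"]) (auto simp: Q_def)
  qed
  obtain u where u: "bs (int Q) x = (\<Sum>k\<in>{0..<Q}. f (u k))"
     "\<And>k. k < Q \<Longrightarrow> 1 / (real Q)\<^sup>2 \<le> u k \<and> 1 / (real Q)\<^sup>2 \<le> 1 - u k"
     "\<And>k. 1 \<le> k \<Longrightarrow> k + 2 \<le> Q \<Longrightarrow> (real k - 1) / Q < u k \<and> u k < (real k + 2) / Q"
    using *[OF gx] by blast
  obtain v where v: "bs (int Q) y = (\<Sum>k\<in>{0..<Q}. f (v k))"
     "\<And>k. k < Q \<Longrightarrow> 1 / (real Q)\<^sup>2 \<le> v k \<and> 1 / (real Q)\<^sup>2 \<le> 1 - v k"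
     "\<And>k. 1 \<le> k \<Longrightarrow> k + 2 \<le> Q \<Longrightarrow> (real k - 1) / Q < v k \<and> v k < (real k + 2) / Q"
    using *[OF gy] by blast
  have lnQ: "0 \<le> ln (real Q)" using Q6 by simp
  define E where "E = (am + ap) * (2 * ln Q) + G"
  have fE: "\<bar>f (w k)\<bar> \<le> E" if "1 / (real Q)\<^sup>2 \<le> w k \<and> 1 / (real Q)\<^sup>2 \<le> 1 - w k" for w :: "nat \<Rightarrow> real" and k
  proof -
    have "ln (1 / (1 / (real Q)\<^sup>2)) = 2 * ln Q" using Q6 by (simp add: ln_realpow)
    then show ?thesis using f_abs_le[of "1 / (real Q)\<^sup>2" "w k"] that Q6 unfolding E_def by auto
  qed
  have E0: "0 \<le> E" using lnQ am_pos ap_nonneg G_nonneg by (simp add: E_def)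
  have split: "{0..<Q} = {2..Q-4} \<union> {0, 1, Q-3, Q-2, Q-1}" using Q6 by auto
  have "\<bar>bs (int Q) x - bs (int Q) y\<bar> \<le> (\<Sum>k\<in>{0..<Q}. \<bar>f (u k) - f (v k)\<bar>)"
    unfolding u(1) v(1) by (simp add: sum_subtractf[symmetric] sum_abs)
  also have "\<dots> = (\<Sum>k\<in>{2..Q-4}. \<bar>f (u k) - f (v k)\<bar>) + (\<Sum>k\<in>{0, 1, Q-3, Q-2, Q-1}. \<bar>f (u k) - f (v k)\<bar>)"
    unfolding split using Q6 by (intro sum.union_disjoint) auto
  also have "(\<Sum>k\<in>{0, 1, Q-3, Q-2, Q-1}. \<bar>f (u k) - f (v k)\<bar>) \<le> (\<Sum>k\<in>{0, 1, Q-3, Q-2, Q-1}. 2 * E)"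
  proof (rule sum_mono)
    fix k assume "k \<in> {0, 1, Q-3, Q-2, Q-1}"
    then have "k < Q" using Q6 by auto
    then have "\<bar>f (u k)\<bar> \<le> E" "\<bar>f (v k)\<bar> \<le> E" using fE u(2) v(2) by auto
    then show "\<bar>f (u k) - f (v k)\<bar> \<le> 2 * E" by linarith
  qed
  also have "(\<Sum>k\<in>{0, 1, Q-3, Q-2, Q-1}. 2 * E) \<le> 5 * (2 * E)"
  proof -
    have "card {0, 1, Q-3, Q-2, Q-1} \<le> 5" by (simp add: card_insert_if)
    then have "real (card {0, 1, Q-3, Q-2, Q-1}) \<le> 5" by linarith
    then show ?thesis using E0 by (simp only: sum_constant) (intro mult_right_mono, auto)
  qed
  also have "(\<Sum>k\<in>{2..Q-4}. \<bar>f (u k) - f (v k)\<bar>) \<le> (\<Sum>k\<in>{2..Q-4}. 3 * Cf * (1 / real (k - 1) + 1 / real (Q - 2 - k)))"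
  proof (rule sum_mono)
    fix k assume "k \<in> {2..Q-4}"
    then have k: "2 \<le> k" "k + 4 \<le> Q" using Q6 by auto
    define l r where "l = (real k - 1) / Q" and "r = (real k + 2) / Q"
    have uv: "u k \<in> {l..r}" "v k \<in> {l..r}" using u(3)[of k] v(3)[of k] k by (auto simp: l_def r_def)
    have lr: "0 < l" "r < 1" using k by (auto simp: l_def r_def field_simps)
    define B where "B = Cf * (Q / real (k - 1) + Q / real (Q - 2 - k))"
    have B: "norm (f1 x) \<le> B" if "x \<in> {l..r}" for x
    proof -
      have x01: "0 < x" "x < 1" using that lr by auto
      have "1 / x \<le> 1 / l" "1 / (1 - x) \<le> 1 / (1 - r)"
        using that lr x01 by (intro divide_left_mono; simp)+
      moreover have "1 / l = Q / real (k - 1)" using k by (simp add: l_def of_nat_diff)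
      moreover have "1 / (1 - r) = Q / real (Q - 2 - k)"
      proof -
        have "1 - r = real (Q - 2 - k) / Q" using k by (simp add: r_def of_nat_diff field_simps)
        then show ?thesis by simp
      qed
      ultimately have "recip_dist x \<le> Q / real (k - 1) + Q / real (Q - 2 - k)" unfolding recip_dist_def by (metis add_mono)
      then have "Cf * recip_dist x \<le> B" unfolding B_def using Cf_pos by (intro mult_left_mono) auto
      then show ?thesis using f1_bound[OF x01] by simp
    qed
    have "norm (f (u k) - f (v k)) \<le> B * norm (u k - v k)"
    proof (rule field_differentiable_bound[of "{l..r}" f f1])
      fix x assume "x \<in> {l..r}"
      then have "0 < x" "x < 1" using lr by auto
      then show "(f has_field_derivative f1 x) (at x within {l..r})" using f_deriv DERIV_subset by blast
    qed (use B uv in auto)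
    also have "\<dots> \<le> B * (3 / Q)"
    proof (rule mult_left_mono)
      have "r - l = 3 / Q" by (simp add: r_def l_def diff_divide_distrib[symmetric])
      then show "norm (u k - v k) \<le> 3 / Q" using uv by auto
      show "0 \<le> B" unfolding B_def using Cf_pos by simp
    qed
    also have "\<dots> = 3 * Cf * (1 / real (k - 1) + 1 / real (Q - 2 - k))"
    proof -
      have "c * (real Q / x + real Q / y) * (3 / real Q) = 3 * c * (1 / x + 1 / y)" for c x y :: real
        using Q6 by (simp add: distrib_left add_divide_distrib mult.commute)
      then show ?thesis unfolding B_def .
    qed
    finally show "\<bar>f (u k) - f (v k)\<bar> \<le> 3 * Cf * (1 / real (k - 1) + 1 / real (Q - 2 - k))" by simp
  qed
  also have "\<dots> = 3 * Cf * ((\<Sum>k\<in>{2..Q-4}. 1 / real (k - 1)) + (\<Sum>k\<in>{2..Q-4}. 1 / real (Q - 2 - k)))"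
    by (simp only: sum_distrib_left[symmetric] sum.distrib[symmetric])
  also have "(\<Sum>k\<in>{2..Q-4}. 1 / real (k - 1)) = (\<Sum>k\<in>{1..Q-5}. 1 / real k)"
    by (rule sum.reindex_bij_witness[of _ "\<lambda>k. k + 1" "\<lambda>k. k - 1"]) (use Q6 in auto)
  also have "\<dots> \<le> harm Q" unfolding harm_def by (auto simp: inverse_eq_divide intro!: sum_mono2)
  also have "(\<Sum>k\<in>{2..Q-4}. 1 / real (Q - 2 - k)) = (\<Sum>k\<in>{2..Q-4}. 1 / real k)"
    by (rule sum.reindex_bij_witness[of _ "\<lambda>k. Q - 2 - k" "\<lambda>k. Q - 2 - k"]) auto
  also have "\<dots> \<le> harm Q" unfolding harm_def by (auto simp: inverse_eq_divide intro!: sum_mono2)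
  finally have "\<bar>bs (int Q) x - bs (int Q) y\<bar> \<le> 3 * Cf * (harm Q + harm Q) + 5 * (2 * E)"
    using Cf_pos by (simp add: mult_left_mono)
  also have "\<dots> \<le> 3 * Cf * (2 * (ln Q + 1)) + 5 * (2 * E)"
    using harm_le_ln[of Q] Q6 Cf_pos by (intro add_mono mult_left_mono) auto
  also have "\<dots> \<le> C4 * (ln Q + 1)"
  proof -
    have "0 \<le> Cf * (ln Q + 1)" "0 \<le> am + ap" "0 \<le> G * ln Q"
      using lnQ Cf_pos am_pos ap_nonneg G_nonneg by simp_all
    then show ?thesis by (simp add: C4_def E_def algebra_simps)
  qed
  finally show ?thesis by (simp add: Q_def)
qed

text \<open>Every block of \<open>Q\<close> consecutive orbit points has one within
  \<open>3 / Q\<close> of the singularity, so the mean of \<open>1 / (pt x j)\<^sup>2\<close> over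
  long stretches is as large as desired, uniformly in \<open>m\<close> and \<open>x\<close>. This is
  what lets the convexity of the logarithm outweigh the bounded second derivative of
  \<open>g\<close>.\<close>

lemma many_close_visits:
  assumes "0 < r"
  shows "\<exists>e1::nat. e1 \<ge> 1 \<and> (\<forall>m::int. \<forall>L::nat. \<forall>x. L \<ge> e1 \<longrightarrow> (\<forall>j\<in>{m..<m + int L}. 0 < pt x j) \<longrightarrow>
     (\<exists>j\<in>{m..<m + int L}. pt x j < r) \<and> M * real L \<le> (\<Sum>j\<in>{m..<m + int L}. 1 / (pt x j)\<^sup>2))"
proof -
  \<comment> \<open>A block contributes \<open>Q\<^sup>2 / 9\<close>, and rounding down to complete
    blocks costs a factor 2; hence 18.\<close>
  obtain n0 where n0: "real n0 > max 3 (max (3 / r) (18 * \<bar>M\<bar>))" using reals_Archimedean2 by blast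
  define Q where "Q = q n0"
  have Qn: "real n0 \<le> real Q" using q_ge[of n0] by (simp add: Q_def)
  have Q3: "3 \<le> Q" "3 / r < Q" "18 * M \<le> Q" using n0 Qn by linarith+
  have near: "\<exists>j\<in>{m..<m + int Q}. pt x j < 3 / Q" for m x
  proof -
    obtain j where "j < Q" "frac (x + of_int m * \<alpha> + real j * \<alpha>) < 3 / Q"
      using exists_small_frac[of n0 "x + of_int m * \<alpha>"] Q3 by (auto simp: Q_def)
    then show ?thesis by (intro bexI[of _ "m + int j"]) (auto simp: pt_def algebra_simps)
  qed
  have r: "3 / Q < r" using Q3 assms by (simp add: field_simps)
  have blocks: "real c * ((real Q)\<^sup>2 / 9) \<le> (\<Sum>j\<in>{m..<m + int (c * Q)}. 1 / (pt x j)\<^sup>2)"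
    if "\<And>j. m \<le> j \<Longrightarrow> j < m + int (c * Q) \<Longrightarrow> 0 < pt x j" for m c x
    using that
  proof (induction c)
    case 0 then show ?case by simp
  next
    case (Suc c)
    have "0 \<le> int (c * Q)" by simp
    then have sp: "{m..<m + int (Suc c * Q)} = {m..<m + int (c * Q)} \<union> {m + int (c * Q)..<m + int (c * Q) + int Q}"
      by (auto simp del: of_nat_mult)
    obtain j where j: "j \<in> {m + int (c * Q)..<m + int (c * Q) + int Q}" "pt x j < 3 / Q" using near by blast
    have "m \<le> j" "j < m + int (Suc c * Q)" using j \<open>0 \<le> int (c * Q)\<close> by (auto simp del: of_nat_mult simp: algebra_simps)
    then have "0 < pt x j" by (rule Suc.prems)
    then have "(pt x j)\<^sup>2 \<le> (3 / Q)\<^sup>2" using j by (intro power_mono) auto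
    then have "1 / (3 / Q)\<^sup>2 \<le> 1 / (pt x j)\<^sup>2"
      using \<open>0 < pt x j\<close> Q3 by (intro divide_left_mono mult_pos_pos zero_less_power) auto
    then have "(real Q)\<^sup>2 / 9 \<le> 1 / (pt x j)\<^sup>2" by (simp add: power_divide)
    also have "\<dots> \<le> (\<Sum>j\<in>{m + int (c * Q)..<m + int (c * Q) + int Q}. 1 / (pt x j)\<^sup>2)"
      using j by (intro member_le_sum) auto
    finally have "(real Q)\<^sup>2 / 9 \<le> (\<Sum>j\<in>{m + int (c * Q)..<m + int (c * Q) + int Q}. 1 / (pt x j)\<^sup>2)" .
    moreover have "real c * ((real Q)\<^sup>2 / 9) \<le> (\<Sum>j\<in>{m..<m + int (c * Q)}. 1 / (pt x j)\<^sup>2)"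
      using Suc.prems by (intro Suc.IH) auto
    ultimately show ?case unfolding sp by (subst sum.union_disjoint) (auto simp: algebra_simps)
  qed
  show ?thesis
  proof (intro exI[of _ Q] conjI allI impI)
    show "1 \<le> Q" using Q3 by simp
    fix m :: int and L :: nat and x
    assume L: "Q \<le> L" and pos: "\<forall>j\<in>{m..<m + int L}. 0 < pt x j"
    obtain j where "j \<in> {m..<m + int Q}" "pt x j < 3 / Q" using near by blast
    then show "\<exists>j\<in>{m..<m + int L}. pt x j < r" using L r by (intro bexI[of _ j]) auto
    define c where "c = L div Q"
    have cL: "c * Q \<le> L" by (simp add: c_def)
    have "L = c * Q + L mod Q" "L mod Q < Q" using Q3 by (simp_all add: c_def)
    then have "L < Suc c * Q" by simp
    moreover have "1 \<le> c" using L Q3 by (simp add: c_def Suc_le_eq div_greater_zero_iff)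
    then have "Suc c * Q \<le> 2 * (c * Q)" by simp
    ultimately have "L \<le> 2 * (c * Q)" by linarith
    then have c: "real L \<le> 2 * (real c * real Q)" by (metis of_nat_le_iff of_nat_mult of_nat_numeral)
    have "M * real L \<le> real Q / 18 * real L" using Q3 by (intro mult_right_mono) auto
    also have "\<dots> \<le> real Q / 18 * (2 * (real c * real Q))" using c by (intro mult_left_mono) auto
    also have "\<dots> = real c * ((real Q)\<^sup>2 / 9)" by (simp add: power2_eq_square)
    also have "\<dots> \<le> (\<Sum>j\<in>{m..<m + int (c * Q)}. 1 / (pt x j)\<^sup>2)"
    proof (rule blocks)
      fix j assume "m \<le> j" "j < m + int (c * Q)"
      moreover have "int (c * Q) \<le> int L" using cL by (simp only: of_nat_le_iff)
      ultimately have "j \<in> {m..<m + int L}" by simp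
      then show "0 < pt x j" using pos by blast
    qed
    also have "\<dots> \<le> (\<Sum>j\<in>{m..<m + int L}. 1 / (pt x j)\<^sup>2)" 
    proof (rule sum_mono2)
      have "int (c * Q) \<le> int L" using cL by (simp only: of_nat_le_iff)
      then show "{m..<m + int (c * Q)} \<subseteq> {m..<m + int L}" by auto
    qed auto
    finally show "M * real L \<le> (\<Sum>j\<in>{m..<m + int L}. 1 / (pt x j)\<^sup>2)" .
  qed
qed

end

section \<open>Sparseness of nearly constant Birkhoff sums\<close>

text \<open>Models the change of a Birkhoff sum when its base point moves left by \<open>t\<close>.
  The factor 12 is 4, from halving the distance to the nearest singularity, times 3, since the part
  coming from \<open>g\<close> keeps \<open>P2\<close> between one half and three halves of the
  singular part.\<close>

locale doubling_convex =
  fixes P P1 P2 :: "real \<Rightarrow> real" and h :: real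
  assumes h_pos: "0 < h"
    and P_deriv: "\<And>t. 0 \<le> t \<Longrightarrow> t \<le> h \<Longrightarrow> (P has_real_derivative P1 t) (at t)"
    and P1_deriv: "\<And>t. 0 \<le> t \<Longrightarrow> t \<le> h \<Longrightarrow> (P1 has_real_derivative P2 t) (at t)"
    and P2_nonneg: "\<And>t. 0 \<le> t \<Longrightarrow> t \<le> h \<Longrightarrow> 0 \<le> P2 t"
    and P2_doubling: "\<And>s t. 0 \<le> s \<Longrightarrow> s \<le> t \<Longrightarrow> t \<le> h \<Longrightarrow> P2 t \<le> 12 * P2 s"
begin

lemma P_mvt:
  assumes "0 \<le> s" "s < t" "t \<le> h"
  shows "\<exists>\<xi>. s < \<xi> \<and> \<xi> < t \<and> P t - P s = (t - s) * P1 \<xi>"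
  using MVT2[of s t P P1] P_deriv assms by auto

lemma P1_mvt:
  assumes "0 \<le> s" "s < t" "t \<le> h"
  shows "\<exists>\<xi>. s < \<xi> \<and> \<xi> < t \<and> P1 t - P1 s = (t - s) * P2 \<xi>"
  using MVT2[of s t P1 P2] P1_deriv assms by auto

lemma P1_mono:
  assumes "0 \<le> s" "s \<le> t" "t \<le> h" shows "P1 s \<le> P1 t"
proof (cases "s = t")
  case False
  then obtain \<xi> where x: "s < \<xi>" "\<xi> < t" "P1 t - P1 s = (t - s) * P2 \<xi>" using P1_mvt[of s t] assms by auto
  have "0 \<le> (t - s) * P2 \<xi>" using x assms P2_nonneg by simp
  then show ?thesis using x by linarith
qed simp

lemma P_le_max:
  assumes "0 \<le> s" "s \<le> t" "t \<le> r" "r \<le> h" shows "P t \<le> max (P s) (P r)"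
proof (cases "s = t \<or> t = r")
  case False
  then have st: "s < t" "t < r" using assms by auto
  obtain x where x: "s < x" "x < t" "P t - P s = (t - s) * P1 x" using P_mvt[of s t] assms st by auto
  obtain y where y: "t < y" "y < r" "P r - P t = (r - t) * P1 y" using P_mvt[of t r] assms st by auto
  have xy: "P1 x \<le> P1 y" using P1_mono[of x y] x y assms by auto
  show ?thesis
  proof (cases "P1 x \<le> 0")
    case True
    then have "P t - P s \<le> 0" using x st by (simp add: mult_nonneg_nonpos)
    then show ?thesis by simp
  next
    case False
    then have "0 \<le> P r - P t" using y st xy by (simp add: mult_nonneg_nonneg)
    then show ?thesis by simp
  qed
qed auto

text \<open>Subtracting the parabola with second derivative \<open>B\<close> leaves a function whose
  derivative is nondecreasing.\<close>

lemma second_difference: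
  assumes s: "0 \<le> s" and d: "0 < d" and r: "s + 2 * d \<le> h"
    and B: "\<And>t. s \<le> t \<Longrightarrow> t \<le> s + 2 * d \<Longrightarrow> B \<le> P2 t"
  shows "B * d\<^sup>2 \<le> P s - 2 * P (s + d) + P (s + 2 * d)"
proof -
  define R where "R t = P t - B * t\<^sup>2 / 2" for t
  define R1 where "R1 t = P1 t - B * t" for t
  have R: "(R has_real_derivative R1 t) (at t)" if "s \<le> t" "t \<le> s + 2 * d" for t
    unfolding R_def[abs_def] R1_def using that s r by (auto intro!: derivative_eq_intros P_deriv)
  have R1: "(R1 has_real_derivative P2 t - B) (at t)" if "s \<le> t" "t \<le> s + 2 * d" for t
    unfolding R1_def[abs_def] using that s r by (auto intro!: derivative_eq_intros P1_deriv)
  obtain x where x: "s < x" "x < s + d" "R (s + d) - R s = (s + d - s) * R1 x"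
    using MVT2[of s "s + d" R R1] R d by auto
  obtain y where y: "s + d < y" "y < s + 2 * d" "R (s + 2 * d) - R (s + d) = (s + 2 * d - (s + d)) * R1 y"
    using MVT2[of "s + d" "s + 2 * d" R R1] R d by auto
  have "R1 x \<le> R1 y"
  proof (rule DERIV_nonneg_imp_nondecreasing[of x y R1])
    fix t assume "x \<le> t" "t \<le> y"
    then show "\<exists>z. (R1 has_real_derivative z) (at t) \<and> 0 \<le> z"
      using R1[of t] B[of t] x y d by (intro exI[of _ "P2 t - B"]) auto
  qed (use x y in auto)
  then have "d * R1 x \<le> d * R1 y" using d by simp
  then have "R (s + d) - R s \<le> R (s + 2 * d) - R (s + d)" using x y by simp
  moreover have "B * s\<^sup>2 - 2 * (B * (s + d)\<^sup>2) + B * (s + 2 * d)\<^sup>2 = 2 * (B * d\<^sup>2)"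
    by (simp add: power2_eq_square algebra_simps)
  ultimately show ?thesis unfolding R_def by linarith
qed

text \<open>Smallness of \<open>P\<close> on an interval bounds a second difference and hence, by
  doubling, the second derivative everywhere to the right of its midpoint. From there
  \<open>P\<close> grows at most quadratically up to \<open>h\<close>, so a definite value
  \<open>P h\<close> forces the interval to be short.\<close>

lemma level_set_short:
  assumes t: "0 \<le> t1" "t1 < t2" "t2 \<le> h" and small: "\<And>t. t1 \<le> t \<Longrightarrow> t \<le> t2 \<Longrightarrow> \<bar>P t\<bar> \<le> \<epsilon>"
  shows "\<bar>P h\<bar> * (t2 - t1)\<^sup>2 \<le> 800 * \<epsilon> * h\<^sup>2"
proof -
  define l where "l = t2 - t1"
  have l: "0 < l" "l \<le> h" using t by (auto simp: l_def)
  have e: "0 \<le> \<epsilon>" using small[of t1] t by linarith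
  define m where "m = t1 + l / 2"
  have m: "t1 < m" "m < t2" using l by (auto simp: m_def l_def field_simps)
  \<comment> \<open>The second difference with step \<open>l / 4\<close> is at most
    \<open>4 * \<epsilon>\<close>, and 4 * 12 * 16 = 768.\<close>
  define B where "B = 768 * \<epsilon> / l\<^sup>2"
  have P2B: "P2 t \<le> B" if mt: "m \<le> t" "t \<le> h" for t
  proof -
    have "P2 t / 12 * (l / 4)\<^sup>2 \<le> P t1 - 2 * P (t1 + l / 4) + P (t1 + 2 * (l / 4))"
    proof (rule second_difference)
      fix s assume s: "t1 \<le> s" "s \<le> t1 + 2 * (l / 4)"
      then have "P2 t \<le> 12 * P2 s" using mt t by (intro P2_doubling) (auto simp: m_def)
      then show "P2 t / 12 \<le> P2 s" by simp
    qed (use t l m in \<open>auto simp: m_def\<close>)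
    moreover have "\<bar>P t1\<bar> \<le> \<epsilon>" "\<bar>P (t1 + l / 4)\<bar> \<le> \<epsilon>" "\<bar>P (t1 + 2 * (l / 4))\<bar> \<le> \<epsilon>"
      using l by (auto intro!: small simp: l_def field_simps)
    ultimately have "P2 t / 12 * (l / 4)\<^sup>2 \<le> 4 * \<epsilon>" by linarith
    then have "P2 t * l\<^sup>2 \<le> 768 * \<epsilon>" by (simp add: power2_eq_square field_simps)
    then show ?thesis using l by (simp add: B_def field_simps)
  qed
  obtain \<xi> where x: "m < \<xi>" "\<xi> < t2" "P t2 - P m = (t2 - m) * P1 \<xi>"
    using P_mvt[of m t2] m t by auto
  have B0: "0 \<le> B" using e l by (simp add: B_def)
  have x1: "\<bar>P1 \<xi>\<bar> \<le> 4 * \<epsilon> / l"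
  proof -
    have "\<bar>P t2 - P m\<bar> \<le> 2 * \<epsilon>" using small[of t2] small[of m] m t by linarith
    then have "(l / 2) * \<bar>P1 \<xi>\<bar> \<le> 2 * \<epsilon>" 
    proof -
      have "t2 - m = l / 2" by (simp add: m_def l_def field_simps)
      then have "\<bar>l / 2 * P1 \<xi>\<bar> \<le> 2 * \<epsilon>" using x(3) \<open>\<bar>P t2 - P m\<bar> \<le> 2 * \<epsilon>\<close> by metis
      then show ?thesis using l by (simp only: abs_mult)
    qed
    then show ?thesis using l by (simp add: field_simps)
  qed
  have slope: "\<bar>P1 t\<bar> \<le> 4 * \<epsilon> / l + B * h" if tt: "\<xi> < t" "t \<le> h" for t
  proof -
    obtain s where s: "\<xi> < s" "s < t" "P1 t - P1 \<xi> = (t - \<xi>) * P2 s" using P1_mvt[of \<xi> t] tt x m t by auto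
    have "(t - \<xi>) * P2 s \<le> h * B"
      using P2B[of s] P2_nonneg[of s] s tt x m t B0 by (intro mult_mono) auto
    moreover have "0 \<le> (t - \<xi>) * P2 s" using P2_nonneg[of s] s tt x m t by simp
    ultimately show ?thesis using s x1 by (simp add: mult.commute)
  qed
  have "\<bar>P h - P \<xi>\<bar> \<le> h * (4 * \<epsilon> / l + B * h)"
  proof -
    obtain s where s: "\<xi> < s" "s < h" "P h - P \<xi> = (h - \<xi>) * P1 s" using P_mvt[of \<xi> h] x m t by auto
    have "\<bar>P h - P \<xi>\<bar> = (h - \<xi>) * \<bar>P1 s\<bar>" using s x t by (simp add: abs_mult)
    also have "\<dots> \<le> h * (4 * \<epsilon> / l + B * h)"
      using slope[of s] s x m t by (intro mult_mono) auto
    finally show ?thesis .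
  qed
  then have "\<bar>P h\<bar> \<le> \<epsilon> + h * (4 * \<epsilon> / l + B * h)" using small[of \<xi>] x m by linarith
  then have "\<bar>P h\<bar> * l\<^sup>2 \<le> (\<epsilon> + h * (4 * \<epsilon> / l + B * h)) * l\<^sup>2" by (intro mult_right_mono) auto
  also have "\<dots> = \<epsilon> * l\<^sup>2 + 4 * \<epsilon> * (h * l) + 768 * \<epsilon> * h\<^sup>2"
    using l by (simp add: B_def power2_eq_square field_simps)
  also have "\<dots> \<le> \<epsilon> * h\<^sup>2 + 4 * \<epsilon> * h\<^sup>2 + 768 * \<epsilon> * h\<^sup>2"
    using l e by (intro add_mono mult_left_mono) (auto simp: power2_eq_square intro!: mult_mono)
  also have "\<dots> \<le> 800 * \<epsilon> * h\<^sup>2" using mult_nonneg_nonneg[OF e, of "h\<^sup>2"] by (simp add: algebra_simps)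
  finally show ?thesis by (simp add: l_def)
qed

end

lemma card_separated:
  fixes T :: "real set"
  assumes fin: "finite T" and sep: "\<And>s t. s \<in> T \<Longrightarrow> t \<in> T \<Longrightarrow> s \<noteq> t \<Longrightarrow> \<sigma> \<le> \<bar>s - t\<bar>" and s: "0 < \<sigma>"
    and diam: "\<And>s t. s \<in> T \<Longrightarrow> t \<in> T \<Longrightarrow> s < t \<Longrightarrow> t - s \<le> l" and l: "0 \<le> l"
  shows "real (card T) \<le> l / \<sigma> + 1"
proof (cases "T = {}")
  case False
  define m where "m = Min T"
  have m: "m \<in> T" "\<And>t. t \<in> T \<Longrightarrow> m \<le> t" using fin False by (auto simp: m_def)
  have d: "t - m \<le> l" if "t \<in> T" for t using diam[of m t] m that l by (cases "t = m") (auto simp: less_le)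
  have "inj_on (\<lambda>t. \<lfloor>(t - m) / \<sigma>\<rfloor>) T"
  proof (rule inj_onI, rule ccontr)
    fix x y assume xy: "x \<in> T" "y \<in> T" "\<lfloor>(x - m) / \<sigma>\<rfloor> = \<lfloor>(y - m) / \<sigma>\<rfloor>" "x \<noteq> y"
    then have "\<bar>(x - m) / \<sigma> - (y - m) / \<sigma>\<bar> < 1" by linarith
    then have "\<bar>x - y\<bar> / \<sigma> < 1" using s by (simp add: diff_divide_distrib[symmetric])
    then show False using sep[OF xy(1,2,4)] s by (simp add: field_simps)
  qed
  moreover have "(\<lambda>t. \<lfloor>(t - m) / \<sigma>\<rfloor>) ` T \<subseteq> {0..\<lfloor>l / \<sigma>\<rfloor>}"
    using m d s by (auto intro!: floor_mono divide_right_mono)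
  ultimately have "card T \<le> card {0..\<lfloor>l / \<sigma>\<rfloor>}" by (intro card_inj_on_le) auto
  also have "\<dots> = nat (\<lfloor>l / \<sigma>\<rfloor> + 1)" by simp
  finally have "real (card T) \<le> real (nat (\<lfloor>l / \<sigma>\<rfloor> + 1))" by simp
  also have "\<dots> = of_int \<lfloor>l / \<sigma>\<rfloor> + 1" using l s by simp
  finally show ?thesis by linarith
qed (use l s in simp)

context doubling_convex
begin

text \<open>A convex function lies in \<open>{-\<epsilon>..\<epsilon>}\<close> on at most two
  intervals, before and after it dips below \<open>- \<epsilon>\<close>; \<open>T1\<close> collects
  the points of the first. Each is short, so it holds few separated points.\<close>

lemma level_set_count:
  assumes fin: "finite T" and T: "\<And>t. t \<in> T \<Longrightarrow> 0 \<le> t \<and> t \<le> h \<and> \<bar>P t\<bar> \<le> \<epsilon>"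
    and sep: "\<And>s t. s \<in> T \<Longrightarrow> t \<in> T \<Longrightarrow> s \<noteq> t \<Longrightarrow> \<sigma> \<le> \<bar>s - t\<bar>" and s: "0 < \<sigma>"
    and e: "0 \<le> \<epsilon>" and k: "0 < \<kappa>" "\<bar>P h\<bar> = \<kappa>"
  shows "real (card T) \<le> 2 * (h * sqrt (800 * \<epsilon> / \<kappa>) / \<sigma> + 1)"
proof -
  define l where "l = h * sqrt (800 * \<epsilon> / \<kappa>)"
  have l: "0 \<le> l" using h_pos e k by (simp add: l_def)
  have short: "t2 - t1 \<le> l" if "0 \<le> t1" "t1 < t2" "t2 \<le> h" "\<And>t. t1 \<le> t \<Longrightarrow> t \<le> t2 \<Longrightarrow> \<bar>P t\<bar> \<le> \<epsilon>" for t1 t2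
  proof -
    have "\<kappa> * (t2 - t1)\<^sup>2 \<le> 800 * \<epsilon> * h\<^sup>2" using level_set_short[OF that] k by simp
    then have "(t2 - t1)\<^sup>2 \<le> l\<^sup>2" using k e by (simp add: l_def power_mult_distrib field_simps)
    then show ?thesis using l by (rule power2_le_imp_le)
  qed
  define T1 where "T1 = {t \<in> T. \<forall>s. 0 \<le> s \<and> s \<le> t \<longrightarrow> - \<epsilon> \<le> P s}"
  have c1: "real (card T1) \<le> l / \<sigma> + 1"
  proof (rule card_separated[OF _ _ s _ l])
    fix t1 t2 assume t: "t1 \<in> T1" "t2 \<in> T1" "t1 < t2"
    show "t2 - t1 \<le> l"
    proof (rule short)
      fix t assume tt: "t1 \<le> t" "t \<le> t2"
      have "t1 \<in> T" "t2 \<in> T" using t by (auto simp: T1_def)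
      note T[OF this(1)] T[OF this(2)]
      moreover from this have "P t \<le> max (P t1) (P t2)" using tt by (intro P_le_max) auto
      moreover have "- \<epsilon> \<le> P t" using t tt calculation by (auto simp: T1_def)
      ultimately show "\<bar>P t\<bar> \<le> \<epsilon>" by (auto simp: abs_le_iff max_def split: if_splits)
    qed (use t T in \<open>auto simp: T1_def\<close>)
  qed (use fin sep in \<open>auto simp: T1_def\<close>)
  have c2: "real (card (T - T1)) \<le> l / \<sigma> + 1"
  proof (rule card_separated[OF _ _ s _ l])
    fix t1 t2 assume t: "t1 \<in> T - T1" "t2 \<in> T - T1" "t1 < t2"
    obtain s0 where s0: "0 \<le> s0" "s0 \<le> t1" "P s0 < - \<epsilon>" using t by (auto simp: T1_def not_le)
    show "t2 - t1 \<le> l"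
    proof (rule short)
      fix t assume tt: "t1 \<le> t" "t \<le> t2"
      have "t1 \<in> T" "t2 \<in> T" using t by auto
      note TT = T[OF this(1)] T[OF this(2)]
      have "P t \<le> max (P t1) (P t2)" using tt TT by (intro P_le_max) auto
      then have "P t \<le> \<epsilon>" using TT by (auto simp: abs_le_iff max_def split: if_splits)
      moreover have "P t1 \<le> max (P s0) (P t)" using tt TT s0 by (intro P_le_max) auto
      then have "- \<epsilon> \<le> P t" using TT s0 by (auto simp: abs_le_iff max_def split: if_splits)
      ultimately show "\<bar>P t\<bar> \<le> \<epsilon>" by linarith
    qed (use t T in auto)
  qed (use fin sep in auto)
  have "card T = card T1 + card (T - T1)"
    using fin card_Diff_subset[of T1 T] card_mono[of T T1] finite_subset[of T1 T] by (auto simp: T1_def)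
  then show ?thesis using c1 c2 unfolding l_def by simp
qed

end

text \<open>Peeling off intervals from right to left, disjoint intervals inside
  \<open>{-1..<1}\<close> cover \<open>A\<close>, and their total length is at most 2. Formally, at
  a least point violating the bound \<open>c * (w + 1)\<close> the interval ending there and the
  bound before it give a contradiction; the summand 1 allows an interval to start below 0.\<close>

lemma greedy_count:
  fixes A :: "real set" and c :: real
  assumes "finite A" "A \<subseteq> {0..<1}" "0 \<le> c"
    and "\<And>w. w \<in> A \<Longrightarrow> \<exists>h. 0 < h \<and> h < 1 \<and> real (card (A \<inter> {w-h..w})) \<le> c * h"
  shows "real (card A) \<le> 2 * c"
proof -
  have *: "\<forall>w\<in>A. real (card (A \<inter> {..w})) \<le> c * (w + 1)"
  proof (rule ccontr)
    assume "\<not> ?thesis"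
    then have ne: "{w \<in> A. \<not> real (card (A \<inter> {..w})) \<le> c * (w + 1)} \<noteq> {}" by auto
    define w where "w = Min {w \<in> A. \<not> real (card (A \<inter> {..w})) \<le> c * (w + 1)}"
    have w: "w \<in> A" "\<not> real (card (A \<inter> {..w})) \<le> c * (w + 1)"
      using Min_in[OF _ ne] assms(1) unfolding w_def by auto
    have wmin: "real (card (A \<inter> {..v})) \<le> c * (v + 1)" if "v \<in> A" "v < w" for v
    proof (rule ccontr)
      assume "\<not> ?thesis"
      then have "w \<le> v" unfolding w_def using that assms(1) by (intro Min_le) auto
      then show False using that by simp
    qed
    obtain h where h: "0 < h" "h < 1" "real (card (A \<inter> {w-h..w})) \<le> c * h" using assms(4)[OF w(1)] by blast
    define R where "R = A \<inter> {..<w-h}"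
    have R: "real (card R) \<le> c * (w - h + 1)"
    proof (cases "R = {}")
      case True
      have "0 \<le> c * (w - h + 1)" using assms(2,3) w h by (intro mult_nonneg_nonneg) auto
      then show ?thesis using True by simp
    next
      case False
      have fR: "finite R" using assms(1) by (simp add: R_def)
      define v where "v = Max R"
      have v: "v \<in> A" "v < w - h" "\<And>x. x \<in> R \<Longrightarrow> x \<le> v"
        using Max_in[OF fR False] fR by (auto simp: v_def R_def)
      have "card R \<le> card (A \<inter> {..v})" using v assms(1) by (intro card_mono) (auto simp: R_def)
      also have "real (card (A \<inter> {..v})) \<le> c * (v + 1)" using wmin v h by auto
      also have "\<dots> \<le> c * (w - h + 1)" using v assms(3) by (intro mult_left_mono) auto
      finally show ?thesis by simp
    qed
    have "A \<inter> {..w} \<subseteq> R \<union> (A \<inter> {w-h..w})" by (auto simp: R_def)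
    then have "card (A \<inter> {..w}) \<le> card (R \<union> (A \<inter> {w-h..w}))" using assms(1) by (intro card_mono) (auto simp: R_def)
    also have "\<dots> \<le> card R + card (A \<inter> {w-h..w})" by (rule card_Un_le)
    finally have "real (card (A \<inter> {..w})) \<le> c * (w - h + 1) + c * h" using R h by linarith
    then show False using w by (simp add: algebra_simps)
  qed
  show ?thesis
  proof (cases "A = {}")
    case False
    then have M: "Max A \<in> A" using assms(1) by simp
    have "A \<inter> {..Max A} = A" using assms(1) by auto
    then have "real (card A) \<le> c * (Max A + 1)" using * M by force
    also have "\<dots> \<le> c * 2" using M assms(2,3) by (intro mult_left_mono) auto
    finally show ?thesis by simp
  qed (use assms in simp)
qed

context arnold_roof_flow
begin

text \<open>The variation that a sum is certain to reach on the local interval. A second difference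
  of size \<open>am / 32\<close> consists of one value counted twice and another counted once, hence
  96; the cap 1/2 keeps the variation below 1.\<close>

definition \<kappa>\<^sub>0 :: real where "\<kappa>\<^sub>0 = min (1/2) (am / 96)"

lemma \<kappa>\<^sub>0_pos: "0 < \<kappa>\<^sub>0" using am_pos by (simp add: \<kappa>\<^sub>0_def)

text \<open>The interval lies to the left of \<open>w\<close> because the only terms of the second derivative that grow to the
  left come from singularities on the left; half the distance to the nearest of them is a safe length.\<close>

lemma local_interval:
  fixes w :: real
  assumes fin: "finite S" and pos: "\<And>j. j \<in> S \<Longrightarrow> 0 < pt w j"
    and curv: "2 * G * real (card S) \<le> (\<Sum>j\<in>S. am / (pt w j)\<^sup>2)"
    and near: "\<exists>j\<in>S. pt w j < r"
  shows "\<exists>h. 0 < h \<and> h < r \<and> h < 1 \<and> \<kappa>\<^sub>0 \<le> 4 * Cf * KS S w * h \<and>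
     (\<forall>w'\<in>{w-h..w}. \<bar>GS S w' - GS S w\<bar> < 1) \<and>
     (\<forall>T \<epsilon> \<sigma>. finite T \<longrightarrow> T \<subseteq> {w-h..w} \<longrightarrow> 0 < \<sigma> \<longrightarrow> 0 \<le> \<epsilon> \<longrightarrow>
        (\<forall>s\<in>T. \<forall>t\<in>T. s \<noteq> t \<longrightarrow> \<sigma> \<le> \<bar>s - t\<bar>) \<longrightarrow> (\<forall>t\<in>T. \<bar>GS S t - GS S w\<bar> \<le> \<epsilon>) \<longrightarrow>
        real (card T) \<le> 2 * (h * sqrt (800 * \<epsilon> / \<kappa>\<^sub>0) / \<sigma> + 1))"
proof -
  define u where "u j = pt w j" for j
  have u01: "0 < u j" "u j < 1" if "j \<in> S" for j using pos[OF that] pt_range by (auto simp: u_def)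
  have ne: "S \<noteq> {}" using near by auto
  define \<rho> where "\<rho> = Min (u ` S)"
  have rho_le: "\<rho> \<le> u j" if "j \<in> S" for j using that fin by (simp add: \<rho>_def)
  obtain j0 where j0: "j0 \<in> S" "u j0 = \<rho>"
  proof -
    have "\<rho> \<in> u ` S" unfolding \<rho>_def using fin ne by (intro Min_in) auto
    then show ?thesis using that by auto
  qed
  have rho: "0 < \<rho>" "\<rho> < 1" "\<rho> < r" using j0 u01 near rho_le by (auto simp: u_def intro: le_less_trans)
  define Q where "Q t = (\<Sum>j\<in>S. f (u j - t))" for t
  define P where "P t = Q t - Q 0" for t
  define P1 where "P1 t = (\<Sum>j\<in>S. - f1 (u j - t))" for t
  define P2 where "P2 t = (\<Sum>j\<in>S. f2 (u j - t))" for t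
  \<comment> \<open>The singular part of \<open>P2\<close>. By \<open>curv\<close> it is at least
    twice what \<open>g2\<close> can contribute, so the two stay comparable.\<close>
  define H where "H t = (\<Sum>j\<in>S. am / (u j - t)\<^sup>2 + ap / (1 - (u j - t))\<^sup>2)" for t
  have GSQ: "GS S (w - t) = Q t" if "0 \<le> t" "t \<le> \<rho> / 2" for t
  proof -
    have "pt (w - t) j = u j - t" if j: "j \<in> S" for j
    proof -
      have "frac (w + of_int j * \<alpha> + (- t)) = frac (w + of_int j * \<alpha>) + (- t)"
        using that \<open>0 \<le> t\<close> \<open>t \<le> \<rho> / 2\<close> rho_le[OF j] u01[OF j] rho by (intro frac_shift) (auto simp: u_def pt_def)
      then show ?thesis by (simp add: u_def pt_def algebra_simps)
    qed
    then show ?thesis by (simp add: GS_def Q_def)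
  qed
  have rng: "0 < u j - t" "u j - t < 1" "u j / 2 \<le> u j - t" if "j \<in> S" "0 \<le> t" "t \<le> \<rho> / 2" for j t
    using that rho_le[OF that(1)] u01[OF that(1)] by auto
  have minus: "((\<lambda>t. c - t) has_real_derivative -1) (at t)" for c t :: real
    by (auto intro!: derivative_eq_intros)
  have D0: "(P has_real_derivative P1 t) (at t)" if "0 \<le> t" "t \<le> \<rho> / 2" for t
  proof -
    have "((\<lambda>t. \<Sum>j\<in>S. f (u j - t)) has_real_derivative (\<Sum>j\<in>S. f1 (u j - t) * (- 1))) (at t)"
    proof (rule DERIV_sum)
      fix j assume "j \<in> S"
      then show "((\<lambda>t. f (u j - t)) has_real_derivative f1 (u j - t) * - 1) (at t)"
        using DERIV_chain2[where f = f and g = "\<lambda>t. u j - t" and Da = "f1 (u j - t)" and Db = "-1" and x = t and s = UNIV]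
          f_deriv[of "u j - t"] rng[of j t] that minus by auto
    qed
    from DERIV_diff[OF this DERIV_const[of "Q 0"]] show ?thesis by (simp add: P_def[abs_def] Q_def P1_def)
  qed
  have D1: "(P1 has_real_derivative P2 t) (at t)" if "0 \<le> t" "t \<le> \<rho> / 2" for t
    unfolding P1_def[abs_def] P2_def
  proof (rule DERIV_sum)
    fix j assume j: "j \<in> S"
    have "((\<lambda>t. f1 (u j - t)) has_real_derivative f2 (u j - t) * - 1) (at t)"
      using DERIV_chain2[where f = f1 and g = "\<lambda>t. u j - t" and Da = "f2 (u j - t)" and Db = "-1" and x = t and s = UNIV]
        f1_deriv[of "u j - t"] rng[OF j that] minus by auto
    from DERIV_minus[OF this] show "((\<lambda>t. - f1 (u j - t)) has_real_derivative f2 (u j - t)) (at t)" by simp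
  qed
  have H2: "2 * G * real (card S) \<le> H t" if "0 \<le> t" "t \<le> \<rho> / 2" for t
  proof -
    have "(\<Sum>j\<in>S. am / (pt w j)\<^sup>2) \<le> H t" unfolding H_def
    proof (rule sum_mono)
      fix j assume j: "j \<in> S"
      have "am / (u j)\<^sup>2 \<le> am / (u j - t)\<^sup>2"
        using rng[OF j that] that am_pos by (intro divide_left_mono power_mono mult_pos_pos zero_less_power) auto
      moreover have "0 \<le> ap / (1 - (u j - t))\<^sup>2" using ap_nonneg by simp
      ultimately show "am / (pt w j)\<^sup>2 \<le> am / (u j - t)\<^sup>2 + ap / (1 - (u j - t))\<^sup>2" by (simp add: u_def)
    qed
    then show ?thesis using curv by linarith
  qed
  have P2H: "H t / 2 \<le> P2 t" "P2 t \<le> 3 / 2 * H t" if t: "0 \<le> t" "t \<le> \<rho> / 2" for t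
  proof -
    have "P2 t - H t = (\<Sum>j\<in>S. g2 (u j - t))" by (simp add: P2_def H_def f2_def sum_subtractf[symmetric])
    moreover have "\<bar>\<Sum>j\<in>S. g2 (u j - t)\<bar> \<le> (\<Sum>j\<in>S. G)"
      using g2_bounded rng t by (intro order.trans[OF sum_abs] sum_mono) auto
    then have "\<bar>\<Sum>j\<in>S. g2 (u j - t)\<bar> \<le> G * real (card S)" by (simp add: mult.commute)
    ultimately show "H t / 2 \<le> P2 t" "P2 t \<le> 3 / 2 * H t" using H2[OF t] by (simp_all add: abs_le_iff)
  qed
  have Hdbl: "H t \<le> 4 * H s" if st: "0 \<le> s" "s \<le> t" "t \<le> \<rho> / 2" for s t
  proof -
    have "H t \<le> (\<Sum>j\<in>S. 4 * (am / (u j - s)\<^sup>2 + ap / (1 - (u j - s))\<^sup>2))" unfolding H_def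
    proof (rule sum_mono)
      fix j assume j: "j \<in> S"
      have r: "0 < u j - t" "0 < u j - s" "u j - s \<le> 2 * (u j - t)" "u j - s < 1"
        using rng[OF j, of t] rng[OF j, of s] st u01[OF j] by auto
      have "(u j - s)\<^sup>2 \<le> (2 * (u j - t))\<^sup>2" using r by (intro power_mono) auto
      then have "4 * am / (2 * (u j - t))\<^sup>2 \<le> 4 * am / (u j - s)\<^sup>2"
        using r am_pos by (intro divide_left_mono mult_pos_pos zero_less_power) auto
      moreover have "4 * am / (2 * v)\<^sup>2 = am / v\<^sup>2" for v :: real by (simp add: power_mult_distrib)
      ultimately have "am / (u j - t)\<^sup>2 \<le> 4 * am / (u j - s)\<^sup>2" by metis
      moreover have "ap / (1 - (u j - t))\<^sup>2 \<le> ap / (1 - (u j - s))\<^sup>2"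
        using r st ap_nonneg by (intro divide_left_mono power_mono mult_pos_pos zero_less_power) auto
      moreover have "0 \<le> ap / (1 - (u j - s))\<^sup>2" using ap_nonneg by simp
      ultimately show "am / (u j - t)\<^sup>2 + ap / (1 - (u j - t))\<^sup>2 \<le> 4 * (am / (u j - s)\<^sup>2 + ap / (1 - (u j - s))\<^sup>2)"
        by simp
    qed
    then show ?thesis by (simp add: H_def sum_distrib_left)
  qed
  have H0: "0 \<le> H t" for t unfolding H_def using am_pos ap_nonneg by (intro sum_nonneg) auto
  have DC: "doubling_convex P P1 P2 h" if "0 < h" "h \<le> \<rho> / 2" for h
  proof
    fix s t assume st: "0 \<le> s" "s \<le> t" "t \<le> h"
    have "P2 t \<le> 3 / 2 * H t" "H s / 2 \<le> P2 s" using P2H st that by auto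
    then show "P2 t \<le> 12 * P2 s" using Hdbl[of s t] st that by auto
  next
    fix t assume "0 \<le> t" "t \<le> h"
    then show "0 \<le> P2 t" using P2H(1)[of t] H0[of t] that by auto
  qed (use D0 D1 that in auto)
  \<comment> \<open>The singularity at distance \<open>\<rho>\<close> alone makes the second
    difference of \<open>P\<close> at 0 at least \<open>am / 32\<close>, and \<open>P 0 = 0\<close>;
    so one of the other two values is at least \<open>am / 96\<close> in absolute value.\<close>
  have "\<exists>t0. 0 \<le> t0 \<and> t0 \<le> \<rho> / 2 \<and> \<kappa>\<^sub>0 \<le> \<bar>P t0\<bar>"
  proof -
    interpret doubling_convex P P1 P2 "\<rho> / 2" using rho by (intro DC) auto
    have "am / (2 * \<rho>\<^sup>2) * (\<rho> / 4)\<^sup>2 \<le> P 0 - 2 * P (0 + \<rho> / 4) + P (0 + 2 * (\<rho> / 4))"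
    proof (rule second_difference)
      fix t assume t: "0 \<le> t" "t \<le> 0 + 2 * (\<rho> / 4)"
      have "am / \<rho>\<^sup>2 \<le> am / (u j0 - t)\<^sup>2"
        using rng[OF j0(1), of t] j0 t am_pos by (intro divide_left_mono power_mono mult_pos_pos zero_less_power) auto
      also have "\<dots> \<le> am / (u j0 - t)\<^sup>2 + ap / (1 - (u j0 - t))\<^sup>2" using ap_nonneg by simp
      also have "\<dots> \<le> H t" unfolding H_def using j0 fin am_pos ap_nonneg
        by (intro member_le_sum[of j0 S "\<lambda>j. am / (u j - t)\<^sup>2 + ap / (1 - (u j - t))\<^sup>2"]) auto
      finally show "am / (2 * \<rho>\<^sup>2) \<le> P2 t" using P2H(1)[of t] t by simp
    qed (use rho in auto)
    also have "am / (2 * \<rho>\<^sup>2) * (\<rho> / 4)\<^sup>2 = am / 32" using rho by (simp add: power2_eq_square)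
    also have "P 0 = 0" by (simp add: P_def)
    finally have "am / 96 \<le> \<bar>P (\<rho> / 4)\<bar> \<or> am / 96 \<le> \<bar>P (\<rho> / 2)\<bar>" by auto
    then have "\<kappa>\<^sub>0 \<le> \<bar>P (\<rho> / 4)\<bar> \<or> \<kappa>\<^sub>0 \<le> \<bar>P (\<rho> / 2)\<bar>" unfolding \<kappa>\<^sub>0_def by linarith
    moreover have "0 \<le> \<rho> / 4" "\<rho> / 4 \<le> \<rho> / 2" "0 \<le> \<rho> / 2" using rho by auto
    ultimately show ?thesis by blast
  qed
  then obtain t0 where t0: "0 \<le> t0" "t0 \<le> \<rho> / 2" "\<kappa>\<^sub>0 \<le> \<bar>P t0\<bar>" by blast
  have "isCont P t" if "t \<in> {0..\<rho>/2}" for t using D0[of t] that by (auto intro: DERIV_isCont)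
  then have contP: "continuous_on {0..\<rho>/2} (\<lambda>t. \<bar>P t\<bar>)"
    by (intro continuous_on_rabs continuous_at_imp_continuous_on) auto
  \<comment> \<open>The least element \<open>h\<close> of \<open>Z\<close> is the first displacement
    at which the variation reaches \<open>\<kappa>\<^sub>0\<close>: it stays below this on the whole
    interval and equals it at the end.\<close>
  define Z where "Z = {t \<in> {0..t0}. \<bar>P t\<bar> = \<kappa>\<^sub>0}"
  have ivt: "\<exists>t\<ge>0. t \<le> b \<and> \<bar>P t\<bar> = \<kappa>\<^sub>0" if "0 \<le> b" "b \<le> t0" "\<kappa>\<^sub>0 \<le> \<bar>P b\<bar>" for b
    using IVT'[of "\<lambda>t. \<bar>P t\<bar>" 0 \<kappa>\<^sub>0 b] that continuous_on_subset[OF contP, of "{0..b}"] t0 \<kappa>\<^sub>0_pos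
    by (auto simp: P_def)
  have "compact Z"
  proof -
    have "closed {t \<in> {0..t0}. \<bar>P t\<bar> = \<kappa>\<^sub>0}"
      using t0 continuous_on_subset[OF contP, of "{0..t0}"]
      by (intro continuous_closed_preimage_constant) auto
    then have "compact ({0..t0} \<inter> Z)" unfolding Z_def by (intro compact_Int_closed) auto
    moreover have "{0..t0} \<inter> Z = Z" by (auto simp: Z_def)
    ultimately show ?thesis by simp
  qed
  moreover have "Z \<noteq> {}" using ivt[of t0] t0 by (auto simp: Z_def)
  ultimately obtain h where h: "h \<in> Z" "\<And>t. t \<in> Z \<Longrightarrow> h \<le> t" using compact_attains_inf by metis
  have hk: "0 \<le> h" "h \<le> t0" "\<bar>P h\<bar> = \<kappa>\<^sub>0" using h by (auto simp: Z_def)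
  have hpos: "0 < h" using hk \<kappa>\<^sub>0_pos by (cases "h = 0") (auto simp: P_def)
  have hr: "h \<le> \<rho> / 2" using hk t0 by simp
  have Pk: "\<bar>P t\<bar> \<le> \<kappa>\<^sub>0" if tt: "0 \<le> t" "t \<le> h" for t
  proof (rule ccontr)
    assume c: "\<not> ?thesis"
    then obtain s where s: "0 \<le> s" "s \<le> t" "\<bar>P s\<bar> = \<kappa>\<^sub>0" using ivt[of t] tt hk by auto
    then have "h \<le> s" using tt hk by (intro h(2)) (auto simp: Z_def)
    then have "s = t" using s tt by simp
    then show False using s c by simp
  qed
  interpret doubling_convex P P1 P2 h using DC hpos hr by blast
  have GSP: "GS S (w - t) - GS S w = P t" if "0 \<le> t" "t \<le> h" for t
    using GSQ[of t] GSQ[of 0] that hr rho by (simp add: P_def)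
  show ?thesis
  proof (intro exI[of _ h] conjI ballI allI impI)
    show "0 < h" "h < r" "h < 1" using hpos hr rho by auto
    show "\<kappa>\<^sub>0 \<le> 4 * Cf * KS S w * h"
    proof -
      \<comment> \<open>The variation \<open>\<kappa>\<^sub>0\<close> is reached with slope at most
        \<open>2 * Cf * KS S w\<close>, so \<open>h\<close> cannot be too short.\<close>
      obtain \<xi> where x: "0 < \<xi>" "\<xi> < h" "P h - P 0 = (h - 0) * P1 \<xi>" using P_mvt[of 0 h] hpos by auto
      have "\<bar>P1 \<xi>\<bar> \<le> (\<Sum>j\<in>S. \<bar>- f1 (u j - \<xi>)\<bar>)" unfolding P1_def by (rule sum_abs)
      also have "\<dots> \<le> (\<Sum>j\<in>S. 2 * Cf * recip_dist (u j))"
      proof (rule sum_mono)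
        fix j assume j: "j \<in> S"
        have r: "0 < u j - \<xi>" "u j - \<xi> < 1" "u j / 2 \<le> u j - \<xi>" using rng[OF j, of \<xi>] x hr by auto
        have "0 < (u j - \<xi>) * (u j / 2)" "0 < (1 - (u j - \<xi>)) * (1 - u j)"
          using r u01[OF j] x by (auto intro!: mult_pos_pos)
        then have "1 / (u j - \<xi>) \<le> 1 / (u j / 2)" "1 / (1 - (u j - \<xi>)) \<le> 1 / (1 - u j)"
          using r x by (intro divide_left_mono; simp)+
        moreover have "0 \<le> 1 / (1 - u j)" "1 / (u j / 2) = 2 * (1 / u j)" using u01[OF j] by simp_all
        moreover have "a + b \<le> 2 * (c + d)" if "a \<le> e" "b \<le> d" "0 \<le> d" "e = 2 * c" for a b c d e :: real
          using that by simp
        ultimately have "recip_dist (u j - \<xi>) \<le> 2 * recip_dist (u j)" unfolding recip_dist_def by blast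
        then have "Cf * recip_dist (u j - \<xi>) \<le> Cf * (2 * recip_dist (u j))" using Cf_pos by (intro mult_left_mono) auto
        then show "\<bar>- f1 (u j - \<xi>)\<bar> \<le> 2 * Cf * recip_dist (u j)" using f1_bound[OF r(1,2)] by simp
      qed
      also have "\<dots> = 2 * Cf * KS S w" by (simp add: KS_def u_def sum_distrib_left)
      finally have "h * \<bar>P1 \<xi>\<bar> \<le> h * (2 * Cf * KS S w)" using hpos by (intro mult_left_mono) auto
      moreover have "\<kappa>\<^sub>0 = h * \<bar>P1 \<xi>\<bar>" using x hk hpos by (simp add: P_def abs_mult)
      moreover have "0 \<le> h * (Cf * KS S w)" using hpos Cf_pos KS_nonneg by simp
      ultimately show ?thesis by (simp add: algebra_simps)
    qed
    fix w' assume w': "w' \<in> {w-h..w}"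
    have "\<bar>P (w - w')\<bar> \<le> \<kappa>\<^sub>0" using w' by (intro Pk) auto
    then show "\<bar>GS S w' - GS S w\<bar> < 1" using GSP[of "w - w'"] w' by (simp add: \<kappa>\<^sub>0_def)
  next
    fix T \<epsilon> \<sigma>
    assume T: "finite T" "T \<subseteq> {w-h..w}" "0 < \<sigma>" "0 \<le> \<epsilon>"
      "\<forall>s\<in>T. \<forall>t\<in>T. s \<noteq> t \<longrightarrow> \<sigma> \<le> \<bar>s - t\<bar>" "\<forall>t\<in>T. \<bar>GS S t - GS S w\<bar> \<le> \<epsilon>"
    have "real (card ((\<lambda>t. w - t) ` T)) \<le> 2 * (h * sqrt (800 * \<epsilon> / \<kappa>\<^sub>0) / \<sigma> + 1)"
    proof (rule level_set_count)
      fix t assume "t \<in> (\<lambda>t. w - t) ` T"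
      then obtain v where v: "v \<in> T" "t = w - v" by auto
      then have "0 \<le> t" "t \<le> h" using T by auto
      then show "0 \<le> t \<and> t \<le> h \<and> \<bar>P t\<bar> \<le> \<epsilon>" using GSP[of t] v T by auto
    next
      fix s t assume "s \<in> (\<lambda>t. w - t) ` T" "t \<in> (\<lambda>t. w - t) ` T" "s \<noteq> t"
      then obtain v v' where v: "v \<in> T" "s = w - v" "v' \<in> T" "t = w - v'" "v \<noteq> v'" by auto
      then have "\<sigma> \<le> \<bar>v - v'\<bar>" using T(5) by blast
      then show "\<sigma> \<le> \<bar>s - t\<bar>" using v by (simp add: abs_minus_commute)
    qed (use T hk \<kappa>\<^sub>0_pos in auto)
    moreover have "card ((\<lambda>t. w - t) ` T) = card T" by (intro card_image) (auto simp: inj_on_def)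
    ultimately show "real (card T) \<le> 2 * (h * sqrt (800 * \<epsilon> / \<kappa>\<^sub>0) / \<sigma> + 1)" by simp
  qed
qed

text \<open>To the left of \<open>w\<close> the sum varies by less than 1 on the local interval, so
  there the alternative in \<open>gap\<close> leaves only values within \<open>\<epsilon>\<close>,
  and these occur at few points. The lower bound for \<open>h\<close> converts the additive constant
  of the local count into a multiple of \<open>h\<close>, as the greedy argument requires.\<close>

lemma sparse_returns:
  fixes A :: "real set" and S :: "real \<Rightarrow> int set"
  assumes fin: "finite A" and A: "A \<subseteq> {0..<1}" and s: "0 < \<sigma>" and e: "0 \<le> \<epsilon>"
    and sep: "\<And>v w. v \<in> A \<Longrightarrow> w \<in> A \<Longrightarrow> v \<noteq> w \<Longrightarrow> \<sigma> \<le> \<bar>v - w\<bar>"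
    and S: "\<And>w. w \<in> A \<Longrightarrow> finite (S w)"
    and pos: "\<And>w j. w \<in> A \<Longrightarrow> j \<in> S w \<Longrightarrow> 0 < pt w j"
    and curv: "\<And>w. w \<in> A \<Longrightarrow> 2 * G * real (card (S w)) \<le> (\<Sum>j\<in>S w. am / (pt w j)\<^sup>2)"
    and near: "\<And>w. w \<in> A \<Longrightarrow> \<exists>j\<in>S w. pt w j < r"
    and K: "\<And>w. w \<in> A \<Longrightarrow> KS (S w) w \<le> Kmax" and K0: "0 \<le> Kmax"
    and gap: "\<And>v w. v \<in> A \<Longrightarrow> w \<in> A \<Longrightarrow> \<bar>v - w\<bar> < r \<Longrightarrow>
       \<bar>GS (S w) v - GS (S w) w\<bar> \<le> \<epsilon> \<or> 1 \<le> \<bar>GS (S w) v - GS (S w) w\<bar>"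
  shows "real (card A) \<le> 4 * sqrt (800 * \<epsilon> / \<kappa>\<^sub>0) / \<sigma> + 16 * Cf * Kmax / \<kappa>\<^sub>0"
proof -
  define c where "c = 2 * sqrt (800 * \<epsilon> / \<kappa>\<^sub>0) / \<sigma> + 8 * Cf * Kmax / \<kappa>\<^sub>0"
  have c: "0 \<le> c" using s e K0 \<kappa>\<^sub>0_pos Cf_pos by (simp add: c_def)
  have "real (card A) \<le> 2 * c"
  proof (rule greedy_count[OF fin A c])
    fix w assume w: "w \<in> A"
    obtain h where h: "0 < h" "h < r" "h < 1" "\<kappa>\<^sub>0 \<le> 4 * Cf * KS (S w) w * h"
      "\<forall>w'\<in>{w-h..w}. \<bar>GS (S w) w' - GS (S w) w\<bar> < 1"
      and cnt: "\<And>T \<epsilon> \<sigma>. finite T \<Longrightarrow> T \<subseteq> {w-h..w} \<Longrightarrow> 0 < \<sigma> \<Longrightarrow> 0 \<le> \<epsilon> \<Longrightarrow>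
        (\<forall>s\<in>T. \<forall>t\<in>T. s \<noteq> t \<longrightarrow> \<sigma> \<le> \<bar>s - t\<bar>) \<Longrightarrow> (\<forall>t\<in>T. \<bar>GS (S w) t - GS (S w) w\<bar> \<le> \<epsilon>) \<Longrightarrow>
        real (card T) \<le> 2 * (h * sqrt (800 * \<epsilon> / \<kappa>\<^sub>0) / \<sigma> + 1)"
      using local_interval[OF S[OF w] pos[OF w] curv[OF w] near[OF w]] by blast
    have "real (card (A \<inter> {w-h..w})) \<le> 2 * (h * sqrt (800 * \<epsilon> / \<kappa>\<^sub>0) / \<sigma> + 1)"
    proof (rule cnt)
      show "\<forall>t\<in>A \<inter> {w-h..w}. \<bar>GS (S w) t - GS (S w) w\<bar> \<le> \<epsilon>"
      proof
        fix t assume t: "t \<in> A \<inter> {w-h..w}"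
        then have "\<bar>t - w\<bar> < r" using h by auto
        then show "\<bar>GS (S w) t - GS (S w) w\<bar> \<le> \<epsilon>" using gap[of t w] t w h(5) by fastforce
      qed
    qed (use fin s e sep in auto)
    also have "\<dots> \<le> c * h"
    proof -
      have "\<kappa>\<^sub>0 \<le> 4 * Cf * Kmax * h"
        using h(1,4) K[OF w] Cf_pos by (meson less_imp_le mult_left_mono mult_right_mono order.trans mult_nonneg_nonneg zero_le_numeral)
      then have "1 \<le> 4 * Cf * Kmax * h / \<kappa>\<^sub>0" using \<kappa>\<^sub>0_pos by (simp add: field_simps)
      moreover have "c * h = 2 * (h * sqrt (800 * \<epsilon> / \<kappa>\<^sub>0) / \<sigma>) + 2 * (4 * Cf * Kmax * h / \<kappa>\<^sub>0)"
        by (simp add: c_def algebra_simps)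
      moreover have "2 * (X + 1) \<le> 2 * X + 2 * Y" if "1 \<le> Y" for X Y :: real using that by simp
      ultimately show ?thesis by (simp only:)
    qed
    finally show "\<exists>h. 0 < h \<and> h < 1 \<and> real (card (A \<inter> {w-h..w})) \<le> c * h" using h by blast
  qed
  then show ?thesis by (simp add: c_def)
qed

end

section \<open>Events of large measure on the circle\<close>

text \<open>Lives on the Borel sets of the whole line with mass on the fundamental domain only, so
  that functions and events need no restriction to \<open>{0..<1}\<close>.\<close>

definition circle :: "real measure" where
  "circle = density lborel (indicator {0..<1})"

lemma sets_circle [simp, measurable_cong]: "sets circle = sets borel"
  by (simp add: circle_def)

lemma space_circle [simp]: "space circle = UNIV"
  by (simp add: circle_def)

lemma emeasure_circle: "E \<in> sets borel \<Longrightarrow> emeasure circle E = emeasure lborel (E \<inter> {0..<1})"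
proof -
  assume E: "E \<in> sets borel"
  have "emeasure circle E = (\<integral>\<^sup>+x. indicator {0..<1} x * indicator E x \<partial>lborel)"
    unfolding circle_def using E by (intro emeasure_density) auto
  also have "\<dots> = (\<integral>\<^sup>+x. indicator (E \<inter> {0..<1}) x \<partial>lborel)"
    by (intro nn_integral_cong) (auto split: split_indicator)
  also have "\<dots> = emeasure lborel (E \<inter> {0..<1})" using E by (intro nn_integral_indicator) auto
  finally show ?thesis .
qed

lemma nn_integral_circle:
  "h \<in> borel_measurable borel \<Longrightarrow> (\<integral>\<^sup>+x. h x \<partial>circle) = (\<integral>\<^sup>+x. h x * indicator {0..<1} x \<partial>lborel)"
  unfolding circle_def by (subst nn_integral_density) (auto simp: mult.commute)

lemma emeasure_circle_UNIV: "emeasure circle UNIV = 1"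
  by (simp add: emeasure_circle)

interpretation circle: finite_measure circle
  by standard (simp add: emeasure_circle_UNIV)

lemma measure_circle_UNIV: "measure circle UNIV = 1"
  by (simp add: measure_def emeasure_circle_UNIV)

lemma frac_measurable [measurable]: "(frac :: real \<Rightarrow> real) \<in> borel_measurable borel"
  unfolding frac_def[abs_def] by measurable

lemma emeasure_lborel_translate:
  fixes E :: "real set"
  assumes "E \<in> sets borel" shows "emeasure lborel {x. x + t \<in> E} = emeasure lborel E"
proof -
  have "lborel = distr lborel borel (\<lambda>x. t + x)" by (rule lborel_distr_plus[symmetric])
  then have "emeasure lborel E = emeasure (distr lborel borel (\<lambda>x. t + x)) E" by simp
  also have "\<dots> = emeasure lborel ((\<lambda>x. t + x) -` E \<inter> space lborel)" using assms by (intro emeasure_distr) auto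
  also have "(\<lambda>x. t + x) -` E \<inter> space lborel = {x. x + t \<in> E}" by (auto simp: add.commute)
  finally show ?thesis by simp
qed

text \<open>The preimage splits at the wrap-around point into two translates of disjoint pieces of
  \<open>E\<close>.\<close>

lemma circle_rotation: "distr circle borel (\<lambda>x. frac (x + t)) = circle"
proof (rule measure_eqI)
  fix E assume "E \<in> sets (distr circle borel (\<lambda>x. frac (x + t)))"
  then have E[measurable]: "E \<in> sets borel" by simp
  define s where "s = frac t"
  have s: "0 \<le> s" "s < 1" by (simp_all add: s_def frac_lt_1)
  have fs: "frac (x + t) = frac (x + s)" for x
    unfolding s_def by (metis add.commute frac_add_frac)
  have fr: "frac (x + s) = (if x < 1 - s then x + s else x + s - 1)" if "0 \<le> x" "x < 1" for x
    using that s by (auto simp: frac_unique_iff)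
  have m[measurable]: "(\<lambda>x::real. frac (x + t)) \<in> borel_measurable borel" by measurable
  have "emeasure (distr circle borel (\<lambda>x. frac (x + t))) E = emeasure circle ((\<lambda>x. frac (x + t)) -` E)"
    by (subst emeasure_distr) auto
  also have "\<dots> = emeasure lborel ((\<lambda>x. frac (x + t)) -` E \<inter> {0..<1})"
    by (rule emeasure_circle) (use measurable_sets_borel[OF m] in auto)
  also have "(\<lambda>x. frac (x + t)) -` E \<inter> {0..<1} = {x. x + s \<in> E \<inter> {s..<1}} \<union> {x. x + (s - 1) \<in> E \<inter> {0..<s}}"
    using s by (auto simp: fs fr algebra_simps split: if_splits)
  also have "emeasure lborel \<dots> = emeasure lborel {x. x + s \<in> E \<inter> {s..<1}} + emeasure lborel {x. x + (s - 1) \<in> E \<inter> {0..<s}}"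
  proof (rule plus_emeasure[symmetric])
    have "(\<lambda>x. x + c) -` F \<in> sets borel" if "F \<in> sets borel" for c and F :: "real set"
      by (rule measurable_sets_borel[OF _ that]) measurable
    from this[of "E \<inter> {s..<1}" s] this[of "E \<inter> {0..<s}" "s - 1"]
    show "{x. x + s \<in> E \<inter> {s..<1}} \<in> sets lborel" "{x. x + (s - 1) \<in> E \<inter> {0..<s}} \<in> sets lborel"
      by (auto simp: vimage_def)
  qed auto
  also have "\<dots> = emeasure lborel (E \<inter> {s..<1}) + emeasure lborel (E \<inter> {0..<s})"
    by (subst (1 2) emeasure_lborel_translate) auto
  also have "\<dots> = emeasure lborel ((E \<inter> {s..<1}) \<union> (E \<inter> {0..<s}))"
    by (rule plus_emeasure) auto
  also have "(E \<inter> {s..<1}) \<union> (E \<inter> {0..<s}) = E \<inter> {0..<1}" using s by auto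
  also have "emeasure lborel \<dots> = emeasure circle E" by (simp add: emeasure_circle)
  finally show "emeasure (distr circle borel (\<lambda>x. frac (x + t))) E = emeasure circle E" .
qed simp

lemma emeasure_circle_rotation:
  assumes [measurable]: "E \<in> sets borel" shows "emeasure circle {x. frac (x + t) \<in> E} = emeasure circle E"
proof -
  have "emeasure circle E = emeasure (distr circle borel (\<lambda>x. frac (x + t))) E" by (simp add: circle_rotation)
  also have "\<dots> = emeasure circle {x. frac (x + t) \<in> E}"
    by (subst emeasure_distr) (auto simp: vimage_def)
  finally show ?thesis by simp
qed

lemma measure_circle_rotation:
  "E \<in> sets borel \<Longrightarrow> measure circle {x. frac (x + t) \<in> E} = measure circle E"
  by (simp add: measure_def emeasure_circle_rotation)

lemma nn_integral_circle_rotation: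
  assumes [measurable]: "h \<in> borel_measurable borel"
  shows "(\<integral>\<^sup>+x. h (frac (x + t)) \<partial>circle) = (\<integral>\<^sup>+x. h x \<partial>circle)"
proof -
  have "(\<integral>\<^sup>+x. h x \<partial>circle) = (\<integral>\<^sup>+x. h x \<partial>distr circle borel (\<lambda>x. frac (x + t)))" by (simp add: circle_rotation)
  also have "\<dots> = (\<integral>\<^sup>+x. h (frac (x + t)) \<partial>circle)" by (subst nn_integral_distr) auto
  finally show ?thesis by simp
qed

lemma measure_circle_outside: "measure circle (UNIV - {0..<1}) = 0"
proof -
  have "(UNIV - {0..<1}) \<inter> {0..<1::real} = {}" by auto
  then show ?thesis by (simp add: measure_def emeasure_circle)
qed

lemma measure_circle_ge_diff:
  assumes "E \<in> sets borel" "F \<in> sets borel" "{0..<1} \<subseteq> E \<union> F"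
  shows "1 - measure circle F \<le> measure circle E"
proof -
  have "E \<union> F \<union> (UNIV - {0..<1}) = UNIV" using assms(3) by blast
  then have "1 = measure circle (E \<union> F \<union> (UNIV - {0..<1}))" using measure_circle_UNIV by simp
  also have "\<dots> \<le> measure circle (E \<union> F) + measure circle (UNIV - {0..<1})"
    using assms by (intro measure_Un_le) auto
  also have "\<dots> \<le> measure circle E + measure circle F"
    using assms measure_Un_le[of E circle F] by (simp add: measure_circle_outside)
  finally show ?thesis by simp
qed

text \<open>The exceptional set is a Borel cover, so \<open>P\<close> itself need not be measurable,
  and exceptional measures simply add up.\<close>

definition mostly :: "real \<Rightarrow> (real \<Rightarrow> bool) \<Rightarrow> bool" where
  "mostly \<eta> P \<longleftrightarrow> (\<exists>E\<in>sets borel. measure circle E \<le> \<eta> \<and> (\<forall>x\<in>{0..<1}-E. P x))"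

lemma mostly_mono:
  "mostly \<eta> P \<Longrightarrow> \<eta> \<le> \<eta>' \<Longrightarrow> (\<And>x. 0 \<le> x \<Longrightarrow> x < 1 \<Longrightarrow> P x \<Longrightarrow> Q x) \<Longrightarrow> mostly \<eta>' Q"
proof -
  assume "mostly \<eta> P" and *: "\<eta> \<le> \<eta>'" "\<And>x. 0 \<le> x \<Longrightarrow> x < 1 \<Longrightarrow> P x \<Longrightarrow> Q x"
  then obtain E where "E \<in> sets borel" "measure circle E \<le> \<eta>" "\<forall>x\<in>{0..<1}-E. P x" unfolding mostly_def by blast
  then show "mostly \<eta>' Q" unfolding mostly_def using * by (intro bexI[of _ E]) auto
qed

lemma mostly_conj:
  assumes "mostly \<eta> P" "mostly \<eta>' Q" shows "mostly (\<eta> + \<eta>') (\<lambda>x. P x \<and> Q x)"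
proof -
  obtain E F where "E \<in> sets borel" "measure circle E \<le> \<eta>" "\<forall>x\<in>{0..<1}-E. P x"
    "F \<in> sets borel" "measure circle F \<le> \<eta>'" "\<forall>x\<in>{0..<1}-F. Q x"
    using assms unfolding mostly_def by blast
  then show ?thesis unfolding mostly_def using measure_Un_le[of E circle F]
    by (intro bexI[of _ "E \<union> F"]) auto
qed

lemma mostly_AE:
  assumes "AE x in circle. P x" shows "mostly 0 P"
proof -
  obtain N where "N \<in> null_sets circle" "{x. \<not> P x} \<subseteq> N" using assms by (auto simp: eventually_ae_filter)
  then show ?thesis unfolding mostly_def by (intro bexI[of _ N]) (auto simp: measure_def null_sets_def)
qed

lemma mostly_rotation:
  assumes "mostly \<eta> P" shows "mostly \<eta> (\<lambda>x. P (frac (x + t)))"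
proof -
  obtain E where E: "E \<in> sets borel" "measure circle E \<le> \<eta>" "\<forall>x\<in>{0..<1}-E. P x"
    using assms unfolding mostly_def by blast
  have "(\<lambda>x. frac (x + t)) -` E \<in> sets borel"
    by (rule measurable_sets_borel[OF _ E(1)]) measurable
  then show ?thesis unfolding mostly_def using E
    by (intro bexI[of _ "{x. frac (x + t) \<in> E}"]) (auto simp: measure_circle_rotation vimage_def frac_lt_1)
qed

lemma mostly_D:
  assumes "mostly \<eta> P" "\<eta> < 1" shows "\<exists>x. 0 \<le> x \<and> x < 1 \<and> P x"
proof (rule ccontr)
  assume *: "\<not> ?thesis"
  obtain E where E: "E \<in> sets borel" "measure circle E \<le> \<eta>" "\<forall>x\<in>{0..<1}-E. P x"
    using assms unfolding mostly_def by blast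
  then have "{0..<1} \<subseteq> E \<union> {}" using * by fastforce
  then have "1 \<le> measure circle E" using measure_circle_ge_diff[of E "{}"] E by simp
  then show False using E assms by simp
qed

text \<open>Markov's inequality for the number of visits to the exceptional set; by invariance the
  mean of this number is \<open>B\<close> times the measure of the set.\<close>

lemma mostly_orbit_average:
  fixes c :: real and \<alpha> :: real and B :: nat
  assumes "mostly \<eta> P" and c: "0 < c"
  shows "mostly (\<eta> * c) (\<lambda>x. real (card {j\<in>{..<B}. \<not> P (frac (x + real j * \<alpha>))}) \<le> real B / c)"
proof (cases "B = 0")
  case True
  have "0 \<le> \<eta>" using assms unfolding mostly_def by (meson measure_nonneg order_trans)
  then show ?thesis using True c unfolding mostly_def by (intro bexI[of _ "{}"]) auto
next
  case False
  obtain E where E[measurable]: "E \<in> sets borel" "measure circle E \<le> \<eta>" "\<forall>x\<in>{0..<1}-E. P x"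
    using assms unfolding mostly_def by blast
  define N where "N x = (\<Sum>j<B. indicator E (frac (x + real j * \<alpha>)) :: ennreal)" for x
  have N[measurable]: "N \<in> borel_measurable borel" unfolding N_def[abs_def] using E(1) by measurable
  define F where "F = {x. ennreal (real B / c) \<le> N x}"
  have F[measurable]: "F \<in> sets borel" unfolding F_def by measurable
  have NN: "N x = of_nat (card {j\<in>{..<B}. frac (x + real j * \<alpha>) \<in> E})" for x
    unfolding N_def indicator_def of_bool_def by (subst sum.inter_filter[symmetric]) auto
  have "(\<integral>\<^sup>+x. N x \<partial>circle) = (\<Sum>j<B. \<integral>\<^sup>+x. indicator E (frac (x + real j * \<alpha>)) \<partial>circle)"
    unfolding N_def using E(1) by (intro nn_integral_sum) measurable
  also have "\<dots> = (\<Sum>j<B. emeasure circle E)"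
    using E(1) by (intro sum.cong refl) (subst nn_integral_circle_rotation, auto)
  also have "\<dots> = ennreal (real B * measure circle E)"
    by (simp add: circle.emeasure_eq_measure ennreal_mult ennreal_of_nat_eq_real_of_nat)
  finally have int: "(\<integral>\<^sup>+x. N x \<partial>circle) = ennreal (real B * measure circle E)" .
  have "ennreal (real B / c) * emeasure circle F = (\<integral>\<^sup>+x. ennreal (real B / c) * indicator F x \<partial>circle)"
    using F by (simp add: nn_integral_cmult_indicator)
  also have "\<dots> \<le> (\<integral>\<^sup>+x. N x \<partial>circle)"
    by (intro nn_integral_mono) (auto simp: F_def split: split_indicator)
  finally have "ennreal (real B / c * measure circle F) \<le> ennreal (real B * measure circle E)"
    unfolding int circle.emeasure_eq_measure using c by (subst ennreal_mult) auto
  then have "real B / c * measure circle F \<le> real B * measure circle E"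
    by (subst (asm) ennreal_le_iff) auto
  then have "measure circle F \<le> measure circle E * c" using False c by (simp add: field_simps)
  also have "\<dots> \<le> \<eta> * c" using E c by (intro mult_right_mono) auto
  finally have mF: "measure circle F \<le> \<eta> * c" .
  show ?thesis unfolding mostly_def
  proof (intro bexI[of _ F] conjI ballI)
    fix x assume x: "x \<in> {0..<1} - F"
    have "card {j\<in>{..<B}. \<not> P (frac (x + real j * \<alpha>))} \<le> card {j\<in>{..<B}. frac (x + real j * \<alpha>) \<in> E}"
      using E(3) frac_lt_1 frac_ge_0 by (intro card_mono) (auto, force)
    moreover have "real (card {j\<in>{..<B}. frac (x + real j * \<alpha>) \<in> E}) < real B / c"
    proof -
      have "N x < ennreal (real B / c)" using x by (auto simp: F_def not_le)
      then have "ennreal (real (card {j\<in>{..<B}. frac (x + real j * \<alpha>) \<in> E})) < ennreal (real B / c)"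
        by (simp add: NN ennreal_of_nat_eq_real_of_nat)
      then show ?thesis by (simp add: ennreal_less_iff)
    qed
    ultimately show "real (card {j\<in>{..<B}. \<not> P (frac (x + real j * \<alpha>))}) \<le> real B / c" by linarith
  qed (use mF F in auto)
qed

text \<open>A quantitative form of Lusin's theorem. The level sets of
  \<open>\<lfloor>F x / \<epsilon>\<rfloor>\<close> are disjoint and finitely many carry almost all
  the mass; compact sets inside them have positive mutual distances, so nearby points share a
  level.\<close>

lemma almost_uniform_continuity:
  fixes F :: "real \<Rightarrow> real"
  assumes F[measurable]: "F \<in> borel_measurable borel" and e: "0 < \<epsilon>" and \<eta>: "0 < \<eta>"
  shows "\<exists>r>0. \<exists>E\<in>sets borel. measure circle E \<le> \<eta> \<and>
    (\<forall>x\<in>{0..<1}-E. \<forall>y\<in>{0..<1}-E. \<bar>x - y\<bar> < r \<longrightarrow> \<bar>F x - F y\<bar> < \<epsilon>)"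
proof -
  define A where "A i = {x\<in>{0..<1}. real_of_int \<lfloor>F x / \<epsilon>\<rfloor> = real_of_int i}" for i :: int
  have A[measurable]: "A i \<in> sets borel" for i unfolding A_def by measurable
  define T where "T n = {x\<in>{0..<1}. \<bar>real_of_int \<lfloor>F x / \<epsilon>\<rfloor>\<bar> > real n}" for n
  have T[measurable]: "T n \<in> sets borel" for n unfolding T_def by measurable
  have "(\<lambda>n. measure circle (T n)) \<longlonglongrightarrow> measure circle (\<Inter>n. T n)"
    by (rule circle.finite_Lim_measure_decseq) (auto simp: decseq_def T_def)
  moreover have "(\<Inter>n. T n) = {}"
  proof -
    have "x \<notin> T (nat \<bar>\<lfloor>F x / \<epsilon>\<rfloor>\<bar>)" for x unfolding T_def by simp
    then show ?thesis by blast
  qed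
  ultimately have "(\<lambda>n. measure circle (T n)) \<longlonglongrightarrow> 0" by simp
  then have "eventually (\<lambda>n. measure circle (T n) < \<eta> / 2) sequentially"
    using \<eta> by (intro order_tendstoD(2)) auto
  then obtain n where n: "measure circle (T n) < \<eta> / 2" by (auto simp: eventually_sequentially)
  define I where "I = {- int n..int n}"
  define d where "d = \<eta> / (2 * real (card I))"
  have cI: "0 < card I" by (simp add: I_def)
  have d: "0 < d" using \<eta> cI by (simp add: d_def)
  have "\<exists>K. closed K \<and> K \<subseteq> A i \<and> measure circle (A i - K) \<le> d" for i
  proof -
    have "A i \<in> sets lebesgue" using A[of i] by simp
    then obtain K where K: "closed K" "K \<subseteq> A i" "emeasure lebesgue (A i - K) < ennreal d"
      using sets_lebesgue_inner_closed[OF _ d] by metis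
    have AK: "A i - K \<in> sets borel" using K A[of i] by auto
    have "emeasure circle (A i - K) \<le> emeasure lborel (A i - K)"
      unfolding emeasure_circle[OF AK] using AK by (intro emeasure_mono) auto
    also have "\<dots> = emeasure lebesgue (A i - K)" using AK by simp
    also have "\<dots> \<le> ennreal d" using K by simp
    finally have "measure circle (A i - K) \<le> d" using d by (simp add: circle.emeasure_eq_measure)
    then show ?thesis using K by blast
  qed
  then obtain K where K: "\<And>i. closed (K i)" "\<And>i. K i \<subseteq> A i" "\<And>i. measure circle (A i - K i) \<le> d" by metis
  have comp: "compact (K i)" for i
  proof -
    have "bounded (K i)" using K(2)[of i] by (intro bounded_subset[OF bounded_closed_interval[of 0 1]]) (auto simp: A_def)
    then show ?thesis using K(1) compact_eq_bounded_closed by blast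
  qed
  have "\<exists>r>0. \<forall>x\<in>K i. \<forall>y\<in>K j. r \<le> dist x y" if "i \<noteq> j" for i j
  proof (intro separate_compact_closed comp K(1))
    have "A i \<inter> A j = {}" using that by (auto simp: A_def)
    then show "K i \<inter> K j = {}" using K(2) by blast
  qed
  then have "\<forall>p. \<exists>r. fst p \<noteq> snd p \<longrightarrow> 0 < r \<and> (\<forall>x\<in>K (fst p). \<forall>y\<in>K (snd p). r \<le> dist x y)" by blast
  from choice[OF this] obtain r' where r': "\<forall>p. fst p \<noteq> snd p \<longrightarrow> 0 < r' p \<and> (\<forall>x\<in>K (fst p). \<forall>y\<in>K (snd p). r' p \<le> dist x y)"
    by (rule exE)
  define r where "r i j = r' (i, j)" for i j
  have r: "0 < r i j" "\<And>x y. x \<in> K i \<Longrightarrow> y \<in> K j \<Longrightarrow> r i j \<le> dist x y" if "i \<noteq> j" for i j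
    using r'[THEN spec, of "(i, j)", unfolded fst_conv snd_conv, THEN mp, OF that] unfolding r_def by blast+
  define R where "R = Min (insert 1 ((\<lambda>(i,j). r i j) ` {(i,j)\<in>I\<times>I. i \<noteq> j}))"
  have fin: "finite (insert 1 ((\<lambda>(i,j). r i j) ` {(i,j)\<in>I\<times>I. i \<noteq> j}))"
  proof -
    have "finite {(i,j)\<in>I\<times>I. i \<noteq> j}" by (rule finite_subset[of _ "I \<times> I"]) (auto simp: I_def)
    then show ?thesis by simp
  qed
  have R0: "0 < R" unfolding R_def using fin r(1) by (subst Min_gr_iff) auto
  have Rle: "R \<le> r i j" if "i \<in> I" "j \<in> I" "i \<noteq> j" for i j
    unfolding R_def using fin that by (intro Min_le) auto
  define E where "E = T n \<union> (\<Union>i\<in>I. A i - K i)"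
  have Em[measurable]: "E \<in> sets borel" unfolding E_def using K(1) by (auto simp: I_def)
  have "measure circle E \<le> measure circle (T n) + measure circle (\<Union>i\<in>I. A i - K i)"
    unfolding E_def using K(1) by (intro measure_Un_le) (auto simp: I_def)
  also have "measure circle (\<Union>i\<in>I. A i - K i) \<le> (\<Sum>i\<in>I. measure circle (A i - K i))"
    using K(1) by (intro circle.finite_measure_subadditive_finite) (auto simp: I_def)
  also have "\<dots> \<le> (\<Sum>i\<in>I. d)" using K(3) by (intro sum_mono)
  also have "\<dots> = \<eta> / 2" using cI by (simp add: d_def)
  finally have mE: "measure circle E \<le> \<eta>" using n by simp
  have "\<bar>F x - F y\<bar> < \<epsilon>" if xy: "x \<in> {0..<1} - E" "y \<in> {0..<1} - E" "\<bar>x - y\<bar> < R" for x y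
  proof -
    have in_K: "\<lfloor>F z / \<epsilon>\<rfloor> \<in> I \<and> z \<in> K \<lfloor>F z / \<epsilon>\<rfloor>" if "z \<in> {0..<1} - E" for z
    proof -
      have "\<not> real n < \<bar>real_of_int \<lfloor>F z / \<epsilon>\<rfloor>\<bar>" using that by (auto simp: E_def T_def)
      then have "\<lfloor>F z / \<epsilon>\<rfloor> \<in> I" unfolding I_def atLeastAtMost_iff by linarith
      moreover have "z \<in> A \<lfloor>F z / \<epsilon>\<rfloor>" using that by (auto simp: A_def)
      ultimately show ?thesis using that by (auto simp: E_def)
    qed
    have "\<lfloor>F x / \<epsilon>\<rfloor> = \<lfloor>F y / \<epsilon>\<rfloor>"
    proof (rule ccontr)
      assume ne: "\<lfloor>F x / \<epsilon>\<rfloor> \<noteq> \<lfloor>F y / \<epsilon>\<rfloor>"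
      have "R \<le> dist x y" using r(2)[OF ne] Rle[OF _ _ ne] in_K[OF xy(1)] in_K[OF xy(2)] by (meson order.trans)
      then show False using xy by (simp add: dist_real_def)
    qed
    then have "\<bar>F x / \<epsilon> - F y / \<epsilon>\<bar> < 1" by linarith
    then show ?thesis using e by (simp add: diff_divide_distrib[symmetric])
  qed
  then show ?thesis using R0 mE Em by blast
qed

lemma mostly_finite:
  assumes "finite J" "\<And>j. j \<in> J \<Longrightarrow> mostly (\<eta> j) (P j)"
  shows "mostly (sum \<eta> J) (\<lambda>x. \<forall>j\<in>J. P j x)"
  using assms
proof (induction J rule: finite_induct)
  case empty
  then show ?case unfolding mostly_def by (intro bexI[of _ "{}"]) auto
next
  case (insert j J)
  have "mostly (\<eta> j + sum \<eta> J) (\<lambda>x. P j x \<and> (\<forall>j\<in>J. P j x))"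
    using insert by (intro mostly_conj) auto
  then show ?case using insert by (simp add: mostly_mono)
qed

lemma mostly_markov:
  fixes h :: "real \<Rightarrow> real"
  assumes h[measurable]: "h \<in> borel_measurable borel" and int: "(\<integral>\<^sup>+x. ennreal (h x) \<partial>circle) \<le> ennreal c"
    and l: "0 < l" and c: "0 \<le> c"
  shows "mostly (c / l) (\<lambda>x. h x \<le> l)"
proof -
  define F where "F = {x. l < h x}"
  have F[measurable]: "F \<in> sets borel" unfolding F_def by measurable
  have "ennreal (l * measure circle F) = (\<integral>\<^sup>+x. ennreal l * indicator F x \<partial>circle)"
    using F l by (subst nn_integral_cmult_indicator) (auto simp: circle.emeasure_eq_measure ennreal_mult)
  also have "\<dots> \<le> (\<integral>\<^sup>+x. ennreal (h x) \<partial>circle)"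
    by (intro nn_integral_mono) (auto simp: F_def split: split_indicator intro!: ennreal_leI)
  also have "\<dots> \<le> ennreal c" by (rule int)
  finally have "l * measure circle F \<le> c" using c by (simp add: ennreal_le_iff)
  then have "measure circle F \<le> c / l" using l by (simp add: field_simps)
  then show ?thesis unfolding mostly_def using F by (intro bexI[of _ F]) (auto simp: F_def)
qed

lemma mostly_far_from_ends:
  assumes "0 < d" "d \<le> 1/2"
  shows "mostly (2 * d) (\<lambda>x. d \<le> x \<and> d \<le> 1 - x)"
proof -
  define E :: "real set" where "E = {0..<d} \<union> {1-d<..<1}"
  have "emeasure circle E = emeasure lborel ({0..<d} \<union> {1-d<..<1})"
    using assms by (subst emeasure_circle) (auto simp: E_def intro!: arg_cong[where f = "emeasure lborel"])
  also have "\<dots> \<le> emeasure lborel {0..<d} + emeasure lborel {1-d<..<1}"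
    by (intro emeasure_subadditive) auto
  also have "\<dots> = ennreal (2 * d)" using assms by (simp flip: ennreal_plus)
  finally have "measure circle E \<le> 2 * d" using assms by (simp add: circle.emeasure_eq_measure)
  then show ?thesis unfolding mostly_def by (intro bexI[of _ E]) (auto simp: E_def)
qed

text \<open>The cut-off at \<open>d\<close> leaves a mean that is logarithmic in
  \<open>1 / d\<close>; the logarithms in the bounds for \<open>KS\<close> originate here.\<close>

lemma nn_integral_recip_dist:
  assumes d: "0 < d" "d \<le> 1/2"
  shows "(\<integral>\<^sup>+x. ennreal (if d \<le> x \<and> x \<le> 1 - d then recip_dist x else 0) \<partial>circle) \<le> ennreal (2 * ln (1 / d))"
proof -
  have m[measurable]: "recip_dist \<in> borel_measurable borel" unfolding recip_dist_def[abs_def] by measurable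
  have "(\<integral>\<^sup>+x. ennreal (if d \<le> x \<and> x \<le> 1 - d then recip_dist x else 0) \<partial>circle)
     = (\<integral>\<^sup>+x. ennreal (recip_dist x) * indicator {d..1-d} x \<partial>lborel)"
    using d by (subst nn_integral_circle) (auto intro!: nn_integral_cong split: split_indicator)
  also have "\<dots> = ennreal ((ln (1 - d) - ln (1 - (1 - d))) - (ln d - ln (1 - d)))"
  proof (rule nn_integral_FTC_Icc)
    fix x assume x: "x \<in> {d..1-d}"
    then have x': "0 < x" "x < 1" using d by auto
    show "((\<lambda>x. ln x - ln (1 - x)) has_real_derivative recip_dist x) (at x)"
      unfolding recip_dist_def using x'
      by (auto intro!: derivative_eq_intros)
    show "0 \<le> recip_dist x" using x' by (auto simp: recip_dist_def)
  qed (use d m in auto)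
  also have "\<dots> \<le> ennreal (2 * ln (1 / d))"
    using d by (intro ennreal_leI) (simp add: ln_div)
  finally show ?thesis .
qed

section \<open>Ergodicity of the rotation\<close>

context irrational_rotation
begin

lemma exists_orbit_close:
  assumes "0 < r" shows "\<exists>j::nat. frac (x + real j * \<alpha>) < r"
proof -
  obtain n where n: "real n > max 3 (3 / r)" using reals_Archimedean2 by blast
  have qn: "real n \<le> q n" using q_ge by simp
  then have "3 \<le> q n" using n by linarith
  then obtain j where "frac (x + real j * \<alpha>) < 3 / q n" using exists_small_frac by blast
  moreover have "3 / q n < r"
  proof -
    have "3 / r < q n" "0 < real (q n)" using n qn by linarith+
    then show ?thesis using assms by (simp add: field_simps)
  qed
  ultimately show ?thesis by (meson less_trans)
qed

text \<open>The mass \<open>e v\<close> that a rotation by \<open>v\<close> carries out of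
  \<open>E\<close> is small for small \<open>v\<close>. By invariance of \<open>E\<close> and
  density of orbits, every \<open>e t\<close> equals some \<open>e v\<close> with \<open>v\<close>
  small, so \<open>e\<close> vanishes identically. Its integral over \<open>t\<close> is the product
  of the measures of \<open>E\<close> and its complement.\<close>

lemma rotation_ergodic:
  assumes E[measurable]: "E \<in> sets borel" and inv: "AE x in circle. x \<in> E \<longleftrightarrow> frac (x + \<alpha>) \<in> E"
  shows "measure circle E = 0 \<or> measure circle (UNIV - E) = 0"
proof -
  define e where "e v = measure circle {x. x \<in> E \<and> frac (x + v) \<notin> E}" for v
  have em[measurable]: "{x. x \<in> E \<and> frac (x + v) \<notin> E} \<in> sets borel" for v by measurable
  have shift: "AE x in circle. P (frac (x + t))" if P: "AE x in circle. P x" and [measurable]: "Measurable.pred borel P" for P t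
  proof -
    have "AE x in distr circle borel (\<lambda>x. frac (x + t)). P x" by (subst circle_rotation) (rule P)
    then show ?thesis by (subst (asm) AE_distr_iff) auto
  qed
  have fwd: "AE x in circle. x \<in> E \<longleftrightarrow> frac (x + real j * \<alpha>) \<in> E" for j :: nat
  proof (induction j)
    case 0
    have "AE x in circle. x \<in> {0..<1}" by (rule AE_I[of _ _ "UNIV - {0..<1}"]) (auto simp: emeasure_circle Diff_Int_distrib2)
    then show ?case by eventually_elim auto
  next
    case (Suc j)
    have "AE x in circle. frac (x + real j * \<alpha>) \<in> E \<longleftrightarrow> frac (frac (x + real j * \<alpha>) + \<alpha>) \<in> E"
      by (rule shift[OF inv]) measurable
    then show ?case using Suc by eventually_elim (simp add: frac_add_frac algebra_simps)
  qed
  have bwd: "AE x in circle. x \<in> E \<longleftrightarrow> frac (x - real j * \<alpha>) \<in> E" for j :: nat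
  proof -
    have "AE x in circle. frac (x + (- real j * \<alpha>)) \<in> E \<longleftrightarrow> frac (frac (x + (- real j * \<alpha>)) + real j * \<alpha>) \<in> E"
      by (rule shift[OF fwd]) measurable
    moreover have "AE x in circle. x \<in> {0..<1}" by (rule AE_I[of _ _ "UNIV - {0..<1}"]) (auto simp: emeasure_circle Diff_Int_distrib2)
    ultimately show ?thesis by eventually_elim (auto simp: frac_add_frac)
  qed
  have small: "\<exists>r>0. \<forall>v. 0 \<le> v \<longrightarrow> v < r \<longrightarrow> e v \<le> \<eta>" if \<eta>: "0 < \<eta>" for \<eta>
  proof -
    have "(indicator E :: real \<Rightarrow> real) \<in> borel_measurable borel" by measurable
    then obtain r N where r: "0 < r" and N[measurable]: "N \<in> sets borel" and mN: "measure circle N \<le> \<eta> / 8"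
      and NN: "\<And>x y. x \<in> {0..<1} - N \<Longrightarrow> y \<in> {0..<1} - N \<Longrightarrow> \<bar>x - y\<bar> < r \<Longrightarrow>
        \<bar>indicator E x - indicator E y\<bar> < (1/2 :: real)"
      using almost_uniform_continuity[of "indicator E" "1/2" "\<eta> / 8"] \<eta> by auto
    define r' where "r' = min r (min (\<eta> / 4) 1)"
    show ?thesis
    proof (intro exI[of _ r'] conjI allI impI)
      show "0 < r'" using r \<eta> by (simp add: r'_def)
      fix v assume v: "0 \<le> v" "v < r'"
      have sub: "{x. x \<in> E \<and> frac (x + v) \<notin> E} \<subseteq> N \<union> {x. frac (x + v) \<in> N} \<union> {1 - v..<1} \<union> (UNIV - {0..<1})"
      proof
        fix x assume x: "x \<in> {x. x \<in> E \<and> frac (x + v) \<notin> E}"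
        show "x \<in> N \<union> {x. frac (x + v) \<in> N} \<union> {1 - v..<1} \<union> (UNIV - {0..<1})"
        proof (rule ccontr)
          assume "\<not> ?thesis"
          then have c: "x \<notin> N" "frac (x + v) \<notin> N" "0 \<le> x" "x < 1 - v" by auto
          have f: "frac (x + v) = x + v" using c v by simp
          have "\<bar>indicator E x - indicator E (x + v)\<bar> < (1/2 :: real)"
            using c v f by (intro NN) (auto simp: r'_def)
          then show False using x f by (simp add: indicator_def)
        qed
      qed
      have "e v \<le> measure circle (N \<union> {x. frac (x + v) \<in> N} \<union> {1 - v..<1} \<union> (UNIV - {0..<1}))"
        unfolding e_def by (intro circle.finite_measure_mono sub) auto
      also have "\<dots> \<le> measure circle (N \<union> {x. frac (x + v) \<in> N} \<union> {1 - v..<1}) + measure circle (UNIV - {0..<1})"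
        by (intro measure_Un_le) auto
      also have "\<dots> \<le> measure circle (N \<union> {x. frac (x + v) \<in> N}) + measure circle {1 - v..<1}"
        unfolding measure_circle_outside by (simp, intro measure_Un_le) auto
      also have "measure circle (N \<union> {x. frac (x + v) \<in> N}) \<le> measure circle N + measure circle {x. frac (x + v) \<in> N}"
        by (intro measure_Un_le) auto
      also have "measure circle {x. frac (x + v) \<in> N} = measure circle N" by (rule measure_circle_rotation) simp
      also have "measure circle {1 - v..<1} = v"
      proof -
        have "{1 - v..<1} \<inter> {0..<1} = {1 - v..<1}" using v by (auto simp: r'_def)
        then show ?thesis using v by (simp add: measure_def emeasure_circle)
      qed
      also have "v \<le> \<eta> / 4" using v by (simp add: r'_def)
      finally show "e v \<le> \<eta>" using mN \<eta> by linarith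
    qed
  qed
  have e0: "e t = 0" for t
  proof -
    have "e t \<le> \<eta>" if \<eta>: "0 < \<eta>" for \<eta>
    proof -
      obtain r where r: "0 < r" "\<And>v. 0 \<le> v \<Longrightarrow> v < r \<Longrightarrow> e v \<le> \<eta>" using small[OF \<eta>] by blast
      obtain j :: nat where j: "frac (t + real j * \<alpha>) < r" using exists_orbit_close[OF r(1)] by blast
      define v where "v = frac (t + real j * \<alpha>)"
      have "e t = measure circle {x. frac (x - real j * \<alpha>) \<in> {y. y \<in> E \<and> frac (y + v) \<notin> E}}"
        unfolding e_def
      proof (rule measure_eq_AE)
        show "AE x in circle. (x \<in> {x. x \<in> E \<and> frac (x + t) \<notin> E}) = (x \<in> {x. frac (x - real j * \<alpha>) \<in> {y. y \<in> E \<and> frac (y + v) \<notin> E}})"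
          using bwd[of j]
        proof eventually_elim
          case (elim x)
          have "frac (frac (x - real j * \<alpha>) + v) = frac (x + t)"
            unfolding v_def by (metis add.commute frac_add_frac add_diff_cancel_right' add.assoc diff_add_cancel diff_add_eq)
          then show ?case using elim by simp
        qed
      qed auto
      also have "\<dots> = e v" unfolding e_def
        using measure_circle_rotation[of "{y. y \<in> E \<and> frac (y + v) \<notin> E}" "- (real j * \<alpha>)"] by simp
      also have "\<dots> \<le> \<eta>" using r(2) j by (simp add: v_def)
      finally show ?thesis .
    qed
    moreover have "0 \<le> e t" by (simp add: e_def)
    ultimately show ?thesis by (meson dense_le_bounded antisym field_le_epsilon add_0 le_less_linear dense not_less)
  qed
  have "0 = (\<integral>\<^sup>+t. ennreal (e t) \<partial>circle)" by (simp add: e0)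
  also have "\<dots> = (\<integral>\<^sup>+t. (\<integral>\<^sup>+x. indicator E x * indicator (UNIV - E) (frac (x + t)) \<partial>circle) \<partial>circle)"
  proof (rule nn_integral_cong)
    fix t
    have "ennreal (e t) = (\<integral>\<^sup>+x. indicator {x. x \<in> E \<and> frac (x + t) \<notin> E} x \<partial>circle)"
      unfolding e_def circle.emeasure_eq_measure[symmetric] by (subst nn_integral_indicator) auto
    also have "\<dots> = (\<integral>\<^sup>+x. indicator E x * indicator (UNIV - E) (frac (x + t)) \<partial>circle)"
      by (intro nn_integral_cong) (auto split: split_indicator)
    finally show "ennreal (e t) = (\<integral>\<^sup>+x. indicator E x * indicator (UNIV - E) (frac (x + t)) \<partial>circle)" .
  qed
  also have "\<dots> = (\<integral>\<^sup>+x. (\<integral>\<^sup>+t. indicator E x * indicator (UNIV - E) (frac (x + t)) \<partial>circle) \<partial>circle)"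
  proof -
    interpret pair_sigma_finite circle circle ..
    show ?thesis by (rule Fubini') measurable
  qed
  also have "\<dots> = (\<integral>\<^sup>+x. indicator E x * emeasure circle (UNIV - E) \<partial>circle)"
  proof (rule nn_integral_cong)
    fix x :: real
    have "(\<integral>\<^sup>+t. indicator E x * indicator (UNIV - E) (frac (x + t)) \<partial>circle)
       = indicator E x * (\<integral>\<^sup>+t. indicator (UNIV - E) (frac (t + x)) \<partial>circle)"
      by (subst nn_integral_cmult) (auto simp: add.commute)
    also have "(\<integral>\<^sup>+t. indicator (UNIV - E) (frac (t + x)) \<partial>circle) = (\<integral>\<^sup>+t. indicator (UNIV - E) t \<partial>circle)"
      by (rule nn_integral_circle_rotation) auto
    also have "\<dots> = emeasure circle (UNIV - E)" by (rule nn_integral_indicator) auto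
    finally show "(\<integral>\<^sup>+t. indicator E x * indicator (UNIV - E) (frac (x + t)) \<partial>circle) = indicator E x * emeasure circle (UNIV - E)" .
  qed
  also have "\<dots> = emeasure circle E * emeasure circle (UNIV - E)"
    by (subst nn_integral_multc) auto
  finally have "emeasure circle E * emeasure circle (UNIV - E) = 0" by simp
  then show ?thesis by (auto simp: measure_def)
qed

end

section \<open>Typical size of the derivative and the sparseness threshold\<close>

context arnold_roof_flow
begin

text \<open>Keeping at most \<open>3 * J\<close> points at distance \<open>\<eta> / (12 * J)\<close>
  from the singularity costs half of \<open>\<eta>\<close>. The other half goes into Markov's
  inequality for the truncated \<open>KS\<close>, whose mean is logarithmic per point.\<close>

lemma mostly_KS:
  fixes J :: nat
  assumes J: "1 \<le> J" and \<eta>: "0 < \<eta>" "\<eta> \<le> 1"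
  shows "mostly \<eta> (\<lambda>x. (\<forall>j. \<bar>j\<bar> \<le> int J \<longrightarrow> \<eta> / (12 * J) \<le> pt x j \<and> \<eta> / (12 * J) \<le> 1 - pt x j) \<and>
    KS {- int J..int J} x \<le> 12 * J * ln (12 * J / \<eta>) / \<eta>)"
proof -
  define d where "d = \<eta> / (12 * J)"
  have d: "0 < d" "d \<le> 1/2" using J \<eta> by (auto simp: d_def field_simps)
  define S where "S = {- int J..int J}"
  have cS: "real (card S) \<le> 3 * J" "finite S" using J by (auto simp: S_def)
  have 1: "mostly (\<eta> / 2) (\<lambda>x. \<forall>j\<in>S. d \<le> pt x j \<and> d \<le> 1 - pt x j)"
  proof -
    have "mostly (\<Sum>j\<in>S. 2 * d) (\<lambda>x. \<forall>j\<in>S. d \<le> pt x j \<and> d \<le> 1 - pt x j)"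
      unfolding pt_def using mostly_rotation[OF mostly_far_from_ends[OF d]] by (intro mostly_finite cS(2)) auto
    moreover have "(\<Sum>j\<in>S. 2 * d) \<le> \<eta> / 2"
    proof -
      have "(\<Sum>j\<in>S. 2 * d) = card S * (2 * d)" by simp
      also have "\<dots> \<le> 3 * J * (2 * d)" using cS d by (intro mult_right_mono) auto
      also have "\<dots> = \<eta> / 2" using J by (simp add: d_def field_simps)
      finally show ?thesis .
    qed
    ultimately show ?thesis by (rule mostly_mono) auto
  qed
  define \<phi> where "\<phi> u = (if d \<le> u \<and> u \<le> 1 - d then recip_dist u else 0)" for u
  have phi[measurable]: "\<phi> \<in> borel_measurable borel" unfolding \<phi>_def[abs_def] recip_dist_def[abs_def] by measurable
  define h where "h x = (\<Sum>j\<in>S. \<phi> (frac (x + of_int j * \<alpha>)))" for x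
  have h[measurable]: "h \<in> borel_measurable borel" unfolding h_def[abs_def] by measurable
  have ph0: "0 \<le> \<phi> u" for u using d by (auto simp: \<phi>_def recip_dist_def)
  have lnd: "0 \<le> ln (1 / d)" using d by simp
  have "(\<integral>\<^sup>+x. ennreal (h x) \<partial>circle) = (\<integral>\<^sup>+x. (\<Sum>j\<in>S. ennreal (\<phi> (frac (x + of_int j * \<alpha>)))) \<partial>circle)"
    unfolding h_def using ph0 by (intro nn_integral_cong) (simp add: sum_ennreal)
  also have "\<dots> = (\<Sum>j\<in>S. \<integral>\<^sup>+x. ennreal (\<phi> (frac (x + of_int j * \<alpha>))) \<partial>circle)"
    by (intro nn_integral_sum) measurable
  also have "\<dots> = (\<Sum>j\<in>S. \<integral>\<^sup>+x. ennreal (\<phi> x) \<partial>circle)"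
    by (intro sum.cong refl nn_integral_circle_rotation[where h = "\<lambda>u. ennreal (\<phi> u)"]) measurable
  also have "\<dots> \<le> (\<Sum>j\<in>S. ennreal (2 * ln (1 / d)))"
    using nn_integral_recip_dist[OF d] unfolding \<phi>_def by (intro sum_mono) auto
  also have "\<dots> = ennreal (card S * (2 * ln (1 / d)))"
    using lnd by (simp add: ennreal_mult ennreal_of_nat_eq_real_of_nat)
  also have "\<dots> \<le> ennreal (6 * J * ln (1 / d))"
  proof (rule ennreal_leI)
    have "card S * (2 * ln (1 / d)) \<le> 3 * J * (2 * ln (1 / d))" using cS lnd by (intro mult_right_mono) auto
    then show "card S * (2 * ln (1 / d)) \<le> 6 * J * ln (1 / d)" by simp
  qed
  finally have int: "(\<integral>\<^sup>+x. ennreal (h x) \<partial>circle) \<le> ennreal (6 * J * ln (1 / d))" .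
  have lnd': "0 < ln (1 / d)" using d by (intro ln_gt_zero) auto
  define l where "l = 12 * J * ln (1 / d) / \<eta>"
  have l: "0 < l" using J \<eta> lnd' by (simp add: l_def)
  have 2: "mostly (\<eta> / 2) (\<lambda>x. h x \<le> l)"
  proof (rule mostly_mono[OF mostly_markov[OF h int l]])
    show "0 \<le> 6 * J * ln (1 / d)" using lnd by simp
    show "6 * J * ln (1 / d) / l \<le> \<eta> / 2" using J lnd' \<eta> by (simp add: l_def)
  qed auto
  have "mostly (\<eta> / 2 + \<eta> / 2) (\<lambda>x. (\<forall>j\<in>S. d \<le> pt x j \<and> d \<le> 1 - pt x j) \<and> h x \<le> l)"
    by (rule mostly_conj[OF 1 2])
  then show ?thesis
  proof (rule mostly_mono)
    fix x assume x: "(\<forall>j\<in>S. d \<le> pt x j \<and> d \<le> 1 - pt x j) \<and> h x \<le> l"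
    have "KS S x = h x" unfolding KS_def h_def using x by (intro sum.cong) (auto simp: \<phi>_def pt_def)
    moreover have "1 / d = 12 * J / \<eta>" by (simp add: d_def)
    ultimately show "(\<forall>j. \<bar>j\<bar> \<le> int J \<longrightarrow> \<eta> / (12 * J) \<le> pt x j \<and> \<eta> / (12 * J) \<le> 1 - pt x j) \<and>
      KS {- int J..int J} x \<le> 12 * J * ln (12 * J / \<eta>) / \<eta>"
      using x by (auto simp: S_def[symmetric] d_def[symmetric] l_def) (auto simp: S_def abs_le_iff d_def)
  qed simp
qed

definition bs_set :: "int \<Rightarrow> int set" where
  "bs_set e = (if e \<ge> 0 then {0..<e} else {e..<0})"

lemma bs_GS: "bs e x = (if e \<ge> 0 then 1 else -1) * GS (bs_set e) x"
proof -
  have "{0..e-1} = {0..<e}" "{e..-1} = {e..<0}" by auto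
  then show ?thesis by (simp add: bs_def bs_set_def)
qed

lemma bs_GS_diff: "\<bar>GS (bs_set e) x - GS (bs_set e) y\<bar> = \<bar>bs e x - bs e y\<bar>"
  by (simp add: bs_GS abs_minus_commute)

lemma bs_abs_ge: "a * \<bar>of_int (k - m)\<bar> \<le> \<bar>bs k x - bs m x\<bar>"
proof (cases "m \<le> k")
  case True
  then show ?thesis using bs_mono_diff[OF True, of x] by simp
next
  case False
  then have "m \<ge> k" by simp
  from bs_mono_diff[OF this, of x] False show ?thesis by simp
qed

text \<open>The form of \<open>sparse_returns\<close> for sums whose length \<open>e w\<close>
  varies with the base point. The order of quantifiers matters: \<open>e1\<close> depends on
  \<open>r\<close> alone, while spacing, tolerance and range of lengths stay free. Nearby points
  have equal lengths or lengths that differ by \<open>J0\<close>, and \<open>2 \<le> a * J0\<close>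
  makes the two sums at one point differ by at least 2.\<close>

definition sparse_threshold :: "real \<Rightarrow> nat \<Rightarrow> bool" where
  "sparse_threshold r e1 \<longleftrightarrow> (\<forall>A \<sigma> \<epsilon> e E Kmax J0. finite A \<longrightarrow> A \<subseteq> {0..<1} \<longrightarrow> 0 < \<sigma> \<longrightarrow>
     (\<forall>v\<in>A. \<forall>w\<in>A. v \<noteq> w \<longrightarrow> \<sigma> \<le> \<bar>v - w\<bar>) \<longrightarrow> 0 \<le> \<epsilon> \<longrightarrow> \<epsilon> \<le> 1/2 \<longrightarrow> 0 \<le> Kmax \<longrightarrow> 2 \<le> a * J0 \<longrightarrow>
     (\<forall>w\<in>A. int e1 \<le> \<bar>e w\<bar> \<and> \<bar>e w\<bar> \<le> E \<and> (\<forall>j. \<bar>j\<bar> \<le> E \<longrightarrow> 0 < pt w j) \<and> KS {-E..E} w \<le> Kmax) \<longrightarrow>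
     (\<forall>v\<in>A. \<forall>w\<in>A. \<bar>v - w\<bar> < r \<longrightarrow> \<bar>bs (e w) w - bs (e v) v\<bar> \<le> \<epsilon> \<and> (e w = e v \<or> J0 \<le> real_of_int \<bar>e w - e v\<bar>)) \<longrightarrow>
     real (card A) \<le> 4 * sqrt (800 * \<epsilon> / \<kappa>\<^sub>0) / \<sigma> + 16 * Cf * Kmax / \<kappa>\<^sub>0)"

text \<open>Long sums see the singularity often enough for the curvature condition; this is the
  choice \<open>2 * G / am\<close>. Equal lengths give the first alternative of \<open>gap\<close>.
  Different lengths make the sum of length \<open>e w\<close> jump by at least
  \<open>2 - \<epsilon>\<close> between \<open>v\<close> and \<open>w\<close>, which is the
  second.\<close>

lemma sparse_orbit:
  assumes r: "0 < r"
  shows "\<exists>e1. sparse_threshold r e1"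
proof -
  obtain e1 :: nat where e1: "1 \<le> e1" "\<And>m L x. e1 \<le> L \<Longrightarrow> (\<And>j. j \<in> {m..<m + int L} \<Longrightarrow> 0 < pt x j) \<Longrightarrow>
     (\<exists>j\<in>{m..<m + int L}. pt x j < r) \<and> 2 * G / am * real L \<le> (\<Sum>j\<in>{m..<m + int L}. 1 / (pt x j)\<^sup>2)"
    using many_close_visits[OF r, of "2 * G / am"] by blast
  show ?thesis
    unfolding sparse_threshold_def
  proof (intro exI[of _ e1] allI impI)
    fix A :: "real set" and \<sigma> \<epsilon> Kmax J0 :: real and e :: "real \<Rightarrow> int" and E :: int
    assume A: "finite A" "A \<subseteq> {0..<1}" "0 < \<sigma>" "\<forall>v\<in>A. \<forall>w\<in>A. v \<noteq> w \<longrightarrow> \<sigma> \<le> \<bar>v - w\<bar>"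
      "0 \<le> \<epsilon>" "\<epsilon> \<le> 1/2" "0 \<le> Kmax" "2 \<le> a * J0"
    assume ew: "\<forall>w\<in>A. int e1 \<le> \<bar>e w\<bar> \<and> \<bar>e w\<bar> \<le> E \<and> (\<forall>j. \<bar>j\<bar> \<le> E \<longrightarrow> 0 < pt w j) \<and> KS {-E..E} w \<le> Kmax"
    assume vw: "\<forall>v\<in>A. \<forall>w\<in>A. \<bar>v - w\<bar> < r \<longrightarrow> \<bar>bs (e w) w - bs (e v) v\<bar> \<le> \<epsilon> \<and> (e w = e v \<or> J0 \<le> real_of_int \<bar>e w - e v\<bar>)"
    have form: "\<exists>m L. bs_set (e w) = {m..<m + int L} \<and> e1 \<le> L" if "w \<in> A" for w
    proof (cases "e w \<ge> 0")
      case True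
      then show ?thesis using ew that by (intro exI[of _ 0] exI[of _ "nat (e w)"]) (auto simp: bs_set_def)
    next
      case False
      then show ?thesis using ew that by (intro exI[of _ "e w"] exI[of _ "nat (- e w)"]) (auto simp: bs_set_def)
    qed
    have sub: "bs_set (e w) \<subseteq> {-E..E}" if "w \<in> A" for w using ew that by (auto simp: bs_set_def)
    have pos: "0 < pt w j" if "w \<in> A" "j \<in> bs_set (e w)" for w j
      using sub[OF that(1)] that ew by (auto simp: abs_le_iff dest!: subsetD)
    show "real (card A) \<le> 4 * sqrt (800 * \<epsilon> / \<kappa>\<^sub>0) / \<sigma> + 16 * Cf * Kmax / \<kappa>\<^sub>0"
    proof (rule sparse_returns[where S = "\<lambda>w. bs_set (e w)" and r = r])
      fix w assume w: "w \<in> A"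
      obtain m L where mL: "bs_set (e w) = {m..<m + int L}" "e1 \<le> L" using form[OF w] by blast
      have *: "(\<exists>j\<in>{m..<m + int L}. pt w j < r) \<and> 2 * G / am * real L \<le> (\<Sum>j\<in>{m..<m + int L}. 1 / (pt w j)\<^sup>2)"
        using pos[OF w] mL by (intro e1(2)) auto
      show "finite (bs_set (e w))" by (simp add: bs_set_def)
      show "\<exists>j\<in>bs_set (e w). pt w j < r" using * mL by simp
      have "am * (2 * G / am * real L) \<le> am * (\<Sum>j\<in>{m..<m + int L}. 1 / (pt w j)\<^sup>2)"
        using * am_pos by (intro mult_left_mono) auto
      then show "2 * G * real (card (bs_set (e w))) \<le> (\<Sum>j\<in>bs_set (e w). am / (pt w j)\<^sup>2)"
        using mL am_pos by (simp add: sum_distrib_left)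
      show "KS (bs_set (e w)) w \<le> Kmax"
        using KS_mono[OF _ sub[OF w], of w] ew w by force
    next
      fix v w assume v: "v \<in> A" "w \<in> A" "\<bar>v - w\<bar> < r"
      have 1: "\<bar>bs (e w) w - bs (e v) v\<bar> \<le> \<epsilon>" using vw v by blast
      show "\<bar>GS (bs_set (e w)) v - GS (bs_set (e w)) w\<bar> \<le> \<epsilon> \<or> 1 \<le> \<bar>GS (bs_set (e w)) v - GS (bs_set (e w)) w\<bar>"
      proof (cases "e w = e v")
        case True
        then show ?thesis using 1 by (simp add: bs_GS_diff abs_minus_commute)
      next
        case False
        then have "J0 \<le> real_of_int \<bar>e w - e v\<bar>" using vw v by blast
        then have "a * J0 \<le> a * \<bar>of_int (e w - e v)\<bar>"
          using a_pos by (intro mult_left_mono) auto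
        then have "2 \<le> \<bar>bs (e w) v - bs (e v) v\<bar>" using bs_abs_ge[of "e w" "e v" v] A by linarith
        then show ?thesis using 1 A unfolding bs_GS_diff by linarith
      qed
    qed (use A pos in auto)
  qed
qed

end

section \<open>Discrepancies at the denominators\<close>

lemma card_le_fibers:
  fixes c :: real
  assumes "finite S" "\<And>w. w \<in> h ` S \<Longrightarrow> real (card {j\<in>S. h j = w}) \<le> c"
  shows "real (card S) \<le> c * real (card (h ` S))"
proof -
  have "card S = (\<Sum>w\<in>h ` S. card {j\<in>S. h j = w})"
    using sum.image_gen[OF assms(1), of "\<lambda>_. 1::nat" h] by simp
  then have "real (card S) = (\<Sum>w\<in>h ` S. real (card {j\<in>S. h j = w}))" by simp
  also have "\<dots> \<le> (\<Sum>w\<in>h ` S. c)" using assms(2) by (intro sum_mono) auto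
  finally show ?thesis by (simp add: mult.commute)
qed

context arnold_roof_flow
begin

lemma pt_separated:
  assumes "k \<noteq> m" "\<bar>k - m\<bar> < int (q (Suc l))"
  shows "1 / (2 * real (q (Suc l))) \<le> \<bar>pt x k - pt x m\<bar>"
proof -
  have e: "pt x k - pt x m = of_int (k - m) * \<alpha> - of_int (\<lfloor>x + of_int k * \<alpha>\<rfloor> - \<lfloor>x + of_int m * \<alpha>\<rfloor>)"
    by (simp add: pt_def frac_def algebra_simps)
  have "\<bar>err l\<bar> \<le> \<bar>pt x k - pt x m\<bar>" unfolding e
    by (rule best_approximation) (use assms in auto)
  then show ?thesis using err_ge[of l] by linarith
qed

lemma int_multiples_apart:
  "\<exists>d>0. \<forall>e z :: int. e \<noteq> 0 \<longrightarrow> real_of_int \<bar>e\<bar> \<le> N \<longrightarrow> d \<le> \<bar>of_int e * \<alpha> - of_int z\<bar>"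
proof -
  obtain n where n: "real n > N" using reals_Archimedean2 by blast
  show ?thesis
  proof (intro exI[of _ "\<bar>err n\<bar>"] conjI allI impI)
    show "0 < \<bar>err n\<bar>" using err_nz by simp
    fix e z :: int assume e: "e \<noteq> 0" "real_of_int \<bar>e\<bar> \<le> N"
    have "real n \<le> real (q (Suc n))" using q_ge[of "Suc n"] by simp
    then have "real_of_int \<bar>e\<bar> < real_of_int (int (q (Suc n)))" using e n by simp
    then have "\<bar>e\<bar> < int (q (Suc n))" by (simp only: of_int_less_iff)
    then show "\<bar>err n\<bar> \<le> \<bar>of_int e * \<alpha> - of_int z\<bar>" using best_approximation[OF e(1)] by blast
  qed
qed

text \<open>Split the sum of length \<open>j + Q\<close> at \<open>j\<close> and at
  \<open>Q\<close>. The dependence of a long sum on the position along the orbit thereby becomes the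
  effect of a displacement on a short sum.\<close>

lemma bs_swap: "bs Q (x + of_int j * \<alpha>) = bs Q x + (bs j (x + of_int Q * \<alpha>) - bs j x)"
  using bs_cocycle[of j Q x] bs_cocycle[of Q j x] by (simp add: add.commute)

lemma bs_pt: "bs m (pt x j) = bs m (x + of_int j * \<alpha>)"
  by (simp add: pt_def bs_frac)

end

text \<open>\<open>(Y x, V x)\<close> plays the role of the image of \<open>(x, 0)\<close>. By
  \<open>ac\<close>, small sets pull back to small sets under \<open>Y\<close>, so statements about
  typical points may be applied at \<open>Y x\<close>. By \<open>growth\<close>, consecutive
  denominators have comparable logarithms.\<close>

locale base_map = arnold_roof_flow +
  fixes Y V :: "real \<Rightarrow> real" and Cg :: real
  assumes Y_meas [measurable]: "Y \<in> borel_measurable borel"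
    and V_meas [measurable]: "V \<in> borel_measurable borel"
    and Y_range: "\<And>x. 0 \<le> Y x \<and> Y x < 1"
    and V_range: "\<And>x. 0 \<le> V x \<and> V x < f (Y x)"
    and cocycle: "AE x in circle. \<forall>m. \<exists>k. Y (pt x m) = pt (Y x) k \<and> V (pt x m) = V x + bs m x - bs k (Y x)"
    and ac: "\<And>\<eta>. 0 < \<eta> \<Longrightarrow> \<exists>\<kappa>>0. \<forall>E\<in>sets borel. measure circle E \<le> \<kappa> \<longrightarrow> measure circle {x. Y x \<in> E} \<le> \<eta>"
    and f_meas: "(\<lambda>x. f (frac x)) \<in> borel_measurable borel"
    and f_int: "(\<integral>\<^sup>+x. ennreal (f (frac x)) \<partial>circle) = 1"
    and growth: "\<And>n. real (q (Suc n)) \<le> Cg * (real (q n))\<^sup>2"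
begin

definition equivariant :: "real \<Rightarrow> bool" where
  "equivariant x \<longleftrightarrow> (\<forall>m. \<exists>k. Y (pt x m) = pt (Y x) k \<and> V (pt x m) = V x + bs m x - bs k (Y x))"

definition disc :: "int \<Rightarrow> real \<Rightarrow> real" where
  "disc m x = bs m x - bs m (Y x)"

lemma mostly_equivariant: "mostly 0 equivariant"
  by (rule mostly_AE) (use cocycle in \<open>simp add: equivariant_def[abs_def]\<close>)

lemma mostly_Y:
  assumes "0 < \<eta>"
  shows "\<exists>\<kappa>>0. \<kappa> \<le> 1 \<and> (\<forall>P. mostly \<kappa> P \<longrightarrow> mostly \<eta> (\<lambda>x. P (Y x)))"
proof -
  obtain \<kappa> where k: "\<kappa> > 0" "\<And>E. E \<in> sets borel \<Longrightarrow> measure circle E \<le> \<kappa> \<Longrightarrow> measure circle {x. Y x \<in> E} \<le> \<eta>"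
    using ac[OF assms] by blast
  show ?thesis
  proof (intro exI[of _ "min \<kappa> 1"] conjI allI impI)
    fix P assume "mostly (min \<kappa> 1) P"
    then obtain E where E: "E \<in> sets borel" "measure circle E \<le> \<kappa>" "\<forall>x\<in>{0..<1}-E. P x" unfolding mostly_def by auto
    have "Y -` E \<in> sets borel" by (rule measurable_sets_borel[OF Y_meas E(1)])
    then show "mostly \<eta> (\<lambda>x. P (Y x))" unfolding mostly_def using k(2)[OF E(1,2)] E(3) Y_range
      by (intro bexI[of _ "{x. Y x \<in> E}"]) (auto simp: vimage_def)
  qed (use k in auto)
qed

lemma mostly_V:
  assumes "0 < \<eta>" shows "\<exists>H>0. mostly \<eta> (\<lambda>x. V x \<le> H)"
proof -
  define T where "T n = {x. real n < V x}" for n :: nat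
  have T[measurable]: "T n \<in> sets borel" for n unfolding T_def by measurable
  have "(\<lambda>n. measure circle (T n)) \<longlonglongrightarrow> measure circle (\<Inter>n. T n)"
    by (rule circle.finite_Lim_measure_decseq) (auto simp: decseq_def T_def)
  moreover have "(\<Inter>n. T n) = {}"
  proof -
    have "\<exists>n. x \<notin> T n" for x using reals_Archimedean2[of "V x"] by (auto simp: T_def not_less intro: less_imp_le)
    then show ?thesis by blast
  qed
  ultimately have "(\<lambda>n. measure circle (T n)) \<longlonglongrightarrow> 0" by simp
  then have "eventually (\<lambda>n. measure circle (T n) < \<eta>) sequentially"
    using assms by (intro order_tendstoD(2)) auto
  then obtain n where n: "measure circle (T n) < \<eta>" by (auto simp: eventually_sequentially)
  show ?thesis
  proof (intro exI[of _ "real n + 1"] conjI)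
    show "mostly \<eta> (\<lambda>x. V x \<le> real n + 1)" unfolding mostly_def
      by (rule bexI[of _ "T n"]) (use n in \<open>auto simp: T_def\<close>)
  qed simp
qed

text \<open>The sum of the positive roof over all indices up to \<open>J\<close> in absolute value
  dominates every \<open>bs i\<close>, and its mean is \<open>2 * J + 1\<close> because the roof has
  integral 1; Markov's inequality does the rest.\<close>

lemma mostly_bs_range:
  assumes "0 < \<eta>"
  shows "mostly \<eta> (\<lambda>x. \<forall>i. \<bar>i\<bar> \<le> int J \<longrightarrow> \<bar>bs i x\<bar> \<le> (2 * real J + 1) / \<eta>)"
proof -
  define S where "S = {- int J..int J}"
  have cS: "card S = 2 * J + 1" by (simp add: S_def)
  define h where "h x = (\<Sum>j\<in>S. f (frac (x + of_int j * \<alpha>)))" for x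
  have fm: "(\<lambda>x. f (frac (x + t))) \<in> borel_measurable borel" for t
    by (rule measurable_compose[OF _ f_meas]) simp
  have h[measurable]: "h \<in> borel_measurable borel" unfolding h_def[abs_def] using fm by (intro borel_measurable_sum) auto
  have f0: "0 \<le> f (frac u)" for u using f_ge[of "frac u"] a_pos by (simp add: frac_lt_1)
  have "(\<integral>\<^sup>+x. ennreal (h x) \<partial>circle) = (\<integral>\<^sup>+x. (\<Sum>j\<in>S. ennreal (f (frac (x + of_int j * \<alpha>)))) \<partial>circle)"
    unfolding h_def using f0 by (intro nn_integral_cong) (simp add: sum_ennreal)
  also have "\<dots> = (\<Sum>j\<in>S. \<integral>\<^sup>+x. ennreal (f (frac (x + of_int j * \<alpha>))) \<partial>circle)"
    using fm by (intro nn_integral_sum) auto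
  also have "\<dots> = (\<Sum>j\<in>S. 1)"
  proof (intro sum.cong refl)
    fix j
    have "(\<integral>\<^sup>+x. ennreal (f (frac (x + of_int j * \<alpha>))) \<partial>circle) = (\<integral>\<^sup>+x. ennreal (f (frac (frac (x + of_int j * \<alpha>)))) \<partial>circle)"
      by simp
    also have "\<dots> = (\<integral>\<^sup>+x. ennreal (f (frac x)) \<partial>circle)"
      using f_meas by (intro nn_integral_circle_rotation[where h = "\<lambda>u. ennreal (f (frac u))"]) auto
    finally show "(\<integral>\<^sup>+x. ennreal (f (frac (x + of_int j * \<alpha>))) \<partial>circle) = 1" using f_int by simp
  qed
  also have "\<dots> = ennreal (2 * real J + 1)" by (simp add: cS) (metis ennreal_of_nat_eq_real_of_nat of_nat_add of_nat_mult of_nat_numeral of_nat_1 add.commute of_nat_Suc)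
  finally have int: "(\<integral>\<^sup>+x. ennreal (h x) \<partial>circle) \<le> ennreal (2 * real J + 1)" by simp
  have "mostly ((2 * real J + 1) / ((2 * real J + 1) / \<eta>)) (\<lambda>x. h x \<le> (2 * real J + 1) / \<eta>)"
    using assms by (intro mostly_markov[OF h int]) auto
  then show ?thesis
  proof (rule mostly_mono)
    fix x assume hx: "h x \<le> (2 * real J + 1) / \<eta>"
    show "\<forall>i. \<bar>i\<bar> \<le> int J \<longrightarrow> \<bar>bs i x\<bar> \<le> (2 * real J + 1) / \<eta>"
    proof (intro allI impI)
      fix i assume i: "\<bar>i\<bar> \<le> int J"
      have "\<bar>bs i x\<bar> = \<bar>GS (bs_set i) x\<bar>" by (simp add: bs_GS)
      also have "\<dots> = (\<Sum>j\<in>bs_set i. f (frac (x + of_int j * \<alpha>)))"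
        unfolding GS_def pt_def using f0 by (intro abs_of_nonneg sum_nonneg) auto
      also have "\<dots> \<le> h x" unfolding h_def using i f0 by (intro sum_mono2) (auto simp: S_def bs_set_def)
      finally show "\<bar>bs i x\<bar> \<le> (2 * real J + 1) / \<eta>" using hx by simp
    qed
  qed (use assms in auto)
qed

lemma almost_uniform_YV:
  assumes "0 < \<epsilon>" "0 < \<eta>"
  shows "\<exists>r>0. \<exists>P. mostly \<eta> P \<and> (\<forall>x y. 0 \<le> x \<longrightarrow> x < 1 \<longrightarrow> 0 \<le> y \<longrightarrow> y < 1 \<longrightarrow> P x \<longrightarrow> P y \<longrightarrow> \<bar>x - y\<bar> < r \<longrightarrow>
    \<bar>Y x - Y y\<bar> < \<epsilon> \<and> \<bar>V x - V y\<bar> < \<epsilon>)"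
proof -
  obtain r1 E1 where 1: "r1 > 0" "E1 \<in> sets borel" "measure circle E1 \<le> \<eta> / 2"
    "\<forall>x\<in>{0..<1}-E1. \<forall>y\<in>{0..<1}-E1. \<bar>x - y\<bar> < r1 \<longrightarrow> \<bar>Y x - Y y\<bar> < \<epsilon>"
    using almost_uniform_continuity[OF Y_meas assms(1), of "\<eta> / 2"] assms by auto
  obtain r2 E2 where 2: "r2 > 0" "E2 \<in> sets borel" "measure circle E2 \<le> \<eta> / 2"
    "\<forall>x\<in>{0..<1}-E2. \<forall>y\<in>{0..<1}-E2. \<bar>x - y\<bar> < r2 \<longrightarrow> \<bar>V x - V y\<bar> < \<epsilon>"
    using almost_uniform_continuity[OF V_meas assms(1), of "\<eta> / 2"] assms by auto
  have "mostly (\<eta> / 2 + \<eta> / 2) (\<lambda>x. x \<notin> E1 \<and> x \<notin> E2)"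
    by (rule mostly_conj) (use 1 2 in \<open>auto simp: mostly_def\<close>)
  then show ?thesis using 1 2
    by (intro exI[of _ "min r1 r2"] conjI exI[of _ "\<lambda>x. x \<notin> E1 \<and> x \<notin> E2"]) auto
qed

text \<open>Time alone controls the index: the elapsed time \<open>V x + bs j x\<close> is
  nonnegative and below \<open>a * B\<close>, and every step of the orbit of \<open>Y x\<close>
  takes time at least \<open>a\<close>.\<close>

lemma fibre_index_bounds:
  assumes eq: "Y (pt x (int j)) = pt (Y x) k" "V (pt x (int j)) = V x + bs (int j) x - bs k (Y x)"
    and j: "j < B'" and B: "bs (int B') x + V x < a * real B"
  shows "0 \<le> k" "k < int B"
proof -
  have "V (pt x (int j)) < f (pt (Y x) k)" using V_range[of "pt x (int j)"] eq(1) by simp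
  then have "V x + bs (int j) x < bs (k + 1) (Y x)" using eq(2) by (simp add: bs_Suc)
  moreover have "0 \<le> V x" "0 \<le> bs (int j) x" using V_range bs_le_iff[of 0 x "int j"] by (auto simp: bs_0)
  ultimately have "bs 0 (Y x) < bs (k + 1) (Y x)" by (simp add: bs_0)
  then show "0 \<le> k" by (simp add: bs_less_iff)
  have "bs k (Y x) \<le> V x + bs (int j) x" using eq(2) V_range[of "pt x (int j)"] by linarith
  also have "\<dots> \<le> V x + bs (int B') x" using j by (simp add: bs_le_iff)
  also have "\<dots> < a * real B" using B by simp
  also have "\<dots> \<le> bs (int B) (Y x)" using bs_mono_diff[of 0 "int B" "Y x"] by (simp add: bs_0)
  finally show "k < int B" by (simp add: bs_less_iff)
qed

lemma frac_near_int:
  assumes "\<bar>frac (y + t) - y\<bar> \<le> \<epsilon>" shows "\<exists>z::int. \<bar>t - of_int z\<bar> \<le> \<epsilon>"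
  using assms by (intro exI[of _ "\<lfloor>y + t\<rfloor>"]) (simp add: frac_def algebra_simps)

text \<open>A discrepancy above \<open>4 * \<epsilon>\<close> at \<open>x\<close> is almost the same
  at the first \<open>B'\<close> points \<open>X j\<close>. At a good point \<open>Y\<close> moves
  little when \<open>X j\<close> is displaced by \<open>Q * \<alpha>\<close>; hence
  \<open>Y (pt (X j) Q)\<close> is reached from \<open>W j\<close> by an index \<open>i\<close> with
  \<open>i * \<alpha>\<close> near an integer, and the sum of length \<open>i\<close> at
  \<open>W j\<close> is close to the discrepancy, so \<open>i \<noteq> 0\<close>. As all these sums
  have nearly one value, there are few different \<open>W j\<close>. Few \<open>j\<close> share one
  \<open>W j\<close>: they share \<open>k j\<close>, so their times differ by at most
  \<open>H\<close>.\<close>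

lemma small_discrepancy_core:
  fixes x :: real and good :: "real \<Rightarrow> bool"
  assumes sparse: "sparse_threshold r e1"
    and x: "equivariant x" "bs (int B') x + V x < a * real B" and B: "B = q (Suc l)"
    and g: "\<And>x'. 0 \<le> x' \<Longrightarrow> x' < 1 \<Longrightarrow> good x' \<Longrightarrow> equivariant x' \<and> \<bar>Y (pt x' Q) - Y x'\<bar> \<le> \<epsilon> \<and> \<bar>V (pt x' Q) - V x'\<bar> \<le> \<epsilon> \<and>
        V x' \<le> H \<and> \<bar>disc Q x'\<bar> \<le> Dmax \<and> (\<forall>j. \<bar>j\<bar> \<le> E \<longrightarrow> 0 < pt (pt (Y x') Q) j) \<and> KS {-E..E} (pt (Y x') Q) \<le> Kmax"
    and slow_x: "\<And>j. 0 \<le> j \<Longrightarrow> j < int B' \<Longrightarrow> \<bar>bs j (x + of_int Q * \<alpha>) - bs j x\<bar> \<le> \<epsilon>"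
    and slow_y: "\<And>j. 0 \<le> j \<Longrightarrow> j < int B \<Longrightarrow> \<bar>bs j (Y x + of_int Q * \<alpha>) - bs j (Y x)\<bar> \<le> \<epsilon>"
    and many: "real (card {j\<in>{..<B'}. \<not> good (pt x (int j))}) \<le> real B' / 2"
    and e: "0 < \<epsilon>" "\<epsilon> \<le> 1/12" and E: "Dmax + \<epsilon> \<le> a * E" and K0: "0 \<le> Kmax" and H: "0 \<le> H"
    and J0: "2 \<le> a * J0"
    and apart: "\<And>i z :: int. i \<noteq> 0 \<Longrightarrow> \<bar>of_int i * \<alpha> - of_int z\<bar> \<le> 4 * \<epsilon> \<Longrightarrow> max (real e1) J0 \<le> real_of_int \<bar>i\<bar>"
    and Qa: "\<bar>of_int Q * \<alpha> - of_int pQ\<bar> \<le> \<epsilon>"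
    and big: "4 * \<epsilon> < \<bar>disc Q x\<bar>"
  shows "real B' / 2 \<le> (H / a + 1) * (8 * sqrt (4800 * \<epsilon> / \<kappa>\<^sub>0) * real B + 16 * Cf * Kmax / \<kappa>\<^sub>0)"
proof -
  define y where "y = Y x"
  define X where "X j = pt x (int j)" for j :: nat
  have X01: "0 \<le> X j" "X j < 1" for j by (auto simp: X_def pt_range)
  have "\<forall>j. \<exists>k. Y (X j) = pt y k \<and> V (X j) = V x + bs (int j) x - bs k y"
    using x(1) unfolding equivariant_def X_def y_def by blast
  from choice[OF this] obtain k where k: "\<And>j. Y (X j) = pt y (k j)" "\<And>j. V (X j) = V x + bs (int j) x - bs (k j) y"
    by blast
  have kB: "0 \<le> k j" "k j < int B" if "j < B'" for j
    using fibre_index_bounds[of x j "k j", OF _ _ that x(2)] k[of j] by (auto simp: X_def y_def)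
  define S where "S = {j\<in>{..<B'}. good (X j)}"
  have S: "finite S" "\<And>j. j \<in> S \<Longrightarrow> j < B'" "\<And>j. j \<in> S \<Longrightarrow> good (X j)" by (auto simp: S_def)
  have cS: "real B' / 2 \<le> real (card S)"
  proof -
    have "S \<union> {j\<in>{..<B'}. \<not> good (X j)} = {..<B'}" by (auto simp: S_def)
    then have "B' = card (S \<union> {j\<in>{..<B'}. \<not> good (X j)})" by simp
    also have "\<dots> \<le> card S + card {j\<in>{..<B'}. \<not> good (X j)}" by (rule card_Un_le)
    finally have "real B' \<le> real (card S) + real (card {j\<in>{..<B'}. \<not> good (X j)})" by linarith
    then show ?thesis using many unfolding X_def by linarith
  qed
  have disc_close: "\<bar>disc Q (X j) - disc Q x\<bar> \<le> 2 * \<epsilon>" if "j < B'" for j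
  proof -
    have "bs Q (X j) = bs Q x + (bs (int j) (x + of_int Q * \<alpha>) - bs (int j) x)"
      unfolding X_def bs_pt by (rule bs_swap)
    moreover have "bs Q (Y (X j)) = bs Q y + (bs (k j) (y + of_int Q * \<alpha>) - bs (k j) y)"
      unfolding k bs_pt by (rule bs_swap)
    ultimately have "disc Q (X j) - disc Q x = (bs (int j) (x + of_int Q * \<alpha>) - bs (int j) x) - (bs (k j) (y + of_int Q * \<alpha>) - bs (k j) y)"
      by (simp add: disc_def y_def)
    moreover have "\<bar>bs (int j) (x + of_int Q * \<alpha>) - bs (int j) x\<bar> \<le> \<epsilon>" using that by (intro slow_x) auto
    moreover have "\<bar>bs (k j) (y + of_int Q * \<alpha>) - bs (k j) y\<bar> \<le> \<epsilon>"
      unfolding y_def using kB[OF that] by (intro slow_y) auto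
    ultimately show ?thesis by linarith
  qed
  define W where "W j = pt (Y (X j)) Q" for j
  have W: "W j = pt y (k j + Q)" for j by (simp add: W_def k pt_pt)
  \<comment> \<open>Of the tolerance \<open>3 * \<epsilon>\<close>, two parts are the variation of
    the discrepancy along the orbit and one is the change of \<open>V\<close>.\<close>
  have "\<exists>i. \<bar>bs i (W j) - disc Q x\<bar> \<le> 3 * \<epsilon> \<and> (\<exists>z. \<bar>of_int i * \<alpha> - of_int z\<bar> \<le> 2 * \<epsilon>) \<and> i \<noteq> 0 \<and> \<bar>i\<bar> \<le> E" if j: "j \<in> S" for j
  proof -
    note gj = g[OF X01 S(3)[OF j]]
    obtain m where m: "Y (pt (X j) Q) = pt (Y (X j)) m" "V (pt (X j) Q) = V (X j) + bs Q (X j) - bs m (Y (X j))"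
      using gj unfolding equivariant_def by blast
    define i where "i = m - Q"
    have "bs m (Y (X j)) = bs Q (Y (X j)) + bs i (Y (X j) + of_int Q * \<alpha>)"
      using bs_cocycle[of Q i "Y (X j)"] by (simp add: i_def)
    then have "bs m (Y (X j)) = bs Q (Y (X j)) + bs i (W j)" by (simp add: W_def bs_pt)
    then have c: "\<bar>bs i (W j) - disc Q (X j)\<bar> \<le> \<epsilon>" 
    proof -
      have "\<bar>V (pt (X j) Q) - V (X j)\<bar> \<le> \<epsilon>" using gj by blast
      then show ?thesis using m(2) \<open>bs m (Y (X j)) = bs Q (Y (X j)) + bs i (W j)\<close> unfolding disc_def by linarith
    qed
    then have c3: "\<bar>bs i (W j) - disc Q x\<bar> \<le> 3 * \<epsilon>" using disc_close[OF S(2)[OF j]] by linarith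
    have "\<bar>frac (Y (X j) + of_int m * \<alpha>) - Y (X j)\<bar> \<le> \<epsilon>" using gj m(1) by (simp add: pt_def)
    then obtain z where "\<bar>of_int m * \<alpha> - of_int z\<bar> \<le> \<epsilon>" using frac_near_int by blast
    then have "\<bar>of_int i * \<alpha> - of_int (z - pQ)\<bar> \<le> 2 * \<epsilon>" using Qa by (simp add: i_def algebra_simps)
    moreover have "i \<noteq> 0" using c3 big e by (auto simp: bs_0)
    moreover have "\<bar>i\<bar> \<le> E"
    proof -
      have "a * real_of_int \<bar>i\<bar> \<le> \<bar>bs i (W j)\<bar>" using bs_abs_ge[of i 0 "W j"] by (simp add: bs_0)
      also have "\<dots> \<le> Dmax + \<epsilon>" using c gj by linarith
      also have "\<dots> \<le> a * real_of_int E" by (rule E)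
      finally show ?thesis using a_pos by simp
    qed
    ultimately show ?thesis using c3 by blast
  qed
  then have "\<forall>j. \<exists>i. j \<in> S \<longrightarrow> \<bar>bs i (W j) - disc Q x\<bar> \<le> 3 * \<epsilon> \<and> (\<exists>z. \<bar>of_int i * \<alpha> - of_int z\<bar> \<le> 2 * \<epsilon>) \<and> i \<noteq> 0 \<and> \<bar>i\<bar> \<le> E"
    by blast
  from choice[OF this] obtain i where i: "\<And>j. j \<in> S \<Longrightarrow> \<bar>bs (i j) (W j) - disc Q x\<bar> \<le> 3 * \<epsilon>"
    "\<And>j. j \<in> S \<Longrightarrow> \<exists>z. \<bar>of_int (i j) * \<alpha> - of_int z\<bar> \<le> 2 * \<epsilon>" "\<And>j. j \<in> S \<Longrightarrow> i j \<noteq> 0" "\<And>j. j \<in> S \<Longrightarrow> \<bar>i j\<bar> \<le> E"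
    by blast
  define A where "A = W ` S"
  define rep where "rep w = (SOME j. j \<in> S \<and> W j = w)" for w
  have rep: "rep w \<in> S" "W (rep w) = w" if "w \<in> A" for w
  proof -
    have "\<exists>j. j \<in> S \<and> W j = w" using that by (auto simp: A_def)
    from someI_ex[OF this] show "rep w \<in> S" "W (rep w) = w" by (auto simp: rep_def)
  qed
  have sepW: "1 / (2 * real B) \<le> \<bar>W j - W j'\<bar>" if "j \<in> S" "j' \<in> S" "k j \<noteq> k j'" for j j'
    unfolding W B using that kB[OF S(2)[OF that(1)]] kB[OF S(2)[OF that(2)]] B by (intro pt_separated) auto
  have Bpos: "0 < real B" using q_pos[of "Suc l"] B by simp
  have sep: "\<forall>v\<in>A. \<forall>w\<in>A. v \<noteq> w \<longrightarrow> 1 / (2 * real B) \<le> \<bar>v - w\<bar>"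
  proof (intro ballI impI)
    fix v w assume vw: "v \<in> A" "w \<in> A" "v \<noteq> w"
    then have "k (rep v) \<noteq> k (rep w)" using rep W by metis
    then show "1 / (2 * real B) \<le> \<bar>v - w\<bar>" using sepW[of "rep v" "rep w"] rep vw by simp
  qed
  \<comment> \<open>Two values within \<open>3 * \<epsilon>\<close> of \<open>disc Q x\<close>
    differ by at most \<open>6 * \<epsilon>\<close>, and the threshold requires this to be at most
    1/2; hence the bound 1/12 on \<open>\<epsilon>\<close>.\<close>
  have "real (card A) \<le> 4 * sqrt (800 * (6 * \<epsilon>) / \<kappa>\<^sub>0) / (1 / (2 * real B)) + 16 * Cf * Kmax / \<kappa>\<^sub>0"
  proof (rule sparse[unfolded sparse_threshold_def, rule_format, where e = "\<lambda>w. i (rep w)" and E = E])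
    show "finite A" using S by (simp add: A_def)
    show "A \<subseteq> {0..<1}" by (auto simp: A_def W pt_range)
    show "1 / (2 * real B) \<le> \<bar>v - w\<bar>" if "v \<in> A" "w \<in> A" "v \<noteq> w" for v w using sep that by blast
    fix w assume w: "w \<in> A"
    note ri = rep[OF w]
    obtain z where "\<bar>of_int (i (rep w)) * \<alpha> - of_int z\<bar> \<le> 2 * \<epsilon>" using i(2)[OF ri(1)] by blast
    then have "\<bar>of_int (i (rep w)) * \<alpha> - of_int z\<bar> \<le> 4 * \<epsilon>" using e by linarith
    from apart[OF i(3)[OF ri(1)] this] have "int e1 \<le> \<bar>i (rep w)\<bar>" by linarith
    moreover have "(\<forall>j. \<bar>j\<bar> \<le> E \<longrightarrow> 0 < pt w j) \<and> KS {-E..E} w \<le> Kmax"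
      using g[OF X01 S(3)[OF ri(1)]] ri(2) unfolding W_def by simp
    ultimately show "int e1 \<le> \<bar>i (rep w)\<bar> \<and> \<bar>i (rep w)\<bar> \<le> E \<and> (\<forall>j. \<bar>j\<bar> \<le> E \<longrightarrow> 0 < pt w j) \<and> KS {-E..E} w \<le> Kmax"
      using i(4)[OF ri(1)] by blast
  next
    fix v w assume vw: "v \<in> A" "w \<in> A"
    note rv = rep[OF vw(1)] and rw = rep[OF vw(2)]
    have "\<bar>bs (i (rep w)) w - bs (i (rep v)) v\<bar> \<le> 6 * \<epsilon>"
      using i(1)[OF rv(1)] i(1)[OF rw(1)] rv rw by simp
    moreover have "i (rep w) = i (rep v) \<or> J0 \<le> real_of_int \<bar>i (rep w) - i (rep v)\<bar>"
    proof (cases "i (rep w) = i (rep v)")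
      case False
      obtain z z' where "\<bar>of_int (i (rep w)) * \<alpha> - of_int z\<bar> \<le> 2 * \<epsilon>" "\<bar>of_int (i (rep v)) * \<alpha> - of_int z'\<bar> \<le> 2 * \<epsilon>"
        using i(2)[OF rv(1)] i(2)[OF rw(1)] by blast
      then have "\<bar>of_int (i (rep w) - i (rep v)) * \<alpha> - of_int (z - z')\<bar> \<le> 4 * \<epsilon>" by (simp add: algebra_simps)
      from apart[OF _ this] False show ?thesis by simp
    qed simp
    ultimately show "\<bar>bs (i (rep w)) w - bs (i (rep v)) v\<bar> \<le> 6 * \<epsilon> \<and> (i (rep w) = i (rep v) \<or> J0 \<le> real_of_int \<bar>i (rep w) - i (rep v)\<bar>)"
      by blast
  qed (use e K0 J0 Bpos in auto)
  then have cA: "real (card A) \<le> 8 * sqrt (4800 * \<epsilon> / \<kappa>\<^sub>0) * real B + 16 * Cf * Kmax / \<kappa>\<^sub>0" by simp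
  have "real (card S) \<le> (H / a + 1) * real (card (W ` S))"
  proof (rule card_le_fibers[OF S(1)])
    fix w assume "w \<in> W ` S"
    define F where "F = {j\<in>S. W j = w}"
    have same: "k j = k j'" if "j \<in> F" "j' \<in> F" for j j'
    proof (rule ccontr)
      assume "k j \<noteq> k j'"
      then have "1 / (2 * real B) \<le> \<bar>W j - W j'\<bar>" using that by (intro sepW) (auto simp: F_def)
      then show False using that Bpos by (simp add: F_def)
    qed
    have "real (card (real ` F)) \<le> (H / a) / 1 + 1"
    proof (rule card_separated)
      show "finite (real ` F)" using S by (simp add: F_def)
      fix s t assume st: "s \<in> real ` F" "t \<in> real ` F"
      then obtain j j' where j: "s = real j" "t = real j'" "j \<in> F" "j' \<in> F" by auto
      show "1 \<le> \<bar>s - t\<bar>" if "s \<noteq> t" using that j by auto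
      show "t - s \<le> H / a" if "s < t"
      proof -
        have "V (X j') - V (X j) = bs (int j') x - bs (int j) x" using k(2)[of j] k(2)[of j'] same[OF j(3,4)] by simp
        moreover have "V (X j') \<le> H" using g[OF X01 S(3)] j(4) by (auto simp: F_def)
        moreover have "0 \<le> V (X j)" using V_range by blast
        ultimately have "bs (int j') x - bs (int j) x \<le> H" by linarith
        moreover have "a * real_of_int (int j' - int j) \<le> bs (int j') x - bs (int j) x"
          using that j by (intro bs_mono_diff) auto
        ultimately have "a * (t - s) \<le> H" using j by simp
        then show ?thesis using a_pos by (simp add: field_simps)
      qed
    qed (use H a_pos in auto)
    then show "real (card {j\<in>S. W j = w}) \<le> H / a + 1"
      by (simp add: F_def card_image)
  qed
  also have "\<dots> \<le> (H / a + 1) * (8 * sqrt (4800 * \<epsilon> / \<kappa>\<^sub>0) * real B + 16 * Cf * Kmax / \<kappa>\<^sub>0)"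
    using cA H a_pos unfolding A_def by (intro mult_left_mono) auto
  finally show ?thesis using cS by linarith
qed

end

lemma ln_square_small:
  fixes c1 c2 k :: real
  assumes k: "0 < k"
  shows "\<exists>B0. \<forall>B\<ge>B0. (c1 + c2 * ln B)\<^sup>2 \<le> k * B"
proof -
  have l: "((\<lambda>x::real. ln x ^ n / x) \<longlongrightarrow> 0) at_top" for n :: nat
  proof -
    have "((\<lambda>x::real. ln x ^ n / exp (ln x)) \<longlongrightarrow> 0) at_top"
      by (rule filterlim_compose[OF tendsto_power_div_exp_0 ln_at_top])
    moreover have "eventually (\<lambda>x::real. ln x ^ n / exp (ln x) = ln x ^ n / x) at_top"
      using eventually_gt_at_top[of 0] by eventually_elim simp
    ultimately show ?thesis by (rule Lim_transform_eventually)
  qed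
  have "((\<lambda>x. c1\<^sup>2 * (ln x ^ 0 / x) + 2 * c1 * c2 * (ln x ^ 1 / x) + c2\<^sup>2 * (ln x ^ 2 / x)) \<longlongrightarrow>
      c1\<^sup>2 * 0 + 2 * c1 * c2 * 0 + c2\<^sup>2 * 0) at_top"
    by (intro tendsto_add tendsto_mult tendsto_const l)
  then have "eventually (\<lambda>x. c1\<^sup>2 * (ln x ^ 0 / x) + 2 * c1 * c2 * (ln x ^ 1 / x) + c2\<^sup>2 * (ln x ^ 2 / x) < k) at_top"
    using k by (intro order_tendstoD(2)) auto
  then have "eventually (\<lambda>x. (c1 + c2 * ln x)\<^sup>2 \<le> k * x) at_top"
    using eventually_gt_at_top[of 0]
  proof eventually_elim
    case (elim x)
    have "c1\<^sup>2 * (ln x ^ 0 / x) + 2 * c1 * c2 * (ln x ^ 1 / x) + c2\<^sup>2 * (ln x ^ 2 / x) = (c1 + c2 * ln x)\<^sup>2 / x"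
      using elim by (simp add: power2_eq_square field_simps)
    then show ?case using elim by (simp add: field_simps)
  qed
  then show ?thesis by (auto simp: eventually_at_top_linorder)
qed

section \<open>Regular points and the smallness of discrepancies\<close>

context arnold_roof_flow
begin

lemma q_mult_alpha: "of_int (int (q n)) * \<alpha> = err n + of_int (int (p n))"
  by (simp add: cf_err_def)

lemma bs_add_q: "bs m (x + of_int (int (q n)) * \<alpha>) = bs m (x + err n)"
proof -
  have "frac (x + of_int (int (q n)) * \<alpha>) = frac (x + err n)"
    unfolding q_mult_alpha using frac_add_of_int_right[of "x + err n" "int (p n)"] by (simp add: add.assoc)
  then show ?thesis by (metis bs_frac)
qed

lemma pt_q: "pt x (int (q n)) = frac (x + err n)"
  unfolding pt_def q_mult_alpha using frac_add_of_int_right[of "x + err n" "int (p n)"] by (simp add: add.assoc)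

text \<open>A point that is typical at scale \<open>J\<close>, off the exceptional set of
  \<open>mostly_KS\<close>.\<close>

definition regular :: "real \<Rightarrow> nat \<Rightarrow> real \<Rightarrow> bool" where
  "regular \<eta> J x \<longleftrightarrow> (\<forall>j. \<bar>j\<bar> \<le> int J \<longrightarrow> \<eta> / (12 * J) \<le> pt x j \<and> \<eta> / (12 * J) \<le> 1 - pt x j) \<and>
    KS {- int J..int J} x \<le> 12 * J * ln (12 * J / \<eta>) / \<eta>"

lemma mostly_regular: "1 \<le> J \<Longrightarrow> 0 < \<eta> \<Longrightarrow> \<eta> \<le> 1 \<Longrightarrow> mostly \<eta> (regular \<eta> J)"
  using mostly_KS[of J \<eta>] by (simp add: regular_def[abs_def])

lemma regular_KS:
  assumes "regular \<eta> J x" "1 \<le> J" "0 < \<eta>"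
  shows "KS {- int J..int J} x \<le> 144 * (real J)\<^sup>2 / \<eta>\<^sup>2"
proof -
  have "ln (12 * J / \<eta>) \<le> 12 * J / \<eta>" using assms by (intro ln_bound) auto
  then have "12 * J * ln (12 * J / \<eta>) / \<eta> \<le> 12 * J * (12 * J / \<eta>) / \<eta>"
    using assms by (intro divide_right_mono mult_left_mono) auto
  also have "\<dots> = 144 * (real J)\<^sup>2 / \<eta>\<^sup>2" by (simp add: power2_eq_square)
  finally show ?thesis using assms(1) by (simp add: regular_def)
qed

lemma regular_slow:
  assumes r: "regular \<eta> J x" and J: "1 \<le> J" and \<eta>: "0 < \<eta>" and m: "\<bar>m\<bar> \<le> int J"
    and t: "\<bar>t\<bar> \<le> \<eta> / (24 * J)"
  shows "\<bar>bs m (x + t) - bs m x\<bar> \<le> 2 * Cf * (12 * J * ln (12 * J / \<eta>) / \<eta>) * \<bar>t\<bar>"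
proof -
  have "\<bar>bs m (x + t) - bs m x\<bar> \<le> 2 * Cf * KS {- int J..int J} x * \<bar>t\<bar>"
  proof (rule bs_close[OF m])
    show "\<eta> / (12 * J) \<le> pt x j \<and> \<eta> / (12 * J) \<le> 1 - pt x j" if "\<bar>j\<bar> \<le> int J" for j
      using r that by (simp add: regular_def)
    show "\<bar>t\<bar> \<le> \<eta> / (12 * J) / 2" using t by simp
    show "0 < \<eta> / (12 * J)" using J \<eta> by simp
  qed
  also have "\<dots> \<le> 2 * Cf * (12 * J * ln (12 * J / \<eta>) / \<eta>) * \<bar>t\<bar>"
    using r Cf_pos by (intro mult_right_mono mult_left_mono) (auto simp: regular_def)
  finally show ?thesis by simp
qed

end

context base_map
begin

lemma Cg_ge_1: "1 \<le> Cg"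
proof -
  have "1 \<le> real (q (Suc 0))" using q_pos[of "Suc 0"] by simp
  also have "\<dots> \<le> Cg * (real (q 0))\<^sup>2" by (rule growth)
  finally show ?thesis by simp
qed

lemma C4_nonneg: "0 \<le> C4"
  using Cf_pos am_pos ap_nonneg G_nonneg by (simp add: C4_def)

text \<open>The length \<open>B = q (Suc l)\<close> has to meet two opposite demands. A displacement
  by \<open>err n\<close> must hardly change sums of length \<open>B\<close>, which
  \<open>B ^ 4 \<le> q n\<close> ensures; and \<open>ln (q n)\<close>, which governs the size of
  discrepancies, must be comparable to \<open>ln B\<close>. For the largest \<open>l\<close> meeting
  the first demand, \<open>growth\<close> turns the exponent 4 into 8 in the second.\<close>

lemma intermediate_scale:
  "\<exists>n0. \<forall>n\<ge>n0. \<exists>l. C \<le> real (q (Suc l)) \<and> real (q (Suc l)) ^ 4 \<le> real (q n) \<and> real (q n) \<le> Cg ^ 4 * real (q (Suc l)) ^ 8"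
proof -
  obtain n0 :: nat where n0: "real n0 \<ge> max (Cg ^ 4 * \<bar>C\<bar> ^ 8) (real (q (Suc 0)) ^ 4)"
    using real_arch_simple by blast
  show ?thesis
  proof (rule exI[of _ n0], intro allI impI)
    fix n assume "n0 \<le> n"
    then have "real n0 \<le> real (q n)" using q_ge[of n] by simp
    then have Q: "Cg ^ 4 * \<bar>C\<bar> ^ 8 \<le> q n" "real (q (Suc 0)) ^ 4 \<le> q n" using n0 by auto
    define S where "S = {l. real (q (Suc l)) ^ 4 \<le> real (q n)}"
    have "S \<subseteq> {..q n}"
    proof
      fix l assume "l \<in> S"
      then have "real (q (Suc l)) ^ 4 \<le> real (q n)" by (simp add: S_def)
      moreover have "real (q (Suc l)) \<le> real (q (Suc l)) ^ 4" using q_pos[of "Suc l"] by (intro self_le_power) auto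
      ultimately have "q (Suc l) \<le> q n" by linarith
      then show "l \<in> {..q n}" using q_ge[of "Suc l"] by simp
    qed
    then have fin: "finite S" using finite_subset by blast
    have "0 \<in> S" using Q(2) unfolding S_def by blast
    then have ne: "S \<noteq> {}" by blast
    define l where "l = Max S"
    have l: "l \<in> S" using fin ne by (simp add: l_def)
    have "Suc l \<notin> S" using Max_ge[OF fin, of "Suc l"] unfolding l_def by (metis Suc_n_not_le_n)
    then have "real (q n) < real (q (Suc (Suc l))) ^ 4" by (simp add: S_def del: cf_denom.simps)
    also have "\<dots> \<le> (Cg * (real (q (Suc l)))\<^sup>2) ^ 4" by (intro power_mono growth) simp
    also have "\<dots> = Cg ^ 4 * real (q (Suc l)) ^ 8" by (simp add: power_mult_distrib flip: power_mult)
    finally have u: "real (q n) < Cg ^ 4 * real (q (Suc l)) ^ 8" .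
    have "C \<le> real (q (Suc l))"
    proof (rule ccontr)
      assume "\<not> ?thesis"
      then have "real (q (Suc l)) ^ 8 \<le> \<bar>C\<bar> ^ 8" by (intro power_mono) auto
      then have "Cg ^ 4 * real (q (Suc l)) ^ 8 \<le> Cg ^ 4 * \<bar>C\<bar> ^ 8" using Cg_ge_1 by (intro mult_left_mono) auto
      then show False using u Q by linarith
    qed
    then show "\<exists>l. C \<le> real (q (Suc l)) \<and> real (q (Suc l)) ^ 4 \<le> real (q n) \<and> real (q n) \<le> Cg ^ 4 * real (q (Suc l)) ^ 8"
      using l u by (intro exI[of _ l]) (auto simp: S_def)
  qed
qed

lemma mostly_far:
  assumes "2 \<le> q n"
  shows "mostly (2 / real (q n)) (\<lambda>x. \<forall>j. 0 \<le> j \<longrightarrow> j < int (q n) \<longrightarrow> 1 / (q n)\<^sup>2 \<le> pt x j \<and> 1 / (q n)\<^sup>2 \<le> 1 - pt x j)"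
proof -
  define d where "d = 1 / (real (q n))\<^sup>2"
  have "4 \<le> (real (q n))\<^sup>2" using power_mono[of 2 "real (q n)" 2] assms by simp
  then have d: "0 < d" "d \<le> 1/2" using frac_le[of 1 1 2 "(real (q n))\<^sup>2"] assms by (auto simp: d_def)
  have "mostly (\<Sum>j\<in>{0..<int (q n)}. 2 * d) (\<lambda>x. \<forall>j\<in>{0..<int (q n)}. d \<le> pt x j \<and> d \<le> 1 - pt x j)"
    unfolding pt_def using mostly_rotation[OF mostly_far_from_ends[OF d]] by (intro mostly_finite) auto
  then show ?thesis by (rule mostly_mono) (use assms in \<open>auto simp: d_def power2_eq_square\<close>)
qed

text \<open>Otherwise \<open>small_discrepancy_core\<close> would bound half of \<open>B'\<close>, a
  fixed proportion of \<open>B\<close>, by a small multiple of \<open>B\<close>. The competing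
  lengths up to \<open>E\<close> are only logarithmic in \<open>B\<close>, so the term with
  \<open>Kmax\<close> is small against \<open>B\<close> as well.\<close>

theorem small_discrepancy:
  assumes \<epsilon>: "0 < \<epsilon>" and \<eta>: "0 < \<eta>"
  shows "\<exists>n0. \<forall>n\<ge>n0. mostly \<eta> (\<lambda>x. \<bar>disc (int (q n)) x\<bar> \<le> \<epsilon>)"
proof -
  \<comment> \<open>The radius 2 exceeds the diameter of \<open>{0..<1}\<close>: all pairs of points
    are compared, since all sums are close to the single number \<open>disc Q x\<close>.\<close>
  obtain e1 where sparse: "sparse_threshold 2 e1"
    using sparse_orbit[of 2] by auto
  \<comment> \<open>The exceptional sets add up to \<open>18 * \<theta>\<close>: seven in
    \<open>good\<close>, doubled by averaging over the orbit, and four at \<open>x\<close>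
    itself.\<close>
  define \<theta> where "\<theta> = min \<eta> 1 / 64"
  have th: "0 < \<theta>" "\<theta> \<le> 1" "18 * \<theta> \<le> \<eta>" using \<eta> by (auto simp: \<theta>_def)
  obtain H where H: "0 < H" "mostly \<theta> (\<lambda>x. V x \<le> H)" using mostly_V[OF th(1)] by blast
  \<comment> \<open>The orbit of \<open>x\<close> is followed for about \<open>c * B\<close> steps.
    For typical \<open>x\<close> this takes time at most about \<open>a * B / 4\<close>, so
    meanwhile the orbit of \<open>Y x\<close> makes fewer than \<open>B\<close> steps.\<close>
  define c where "c = a * \<theta> / 8"
  have c: "0 < c" using a_pos th by (simp add: c_def)
  have Ha: "1 \<le> H / a + 1" using H a_pos by simp
  define J0 where "J0 = 2 / a"
  obtain d where d: "0 < d" "\<And>i z :: int. i \<noteq> 0 \<Longrightarrow> real_of_int \<bar>i\<bar> \<le> max (real e1) J0 \<Longrightarrow> d \<le> \<bar>of_int i * \<alpha> - of_int z\<bar>"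
    using int_multiples_apart[of "max (real e1) J0"] by blast
  \<comment> \<open>\<open>s\<close> and, below, \<open>k'\<close> make each of the two terms of the
    count at most \<open>c / 16 * B\<close>, against at least \<open>c / 4 * B\<close> on the other
    side.\<close>
  define s where "s = \<kappa>\<^sub>0 * (c / (128 * (H / a + 1)))\<^sup>2 / 4800"
  have s: "0 < s" using \<kappa>\<^sub>0_pos c Ha by (simp add: s_def)
  define \<epsilon>' where "\<epsilon>' = min (\<epsilon> / 4) (min (1 / 12) (min (d / 5) s))"
  have e': "0 < \<epsilon>'" "4 * \<epsilon>' \<le> \<epsilon>" "\<epsilon>' \<le> 1 / 12" "4 * \<epsilon>' < d" "\<epsilon>' \<le> s"
    using \<epsilon> d s by (auto simp: \<epsilon>'_def min_def)
  have sq: "(H / a + 1) * (8 * sqrt (4800 * \<epsilon>' / \<kappa>\<^sub>0)) \<le> c / 16"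
  proof -
    have "4800 * \<epsilon>' / \<kappa>\<^sub>0 \<le> 4800 * s / \<kappa>\<^sub>0" using e' \<kappa>\<^sub>0_pos by (intro divide_right_mono) auto
    also have "\<dots> = (c / (128 * (H / a + 1)))\<^sup>2" using \<kappa>\<^sub>0_pos by (simp add: s_def)
    finally have "sqrt (4800 * \<epsilon>' / \<kappa>\<^sub>0) \<le> c / (128 * (H / a + 1))"
      using c Ha by (intro real_le_lsqrt) auto
    then have "(H / a + 1) * (8 * sqrt (4800 * \<epsilon>' / \<kappa>\<^sub>0)) \<le> (H / a + 1) * (8 * (c / (128 * (H / a + 1))))"
      using Ha by (intro mult_left_mono) auto
    also have "\<dots> = c / 16"
    proof -
      have "h * (8 * (c / (128 * h))) = c / 16" if "1 \<le> h" for h :: real using that by (simp add: field_simps)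
      then show ?thesis using Ha by blast
    qed
    finally show ?thesis .
  qed
  define k' where "k' = c * \<kappa>\<^sub>0 / (256 * Cf * (H / a + 1))"
  have k': "0 < k'" using c \<kappa>\<^sub>0_pos Cf_pos Ha by (simp add: k'_def)
  have k'eq: "(H / a + 1) * (16 * Cf * k' / \<kappa>\<^sub>0) = c / 16"
  proof -
    have "h * (16 * Cf * (c * \<kappa>\<^sub>0 / (256 * Cf * h)) / \<kappa>\<^sub>0) = c / 16" if "1 \<le> h" for h :: real
      using that Cf_pos \<kappa>\<^sub>0_pos by (simp add: field_simps)
    then show ?thesis using Ha unfolding k'_def by blast
  qed
  obtain \<kappa> where ka: "0 < \<kappa>" "\<kappa> \<le> 1" "\<And>P. mostly \<kappa> P \<Longrightarrow> mostly \<theta> (\<lambda>x. P (Y x))"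
    using mostly_Y[OF th(1)] by blast
  obtain r L where r: "0 < r" and L: "mostly \<theta> L" and LYV: "\<And>x y. 0 \<le> x \<Longrightarrow> x < 1 \<Longrightarrow> 0 \<le> y \<Longrightarrow> y < 1 \<Longrightarrow> L x \<Longrightarrow> L y \<Longrightarrow> \<bar>x - y\<bar> < r \<Longrightarrow>
    \<bar>Y x - Y y\<bar> < \<epsilon>' \<and> \<bar>V x - V y\<bar> < \<epsilon>'"
    using almost_uniform_YV[OF e'(1) th(1)] by auto
  \<comment> \<open>\<open>E\<close> is \<open>Dmax / a\<close> up to a constant, and
    \<open>Dmax\<close> is logarithmic in \<open>q n\<close>; the upper bound
    \<open>Cg ^ 4 * B ^ 8\<close> for \<open>q n\<close> turns this into
    \<open>c1 + c2 * ln B\<close>.\<close>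
  define c1 where "c1 = (C4 * (ln (Cg ^ 4) + 1) + 1) / a + 2"
  define c2 where "c2 = 8 * C4 / a"
  obtain B0 where B0: "\<And>B. B0 \<le> B \<Longrightarrow> (c1 + c2 * ln B)\<^sup>2 \<le> (k' * \<kappa>\<^sup>2 / 144) * B"
    using ln_square_small[of "k' * \<kappa>\<^sup>2 / 144" c1 c2] k' ka by auto
  define \<theta>' where "\<theta>' = min \<theta> \<kappa>"
  have th': "0 < \<theta>'" "\<theta>' \<le> \<theta>" "\<theta>' \<le> \<kappa>" "\<theta>' \<le> 1" using th ka by (auto simp: \<theta>'_def)
  define BB where "BB = max B0 (max (3 * (1 / \<theta> + H) / a) (max (2 / c) (max (288 * Cf / (\<theta>'\<^sup>2 * \<epsilon>'))
     (max (24 / \<theta>') (max (4 / \<theta>') (max (2 / r) (max (1 / \<epsilon>') 6)))))))"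
  obtain n0 where n0: "\<And>n. n0 \<le> n \<Longrightarrow> \<exists>l. BB \<le> real (q (Suc l)) \<and> real (q (Suc l)) ^ 4 \<le> real (q n) \<and> real (q n) \<le> Cg ^ 4 * real (q (Suc l)) ^ 8"
    using intermediate_scale[of BB] by blast
  show ?thesis
  proof (intro exI[of _ n0] allI impI)
    fix n assume "n0 \<le> n"
    then obtain l where l: "BB \<le> real (q (Suc l))" "real (q (Suc l)) ^ 4 \<le> real (q n)" "real (q n) \<le> Cg ^ 4 * real (q (Suc l)) ^ 8"
      using n0 by blast
    define B where "B = q (Suc l)"
    define Q where "Q = q n"
    note l' = l[folded B_def Q_def]
    have BB: "B0 \<le> B" "3 * (1 / \<theta> + H) / a \<le> B" "2 / c \<le> B" "288 * Cf / (\<theta>'\<^sup>2 * \<epsilon>') \<le> B" "24 / \<theta>' \<le> B"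
      "4 / \<theta>' \<le> B" "2 / r \<le> B" "1 / \<epsilon>' \<le> B" "6 \<le> real B"
      using l'(1) unfolding BB_def max.bounded_iff by blast+
    have Bp: "0 < real B" using BB by linarith
    have B2: "(real B)\<^sup>2 \<le> real B ^ 4" using BB by (intro power_increasing) auto
    have B1: "real B \<le> (real B)\<^sup>2" using BB by (simp add: power2_eq_square)
    have BQ: "(real B)\<^sup>2 \<le> Q" "real B \<le> Q" using B1 B2 l' by linarith+
    have errQ: "\<bar>err n\<bar> \<le> 1 / real Q"
    proof -
      have "1 / real (q (Suc n)) \<le> 1 / real Q" using q_Suc_ge[of n] q_pos[of n] by (simp add: Q_def frac_le)
      then show ?thesis using err_le[of n] by linarith
    qed
    have errB: "\<bar>err n\<bar> \<le> 1 / real B"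
      using errQ frac_le[of 1 1 "real B" "real Q"] BQ Bp by linarith
    have errB4: "\<bar>err n\<bar> \<le> 1 / real B ^ 4"
      using errQ frac_le[of 1 1 "real B ^ 4" "real Q"] l'(2) zero_less_power[OF Bp, of 4] by linarith
    have errs: "2 * \<bar>err n\<bar> < r" "\<bar>err n\<bar> \<le> \<epsilon>'" "4 * \<bar>err n\<bar> \<le> \<theta>" "2 * \<bar>err n\<bar> \<le> 1 / 2"
    proof -
      have "2 / real B \<le> r" "1 / real B \<le> \<epsilon>'" "4 / real B \<le> \<theta>'"
        using BB Bp r e' th' by (auto simp: field_simps)
      moreover have "1 / real B \<le> 1/6" using BB by (simp add: field_simps)
      moreover have "\<bar>err n\<bar> < 1 / real B"
      proof -
        have "1 / real Q < 1 / real B"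
        proof -
          have "real B < (real B)\<^sup>2" using BB by (simp add: power2_eq_square)
          then show ?thesis using BQ Bp by (intro divide_strict_left_mono) auto
        qed
        then show ?thesis using errQ by linarith
      qed
      ultimately show "2 * \<bar>err n\<bar> < r" "\<bar>err n\<bar> \<le> \<epsilon>'" "4 * \<bar>err n\<bar> \<le> \<theta>" "2 * \<bar>err n\<bar> \<le> 1 / 2"
        using th' by auto
    qed
    have e0: "0 < \<bar>err n\<bar>" using err_nz by simp
    define B' where "B' = nat \<lfloor>c * B\<rfloor>"
    have B': "real B' \<le> c * B" "c * B - 1 \<le> real B'" "2 \<le> c * B"
    proof -
      have "0 \<le> c * B" using c by simp
      then show "real B' \<le> c * B" "c * B - 1 \<le> real B'" unfolding B'_def by linarith+
      show "2 \<le> c * B" using BB c by (simp add: field_simps)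
    qed
    have B'B: "B' \<le> B"
    proof -
      have "c \<le> 1"
      proof -
        have "a * \<theta> / 8 \<le> 1"
        proof -
          have "ennreal a \<le> (\<integral>\<^sup>+x. ennreal a \<partial>circle)" by (simp add: emeasure_circle_UNIV)
          also have "\<dots> \<le> (\<integral>\<^sup>+x. ennreal (f (frac x)) \<partial>circle)"
            using f_ge by (intro nn_integral_mono ennreal_leI) (auto simp: frac_lt_1)
          finally have "a \<le> 1" using f_int by (simp add: ennreal_le_1)
          then have "a * \<theta> \<le> 1 * 1" using th a_pos by (intro mult_mono) auto
          then show ?thesis by simp
        qed
        then show ?thesis by (simp add: c_def)
      qed
      then have "c * B \<le> 1 * real B" by (intro mult_right_mono) auto
      then show ?thesis using B' by simp
    qed
    define Dmax where "Dmax = C4 * (ln Q + 1)"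
    define E where "E = nat \<lceil>(Dmax + 1) / a\<rceil> + 1"
    have lnQ: "0 \<le> ln (real Q)" using BQ BB by simp
    have Dm: "0 \<le> Dmax" using C4_nonneg lnQ by (simp add: Dmax_def)
    have E1: "1 \<le> E" by (simp add: E_def)
    have Ele: "(Dmax + 1) / a \<le> E" "real E \<le> (Dmax + 1) / a + 2"
    proof -
      have "0 \<le> (Dmax + 1) / a" using Dm a_pos by simp
      then show "(Dmax + 1) / a \<le> E" "real E \<le> (Dmax + 1) / a + 2" unfolding E_def by linarith+
    qed
    have Ec: "real E \<le> c1 + c2 * ln B"
    proof -
      have "ln (real Q) \<le> ln (Cg ^ 4 * real B ^ 8)" using l'(3) BQ BB by simp
      also have "\<dots> = ln (Cg ^ 4) + 8 * ln B" using Cg_ge_1 Bp by (simp add: ln_mult ln_realpow)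
      finally have "C4 * (ln Q + 1) \<le> C4 * (ln (Cg ^ 4) + 8 * ln B + 1)" using C4_nonneg by (intro mult_left_mono) auto
      then have "(Dmax + 1) / a + 2 \<le> (C4 * (ln (Cg ^ 4) + 8 * ln B + 1) + 1) / a + 2"
        using a_pos by (simp add: Dmax_def divide_right_mono)
      also have "\<dots> = c1 + c2 * ln B" using a_pos by (simp add: c1_def c2_def field_simps)
      finally show ?thesis using Ele by linarith
    qed
    have KSE: "144 * (real E)\<^sup>2 / \<kappa>\<^sup>2 \<le> k' * B"
    proof -
      have "(real E)\<^sup>2 \<le> (c1 + c2 * ln B)\<^sup>2" using Ec by (intro power_mono) auto
      also have "\<dots> \<le> (k' * \<kappa>\<^sup>2 / 144) * B" by (rule B0) (rule BB)
      finally show ?thesis using ka by (simp add: field_simps)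
    qed
    define far where "far z \<longleftrightarrow> (\<forall>j. 0 \<le> j \<longrightarrow> j < int (q n) \<longrightarrow> 1 / (q n)\<^sup>2 \<le> pt z j \<and> 1 / (q n)\<^sup>2 \<le> 1 - pt z j)" for z
    have Q2: "2 / real (q n) \<le> \<theta>'"
    proof -
      have "2 / real Q \<le> 4 / real B" using BQ Bp by (intro frac_le) auto
      also have "\<dots> \<le> \<theta>'" using BB Bp th' by (simp add: field_simps)
      finally show ?thesis by (simp add: Q_def)
    qed
    have far: "mostly \<theta>' far" unfolding far_def[abs_def]
      by (rule mostly_mono[OF mostly_far]) (use BQ BB Q2 in \<open>auto simp: Q_def\<close>)
    define good where "good z \<longleftrightarrow> equivariant z \<and> L z \<and> L (frac (z + of_int (int Q) * \<alpha>)) \<and> (2 * \<bar>err n\<bar> \<le> z \<and> 2 * \<bar>err n\<bar> \<le> 1 - z) \<and>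
       V z \<le> H \<and> far z \<and> far (Y z) \<and> regular \<kappa> E (frac (Y z + of_int (int Q) * \<alpha>))" for z
    have "mostly (0 + (\<theta> + (\<theta> + (\<theta> + (\<theta> + (\<theta> + (\<theta> + \<theta>))))))) good"
      unfolding good_def
    proof (intro mostly_conj)
      show "mostly \<theta> (\<lambda>z. 2 * \<bar>err n\<bar> \<le> z \<and> 2 * \<bar>err n\<bar> \<le> 1 - z)"
        by (rule mostly_mono[OF mostly_far_from_ends]) (use errs e0 in auto)
      show "mostly \<theta> (\<lambda>z. far z)" by (rule mostly_mono[OF far]) (use th' in auto)
      show "mostly \<theta> (\<lambda>z. far (Y z))" by (rule ka(3), rule mostly_mono[OF far]) (use th' in auto)
      show "mostly \<theta> (\<lambda>z. regular \<kappa> E (frac (Y z + of_int (int Q) * \<alpha>)))"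
        by (rule ka(3), rule mostly_rotation, rule mostly_regular) (use E1 ka in auto)
    qed (use mostly_equivariant L mostly_rotation[OF L] H in auto)
    then have good: "mostly (7 * \<theta>) good" by (rule mostly_mono) auto
    have "mostly (7 * \<theta> * 2) (\<lambda>x. real (card {j\<in>{..<B'}. \<not> good (frac (x + real j * \<alpha>))}) \<le> real B' / 2)"
      by (rule mostly_orbit_average[OF good]) simp
    moreover have "mostly \<theta> (\<lambda>x. \<forall>i. \<bar>i\<bar> \<le> int B' \<longrightarrow> \<bar>bs i x\<bar> \<le> (2 * real B' + 1) / \<theta>)"
      by (rule mostly_bs_range[OF th(1)])
    moreover have "mostly \<theta> (regular \<theta>' B)"
      by (rule mostly_mono[OF mostly_regular]) (use BB th' in auto)
    moreover have "mostly \<theta> (\<lambda>x. regular \<theta>' B (Y x))"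
      by (rule ka(3), rule mostly_mono[OF mostly_regular]) (use BB th' in auto)
    ultimately have "mostly (0 + (7 * \<theta> * 2 + (\<theta> + (\<theta> + (\<theta> + \<theta>))))) (\<lambda>x. equivariant x \<and>
       real (card {j\<in>{..<B'}. \<not> good (frac (x + real j * \<alpha>))}) \<le> real B' / 2 \<and>
       (\<forall>i. \<bar>i\<bar> \<le> int B' \<longrightarrow> \<bar>bs i x\<bar> \<le> (2 * real B' + 1) / \<theta>) \<and> V x \<le> H \<and> regular \<theta>' B x \<and> regular \<theta>' B (Y x))"
      using H mostly_equivariant by (intro mostly_conj) auto
    then show "mostly \<eta> (\<lambda>x. \<bar>disc (int (q n)) x\<bar> \<le> \<epsilon>)"
    proof (rule mostly_mono)
      show "0 + (7 * \<theta> * 2 + (\<theta> + (\<theta> + (\<theta> + \<theta>)))) \<le> \<eta>" using th by simp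
      fix x assume x01: "0 \<le> x" "x < 1" and x: "equivariant x \<and>
       real (card {j\<in>{..<B'}. \<not> good (frac (x + real j * \<alpha>))}) \<le> real B' / 2 \<and>
       (\<forall>i. \<bar>i\<bar> \<le> int B' \<longrightarrow> \<bar>bs i x\<bar> \<le> (2 * real B' + 1) / \<theta>) \<and> V x \<le> H \<and> regular \<theta>' B x \<and> regular \<theta>' B (Y x)"
      have slow: "\<bar>bs j (z + of_int (int Q) * \<alpha>) - bs j z\<bar> \<le> \<epsilon>'" if z: "regular \<theta>' B z" and j: "\<bar>j\<bar> \<le> int B" for z j
      proof -
        have t: "\<bar>err n\<bar> \<le> \<theta>' / (24 * B)"
        proof -
          have "1 / (real B)\<^sup>2 \<le> \<theta>' / (24 * B)" using BB(5) Bp th' by (simp add: field_simps power2_eq_square)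
          moreover have "1 / real B ^ 4 \<le> 1 / (real B)\<^sup>2" using B2 Bp by (intro divide_left_mono) auto
          ultimately show ?thesis using errB4 by linarith
        qed
        have B_1: "1 \<le> B" using BB by linarith
        have "\<bar>bs j (z + err n) - bs j z\<bar> \<le> 2 * Cf * (12 * B * ln (12 * B / \<theta>') / \<theta>') * \<bar>err n\<bar>"
          using regular_slow[OF z B_1 th'(1) j t] by simp
        also have "\<dots> \<le> 2 * Cf * (12 * B * (12 * B / \<theta>') / \<theta>') * (1 / real B ^ 4)"
        proof (intro mult_mono divide_right_mono mult_left_mono)
          show "ln (12 * B / \<theta>') \<le> 12 * B / \<theta>'" using Bp th' by (intro ln_bound) auto
        qed (use errB4 Cf_pos th' Bp in auto)
        also have "\<dots> = 288 * Cf / (\<theta>'\<^sup>2 * (real B)\<^sup>2)" using Bp by (simp add: field_simps power2_eq_square power4_eq_xxxx)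
        also have "\<dots> \<le> 288 * Cf / (\<theta>'\<^sup>2 * real B)" using B1 Bp th' Cf_pos by (intro divide_left_mono mult_left_mono) auto
        also have "\<dots> \<le> \<epsilon>'" using BB(4) Bp th' e' by (simp add: field_simps)
        finally show ?thesis unfolding Q_def bs_add_q .
      qed
      show "\<bar>disc (int (q n)) x\<bar> \<le> \<epsilon>"
      proof (rule ccontr)
        assume "\<not> ?thesis"
        then have big: "4 * \<epsilon>' < \<bar>disc (int Q) x\<bar>" using e' by (simp add: Q_def)
        have "real B' / 2 \<le> (H / a + 1) * (8 * sqrt (4800 * \<epsilon>' / \<kappa>\<^sub>0) * real B + 16 * Cf * (k' * B) / \<kappa>\<^sub>0)"
        proof (rule small_discrepancy_core[where x = x and B' = B' and good = good and Q = "int Q" and \<epsilon> = \<epsilon>'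
              and Dmax = Dmax and E = "int E" and pQ = "int (p n)" and l = l, OF sparse])
          show "equivariant x" using x by blast
          show "bs (int B') x + V x < a * real B"
          proof -
            have "bs (int B') x \<le> (2 * real B' + 1) / \<theta>" using x by (auto simp: abs_le_iff)
            also have "\<dots> \<le> (2 * (c * B) + 1) / \<theta>" using B' th by (intro divide_right_mono) auto
            also have "\<dots> = a * B / 4 + 1 / \<theta>" using th by (simp add: c_def field_simps)
            finally have 1: "bs (int B') x \<le> a * B / 4 + 1 / \<theta>" .
            have "3 * (1 / \<theta> + H) \<le> a * B" using BB(2) a_pos by (simp add: field_simps)
            moreover have "0 < a * B" using a_pos Bp by simp
            moreover have "v + w < t" if "v \<le> t / 4 + u" "3 * (u + h) \<le> t" "w \<le> h" "0 < t" for t u v w h :: real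
            proof -
              have "3 * u + 3 * h \<le> t" using that by simp
              then show ?thesis using that by linarith
            qed
            ultimately show ?thesis using 1 x by blast
          qed
          show "B = q (Suc l)" by (simp add: B_def)
          fix z assume z: "0 \<le> z" "z < 1" "good z"
          have pz: "pt z (int Q) = z + err n"
          proof -
            have "frac (z + err n) = z + err n" using z e0 by (auto simp: good_def frac_eq abs_if split: if_splits)
            then show ?thesis by (simp add: Q_def pt_q)
          qed
          have "\<bar>Y (pt z (int Q)) - Y z\<bar> < \<epsilon>' \<and> \<bar>V (pt z (int Q)) - V z\<bar> < \<epsilon>'"
          proof (rule LYV)
            show "L (pt z (int Q))" using z unfolding good_def pt_def by blast
            show "\<bar>pt z (int Q) - z\<bar> < r" using pz errs by simp
          qed (use z in \<open>auto simp: pt_range good_def\<close>)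
          moreover have "\<bar>disc (int Q) z\<bar> \<le> Dmax"
            unfolding disc_def Dmax_def Q_def
            by (rule bs_diff_log) (use z BQ BB in \<open>auto simp: good_def far_def Q_def\<close>)
          moreover have reg: "regular \<kappa> E (pt (Y z) (int Q))" using z unfolding good_def pt_def by blast
          moreover have "0 < pt (pt (Y z) (int Q)) j" if "\<bar>j\<bar> \<le> int E" for j
          proof -
            have "\<kappa> / (12 * E) \<le> pt (pt (Y z) (int Q)) j" using reg that by (simp add: regular_def)
            moreover have "0 < \<kappa> / (12 * E)" using ka E1 by simp
            ultimately show ?thesis by linarith
          qed
          moreover have "KS {- int E..int E} (pt (Y z) (int Q)) \<le> k' * B"
            using regular_KS[OF reg E1 ka(1)] KSE by linarith
          ultimately show "equivariant z \<and> \<bar>Y (pt z (int Q)) - Y z\<bar> \<le> \<epsilon>' \<and> \<bar>V (pt z (int Q)) - V z\<bar> \<le> \<epsilon>' \<and> V z \<le> H \<and>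
             \<bar>disc (int Q) z\<bar> \<le> Dmax \<and> (\<forall>j. \<bar>j\<bar> \<le> int E \<longrightarrow> 0 < pt (pt (Y z) (int Q)) j) \<and> KS {- int E..int E} (pt (Y z) (int Q)) \<le> k' * B"
            using z unfolding good_def by auto
        next
          fix j assume "0 \<le> j" "j < int B'"
          then show "\<bar>bs j (x + of_int (int Q) * \<alpha>) - bs j x\<bar> \<le> \<epsilon>'" using B'B x by (intro slow) auto
        next
          fix j assume "0 \<le> j" "j < int B"
          then show "\<bar>bs j (Y x + of_int (int Q) * \<alpha>) - bs j (Y x)\<bar> \<le> \<epsilon>'" using x by (intro slow) auto
        next
          show "real (card {j\<in>{..<B'}. \<not> good (pt x (int j))}) \<le> real B' / 2" using x by (simp add: pt_def)
          show "Dmax + \<epsilon>' \<le> a * real_of_int (int E)"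
          proof -
            have "Dmax + 1 \<le> a * E" using Ele(1) a_pos by (simp add: field_simps)
            then show ?thesis using e' by simp
          qed
          show "2 \<le> a * J0" using a_pos by (simp add: J0_def)
          show "\<bar>of_int (int Q) * \<alpha> - of_int (int (p n))\<bar> \<le> \<epsilon>'" unfolding Q_def q_mult_alpha using errs by simp
          fix i z :: int assume "i \<noteq> 0" "\<bar>of_int i * \<alpha> - of_int z\<bar> \<le> 4 * \<epsilon>'"
          then show "max (real e1) J0 \<le> real_of_int \<bar>i\<bar>" using d(2)[of i z] e' by linarith
        qed (use e' k' big H in auto)
        also have "\<dots> = ((H / a + 1) * (8 * sqrt (4800 * \<epsilon>' / \<kappa>\<^sub>0)) + (H / a + 1) * (16 * Cf * k' / \<kappa>\<^sub>0)) * B"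
          by (simp add: algebra_simps add_divide_distrib)
        also have "\<dots> \<le> (c / 16 + c / 16) * B" using sq k'eq by (intro mult_right_mono add_mono) auto
        finally have "real B' / 2 \<le> c * B / 8" by simp
        then show False using B' by linarith
      qed
    qed
  qed
qed

end

section \<open>Matching points across a large gap\<close>

lemma frac_eq_shift: "frac x = frac y \<Longrightarrow> frac (x + t) = frac (y + t)"
  by (metis frac_add_frac)

context arnold_roof_flow
begin

lemma pt_cong: "frac z = frac z' \<Longrightarrow> pt z j = pt z' j"
  by (metis pt_frac)

lemma bs_cong: "frac z = frac z' \<Longrightarrow> bs m z = bs m z'"
  by (metis bs_frac)

text \<open>On an interval free of singularities, base points with nearly equal sums are close,
  whichever of them is on the left.\<close>

lemma free_close:
  assumes q: "4 \<le> q n" and w: "0 < \<omega>" "\<omega> \<le> 1"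
    and good: "\<And>j. 0 \<le> j \<Longrightarrow> j < int (q n) \<Longrightarrow> pt y j = pt z j + (y - z) \<and>
       \<omega> / q n \<le> pt z j \<and> \<omega> / q n \<le> 1 - pt z j \<and> \<omega> / q n \<le> pt y j \<and> \<omega> / q n \<le> 1 - pt y j"
  shows "((am - ap) * q n * ln (q n) - C2 * q n / \<omega>) * \<bar>y - z\<bar> \<le> \<bar>bs (int (q n)) z - bs (int (q n)) y\<bar>"
proof (cases "z \<le> y")
  case True
  have "((am - ap) * q n * ln (q n) - C2 * q n / \<omega>) * (y - z) \<le> bs (int (q n)) z - bs (int (q n)) y"
    by (rule bs_decrease[OF q w True]) (use good in blast)
  then show ?thesis using True by simp
next
  case False
  then have yz: "y \<le> z" by simp
  have "((am - ap) * q n * ln (q n) - C2 * q n / \<omega>) * (z - y) \<le> bs (int (q n)) y - bs (int (q n)) z"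
    by (rule bs_decrease[OF q w yz]) (use good in \<open>force simp: algebra_simps\<close>)
  then show ?thesis using yz by simp
qed

lemma pt_decrease:
  assumes "0 \<le> t" "t \<le> pt y j" shows "pt (y - t) j = pt y j - t"
proof -
  have "frac (y + of_int j * \<alpha> + (- t)) = frac (y + of_int j * \<alpha>) + (- t)"
    using assms pt_range[of y j] by (intro frac_shift) (auto simp: pt_def)
  then show ?thesis by (simp add: pt_def algebra_simps)
qed

lemma pt_increase:
  assumes "0 \<le> t" "pt y j + t < 1" shows "pt (y + t) j = pt y j + t"
proof -
  have "frac (y + of_int j * \<alpha> + t) = frac (y + of_int j * \<alpha>) + t"
    using assms pt_range[of y j] by (intro frac_shift) (auto simp: pt_def)
  then show ?thesis by (simp add: pt_def algebra_simps)
qed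

text \<open>Align the orbit points closest to 0 on its right. Moving \<open>y\<close> left by the
  difference \<open>t\<close> of the two minima puts its closest point onto that of
  \<open>x\<close>, and no orbit point of \<open>y\<close> crosses 0 because \<open>t\<close> is at
  most its own minimum.\<close>

lemma argmin_match_aux:
  fixes x y :: real and Q :: nat
  assumes jx: "0 \<le> jx" "jx < int Q" and jy: "0 \<le> jy" "jy < int Q"
    and min: "\<And>j. 0 \<le> j \<Longrightarrow> j < int Q \<Longrightarrow> pt y jy \<le> pt y j" and le: "pt x jx \<le> pt y jy"
  shows "\<exists>i z. \<bar>i\<bar> < int Q \<and> frac z = frac (x + of_int i * \<alpha>) \<and>
     (\<forall>j. 0 \<le> j \<longrightarrow> j < int Q \<longrightarrow> pt y j = pt z j + (y - z))"
proof (intro exI conjI allI impI)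
  define t where "t = pt y jy - pt x jx"
  have t: "0 \<le> t" "t \<le> pt y jy" using le pt_range[of x jx] by (auto simp: t_def)
  show "\<bar>jx - jy\<bar> < int Q" using jx jy by auto
  have "y - t = x + of_int (jx - jy) * \<alpha> + of_int (\<lfloor>y + of_int jy * \<alpha>\<rfloor> - \<lfloor>x + of_int jx * \<alpha>\<rfloor>)"
    by (simp add: t_def pt_def frac_def algebra_simps)
  then show "frac (y - t) = frac (x + of_int (jx - jy) * \<alpha>)" by (simp only: frac_add_of_int_right)
  fix j assume "0 \<le> j" "j < int Q"
  then show "pt y j = pt (y - t) j + (y - (y - t))"
    using min[of j] t by (subst pt_decrease) auto
qed

lemma argmin_match:
  fixes x y :: real and Q :: nat
  assumes Q: "1 \<le> Q"
  shows "(\<exists>i z. \<bar>i\<bar> < int Q \<and> frac z = frac (x + of_int i * \<alpha>) \<and>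
     (\<forall>j. 0 \<le> j \<longrightarrow> j < int Q \<longrightarrow> pt y j = pt z j + (y - z))) \<or>
    (\<exists>i z. \<bar>i\<bar> < int Q \<and> frac z = frac (y + of_int i * \<alpha>) \<and>
     (\<forall>j. 0 \<le> j \<longrightarrow> j < int Q \<longrightarrow> pt x j = pt z j + (x - z)))"
proof -
  have ex: "\<exists>j0. 0 \<le> j0 \<and> j0 < int Q \<and> (\<forall>j. 0 \<le> j \<longrightarrow> j < int Q \<longrightarrow> pt w j0 \<le> pt w j)" for w
  proof -
    have "finite {0..<int Q}" "{0..<int Q} \<noteq> {}" using Q by auto
    from ex_is_arg_min_if_finite[OF this, of "pt w"]
    obtain j0 where "is_arg_min (pt w) (\<lambda>j. j \<in> {0..<int Q}) j0" by blast
    then show ?thesis by (intro exI[of _ j0]) (auto simp: is_arg_min_linorder)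
  qed
  obtain jx where jx: "0 \<le> jx" "jx < int Q" "\<And>j. 0 \<le> j \<Longrightarrow> j < int Q \<Longrightarrow> pt x jx \<le> pt x j" using ex[of x] by blast
  obtain jy where jy: "0 \<le> jy" "jy < int Q" "\<And>j. 0 \<le> j \<Longrightarrow> j < int Q \<Longrightarrow> pt y jy \<le> pt y j" using ex[of y] by blast
  show ?thesis
  proof (cases "pt x jx \<le> pt y jy")
    case True
    show ?thesis by (rule disjI1, rule argmin_match_aux[OF jx(1,2) jy True])
  next
    case False
    then have le: "pt y jy \<le> pt x jx" by simp
    show ?thesis by (rule disjI2, rule argmin_match_aux[OF jy(1,2) jx le])
  qed
qed

text \<open>If both sides were blocked, one orbit point just right of 0 and another just left of it
  would be closer than \<open>\<bar>err n\<bar>\<close>, against \<open>best_approximation\<close>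
  for index differences below \<open>q (Suc n)\<close>.\<close>

lemma free_side:
  assumes u: "0 \<le> u1" "0 \<le> u2" "u1 + u2 \<le> \<bar>err n\<bar>" and N: "N = q (Suc n)" and e1: "\<bar>err n\<bar> < 1"
  shows "(\<forall>j. 0 \<le> j \<longrightarrow> j < int N \<longrightarrow> pt y j = pt (y - u1) j + u1) \<or>
    (\<forall>j. 0 \<le> j \<longrightarrow> j < int N \<longrightarrow> pt y j = pt (y + u2) j - u2)"
proof (rule ccontr)
  assume c: "\<not> ?thesis"
  then obtain j where j: "0 \<le> j" "j < int N" "pt y j \<noteq> pt (y - u1) j + u1" by blast
  have 1: "pt y j < u1" using pt_decrease[of u1 y j] j u by force
  obtain k where k: "0 \<le> k" "k < int N" "pt y k \<noteq> pt (y + u2) k - u2" using c by blast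
  have 2: "1 \<le> pt y k + u2" using pt_increase[of u2 y k] k u by force
  have jk: "j \<noteq> k" using 1 2 u e1 by auto
  have e: "pt y j - pt y k + 1 = of_int (j - k) * \<alpha> - of_int (\<lfloor>y + of_int j * \<alpha>\<rfloor> - \<lfloor>y + of_int k * \<alpha>\<rfloor> - 1)"
    by (simp add: pt_def frac_def algebra_simps)
  have "\<bar>err n\<bar> \<le> \<bar>pt y j - pt y k + 1\<bar>" unfolding e
    by (rule best_approximation) (use jk j k N in auto)
  moreover have "0 \<le> pt y j - pt y k + 1" using pt_range[of y j] pt_range[of y k] by linarith
  ultimately show False using 1 2 u by linarith
qed

lemma bs_return:
  "bs (int (q n)) (x + of_int i * \<alpha>) = bs (int (q n)) x + (bs i (x + err n) - bs i x)"
  using bs_swap[of "int (q n)" x i] unfolding bs_add_q .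

text \<open>\<open>argmin_match\<close> joins \<open>y\<close> to a point \<open>z\<close> of the
  orbit of \<open>x\<close>, or the reverse, without meeting a singularity. The sums at
  \<open>z\<close> and \<open>x\<close> differ by at most \<open>\<epsilon>\<close> because the
  index is below \<open>q n\<close>; so those at \<open>z\<close> and \<open>y\<close> differ by at
  most \<open>2 * \<epsilon>\<close>, and the slope \<open>K\<close> bounds the distance.\<close>

lemma match_first:
  assumes q: "4 \<le> q n" and w: "0 < \<omega>" "\<omega> \<le> 1"
    and gx: "\<And>j. \<bar>j\<bar> \<le> 2 * int (q n) \<Longrightarrow> \<omega> / q n \<le> pt x j \<and> \<omega> / q n \<le> 1 - pt x j"
    and gy: "\<And>j. \<bar>j\<bar> \<le> 2 * int (q n) \<Longrightarrow> \<omega> / q n \<le> pt y j \<and> \<omega> / q n \<le> 1 - pt y j"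
    and D: "\<bar>bs (int (q n)) x - bs (int (q n)) y\<bar> \<le> \<epsilon>"
    and sx: "\<And>i. \<bar>i\<bar> < int (q n) \<Longrightarrow> \<bar>bs i (x + err n) - bs i x\<bar> \<le> \<epsilon>"
    and sy: "\<And>i. \<bar>i\<bar> < int (q n) \<Longrightarrow> \<bar>bs i (y + err n) - bs i y\<bar> \<le> \<epsilon>"
    and K: "K \<le> (am - ap) * q n * ln (q n) - C2 * q n / \<omega>" "0 < K"
  shows "\<exists>i \<delta>. \<bar>i\<bar> < int (q n) \<and> \<bar>\<delta>\<bar> \<le> 2 * \<epsilon> / K \<and> frac y = frac (x + of_int i * \<alpha> + \<delta>)"
proof -
  have aux: "\<bar>v - z\<bar> \<le> 2 * \<epsilon> / K"
    if i: "\<bar>i\<bar> < int (q n)" and z: "frac z = frac (u + of_int i * \<alpha>)"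
      and free: "\<forall>j. 0 \<le> j \<longrightarrow> j < int (q n) \<longrightarrow> pt v j = pt z j + (v - z)"
      and gu: "\<And>j. \<bar>j\<bar> \<le> 2 * int (q n) \<Longrightarrow> \<omega> / q n \<le> pt u j \<and> \<omega> / q n \<le> 1 - pt u j"
      and gv: "\<And>j. \<bar>j\<bar> \<le> 2 * int (q n) \<Longrightarrow> \<omega> / q n \<le> pt v j \<and> \<omega> / q n \<le> 1 - pt v j"
      and D: "\<bar>bs (int (q n)) u - bs (int (q n)) v\<bar> \<le> \<epsilon>" and su: "\<bar>bs i (u + err n) - bs i u\<bar> \<le> \<epsilon>" for u v z i
  proof -
    have "K * \<bar>v - z\<bar> \<le> ((am - ap) * q n * ln (q n) - C2 * q n / \<omega>) * \<bar>v - z\<bar>"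
      using K by (intro mult_right_mono) auto
    also have "\<dots> \<le> \<bar>bs (int (q n)) z - bs (int (q n)) v\<bar>"
    proof (rule free_close[OF q w])
      fix j assume j: "0 \<le> j" "j < int (q n)"
      have "pt z j = pt u (i + j)" unfolding pt_cong[OF z] pt_add ..
      then show "pt v j = pt z j + (v - z) \<and>
       \<omega> / q n \<le> pt z j \<and> \<omega> / q n \<le> 1 - pt z j \<and> \<omega> / q n \<le> pt v j \<and> \<omega> / q n \<le> 1 - pt v j"
        using free gu[of "i + j"] gv[of j] i j by auto
    qed
    also have "\<dots> \<le> 2 * \<epsilon>"
      unfolding bs_cong[OF z] bs_return using D su by linarith
    finally show ?thesis using K by (simp add: field_simps)
  qed
  from argmin_match[of "q n" x y] q
  consider (1) i z where "\<bar>i\<bar> < int (q n)" "frac z = frac (x + of_int i * \<alpha>)"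
      "\<forall>j. 0 \<le> j \<longrightarrow> j < int (q n) \<longrightarrow> pt y j = pt z j + (y - z)"
    | (2) i z where "\<bar>i\<bar> < int (q n)" "frac z = frac (y + of_int i * \<alpha>)"
      "\<forall>j. 0 \<le> j \<longrightarrow> j < int (q n) \<longrightarrow> pt x j = pt z j + (x - z)"
    by auto
  then show ?thesis
  proof cases
    case 1
    have "\<bar>y - z\<bar> \<le> 2 * \<epsilon> / K" by (rule aux[OF 1 gx gy D sx[OF 1(1)]])
    moreover have "frac y = frac (x + of_int i * \<alpha> + (y - z))"
      using frac_eq_shift[OF 1(2), of "y - z"] by simp
    ultimately show ?thesis using 1 by blast
  next
    case 2
    have D': "\<bar>bs (int (q n)) y - bs (int (q n)) x\<bar> \<le> \<epsilon>" using D by linarith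
    have "\<bar>x - z\<bar> \<le> 2 * \<epsilon> / K" by (rule aux[OF 2 gy gx D' sy[OF 2(1)]])
    then have "\<bar>z - x\<bar> \<le> 2 * \<epsilon> / K" by (simp add: abs_minus_commute)
    moreover have "frac y = frac (x + of_int (- i) * \<alpha> + (z - x))"
      using frac_eq_shift[OF 2(2), of "- (of_int i * \<alpha>)"] by simp
    moreover have "\<bar>- i\<bar> < int (q n)" using 2 by simp
    ultimately show ?thesis by blast
  qed
qed

text \<open>At the next level the interval of length \<open>\<bar>\<delta>\<bar>\<close> may contain
  many singularities. Steps of \<open>q n\<close> indices, each a displacement by
  \<open>err n\<close>, absorb it: the remainders after \<open>c\<close> and after
  \<open>c + 1\<close> steps lie on opposite sides and have total length
  \<open>\<bar>err n\<bar>\<close>. By \<open>free_side\<close> one of them meets no singularity,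
  and there the slope at level \<open>Suc n\<close> applies.\<close>

lemma match_second:
  fixes x y :: real
  assumes N: "N = q (Suc n)" "4 \<le> N" and e1: "\<bar>err n\<bar> < 1" and w: "0 < \<omega>" "\<omega> \<le> 1"
    and gx: "\<And>j. \<bar>j\<bar> \<le> 2 * int N \<Longrightarrow> \<omega> / N \<le> pt x j \<and> \<omega> / N \<le> 1 - pt x j"
    and gy: "\<And>j. \<bar>j\<bar> \<le> 2 * int N \<Longrightarrow> \<omega> / N \<le> pt y j \<and> \<omega> / N \<le> 1 - pt y j"
    and D: "\<bar>bs (int N) x - bs (int N) y\<bar> \<le> \<epsilon>"
    and sx: "\<And>i. \<bar>i\<bar> \<le> int J \<Longrightarrow> \<bar>bs i (x + err (Suc n)) - bs i x\<bar> \<le> \<epsilon>"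
    and J: "J \<le> N" "of_int \<bar>i\<bar> + (\<bar>\<delta>\<bar> / \<bar>err n\<bar> + 1) * real (q n) \<le> real J"
    and y: "frac y = frac (x + of_int i * \<alpha> + \<delta>)"
    and K: "K \<le> (am - ap) * N * ln N - C2 * N / \<omega>" "0 < K"
  shows "\<exists>i \<delta>. \<bar>i\<bar> \<le> int J \<and> \<bar>\<delta>\<bar> \<le> 2 * \<epsilon> / K \<and> frac y = frac (x + of_int i * \<alpha> + \<delta>)"
proof -
  define s where "s = err n"
  have s0: "s \<noteq> 0" using err_nz by (simp add: s_def)
  define c where "c = \<lfloor>\<delta> / s\<rfloor>"
  define u where "u = \<delta> - of_int c * s"
  have c: "of_int c \<le> \<delta> / s" "\<delta> / s < of_int c + 1" unfolding c_def by linarith+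
  have us: "0 \<le> u / s" "u / s < 1" using c s0 by (auto simp: u_def diff_divide_distrib)
  have cabs: "\<bar>of_int c\<bar> \<le> \<bar>\<delta>\<bar> / \<bar>s\<bar> + 1" "\<bar>of_int (c + 1)\<bar> \<le> \<bar>\<delta>\<bar> / \<bar>s\<bar> + 1"
  proof -
    have "\<bar>\<delta> / s\<bar> = \<bar>\<delta>\<bar> / \<bar>s\<bar>" by (simp add: abs_divide)
    then show "\<bar>of_int c\<bar> \<le> \<bar>\<delta>\<bar> / \<bar>s\<bar> + 1" "\<bar>of_int (c + 1)\<bar> \<le> \<bar>\<delta>\<bar> / \<bar>s\<bar> + 1"
      using c by (simp_all only: of_int_add of_int_1)
  qed
  have sq: "s = of_int (int (q n)) * \<alpha> - of_int (int (p n))" by (simp add: s_def cf_err_def)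
  have y0: "frac y = frac (x + of_int (i + c * int (q n)) * \<alpha> + u)"
  proof -
    have "x + of_int i * \<alpha> + \<delta> = x + of_int (i + c * int (q n)) * \<alpha> + u + of_int (- (c * int (p n)))"
      by (simp add: u_def sq algebra_simps)
    then show ?thesis using y by (simp only: frac_add_of_int_right)
  qed
  have y1: "frac y = frac (x + of_int (i + (c + 1) * int (q n)) * \<alpha> + (u - s))"
  proof -
    have "x + of_int i * \<alpha> + \<delta> = x + of_int (i + (c + 1) * int (q n)) * \<alpha> + (u - s) + of_int (- ((c + 1) * int (p n)))"
      by (simp add: u_def sq algebra_simps)
    then show ?thesis using y by (simp only: frac_add_of_int_right)
  qed
  have bound: "\<bar>i + c' * int (q n)\<bar> \<le> int J" if "\<bar>of_int c'\<bar> \<le> \<bar>\<delta>\<bar> / \<bar>s\<bar> + 1" for c'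
  proof -
    have "real_of_int \<bar>i + c' * int (q n)\<bar> \<le> of_int \<bar>i\<bar> + \<bar>of_int c'\<bar> * real (q n)"
      by (simp add: abs_mult order.trans[OF abs_triangle_ineq])
    also have "\<dots> \<le> of_int \<bar>i\<bar> + (\<bar>\<delta>\<bar> / \<bar>s\<bar> + 1) * real (q n)" using that by (intro add_left_mono mult_right_mono) auto
    also have "\<dots> \<le> real J" using J by (simp add: s_def)
    finally show ?thesis by linarith
  qed
  have aux: "\<bar>v\<bar> \<le> 2 * \<epsilon> / K"
    if i': "\<bar>i'\<bar> \<le> int J" and yv: "frac y = frac (x + of_int i' * \<alpha> + v)"
      and free: "\<forall>j. 0 \<le> j \<longrightarrow> j < int N \<longrightarrow> pt y j = pt (y - v) j + v" for i' v
  proof -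
    have z: "frac (y - v) = frac (x + of_int i' * \<alpha>)" using frac_eq_shift[OF yv, of "- v"] by simp
    have "K * \<bar>y - (y - v)\<bar> \<le> ((am - ap) * N * ln N - C2 * N / \<omega>) * \<bar>y - (y - v)\<bar>"
      using K by (intro mult_right_mono) auto
    also have "\<dots> \<le> \<bar>bs (int N) (y - v) - bs (int N) y\<bar>"
      unfolding N(1)
    proof (rule free_close)
      fix j assume j: "0 \<le> j" "j < int (q (Suc n))"
      have "pt (y - v) j = pt x (i' + j)" unfolding pt_cong[OF z] pt_add ..
      then show "pt y j = pt (y - v) j + (y - (y - v)) \<and>
       \<omega> / q (Suc n) \<le> pt (y - v) j \<and> \<omega> / q (Suc n) \<le> 1 - pt (y - v) j \<and> \<omega> / q (Suc n) \<le> pt y j \<and> \<omega> / q (Suc n) \<le> 1 - pt y j"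
        using free gx[of "i' + j"] gy[of j] i' j J(1) N(1) by auto
    qed (use N w in auto)
    also have "\<dots> \<le> 2 * \<epsilon>"
      unfolding bs_cong[OF z] N(1) bs_return using D[unfolded N(1)] sx[OF i'] by linarith
    finally show ?thesis using K by (simp add: field_simps)
  qed
  show ?thesis
  proof (cases "0 < s")
    case True
    have u: "0 \<le> u" "0 \<le> s - u" using us True by (auto simp: field_simps)
    from free_side[of u "s - u" n N y] u N e1 True
    consider "\<forall>j. 0 \<le> j \<longrightarrow> j < int N \<longrightarrow> pt y j = pt (y - u) j + u"
      | "\<forall>j. 0 \<le> j \<longrightarrow> j < int N \<longrightarrow> pt y j = pt (y + (s - u)) j - (s - u)" by (auto simp: s_def)
    then show ?thesis
    proof cases
      case 1
      then show ?thesis using aux[OF bound[OF cabs(1)] y0] bound[OF cabs(1)] y0 by blast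
    next
      case 2
      then have "\<forall>j. 0 \<le> j \<longrightarrow> j < int N \<longrightarrow> pt y j = pt (y - (u - s)) j + (u - s)" by (simp add: algebra_simps)
      then show ?thesis using aux[OF bound[OF cabs(2)] y1] bound[OF cabs(2)] y1 by blast
    qed
  next
    case False
    then have sneg: "s < 0" using s0 by simp
    have u: "0 \<le> - u" "0 \<le> u - s" using us sneg by (auto simp: field_simps)
    from free_side[of "u - s" "- u" n N y] u N e1 sneg
    consider "\<forall>j. 0 \<le> j \<longrightarrow> j < int N \<longrightarrow> pt y j = pt (y - (u - s)) j + (u - s)"
      | "\<forall>j. 0 \<le> j \<longrightarrow> j < int N \<longrightarrow> pt y j = pt (y + (- u)) j - (- u)" by (auto simp: s_def)
    then show ?thesis
    proof cases
      case 1
      then show ?thesis using aux[OF bound[OF cabs(2)] y1] bound[OF cabs(2)] y1 by blast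
    next
      case 2
      then have "\<forall>j. 0 \<le> j \<longrightarrow> j < int N \<longrightarrow> pt y j = pt (y - u) j + u" by simp
      then show ?thesis using aux[OF bound[OF cabs(1)] y0] bound[OF cabs(1)] y0 by blast
    qed
  qed
qed

end

context base_map
begin

text \<open>The first matching leaves \<open>\<delta>\<close> of order
  \<open>\<epsilon>6 / (q n * L)\<close>. Measured in steps of size \<open>err n\<close>, each worth
  \<open>q n\<close> indices, this costs an index of order
  \<open>\<epsilon>6 * q (Suc n) / L\<close>, whence the bound \<open>J\<close>. Sums of length up
  to \<open>J\<close> have slope of order \<open>\<epsilon>1 * q (Suc n)\<close>, so the
  displacement \<open>err (Suc n)\<close> hardly changes them, as the second matching needs.\<close>

lemma match_core:
  fixes x y L T \<theta> \<epsilon>1 \<epsilon>4 \<epsilon>6 :: real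
  assumes L_def: "L = ln (real (q n))"
    and Q: "4 \<le> q n" and w: "0 < \<theta>" "\<theta> \<le> 1" and e: "0 < \<epsilon>1" "0 < \<epsilon>4" "0 < \<epsilon>6"
    and L1: "1 \<le> L" and L2: "48 * C2 / (\<theta> * (am - ap)) \<le> L" and L3: "24 * \<epsilon>1 / \<theta> \<le> L" and L4: "\<epsilon>1 \<le> L"
    and Q1: "24 / \<theta> \<le> q n" "12 * Cg / \<theta> \<le> q n"
    and T: "T * q n * L \<le> q (Suc n)" "96 * Cf / (\<theta> * \<epsilon>6) \<le> T" "48 / \<theta> \<le> T" "6 / \<epsilon>1 \<le> T"
    and e16: "8 * \<epsilon>6 / (am - ap) \<le> \<epsilon>1 / 2" "96 * Cf * \<epsilon>1 / \<theta> \<le> \<epsilon>4"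
    and J: "J = nat \<lfloor>\<epsilon>1 * q (Suc n) / L\<rfloor>"
    and D: "\<bar>bs (int (q n)) x - bs (int (q n)) y\<bar> \<le> \<epsilon>6" "\<bar>bs (int (q (Suc n))) x - bs (int (q (Suc n))) y\<bar> \<le> \<epsilon>4"
    and rx: "regular \<theta> (2 * q n) x" "regular \<theta> (2 * q (Suc n)) x" "regular \<theta> J x"
    and ry: "regular \<theta> (2 * q n) y" "regular \<theta> (2 * q (Suc n)) y"
  shows "\<exists>i \<delta>. \<bar>i\<bar> \<le> int J \<and> \<bar>\<delta>\<bar> \<le> 4 * \<epsilon>4 / ((am - ap) * q (Suc n) * L) \<and> frac y = frac (x + of_int i * \<alpha> + \<delta>)"
proof -
  define Q' where "Q' = real (q n)"
  define N where "N = q (Suc n)"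
  define N' where "N' = real N"
  \<comment> \<open>Regularity at scale \<open>2 * M\<close> keeps points at distance
    \<open>\<theta> / (24 * M)\<close> from the singularity. The doubled scale covers the indices
    \<open>i + j\<close> that appear after a shift by \<open>i\<close>.\<close>
  define \<omega> where "\<omega> = \<theta> / 24"
  define c where "c = am - ap"
  have c0: "0 < c" using ap_less_am by (simp add: c_def)
  have Q0: "4 \<le> Q'" using Q by (simp add: Q'_def)
  have LQ: "L = ln Q'" by (simp add: L_def Q'_def)
  have C20: "0 \<le> C2" using am_pos ap_nonneg G_nonneg by (simp add: C2_def)
  have w': "0 < \<omega>" "\<omega> \<le> 1" using w by (auto simp: \<omega>_def)
  have T0: "0 < T" using T(3) w by (smt (verit) divide_pos_pos)
  have TQ: "T * Q' \<le> N' / L" using T(1) L1 by (simp add: Q'_def N'_def N_def field_simps)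
  have NQ: "T * Q' \<le> N'"
  proof -
    have "T * Q' * 1 \<le> T * Q' * L" using L1 T0 Q0 by (intro mult_left_mono) auto
    then show ?thesis using T(1) by (simp add: Q'_def N'_def N_def)
  qed
  have T48: "48 \<le> T"
  proof -
    have "48 / 1 \<le> 48 / \<theta>" using w by (intro divide_left_mono) auto
    then show ?thesis using T by linarith
  qed
  have QN: "Q' \<le> N'"
  proof -
    have "1 * Q' \<le> T * Q'" using T48 Q0 by (intro mult_right_mono) auto
    then show ?thesis using NQ by linarith
  qed
  have N4: "4 \<le> N" using QN Q0 by (simp add: N'_def)
  have N0: "0 < N'" using QN Q0 by linarith
  have errn: "\<bar>err n\<bar> \<le> 1 / N'" using err_le[of n] by (simp add: N'_def N_def)
  have errN: "\<bar>err (Suc n)\<bar> \<le> 1 / N'"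
  proof -
    have "1 / real (q (Suc (Suc n))) \<le> 1 / N'"
      unfolding N'_def N_def using q_Suc_ge[of "Suc n"] q_pos[of "Suc n"] by (intro divide_left_mono) (auto simp del: cf_denom.simps)
    then show ?thesis using err_le[of "Suc n"] by linarith
  qed
  have e1: "\<bar>err n\<bar> < 1"
  proof -
    have "1 / N' \<le> 1 / 4" using QN Q0 by (intro divide_left_mono) auto
    then show ?thesis using errn by linarith
  qed
  have lnQ: "ln (12 * real (2 * q n) / \<theta>) \<le> 2 * L"
  proof -
    have "12 * real (2 * q n) / \<theta> = (24 / \<theta>) * Q'" by (simp add: Q'_def)
    also have "\<dots> \<le> Q' * Q'" using Q1 Q0 by (intro mult_right_mono) (auto simp: Q'_def)
    finally have "ln (12 * real (2 * q n) / \<theta>) \<le> ln (Q' * Q')" using w Q0 by (subst ln_le_cancel_iff) (auto simp: Q'_def)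
    also have "\<dots> = 2 * L" using Q0 by (simp add: ln_mult LQ)
    finally show ?thesis .
  qed
  have slow1: "\<bar>bs i (z + err n) - bs i z\<bar> \<le> \<epsilon>6" if r: "regular \<theta> (2 * q n) z" and i: "\<bar>i\<bar> < int (q n)" for i z
  proof -
    have "1 / N' \<le> 1 / (T * Q')" using NQ T0 Q0 N0 by (intro divide_left_mono) auto
    also have "\<dots> \<le> 1 / ((48 / \<theta>) * Q')" using T w Q0 T0 by (intro divide_left_mono mult_right_mono mult_pos_pos) auto
    finally have s: "\<bar>err n\<bar> \<le> \<theta> / real (24 * (2 * q n))" using errn by (simp add: Q'_def)
    have "\<bar>bs i (z + err n) - bs i z\<bar> \<le> 2 * Cf * (12 * real (2 * q n) * ln (12 * real (2 * q n) / \<theta>) / \<theta>) * \<bar>err n\<bar>"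
      by (rule regular_slow[OF r _ w(1) _ s]) (use i Q in auto)
    also have "\<dots> \<le> 2 * Cf * (12 * real (2 * q n) * (2 * L) / \<theta>) * (1 / N')"
    proof -
      have "2 * Cf * (12 * real (2 * q n) * ln (12 * real (2 * q n) / \<theta>) / \<theta>) \<le> 2 * Cf * (12 * real (2 * q n) * (2 * L) / \<theta>)"
        using Cf_pos lnQ w by (intro divide_right_mono mult_left_mono) auto
      moreover have "0 \<le> 2 * Cf * (12 * real (2 * q n) * (2 * L) / \<theta>)" using Cf_pos w L1 by simp
      ultimately show ?thesis by (intro mult_mono[OF _ errn] abs_ge_zero)
    qed
    also have "\<dots> = (96 * Cf / \<theta>) * (Q' * L) / N'" by (simp add: Q'_def)
    also have "\<dots> \<le> (T * \<epsilon>6) * (Q' * L) / N'"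
      using T(2) e w N0 Q0 L1 by (intro divide_right_mono mult_right_mono) (auto simp: field_simps)
    also have "\<dots> = \<epsilon>6 * ((T * Q' * L) / N')" by simp
    also have "\<dots> \<le> \<epsilon>6 * 1" using T(1) N0 e by (intro mult_left_mono) (auto simp: Q'_def N'_def N_def)
    finally show ?thesis by simp
  qed
  have reg: "\<omega> / real M \<le> pt z j \<and> \<omega> / real M \<le> 1 - pt z j" if "regular \<theta> (2 * M) z" "\<bar>j\<bar> \<le> 2 * int M" for M z j
  proof -
    have "\<theta> / (12 * real (2 * M)) = \<omega> / M" by (simp add: \<omega>_def)
    then show ?thesis using that unfolding regular_def by auto
  qed
  have cL: "C2 / \<omega> \<le> c / 2 * L"
  proof -
    have "48 * C2 / (\<theta> * c) * (c / 2) \<le> L * (c / 2)" using L2 c0 by (intro mult_right_mono) (auto simp: c_def)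
    then show ?thesis using c0 by (simp add: \<omega>_def mult_ac)
  qed
  \<comment> \<open>By \<open>cL\<close> the error term consumes at most half of the main term of
    the slope.\<close>
  have K1: "c / 2 * Q' * L \<le> (am - ap) * q n * ln (q n) - C2 * q n / \<omega>" "0 < c / 2 * Q' * L"
  proof -
    have "C2 / \<omega> * Q' \<le> c / 2 * L * Q'" using cL Q0 by (intro mult_right_mono) auto
    then have "C2 * Q' / \<omega> \<le> c * Q' * L - c / 2 * Q' * L" by (simp add: field_simps)
    then show "c / 2 * Q' * L \<le> (am - ap) * q n * ln (q n) - C2 * q n / \<omega>" by (simp add: Q'_def c_def L_def)
    show "0 < c / 2 * Q' * L" using c0 Q0 L1 by simp
  qed
  obtain i \<delta> where i: "\<bar>i\<bar> < int (q n)" "\<bar>\<delta>\<bar> \<le> 2 * \<epsilon>6 / (c / 2 * Q' * L)" "frac y = frac (x + of_int i * \<alpha> + \<delta>)"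
    using match_first[OF Q w' reg[OF rx(1)] reg[OF ry(1)] D(1) slow1[OF rx(1)] slow1[OF ry(1)] K1] by blast
  have Jb: "real J \<le> \<epsilon>1 * N' / L" "\<epsilon>1 * N' / L - 1 \<le> real J"
  proof -
    have "0 \<le> \<epsilon>1 * N' / L" using e N0 L1 by simp
    then show "real J \<le> \<epsilon>1 * N' / L" "\<epsilon>1 * N' / L - 1 \<le> real J" unfolding J N'_def N_def by linarith+
  qed
  have JN: "J \<le> N"
  proof -
    have "\<epsilon>1 * N' / L \<le> L * N' / L" using L4 L1 N0 by (intro divide_right_mono mult_right_mono) auto
    then show ?thesis using Jb L1 by (simp add: N'_def)
  qed
  have bigJ: "3 * Q' \<le> \<epsilon>1 / 2 * (N' / L)"
  proof -
    have "6 / \<epsilon>1 * Q' \<le> T * Q'" using T Q0 by (intro mult_right_mono) auto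
    then have "6 / \<epsilon>1 * Q' \<le> N' / L" using TQ by linarith
    then have "\<epsilon>1 / 2 * (6 / \<epsilon>1 * Q') \<le> \<epsilon>1 / 2 * (N' / L)" using e by (intro mult_left_mono) auto
    then show ?thesis using e by simp
  qed
  have J2: "of_int \<bar>i\<bar> + (\<bar>\<delta>\<bar> / \<bar>err n\<bar> + 1) * real (q n) \<le> real J"
  proof -
    have "\<bar>\<delta>\<bar> / \<bar>err n\<bar> \<le> \<bar>\<delta>\<bar> / (1 / (2 * N'))" using err_ge[of n] err_nz[of n] N0
      by (intro divide_left_mono) (auto simp: N'_def N_def)
    also have "\<dots> = \<bar>\<delta>\<bar> * (2 * N')" by simp
    also have "\<dots> \<le> 2 * \<epsilon>6 / (c / 2 * Q' * L) * (2 * N')" using i(2) N0 by (intro mult_right_mono) auto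
    also have "\<dots> = 8 * \<epsilon>6 / c * (N' / L) / Q'" by (simp add: mult_ac)
    finally have "\<bar>\<delta>\<bar> / \<bar>err n\<bar> * Q' \<le> 8 * \<epsilon>6 / c * (N' / L) / Q' * Q'" using Q0 by (intro mult_right_mono) auto
    also have "\<dots> = 8 * \<epsilon>6 / c * (N' / L)" using Q0 by simp
    also have "\<dots> \<le> \<epsilon>1 / 2 * (N' / L)" using e16 N0 L1 by (intro mult_right_mono) (auto simp: c_def)
    finally have 1: "\<bar>\<delta>\<bar> / \<bar>err n\<bar> * Q' \<le> \<epsilon>1 / 2 * (N' / L)" .
    have 2: "of_int \<bar>i\<bar> \<le> Q'" using i(1) by (simp add: Q'_def)
    have 3: "\<epsilon>1 / 2 * (N' / L) + \<epsilon>1 / 2 * (N' / L) = \<epsilon>1 * N' / L" by (simp add: field_simps)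
    have "of_int \<bar>i\<bar> + (\<bar>\<delta>\<bar> / \<bar>err n\<bar> + 1) * Q' = of_int \<bar>i\<bar> + \<bar>\<delta>\<bar> / \<bar>err n\<bar> * Q' + Q'" by (simp add: algebra_simps)
    also have "\<dots> \<le> real J" using 1 2 3 bigJ Jb(2) Q0 by linarith
    finally show ?thesis by (simp add: Q'_def)
  qed
  have J1: "1 \<le> J"
  proof -
    have "\<epsilon>1 / 2 * (N' / L) \<le> \<epsilon>1 * N' / L" using e N0 L1 by (simp add: field_simps)
    then show ?thesis using bigJ Jb(2) Q0 by linarith
  qed
  have lnJ: "ln (12 * real J / \<theta>) \<le> 4 * L"
  proof -
    have "12 * real J / \<theta> \<le> 12 * (Cg * Q'\<^sup>2) / \<theta>"
      using JN growth[of n] w by (intro divide_right_mono mult_left_mono) (auto simp: Q'_def N_def)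
    also have "\<dots> = (12 * Cg / \<theta>) * Q'\<^sup>2" by simp
    also have "\<dots> \<le> Q' * Q'\<^sup>2" using Q1 by (intro mult_right_mono) (auto simp: Q'_def)
    also have "\<dots> = Q' ^ 3" by (simp add: power3_eq_cube power2_eq_square)
    finally have "ln (12 * real J / \<theta>) \<le> ln (Q' ^ 3)" using w J1 Q0 by (subst ln_le_cancel_iff) auto
    also have "\<dots> = 3 * L" using Q0 by (simp add: ln_realpow LQ)
    finally show ?thesis using L1 by linarith
  qed
  have slow2: "\<bar>bs i (x + err (Suc n)) - bs i x\<bar> \<le> \<epsilon>4" if i: "\<bar>i\<bar> \<le> int J" for i
  proof -
    have s: "\<bar>err (Suc n)\<bar> \<le> \<theta> / real (24 * J)"
    proof -
      have "24 * real J \<le> 24 * (\<epsilon>1 * N' / L)" using Jb by simp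
      also have "\<dots> = (24 * \<epsilon>1 / \<theta>) * \<theta> * N' / L" using w by simp
      also have "\<dots> \<le> L * \<theta> * N' / L" using L3 L1 w N0 by (intro divide_right_mono mult_right_mono) auto
      also have "\<dots> = \<theta> * N'" using L1 by simp
      finally have "1 / N' \<le> \<theta> / (24 * real J)" using N0 J1 by (simp add: field_simps)
      then show ?thesis using errN by linarith
    qed
    have "\<bar>bs i (x + err (Suc n)) - bs i x\<bar> \<le> 2 * Cf * (12 * real J * ln (12 * real J / \<theta>) / \<theta>) * \<bar>err (Suc n)\<bar>"
      by (rule regular_slow[OF rx(3) J1 w(1) i s])
    also have "\<dots> \<le> 2 * Cf * (12 * (\<epsilon>1 * N' / L) * (4 * L) / \<theta>) * (1 / N')"
    proof -
      have "12 * real J * ln (12 * real J / \<theta>) \<le> 12 * real J * (4 * L)" using lnJ by (intro mult_left_mono) auto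
      also have "\<dots> \<le> 12 * (\<epsilon>1 * N' / L) * (4 * L)" using Jb L1 by (intro mult_right_mono) auto
      finally have "12 * real J * ln (12 * real J / \<theta>) / \<theta> \<le> 12 * (\<epsilon>1 * N' / L) * (4 * L) / \<theta>" using w by (intro divide_right_mono) auto
      then have "2 * Cf * (12 * real J * ln (12 * real J / \<theta>) / \<theta>) \<le> 2 * Cf * (12 * (\<epsilon>1 * N' / L) * (4 * L) / \<theta>)"
        using Cf_pos by (intro mult_left_mono) auto
      moreover have "0 \<le> 2 * Cf * (12 * (\<epsilon>1 * N' / L) * (4 * L) / \<theta>)" using Cf_pos e N0 L1 w by simp
      ultimately show ?thesis by (intro mult_mono[OF _ errN] abs_ge_zero)
    qed
    also have "\<dots> = 96 * Cf * \<epsilon>1 / \<theta>" using L1 N0 by simp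
    finally show ?thesis using e16 by linarith
  qed
  have lnN: "L \<le> ln N'" using QN Q0 by (simp add: LQ)
  have K2: "c / 2 * N' * L \<le> (am - ap) * N * ln N - C2 * N / \<omega>" "0 < c / 2 * N' * L"
  proof -
    have "C2 / \<omega> * N' \<le> c / 2 * L * N'" using cL N0 by (intro mult_right_mono) auto
    moreover have "c * N' * L \<le> c * N' * ln N'" using lnN c0 N0 by (intro mult_left_mono) auto
    ultimately have "C2 * N' / \<omega> \<le> c * N' * ln N' - c / 2 * N' * L" by (simp add: field_simps)
    then show "c / 2 * N' * L \<le> (am - ap) * N * ln N - C2 * N / \<omega>" by (simp add: N'_def c_def)
    show "0 < c / 2 * N' * L" using c0 N0 L1 by simp
  qed
  obtain i' \<delta>' where "\<bar>i'\<bar> \<le> int J" "\<bar>\<delta>'\<bar> \<le> 2 * \<epsilon>4 / (c / 2 * N' * L)" "frac y = frac (x + of_int i' * \<alpha> + \<delta>')"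
    using match_second[OF N_def N4 e1 w' reg[OF rx(2)[folded N_def]] reg[OF ry(2)[folded N_def]] D(2)[folded N_def] slow2 JN J2 i(3) K2]
    by blast
  then show ?thesis by (intro exI[of _ i'] exI[of _ \<delta>']) (auto simp: c_def N'_def N_def)
qed

lemma ln_q_large: "\<exists>n0. \<forall>n\<ge>n0. C \<le> real (q n) \<and> C \<le> ln (real (q n))"
proof -
  define n0 where "n0 = nat \<lceil>max C (exp C)\<rceil>"
  have "C \<le> real (q n) \<and> C \<le> ln (real (q n))" if n: "n0 \<le> n" for n
  proof -
    have 1: "max C (exp C) \<le> real (q n)" using q_ge[of n] n unfolding n0_def by linarith
    then have "ln (exp C) \<le> ln (real (q n))" using q_pos[of n] by (subst ln_le_cancel_iff) auto
    then show ?thesis using 1 by simp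
  qed
  then show ?thesis by blast
qed

text \<open>The seven exceptional sets of measure \<open>\<theta>\<close> come from the discrepancies at \<open>q n\<close> and \<open>q (Suc n)\<close>, from the
  regularity of \<open>x\<close> at three scales and from the regularity of \<open>Y x\<close> at two scales.\<close>

theorem match:
  fixes \<epsilon>1 \<epsilon>3 \<theta> :: real
  assumes e: "0 < \<epsilon>1" "0 < \<epsilon>3" and th: "0 < \<theta>" "\<theta> \<le> 1"
  shows "\<exists>(T::real) n0. \<forall>n\<ge>n0. T * q n * ln (q n) \<le> q (Suc n) \<longrightarrow>
    mostly (7 * \<theta>) (\<lambda>x. \<exists>i \<delta>. \<bar>of_int i\<bar> \<le> \<epsilon>1 * q (Suc n) / ln (q n) \<and> \<bar>\<delta>\<bar> \<le> \<epsilon>3 / (q (Suc n) * ln (q n)) \<and>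
      Y x = frac (x + of_int i * \<alpha> + \<delta>))"
proof -
  obtain \<kappa> where ka: "0 < \<kappa>" "\<kappa> \<le> 1" "\<And>P. mostly \<kappa> P \<Longrightarrow> mostly \<theta> (\<lambda>x. P (Y x))"
    using mostly_Y[OF th(1)] by blast
  define \<theta>' where "\<theta>' = min \<theta> \<kappa>"
  have th': "0 < \<theta>'" "\<theta>' \<le> \<theta>" "\<theta>' \<le> \<kappa>" "\<theta>' \<le> 1" using th ka by (auto simp: \<theta>'_def)
  define c where "c = am - ap"
  have c0: "0 < c" using ap_less_am by (simp add: c_def)
  \<comment> \<open>The tolerances are chosen backwards: \<open>\<epsilon>4\<close> from the
    required precision of \<open>\<delta>\<close>, \<open>\<epsilon>1'\<close> from the slow change
    of sums at level \<open>Suc n\<close>, and \<open>\<epsilon>6\<close> from the index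
    bound.\<close>
  define \<epsilon>4 where "\<epsilon>4 = \<epsilon>3 * c / 4"
  define \<epsilon>1' where "\<epsilon>1' = min \<epsilon>1 (\<epsilon>4 * \<theta>' / (96 * Cf))"
  define \<epsilon>6 where "\<epsilon>6 = \<epsilon>1' * c / 16"
  have e4: "0 < \<epsilon>4" using e c0 by (simp add: \<epsilon>4_def)
  have e1: "0 < \<epsilon>1'" "\<epsilon>1' \<le> \<epsilon>1" "\<epsilon>1' \<le> \<epsilon>4 * \<theta>' / (96 * Cf)" using e e4 th' Cf_pos by (auto simp: \<epsilon>1'_def)
  have e6: "0 < \<epsilon>6" "8 * \<epsilon>6 / c \<le> \<epsilon>1' / 2" using e1 c0 by (auto simp: \<epsilon>6_def)
  have e14: "96 * Cf * \<epsilon>1' / \<theta>' \<le> \<epsilon>4" using e1(3) th' Cf_pos by (simp add: field_simps)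
  define T where "T = max (96 * Cf / (\<theta>' * \<epsilon>6)) (max (48 / \<theta>') (6 / \<epsilon>1'))"
  have T: "96 * Cf / (\<theta>' * \<epsilon>6) \<le> T" "48 / \<theta>' \<le> T" "6 / \<epsilon>1' \<le> T" by (auto simp: T_def)
  obtain m1 where m1: "\<And>n. m1 \<le> n \<Longrightarrow> mostly \<theta> (\<lambda>x. \<bar>disc (int (q n)) x\<bar> \<le> \<epsilon>6)"
    using small_discrepancy[OF e6(1) th(1)] by blast
  obtain m2 where m2: "\<And>n. m2 \<le> n \<Longrightarrow> mostly \<theta> (\<lambda>x. \<bar>disc (int (q n)) x\<bar> \<le> \<epsilon>4)"
    using small_discrepancy[OF e4 th(1)] by blast
  define CC where "CC = max 4 (max (48 * C2 / (\<theta>' * c)) (max (24 * \<epsilon>1' / \<theta>') (max \<epsilon>1' (max (24 / \<theta>') (12 * Cg / \<theta>')))))"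
  obtain m3 where m3: "\<And>n. m3 \<le> n \<Longrightarrow> CC \<le> real (q n) \<and> CC \<le> ln (real (q n))"
    using ln_q_large[of CC] by blast
  show ?thesis
  proof (rule exI[of _ T], rule exI[of _ "max m1 (max m2 m3)"], intro allI impI)
    fix n assume n: "max m1 (max m2 m3) \<le> n" and TN: "T * q n * ln (q n) \<le> q (Suc n)"
    define N where "N = q (Suc n)"
    define L where "L = ln (real (q n))"
    define J where "J = nat \<lfloor>\<epsilon>1' * N / L\<rfloor>"
    have C: "4 \<le> real (q n)" "24 / \<theta>' \<le> real (q n)" "12 * Cg / \<theta>' \<le> real (q n)"
      "4 \<le> L" "48 * C2 / (\<theta>' * c) \<le> L" "24 * \<epsilon>1' / \<theta>' \<le> L" "\<epsilon>1' \<le> L"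
      using m3[of n] n unfolding CC_def max.bounded_iff L_def by auto
    have N0: "0 < real N" using q_pos[of "Suc n"] by (simp add: N_def)
    have J1: "1 \<le> J"
    proof -
      have "6 / \<epsilon>1' * q n * L \<le> T * q n * L" using T C by (intro mult_right_mono) auto
      then have "6 / \<epsilon>1' * q n * L \<le> N" using TN unfolding L_def N_def by linarith
      then have "6 * q n \<le> \<epsilon>1' * N / L" using e1 C by (simp add: field_simps)
      then have "1 \<le> \<epsilon>1' * N / L" using C by linarith
      then show ?thesis unfolding J_def by (simp only: le_nat_iff le_floor_iff of_nat_1 of_int_1)
    qed
    have Jle: "real J \<le> \<epsilon>1 * N / L"
    proof -
      have "0 \<le> \<epsilon>1' * N / L" using e1 N0 C by simp
      then have "real J \<le> \<epsilon>1' * N / L" unfolding J_def by linarith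
      also have "\<dots> \<le> \<epsilon>1 * N / L" using e1 N0 C by (intro divide_right_mono mult_right_mono) auto
      finally show ?thesis .
    qed
    have regx: "mostly \<theta> (regular \<theta>' M)" if "1 \<le> M" for M
      using mostly_mono[OF mostly_regular[OF that th'(1,4)] th'(2)] by blast
    have regy: "mostly \<theta> (\<lambda>x. regular \<theta>' M (Y x))" if "1 \<le> M" for M
      by (rule ka(3)) (use mostly_mono[OF mostly_regular[OF that th'(1,4)] th'(3)] in blast)
    have M1: "1 \<le> 2 * q n" "1 \<le> 2 * N" using q_pos[of n] q_pos[of "Suc n"] by (auto simp: N_def)
    have n': "m1 \<le> n" "m2 \<le> Suc n" using n by auto
    have big: "mostly (\<theta> + (\<theta> + (\<theta> + (\<theta> + (\<theta> + (\<theta> + \<theta>))))))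
      (\<lambda>x. \<bar>disc (int (q n)) x\<bar> \<le> \<epsilon>6 \<and> \<bar>disc (int N) x\<bar> \<le> \<epsilon>4 \<and> regular \<theta>' (2 * q n) x \<and> regular \<theta>' (2 * N) x \<and>
        regular \<theta>' J x \<and> regular \<theta>' (2 * q n) (Y x) \<and> regular \<theta>' (2 * N) (Y x))"
      unfolding N_def
      by (intro mostly_conj m1 m2 regx regy n' J1 M1 M1[unfolded N_def])
    have Cq: "4 \<le> q n" and C1: "1 \<le> L" using C by auto
    have goal: "\<exists>i \<delta>. \<bar>of_int i\<bar> \<le> \<epsilon>1 * N / L \<and> \<bar>\<delta>\<bar> \<le> \<epsilon>3 / (N * L) \<and> Y x = frac (x + of_int i * \<alpha> + \<delta>)"
      if g: "\<bar>disc (int (q n)) x\<bar> \<le> \<epsilon>6 \<and> \<bar>disc (int N) x\<bar> \<le> \<epsilon>4 \<and> regular \<theta>' (2 * q n) x \<and> regular \<theta>' (2 * N) x \<and>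
        regular \<theta>' J x \<and> regular \<theta>' (2 * q n) (Y x) \<and> regular \<theta>' (2 * N) (Y x)" for x
    proof -
      have "\<exists>i \<delta>. \<bar>i\<bar> \<le> int J \<and> \<bar>\<delta>\<bar> \<le> 4 * \<epsilon>4 / ((am - ap) * q (Suc n) * ln (real (q n))) \<and> frac (Y x) = frac (x + of_int i * \<alpha> + \<delta>)"
        unfolding L_def[symmetric]
        by (rule match_core[OF L_def Cq th'(1,4) e1(1) e4 e6(1) C1 C(5)[unfolded c_def] C(6,7) C(2,3) TN[folded L_def] T
          e6(2)[unfolded c_def] e14 J_def[unfolded N_def]]) (use g in \<open>auto simp: disc_def N_def\<close>)
      then obtain i \<delta> where i: "\<bar>i\<bar> \<le> int J" "\<bar>\<delta>\<bar> \<le> 4 * \<epsilon>4 / (c * N * L)" "frac (Y x) = frac (x + of_int i * \<alpha> + \<delta>)"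
        unfolding c_def N_def L_def by blast
      have "4 * \<epsilon>4 / (c * N * L) = \<epsilon>3 / (N * L)" using c0 by (simp add: \<epsilon>4_def)
      moreover have "\<bar>of_int i\<bar> \<le> \<epsilon>1 * N / L" using i(1) Jle by linarith
      moreover have "frac (Y x) = Y x" using Y_range by (simp add: frac_eq)
      ultimately have "\<bar>of_int i\<bar> \<le> \<epsilon>1 * N / L \<and> \<bar>\<delta>\<bar> \<le> \<epsilon>3 / (N * L) \<and> Y x = frac (x + of_int i * \<alpha> + \<delta>)"
        using i by (simp only:)
      then show ?thesis by blast
    qed
    show "mostly (7 * \<theta>) (\<lambda>x. \<exists>i \<delta>. \<bar>of_int i\<bar> \<le> \<epsilon>1 * q (Suc n) / ln (q n) \<and> \<bar>\<delta>\<bar> \<le> \<epsilon>3 / (q (Suc n) * ln (q n)) \<and>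
      Y x = frac (x + of_int i * \<alpha> + \<delta>))"
      unfolding L_def[symmetric] N_def[symmetric]
      by (rule mostly_mono[OF big]) (use goal in auto)
  qed
qed

end

section \<open>Drift of the match along an orbit\<close>

context base_map
begin

definition near_shift :: "nat \<Rightarrow> real \<Rightarrow> real \<Rightarrow> bool" where
  "near_shift M \<rho> x \<longleftrightarrow> (\<exists>e z. \<bar>e\<bar> < int M \<and> \<bar>Y x - (x + of_int e * \<alpha> + of_int z)\<bar> \<le> \<rho>)"

text \<open>All along the orbit \<open>Y (X j)\<close> is a shift of \<open>X j\<close> by
  \<open>e j * \<alpha> + \<delta>\<close> modulo 1, with \<open>e j = i + k j - j\<close> and the
  same \<open>\<delta>\<close>. The cocycle relation keeps \<open>bs (e j) (X j) + V (X j)\<close>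
  near its initial value, and \<open>V\<close> varies little between nearby good points. So the sums
  of lengths \<open>e j\<close> are locally nearly constant, and by sparseness few \<open>j\<close>
  have \<open>e1 \<le> \<bar>e j\<bar>\<close>.\<close>

lemma drift_core:
  fixes x \<delta> \<epsilon> H Kmax J0 d :: real and good :: "real \<Rightarrow> bool"
  assumes sparse: "sparse_threshold r e1"
    and x: "equivariant x" "bs (int N) x + V x < a * real R" and N: "N = q (Suc l)"
    and i: "Y x = frac (x + of_int i * \<alpha> + \<delta>)" "V x \<le> H" "\<bar>bs i x\<bar> + 2 * H + \<epsilon> \<le> a * E"
    and slow: "\<And>k. 0 \<le> k \<Longrightarrow> k < int R \<Longrightarrow> \<bar>bs k (x + of_int i * \<alpha> + \<delta>) - bs k (x + of_int i * \<alpha>)\<bar> \<le> \<epsilon>"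
    and g: "\<And>z. 0 \<le> z \<Longrightarrow> z < 1 \<Longrightarrow> good z \<Longrightarrow> V z \<le> H \<and> (\<forall>j. \<bar>j\<bar> \<le> E \<longrightarrow> 0 < pt z j) \<and> KS {-E..E} z \<le> Kmax"
    and gg: "\<And>z z'. 0 \<le> z \<Longrightarrow> z < 1 \<Longrightarrow> 0 \<le> z' \<Longrightarrow> z' < 1 \<Longrightarrow> good z \<Longrightarrow> good z' \<Longrightarrow> \<bar>z - z'\<bar> < r \<Longrightarrow>
      \<bar>Y z - Y z'\<bar> < \<epsilon> \<and> \<bar>V z - V z'\<bar> < \<epsilon>"
    and e: "0 < \<epsilon>" "\<epsilon> \<le> 1/6" and K0: "0 \<le> Kmax" and J0: "2 \<le> a * J0"
    and apart: "\<And>e z :: int. e \<noteq> 0 \<Longrightarrow> real_of_int \<bar>e\<bar> \<le> J0 \<Longrightarrow> d \<le> \<bar>of_int e * \<alpha> - of_int z\<bar>" and rd: "r + \<epsilon> \<le> d"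
  shows "real (card {j\<in>{..<N}. good (pt x (int j)) \<and> \<not> near_shift e1 \<bar>\<delta>\<bar> (pt x (int j))})
     \<le> 8 * sqrt (2400 * \<epsilon> / \<kappa>\<^sub>0) * real N + 16 * Cf * Kmax / \<kappa>\<^sub>0"
proof -
  define X where "X j = pt x (int j)" for j
  have X01: "0 \<le> X j" "X j < 1" for j by (auto simp: X_def pt_range)
  have "\<forall>j. \<exists>k. Y (X j) = pt (Y x) k \<and> V (X j) = V x + bs (int j) x - bs k (Y x)"
    using x(1) unfolding equivariant_def X_def by blast
  from choice[OF this] obtain k where k: "\<And>j. Y (X j) = pt (Y x) (k j)" "\<And>j. V (X j) = V x + bs (int j) x - bs (k j) (Y x)"
    by blast
  have kB: "0 \<le> k j" "k j < int R" if "j < N" for j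
    using fibre_index_bounds[of x j "k j", OF _ _ that x(2)] k[of j] by (auto simp: X_def)
  define y where "y = x + of_int i * \<alpha>"
  define e where "e j = i + k j - int j" for j
  have Yx: "bs m (Y x) = bs m (y + \<delta>)" "pt (Y x) m = pt (y + \<delta>) m" for m
    by (simp_all add: i(1) y_def bs_frac pt_frac)
  have bse: "\<bar>bs (e j) (X j) + V (X j) - (V x + bs i x)\<bar> \<le> \<epsilon>" if "j < N" for j
  proof -
    have "bs (int j + e j) x = bs (int j) x + bs (e j) (X j)" unfolding X_def bs_pt bs_cocycle ..
    moreover have "int j + e j = i + k j" by (simp add: e_def)
    moreover have "bs (i + k j) x = bs i x + bs (k j) y" unfolding y_def bs_cocycle ..
    ultimately have "bs (e j) (X j) + V (X j) - (V x + bs i x) = bs (k j) y - bs (k j) (y + \<delta>)"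
      using k(2)[of j] Yx by simp
    then show ?thesis using slow[OF kB[OF that]] by (simp add: y_def abs_minus_commute)
  qed
  have YX: "\<exists>z. Y (X j) = X j + of_int (e j) * \<alpha> + \<delta> + of_int z" for j
  proof -
    define u where "u = x + of_int i * \<alpha> + \<delta> + of_int (k j) * \<alpha>"
    have "Y (X j) = frac u" unfolding k Yx by (simp add: pt_def y_def u_def)
    moreover have "u = X j + of_int (e j) * \<alpha> + \<delta> + of_int \<lfloor>x + of_int (int j) * \<alpha>\<rfloor>"
      by (simp add: u_def X_def pt_def e_def frac_def algebra_simps)
    ultimately have "Y (X j) = X j + of_int (e j) * \<alpha> + \<delta> + of_int (\<lfloor>x + of_int (int j) * \<alpha>\<rfloor> - \<lfloor>u\<rfloor>)"
      by (simp add: frac_def)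
    then show ?thesis by blast
  qed
  define S where "S = {j\<in>{..<N}. good (X j) \<and> int e1 \<le> \<bar>e j\<bar>}"
  have S: "finite S" "\<And>j. j \<in> S \<Longrightarrow> j < N" "\<And>j. j \<in> S \<Longrightarrow> good (X j)" "\<And>j. j \<in> S \<Longrightarrow> int e1 \<le> \<bar>e j\<bar>"
    by (auto simp: S_def)
  have sub: "{j\<in>{..<N}. good (pt x (int j)) \<and> \<not> near_shift e1 \<bar>\<delta>\<bar> (pt x (int j))} \<subseteq> S"
  proof
    fix j assume j: "j \<in> {j\<in>{..<N}. good (pt x (int j)) \<and> \<not> near_shift e1 \<bar>\<delta>\<bar> (pt x (int j))}"
    have "int e1 \<le> \<bar>e j\<bar>"
    proof (rule ccontr)
      assume "\<not> ?thesis"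
      moreover obtain z where "Y (X j) = X j + of_int (e j) * \<alpha> + \<delta> + of_int z" using YX by blast
      ultimately have "near_shift e1 \<bar>\<delta>\<bar> (X j)" unfolding near_shift_def
        by - (rule exI[of _ "e j"], rule exI[of _ z], auto)
      then show False using j by (simp add: X_def)
    qed
    then show "j \<in> S" using j by (simp add: S_def X_def)
  qed
  have sepX: "1 / (2 * real N) \<le> \<bar>X j - X j'\<bar>" if "j \<in> S" "j' \<in> S" "j \<noteq> j'" for j j'
    unfolding X_def N using that S(2)[OF that(1)] S(2)[OF that(2)] N by (intro pt_separated) auto
  have Npos: "0 < real N" using q_pos[of "Suc l"] N by simp
  have inj: "inj_on X S"
  proof (rule inj_onI, rule ccontr)
    fix j j' assume j: "j \<in> S" "j' \<in> S" "X j = X j'" "j \<noteq> j'"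
    have "0 < 1 / (2 * real N)" using Npos by simp
    then show False using sepX[OF j(1,2,4)] j(3) by simp
  qed
  define h where "h w = e (inv_into S X w)" for w
  have h: "h (X j) = e j" if "j \<in> S" for j using that inj by (simp add: h_def)
  have Ee: "\<bar>e j\<bar> \<le> E" if "j \<in> S" for j
  proof -
    have "a * real_of_int \<bar>e j\<bar> \<le> \<bar>bs (e j) (X j)\<bar>" using bs_abs_ge[of "e j" 0 "X j"] by (simp add: bs_0)
    also have "\<dots> \<le> \<bar>bs i x\<bar> + 2 * H + \<epsilon>"
      using bse[OF S(2)[OF that]] V_range[of x] V_range[of "X j"] i(2) g[OF X01 S(3)[OF that]] by linarith
    also have "\<dots> \<le> a * real_of_int E" by (rule i(3))
    finally show ?thesis using a_pos by simp
  qed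
  have "real (card (X ` S)) \<le> 4 * sqrt (800 * (3 * \<epsilon>) / \<kappa>\<^sub>0) / (1 / (2 * real N)) + 16 * Cf * Kmax / \<kappa>\<^sub>0"
  proof (rule sparse[unfolded sparse_threshold_def, rule_format, where e = h and E = E])
    show "finite (X ` S)" using S by simp
    show "X ` S \<subseteq> {0..<1}" using X01 by auto
    show "1 / (2 * real N) \<le> \<bar>v - w\<bar>" if "v \<in> X ` S" "w \<in> X ` S" "v \<noteq> w" for v w using that sepX by auto
    fix w assume "w \<in> X ` S"
    then obtain j where j: "j \<in> S" "w = X j" by blast
    show "int e1 \<le> \<bar>h w\<bar> \<and> \<bar>h w\<bar> \<le> E \<and> (\<forall>j. \<bar>j\<bar> \<le> E \<longrightarrow> 0 < pt w j) \<and> KS {-E..E} w \<le> Kmax"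
      unfolding j(2) h[OF j(1)] using S(4)[OF j(1)] Ee[OF j(1)] g[OF X01 S(3)[OF j(1)]] by blast
  next
    fix v w assume "v \<in> X ` S" "w \<in> X ` S" and rr: "\<bar>v - w\<bar> < r"
    then obtain j j' where j: "j \<in> S" "v = X j" "j' \<in> S" "w = X j'" by blast
    note c = gg[OF X01 X01 S(3)[OF j(1)] S(3)[OF j(3)] rr[unfolded j]]
    \<comment> \<open>One error from \<open>bse\<close> at each of the two points and one from the
      variation of \<open>V\<close>.\<close>
    have 1: "\<bar>bs (e j') (X j') - bs (e j) (X j)\<bar> \<le> 3 * \<epsilon>"
      using bse[OF S(2)[OF j(1)]] bse[OF S(2)[OF j(3)]] c by linarith
    \<comment> \<open>For nearby points the two shifts differ modulo 1 by less than
      \<open>r + \<epsilon>\<close>, which \<open>apart\<close> allows only if the indices agree or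
      differ by more than \<open>J0\<close>.\<close>
    have 2: "e j' = e j \<or> J0 \<le> real_of_int \<bar>e j' - e j\<bar>"
    proof (rule ccontr)
      assume neg: "\<not> ?thesis"
      obtain z z' where z: "Y (X j) = X j + of_int (e j) * \<alpha> + \<delta> + of_int z" "Y (X j') = X j' + of_int (e j') * \<alpha> + \<delta> + of_int z'"
        using YX[of j] YX[of j'] by blast
      have "of_int (e j' - e j) * \<alpha> - of_int (z - z') = (Y (X j') - Y (X j)) - (X j' - X j)"
        unfolding z by (simp add: algebra_simps)
      then have "\<bar>of_int (e j' - e j) * \<alpha> - of_int (z - z')\<bar> < r + \<epsilon>" using c rr j by linarith
      moreover have "d \<le> \<bar>of_int (e j' - e j) * \<alpha> - of_int (z - z')\<bar>" by (rule apart) (use neg in auto)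
      ultimately show False using rd by linarith
    qed
    show "\<bar>bs (h w) w - bs (h v) v\<bar> \<le> 3 * \<epsilon> \<and> (h w = h v \<or> J0 \<le> real_of_int \<bar>h w - h v\<bar>)"
      unfolding j(2,4) h[OF j(1)] h[OF j(3)] using 1 2 by blast
  qed (use \<open>0 < \<epsilon>\<close> \<open>\<epsilon> \<le> 1/6\<close> K0 J0 Npos in auto)
  then have "real (card S) \<le> 8 * sqrt (2400 * \<epsilon> / \<kappa>\<^sub>0) * real N + 16 * Cf * Kmax / \<kappa>\<^sub>0"
    using card_image[OF inj] by simp
  moreover have "card {j\<in>{..<N}. good (pt x (int j)) \<and> \<not> near_shift e1 \<bar>\<delta>\<bar> (pt x (int j))} \<le> card S"
    by (rule card_mono[OF S(1) sub])
  ultimately show ?thesis by linarith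
qed

text \<open>Regularity is assumed at \<open>x\<close>, not at the starting point
  \<open>x + i * \<alpha>\<close>. Writing the sum as a difference of sums of lengths
  \<open>i + k\<close> and \<open>i\<close> from \<open>x\<close> costs a factor 2.\<close>

lemma regular_slow_shift:
  assumes r: "regular \<eta> J x" and J: "1 \<le> J" and \<eta>: "0 < \<eta>" and m: "\<bar>i\<bar> \<le> int J" "\<bar>i + k\<bar> \<le> int J"
    and t: "\<bar>t\<bar> \<le> \<eta> / (24 * J)"
  shows "\<bar>bs k (x + of_int i * \<alpha> + t) - bs k (x + of_int i * \<alpha>)\<bar> \<le> 4 * Cf * (12 * J * ln (12 * J / \<eta>) / \<eta>) * \<bar>t\<bar>"
proof -
  have "bs (i + k) (x + t) = bs i (x + t) + bs k (x + of_int i * \<alpha> + t)"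
    using bs_cocycle[of i k "x + t"] by (simp add: algebra_simps)
  moreover have "bs (i + k) x = bs i x + bs k (x + of_int i * \<alpha>)" by (rule bs_cocycle)
  ultimately show ?thesis
    using regular_slow[OF r J \<eta> m(1) t] regular_slow[OF r J \<eta> m(2) t] by linarith
qed

text \<open>The order of choices is essential: \<open>e1\<close> comes from the almost uniform
  continuity of \<open>Y\<close> and \<open>V\<close>, before the precision \<open>\<rho>\<close>
  and the level \<open>n\<close> are chosen. If near shifts were confined to measure 1/8, some orbit
  of length \<open>q (Suc n)\<close> would have at most a fifth of its points near-shifted or not
  good, while \<open>drift_core\<close> allows at most a quarter that are good without a near shift;
  together these must exhaust the orbit.\<close>

theorem near_shift_often:
  assumes gaps: "\<And>(T::real) n0. \<exists>n\<ge>n0. T * q n * ln (q n) \<le> q (Suc n)"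
  shows "\<exists>e1. \<forall>\<rho>>0. \<not> mostly (1/8) (\<lambda>x. \<not> near_shift e1 \<rho> x)"
proof -
  define \<theta> :: real where "\<theta> = 1 / 100"
  have th: "0 < \<theta>" "\<theta> \<le> 1" by (auto simp: \<theta>_def)
  obtain H where H: "0 < H" "mostly \<theta> (\<lambda>x. V x \<le> H)" using mostly_V[OF th(1)] by blast
  define J0 where "J0 = 2 / a"
  have J0: "2 \<le> a * J0" using a_pos by (simp add: J0_def)
  obtain d where d: "0 < d" "\<And>e z :: int. e \<noteq> 0 \<Longrightarrow> real_of_int \<bar>e\<bar> \<le> J0 \<Longrightarrow> d \<le> \<bar>of_int e * \<alpha> - of_int z\<bar>"
    using int_multiples_apart[of J0] by blast
  \<comment> \<open>The factor \<open>64\<^sup>2\<close> brings the square-root term of the count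
    down to an eighth of the orbit; \<open>\<kappa>'\<close> below does the same for the term with
    \<open>Kmax\<close>.\<close>
  define \<epsilon> where "\<epsilon> = min (1/6) (min (d / 2) (\<kappa>\<^sub>0 / (2400 * 64\<^sup>2)))"
  have e: "0 < \<epsilon>" "\<epsilon> \<le> 1/6" "\<epsilon> \<le> d / 2" "\<epsilon> \<le> \<kappa>\<^sub>0 / (2400 * 64\<^sup>2)" using d \<kappa>\<^sub>0_pos by (auto simp: \<epsilon>_def)
  have sq: "8 * sqrt (2400 * \<epsilon> / \<kappa>\<^sub>0) \<le> 1 / 8"
  proof -
    have "sqrt (2400 * \<epsilon> / \<kappa>\<^sub>0) \<le> 1 / 64"
      by (rule real_le_lsqrt) (use e(1,4) \<kappa>\<^sub>0_pos in \<open>auto simp: field_simps power2_eq_square\<close>)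
    then show ?thesis by simp
  qed
  define \<kappa>' where "\<kappa>' = \<kappa>\<^sub>0 / (128 * Cf)"
  have k': "0 < \<kappa>'" "16 * Cf * \<kappa>' / \<kappa>\<^sub>0 = 1 / 8" using \<kappa>\<^sub>0_pos Cf_pos by (auto simp: \<kappa>'_def)
  obtain r0 L where r0: "0 < r0" and L: "mostly \<theta> L" and LYV: "\<And>x y. 0 \<le> x \<Longrightarrow> x < 1 \<Longrightarrow> 0 \<le> y \<Longrightarrow> y < 1 \<Longrightarrow> L x \<Longrightarrow> L y \<Longrightarrow> \<bar>x - y\<bar> < r0 \<Longrightarrow>
    \<bar>Y x - Y y\<bar> < \<epsilon> \<and> \<bar>V x - V y\<bar> < \<epsilon>"
    using almost_uniform_YV[OF e(1) th(1)] by auto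
  define r where "r = min r0 (d / 2)"
  have r: "0 < r" "r \<le> r0" "r + \<epsilon> \<le> d" using r0 d e by (auto simp: r_def min_def)
  obtain e1 where sparse: "sparse_threshold r e1"
    using sparse_orbit[OF r(1)] by blast
  \<comment> \<open>\<open>c3\<close> bounds the lengths \<open>E\<close> by a multiple of
    \<open>Jr\<close>, and \<open>c4\<close> the number of steps of \<open>Y x\<close>, with margin,
    by a multiple of \<open>N\<close>. Then \<open>\<epsilon>1\<close> makes \<open>KS\<close> at
    scale \<open>E\<close> at most \<open>\<kappa>' * N\<close>, its logarithm cancelling the one in
    \<open>Jr\<close>, and \<open>\<epsilon>3\<close> makes the effect of \<open>\<delta>\<close> on
    the sums at most \<open>\<epsilon>\<close>.\<close>
  define c3 where "c3 = (3 / \<theta> + 2 * H + 1) / a + 1"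
  define c4 where "c4 = (3 / \<theta> + H + 1) / a + 2"
  have c34: "1 \<le> c3" "1 \<le> c4" using th H a_pos by (auto simp: c3_def c4_def)
  define \<epsilon>1 where "\<epsilon>1 = \<kappa>' * \<theta> / (48 * c3)"
  define \<epsilon>3 where "\<epsilon>3 = \<epsilon> * \<theta> / (192 * Cf * c4)"
  have e1: "0 < \<epsilon>1" "48 * c3 * \<epsilon>1 / \<theta> = \<kappa>'" using k' th c34 by (auto simp: \<epsilon>1_def)
  have e3: "0 < \<epsilon>3" "192 * Cf * c4 * \<epsilon>3 / \<theta> = \<epsilon>" using e th c34 Cf_pos by (auto simp: \<epsilon>3_def)
  obtain T :: real and n1 where match: "\<And>n. n1 \<le> n \<Longrightarrow> T * q n * ln (q n) \<le> q (Suc n) \<Longrightarrow>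
    mostly (7 * \<theta>) (\<lambda>x. \<exists>i \<delta>. \<bar>of_int i\<bar> \<le> \<epsilon>1 * q (Suc n) / ln (q n) \<and> \<bar>\<delta>\<bar> \<le> \<epsilon>3 / (q (Suc n) * ln (q n)) \<and>
      Y x = frac (x + of_int i * \<alpha> + \<delta>))"
    using match[OF e1(1) e3(1) th] by blast
  have "\<not> mostly (1/8) (\<lambda>x. \<not> near_shift e1 \<rho> x)" if \<rho>: "0 < \<rho>" for \<rho>
  proof
    assume far: "mostly (1/8) (\<lambda>x. \<not> near_shift e1 \<rho> x)"
    define CC where "CC = max 4 (max \<epsilon>1 (max (12 * c3 * Cg / \<theta>) (max (12 * c4 * Cg / \<theta>) (max (24 * c4 * \<epsilon>3 / \<theta>) (\<epsilon>3 / \<rho>)))))"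
    obtain n2 where n2: "\<And>n. n2 \<le> n \<Longrightarrow> CC \<le> real (q n) \<and> CC \<le> ln (real (q n))"
      using ln_q_large[of CC] by blast
    obtain n where n: "max n1 n2 \<le> n" "max T (1 / \<epsilon>1) * q n * ln (q n) \<le> q (Suc n)" using gaps by blast
    define Q where "Q = real (q n)"
    define N where "N = q (Suc n)"
    define L0 where "L0 = ln Q"
    have C: "4 \<le> Q" "12 * c3 * Cg / \<theta> \<le> Q" "12 * c4 * Cg / \<theta> \<le> Q" "4 \<le> L0" "\<epsilon>1 \<le> L0" "24 * c4 * \<epsilon>3 / \<theta> \<le> L0" "\<epsilon>3 / \<rho> \<le> L0"
      using n2[of n] n unfolding CC_def max.bounded_iff L0_def Q_def by auto
    have QL: "0 < Q * L0" using C by simp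
    have TT: "T * Q * L0 \<le> N" "(1 / \<epsilon>1) * Q * L0 \<le> N"
    proof -
      have "T * (Q * L0) \<le> max T (1 / \<epsilon>1) * (Q * L0)" "(1 / \<epsilon>1) * (Q * L0) \<le> max T (1 / \<epsilon>1) * (Q * L0)"
        using QL by (intro mult_right_mono; simp)+
      then show "T * Q * L0 \<le> N" "(1 / \<epsilon>1) * Q * L0 \<le> N" using n(2) unfolding Q_def L0_def N_def by linarith+
    qed
    have N1: "1 \<le> N" using q_pos[of "Suc n"] by (simp add: N_def)
    have NQ: "real N \<le> Cg * Q\<^sup>2" using growth[of n] by (simp add: N_def Q_def)
    define Jr where "Jr = \<epsilon>1 * N / L0"
    have Jr: "1 \<le> Jr" "Jr \<le> N"
    proof -
      have "(1 / \<epsilon>1) * Q * L0 * \<epsilon>1 \<le> N * \<epsilon>1" using TT e1 by (intro mult_right_mono) auto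
      then have "Q * L0 \<le> \<epsilon>1 * N" using e1 by (simp add: mult_ac)
      moreover have "1 * L0 \<le> Q * L0" using C by (intro mult_right_mono) auto
      ultimately have "1 * L0 \<le> \<epsilon>1 * N" by linarith
      then show "1 \<le> Jr" using C by (simp add: Jr_def)
      have "\<epsilon>1 * N / L0 \<le> L0 * N / L0" using C by (intro divide_right_mono mult_right_mono) auto
      then show "Jr \<le> N" using C by (simp add: Jr_def)
    qed
    have logs: "ln (12 * M / \<theta>) \<le> 4 * L0" if M: "0 < M" "M \<le> c * N" "12 * c * Cg / \<theta> \<le> Q" "0 < c" for M c :: real
    proof -
      have "M \<le> c * (Cg * Q\<^sup>2)" using M NQ mult_left_mono[OF NQ, of c] by linarith
      then have "12 * M / \<theta> \<le> 12 * (c * (Cg * Q\<^sup>2)) / \<theta>" using th by (intro divide_right_mono mult_left_mono) auto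
      also have "\<dots> = (12 * c * Cg / \<theta>) * Q\<^sup>2" by simp
      also have "\<dots> \<le> Q * Q\<^sup>2" using M by (intro mult_right_mono) auto
      also have "\<dots> = Q ^ 3" by (simp add: power3_eq_cube power2_eq_square)
      finally have "ln (12 * M / \<theta>) \<le> ln (Q ^ 3)" using M th C by (subst ln_le_cancel_iff) auto
      also have "\<dots> = 3 * L0" using C by (simp add: ln_realpow L0_def)
      finally show ?thesis using C by linarith
    qed
    define J where "J = nat \<lfloor>Jr\<rfloor>"
    have J: "real J \<le> Jr" "J \<le> N"
    proof -
      show "real J \<le> Jr" using Jr unfolding J_def by linarith
      then show "J \<le> N" using Jr by linarith
    qed
    define E where "E = nat \<lceil>((2 * real J + 1) / \<theta> + 2 * H + 1) / a\<rceil>"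
    have E: "((2 * real J + 1) / \<theta> + 2 * H + 1) / a \<le> E" "real E \<le> c3 * Jr" "1 \<le> E"
    proof -
      have p: "0 < ((2 * real J + 1) / \<theta> + 2 * H + 1) / a" using th H a_pos by (intro divide_pos_pos add_nonneg_pos) auto
      then show "((2 * real J + 1) / \<theta> + 2 * H + 1) / a \<le> E" "1 \<le> E" unfolding E_def by linarith+
      have "real E \<le> ((2 * real J + 1) / \<theta> + 2 * H + 1) / a + 1" using p unfolding E_def by linarith
      also have "\<dots> \<le> ((3 * Jr) / \<theta> + 2 * H * Jr + 1 * Jr) / a + 1 * Jr"
        using J Jr th H a_pos by (intro add_mono divide_right_mono) auto
      also have "\<dots> = c3 * Jr" using a_pos th by (simp add: c3_def field_simps)
      finally show "real E \<le> c3 * Jr" .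
    qed
    have KSE: "12 * real E * ln (12 * real E / \<theta>) / \<theta> \<le> \<kappa>' * N"
    proof -
      have "ln (12 * real E / \<theta>) \<le> 4 * L0"
      proof (rule logs)
        have "c3 * Jr \<le> c3 * N" using Jr c34 by (intro mult_left_mono) auto
        then show "real E \<le> c3 * N" using E by linarith
      qed (use E C c34 in auto)
      then have "12 * real E * ln (12 * real E / \<theta>) \<le> 12 * real E * (4 * L0)" by (intro mult_left_mono) auto
      also have "\<dots> \<le> 12 * (c3 * Jr) * (4 * L0)" using E C by (intro mult_right_mono) auto
      also have "\<dots> = 48 * c3 * \<epsilon>1 * N" using C by (simp add: Jr_def)
      finally have "12 * real E * ln (12 * real E / \<theta>) / \<theta> \<le> 48 * c3 * \<epsilon>1 * N / \<theta>" using th by (intro divide_right_mono) auto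
      also have "\<dots> = \<kappa>' * N" unfolding e1(2)[symmetric] by simp
      finally show ?thesis .
    qed
    define R where "R = nat \<lceil>(3 / \<theta> + H + 1) / a * N\<rceil>"
    define R' where "R' = R + N"
    have R: "(3 / \<theta> + H + 1) * N \<le> a * R" "real R' \<le> c4 * N" "1 \<le> R'"
    proof -
      have "0 \<le> (3 / \<theta> + H + 1) / a * N" using th H a_pos by simp
      then have 1: "(3 / \<theta> + H + 1) / a * N \<le> R" "real R \<le> (3 / \<theta> + H + 1) / a * N + 1" unfolding R_def by linarith+
      then have "a * ((3 / \<theta> + H + 1) / a * N) \<le> a * R" using a_pos by (intro mult_left_mono) auto
      then show "(3 / \<theta> + H + 1) * N \<le> a * R" using a_pos by simp
      have "real R' \<le> (3 / \<theta> + H + 1) / a * N + 2 * N" using 1 N1 by (simp add: R'_def)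
      also have "\<dots> = c4 * N" by (simp add: c4_def algebra_simps)
      finally show "real R' \<le> c4 * N" .
      show "1 \<le> R'" using N1 by (simp add: R'_def)
    qed
    define good where "good z \<longleftrightarrow> L z \<and> V z \<le> H \<and> regular \<theta> E z" for z
    have "mostly (1/8 + (\<theta> + (\<theta> + \<theta>))) (\<lambda>z. \<not> near_shift e1 \<rho> z \<and> good z)"
      unfolding good_def by (intro mostly_conj far L H(2) mostly_regular E(3) th)
    \<comment> \<open>With the constant 5 the exceptional sets have total measure 5/8 + 26/100,
      still below 1, while a proportion 1/5 of bad indices remains.\<close>
    from mostly_orbit_average[OF this, where c = 5 and \<alpha> = \<alpha> and B = N]
    have "mostly ((1/8 + (\<theta> + (\<theta> + \<theta>))) * 5) (\<lambda>x. real (card {j\<in>{..<N}. \<not> (\<not> near_shift e1 \<rho> (frac (x + real j * \<alpha>)) \<and> good (frac (x + real j * \<alpha>)))}) \<le> real N / 5)"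
      by simp
    moreover have "mostly (7 * \<theta>) (\<lambda>x. \<exists>i \<delta>. \<bar>of_int i\<bar> \<le> Jr \<and> \<bar>\<delta>\<bar> \<le> \<epsilon>3 / (N * L0) \<and> Y x = frac (x + of_int i * \<alpha> + \<delta>))"
      using match[of n] n(1) TT(1) unfolding Jr_def N_def L0_def Q_def by simp
    moreover have "mostly \<theta> (\<lambda>x. \<forall>i. \<bar>i\<bar> \<le> int J \<longrightarrow> \<bar>bs i x\<bar> \<le> (2 * real J + 1) / \<theta>)"
      "mostly \<theta> (\<lambda>x. \<forall>i. \<bar>i\<bar> \<le> int N \<longrightarrow> \<bar>bs i x\<bar> \<le> (2 * real N + 1) / \<theta>)"
      by (rule mostly_bs_range[OF th(1)])+
    moreover have "mostly \<theta> (regular \<theta> R')" by (rule mostly_regular[OF R(3) th])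
    ultimately have "mostly (0 + (\<theta> + (7 * \<theta> + (\<theta> + (\<theta> + (\<theta> + (1/8 + (\<theta> + (\<theta> + \<theta>))) * 5))))))
      (\<lambda>x. equivariant x \<and> V x \<le> H \<and> (\<exists>i \<delta>. \<bar>of_int i\<bar> \<le> Jr \<and> \<bar>\<delta>\<bar> \<le> \<epsilon>3 / (N * L0) \<and> Y x = frac (x + of_int i * \<alpha> + \<delta>)) \<and>
        (\<forall>i. \<bar>i\<bar> \<le> int J \<longrightarrow> \<bar>bs i x\<bar> \<le> (2 * real J + 1) / \<theta>) \<and> (\<forall>i. \<bar>i\<bar> \<le> int N \<longrightarrow> \<bar>bs i x\<bar> \<le> (2 * real N + 1) / \<theta>) \<and> regular \<theta> R' x \<and>
        real (card {j\<in>{..<N}. \<not> (\<not> near_shift e1 \<rho> (frac (x + real j * \<alpha>)) \<and> good (frac (x + real j * \<alpha>)))}) \<le> real N / 5)"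
      using H mostly_equivariant by (intro mostly_conj) auto
    from mostly_D[OF this] obtain x where x: "equivariant x" "V x \<le> H"
        "\<exists>i \<delta>. \<bar>of_int i\<bar> \<le> Jr \<and> \<bar>\<delta>\<bar> \<le> \<epsilon>3 / (N * L0) \<and> Y x = frac (x + of_int i * \<alpha> + \<delta>)"
        "\<forall>i. \<bar>i\<bar> \<le> int J \<longrightarrow> \<bar>bs i x\<bar> \<le> (2 * real J + 1) / \<theta>" "\<forall>i. \<bar>i\<bar> \<le> int N \<longrightarrow> \<bar>bs i x\<bar> \<le> (2 * real N + 1) / \<theta>"
        "regular \<theta> R' x"
        "real (card {j\<in>{..<N}. \<not> (\<not> near_shift e1 \<rho> (frac (x + real j * \<alpha>)) \<and> good (frac (x + real j * \<alpha>)))}) \<le> real N / 5"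
      by (auto simp: \<theta>_def)
    obtain i \<delta> where i: "\<bar>of_int i\<bar> \<le> Jr" "\<bar>\<delta>\<bar> \<le> \<epsilon>3 / (N * L0)" "Y x = frac (x + of_int i * \<alpha> + \<delta>)" using x(3) by blast
    have iJ: "\<bar>i\<bar> \<le> int J" using i(1) Jr unfolding J_def by (simp add: le_nat_iff le_floor_iff nat_0_le)
    have N0: "0 < real N" using N1 by simp
    have d24: "\<bar>\<delta>\<bar> \<le> \<theta> / real (24 * R')"
    proof -
      have "24 * c4 * \<epsilon>3 \<le> L0 * \<theta>" using C th by (simp add: field_simps)
      then have "24 * (c4 * N) * \<epsilon>3 \<le> \<theta> * (N * L0)" using mult_right_mono[of "24 * c4 * \<epsilon>3" "L0 * \<theta>" "real N"] by (simp add: mult_ac)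
      moreover have "24 * real R' * \<epsilon>3 \<le> 24 * (c4 * N) * \<epsilon>3" using R e3 by (intro mult_right_mono) auto
      ultimately have "24 * real R' * \<epsilon>3 \<le> \<theta> * (N * L0)" by linarith
      then have "\<epsilon>3 / (N * L0) \<le> \<theta> / real (24 * R')" using N0 C R by (simp add: field_simps)
      then show ?thesis using i(2) by linarith
    qed
    have slow: "\<bar>bs k (x + of_int i * \<alpha> + \<delta>) - bs k (x + of_int i * \<alpha>)\<bar> \<le> \<epsilon>" if k: "0 \<le> k" "k < int R" for k
    proof -
      have "\<bar>bs k (x + of_int i * \<alpha> + \<delta>) - bs k (x + of_int i * \<alpha>)\<bar> \<le> 4 * Cf * (12 * real R' * ln (12 * real R' / \<theta>) / \<theta>) * \<bar>\<delta>\<bar>"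
        by (rule regular_slow_shift[OF x(6) R(3) th(1) _ _ d24]) (use iJ J k in \<open>auto simp: R'_def\<close>)
      also have "\<dots> \<le> 4 * Cf * (12 * (c4 * N) * (4 * L0) / \<theta>) * (\<epsilon>3 / (N * L0))"
      proof -
        have "ln (12 * real R' / \<theta>) \<le> 4 * L0" by (rule logs[of _ c4]) (use R C c34 in auto)
        then have "12 * real R' * ln (12 * real R' / \<theta>) \<le> 12 * real R' * (4 * L0)" by (intro mult_left_mono) auto
        also have "\<dots> \<le> 12 * (c4 * N) * (4 * L0)" using R C by (intro mult_right_mono) auto
        finally have "4 * Cf * (12 * real R' * ln (12 * real R' / \<theta>) / \<theta>) \<le> 4 * Cf * (12 * (c4 * N) * (4 * L0) / \<theta>)"
          using Cf_pos th by (intro mult_left_mono divide_right_mono) auto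
        moreover have "0 \<le> 4 * Cf * (12 * (c4 * N) * (4 * L0) / \<theta>)" using Cf_pos th c34 C by simp
        ultimately show ?thesis by (intro mult_mono[OF _ i(2)] abs_ge_zero)
      qed
      also have "\<dots> = 192 * Cf * c4 * \<epsilon>3 / \<theta>" using N0 C by simp
      finally show ?thesis using e3 by linarith
    qed
    have d\<rho>: "\<bar>\<delta>\<bar> \<le> \<rho>"
    proof -
      have "\<epsilon>3 / (N * L0) \<le> \<epsilon>3 / (1 * L0)" using N1 C e3 by (intro divide_left_mono mult_right_mono) auto
      also have "\<dots> \<le> \<rho>" using C \<rho> by (simp add: field_simps)
      finally show ?thesis using i(2) by linarith
    qed
    have "real (card {j\<in>{..<N}. good (pt x (int j)) \<and> \<not> near_shift e1 \<bar>\<delta>\<bar> (pt x (int j))})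
       \<le> 8 * sqrt (2400 * \<epsilon> / \<kappa>\<^sub>0) * real N + 16 * Cf * (\<kappa>' * N) / \<kappa>\<^sub>0"
    proof (rule drift_core[OF sparse x(1) _ N_def i(3) x(2) _ slow, where E = "int E" and ?J0.0 = J0 and d = d])
      show "bs (int N) x + V x < a * real R"
      proof -
        have "bs (int N) x \<le> (2 * real N + 1) / \<theta>" using x(5) by (auto simp: abs_le_iff)
        also have "\<dots> \<le> (3 * real N) / \<theta>" using N1 th by (intro divide_right_mono) auto
        finally have 1: "bs (int N) x \<le> 3 / \<theta> * N" by simp
        have "H * 1 \<le> H * N" using N1 H by (intro mult_left_mono) auto
        then have "bs (int N) x + V x < 3 / \<theta> * N + H * N + 1 * N" using 1 x(2) N0 by linarith
        also have "\<dots> = (3 / \<theta> + H + 1) * N" by (simp add: algebra_simps)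
        finally show ?thesis using R(1) by linarith
      qed
      show "\<bar>bs i x\<bar> + 2 * H + \<epsilon> \<le> a * real_of_int (int E)"
      proof -
        have "\<bar>bs i x\<bar> \<le> (2 * real J + 1) / \<theta>" using x(4) iJ by blast
        moreover have "(2 * real J + 1) / \<theta> + 2 * H + 1 \<le> a * E" using E(1) a_pos by (simp add: field_simps)
        ultimately show ?thesis using e by simp
      qed
      fix z assume z: "good z"
      then have rz: "regular \<theta> E z" by (simp add: good_def)
      have "0 < pt z j" if "\<bar>j\<bar> \<le> int E" for j
      proof -
        have "\<theta> / (12 * E) \<le> pt z j" using rz that by (simp add: regular_def)
        moreover have "0 < \<theta> / (12 * E)" using th E by simp
        ultimately show ?thesis by linarith
      qed
      moreover have "KS {- int E..int E} z \<le> \<kappa>' * N" using rz KSE unfolding regular_def by linarith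
      ultimately show "V z \<le> H \<and> (\<forall>j. \<bar>j\<bar> \<le> int E \<longrightarrow> 0 < pt z j) \<and> KS {- int E..int E} z \<le> \<kappa>' * N"
        using z unfolding good_def by blast
    next
      fix z z' assume "0 \<le> z" "z < 1" "0 \<le> z'" "z' < 1" "good z" "good z'" "\<bar>z - z'\<bar> < r"
      then show "\<bar>Y z - Y z'\<bar> < \<epsilon> \<and> \<bar>V z - V z'\<bar> < \<epsilon>" using LYV[of z z'] r unfolding good_def by auto
    next
      show "0 \<le> \<kappa>' * N" using k' by simp
    next
      show "\<And>e z :: int. e \<noteq> 0 \<Longrightarrow> real_of_int \<bar>e\<bar> \<le> J0 \<Longrightarrow> d \<le> \<bar>of_int e * \<alpha> - of_int z\<bar>" by (rule d(2))
    qed (use e J0 r in auto)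
    also have "\<dots> \<le> 1 / 8 * N + 1 / 8 * N"
    proof (rule add_mono)
      show "8 * sqrt (2400 * \<epsilon> / \<kappa>\<^sub>0) * real N \<le> 1 / 8 * N" using sq by (intro mult_right_mono) auto
      have "16 * Cf * (\<kappa>' * N) / \<kappa>\<^sub>0 = (16 * Cf * \<kappa>' / \<kappa>\<^sub>0) * N" by simp
      then show "16 * Cf * (\<kappa>' * N) / \<kappa>\<^sub>0 \<le> 1 / 8 * N" unfolding k'(2) by simp
    qed
    finally have few: "real (card {j\<in>{..<N}. good (pt x (int j)) \<and> \<not> near_shift e1 \<bar>\<delta>\<bar> (pt x (int j))}) \<le> N / 4" by simp
    have mono: "near_shift e1 \<rho> z" if "near_shift e1 \<bar>\<delta>\<bar> z" for z
      using that d\<rho> unfolding near_shift_def by (meson order.trans)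
    have "{..<N} \<subseteq> {j\<in>{..<N}. good (pt x (int j)) \<and> \<not> near_shift e1 \<bar>\<delta>\<bar> (pt x (int j))} \<union>
       {j\<in>{..<N}. \<not> (\<not> near_shift e1 \<rho> (pt x (int j)) \<and> good (pt x (int j)))}"
      using mono by auto
    from card_mono[OF _ this] have "N \<le> card ({j\<in>{..<N}. good (pt x (int j)) \<and> \<not> near_shift e1 \<bar>\<delta>\<bar> (pt x (int j))} \<union>
       {j\<in>{..<N}. \<not> (\<not> near_shift e1 \<rho> (pt x (int j)) \<and> good (pt x (int j)))})" by simp
    also have "\<dots> \<le> card {j\<in>{..<N}. good (pt x (int j)) \<and> \<not> near_shift e1 \<bar>\<delta>\<bar> (pt x (int j))} +
       card {j\<in>{..<N}. \<not> (\<not> near_shift e1 \<rho> (pt x (int j)) \<and> good (pt x (int j)))}" by (rule card_Un_le)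
    finally have "real N \<le> N / 4 + N / 5" using few x(7) by (simp add: pt_def)
    then show False using N0 by simp
  qed
  then show ?thesis by blast
qed

end

section \<open>From approximate matches to a constant time shift\<close>

lemma AE_circle_iff:
  assumes "S \<in> sets borel"
  shows "(AE x in circle. x \<notin> S) \<longleftrightarrow> measure circle S = 0"
  using AE_iff_null_sets[of S circle] circle.emeasure_eq_measure[of S] assms by (auto simp: null_sets_def)

context arnold_roof_flow
begin

lemma pt_inject: "pt x i = pt x j \<longleftrightarrow> i = j"
proof
  assume "pt x i = pt x j"
  then have "of_int (i - j) * \<alpha> = of_int (\<lfloor>x + of_int i * \<alpha>\<rfloor> - \<lfloor>x + of_int j * \<alpha>\<rfloor>)"
    by (simp add: pt_def frac_def algebra_simps)
  then show "i = j" by (metis alpha_mult_not_int right_minus_eq)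
qed simp

lemma pt_measurable [measurable]: "(\<lambda>x. pt x j) \<in> borel_measurable borel"
  unfolding pt_def by measurable

lemma bs_measurable:
  assumes [measurable]: "(\<lambda>x. f (frac x)) \<in> borel_measurable borel"
  shows "bs m \<in> borel_measurable borel"
proof -
  have "(\<lambda>x. f (frac (x + of_int j * \<alpha>))) \<in> borel_measurable borel" for j by measurable
  then show ?thesis unfolding bs_def[abs_def] GS_def pt_def by measurable
qed

end

context base_map
begin

definition matched :: "real \<Rightarrow> bool" where "matched x \<longleftrightarrow> (\<exists>i. Y x = pt x i)"

text \<open>With a bounded index only finitely many pairs \<open>(e, z)\<close> compete, so the
  infimum 0 of the distances is attained.\<close>

lemma matched_if_near:
  assumes "\<And>k::nat. near_shift M (1 / real (Suc k)) x" and x: "0 \<le> x" "x < 1"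
  shows "matched x"
proof -
  define P where "P = {- int M..int M} \<times> {- int M - 2..int M + 2}"
  define h where "h = (\<lambda>(e, z). \<bar>Y x - (x + of_int e * \<alpha> + of_int z)\<bar>)"
  have fin: "finite (h ` P)" by (simp add: P_def)
  have near: "\<exists>w\<in>P. h w \<le> 1 / real (Suc k)" for k
  proof -
    obtain e z where e: "\<bar>e\<bar> < int M" "\<bar>Y x - (x + of_int e * \<alpha> + of_int z)\<bar> \<le> 1 / real (Suc k)"
      using assms(1)[of k] unfolding near_shift_def by blast
    have "1 / real (Suc k) \<le> 1" by simp
    then have "\<bar>Y x - (x + of_int e * \<alpha> + of_int z)\<bar> \<le> 1" using e by linarith
    moreover have "\<bar>of_int e * \<alpha>\<bar> \<le> real M"
    proof -
      have "\<bar>of_int e\<bar> * \<bar>\<alpha>\<bar> \<le> real M * 1" using e alpha_pos alpha_less1 by (intro mult_mono) auto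
      then show ?thesis by (simp add: abs_mult)
    qed
    ultimately have "\<bar>real_of_int z\<bar> < real M + 3" using x Y_range[of x] by linarith
    then have "\<bar>z\<bar> \<le> int M + 2" by linarith
    then have "(e, z) \<in> P" using e by (auto simp: P_def)
    then show ?thesis using e by (intro bexI[of _ "(e, z)"]) (auto simp: h_def)
  qed
  have ne: "h ` P \<noteq> {}" using near[of 0] by auto
  define m where "m = Min (h ` P)"
  have "m \<le> 1 / real (Suc k)" for k
    using near[of k] fin unfolding m_def by (meson Min_le imageI order.trans)
  then have "m \<le> 0"
    using reals_Archimedean[of m] by (metis inverse_eq_divide linorder_not_less)
  moreover obtain e z where ez: "(e, z) \<in> P" "m = h (e, z)" using Min_in[OF fin ne] unfolding m_def by auto
  ultimately have "Y x = x + of_int e * \<alpha> + of_int z" by (simp add: h_def)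
  then have "frac (Y x) = frac (x + of_int e * \<alpha>)" by (simp only: frac_add_of_int_right)
  moreover have "frac (Y x) = Y x" using Y_range by (simp add: frac_eq)
  ultimately have "Y x = pt x e" by (simp add: pt_def)
  then show ?thesis unfolding matched_def by blast
qed

lemma Y_eq_pt_measurable: "{x. Y x = pt x i} \<in> sets borel"
proof -
  have "{x. Y x = pt x i} = {x. Y x \<le> frac (x + of_int i * \<alpha>)} \<inter> {x. frac (x + of_int i * \<alpha>) \<le> Y x}"
    by (auto simp: pt_def)
  also have "\<dots> \<in> sets borel"
  proof -
    have [measurable]: "(\<lambda>x. frac (x + of_int i * \<alpha>)) \<in> borel_measurable borel" by measurable
    show ?thesis
      using borel_measurable_le[OF Y_meas, of "\<lambda>x. frac (x + of_int i * \<alpha>)"] borel_measurable_le[OF _ Y_meas, of "\<lambda>x. frac (x + of_int i * \<alpha>)"]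
      by (intro sets.Int) simp_all
  qed
  finally show ?thesis .
qed

lemma matched_measurable: "{x. matched x} \<in> sets borel"
proof -
  have "{x. matched x} = (\<Union>i. {x. Y x = pt x i})" by (auto simp: matched_def)
  also have "\<dots> \<in> sets borel" by (intro sets.countable_UN' Y_eq_pt_measurable) auto
  finally show ?thesis .
qed

text \<open>The near-shift sets for precision \<open>1 / Suc k\<close> decrease and all have measure
  above 1/8 with one bound \<open>M\<close> on the index, so their intersection has measure at least
  1/8.\<close>

lemma matched_positive:
  assumes gaps: "\<And>(T::real) n0. \<exists>n\<ge>n0. T * q n * ln (q n) \<le> q (Suc n)"
  shows "0 < measure circle {x. matched x}"
proof -
  obtain M where M: "\<And>\<rho>. 0 < \<rho> \<Longrightarrow> \<not> mostly (1/8) (\<lambda>x. \<not> near_shift M \<rho> x)"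
    using near_shift_often[OF gaps] by blast
  define G where "G k = {x. near_shift M (1 / real (Suc k)) x \<and> x \<in> {0..<1}}" for k :: nat
  have G[measurable]: "G k \<in> sets borel" for k unfolding G_def near_shift_def by measurable
  have big: "1/8 < measure circle (G k)" for k
  proof (rule ccontr)
    assume "\<not> ?thesis"
    then have "mostly (1/8) (\<lambda>x. \<not> near_shift M (1 / real (Suc k)) x)"
      unfolding mostly_def by (intro bexI[OF _ G[of k]]) (auto simp: G_def)
    then show False using M[of "1 / real (Suc k)"] by simp
  qed
  have dec: "decseq G"
  proof (rule decseq_SucI, rule subsetI)
    fix k x assume x: "x \<in> G (Suc k)"
    have "1 / real (Suc (Suc k)) \<le> 1 / real (Suc k)" by (simp add: frac_le)
    then show "x \<in> G k" using x unfolding G_def near_shift_def by (blast intro: order.trans)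
  qed
  have "(\<lambda>k. measure circle (G k)) \<longlonglongrightarrow> measure circle (\<Inter>k. G k)"
    by (rule circle.finite_Lim_measure_decseq) (use dec in auto)
  then have "1/8 \<le> measure circle (\<Inter>k. G k)"
    by (rule LIMSEQ_le_const) (use big in \<open>auto intro: less_imp_le\<close>)
  also have "\<dots> \<le> measure circle {x. matched x}"
    by (rule circle.finite_measure_mono) (use matched_measurable in \<open>auto simp: G_def intro!: matched_if_near\<close>)
  finally show ?thesis by linarith
qed

text \<open>If \<open>Y x = pt x i\<close>, then \<open>(Y x, V x)\<close> is \<open>(x, 0)\<close>
  moved by the flow for time \<open>V x + bs i x\<close>. The sublevel sets \<open>S c\<close> of
  this time within the matched set are invariant, hence null or full. As the matched set has
  positive measure, some \<open>S c\<close> is full; so a single argument shows that almost every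
  point is matched and that the time is constant.\<close>

theorem flow_shift:
  assumes gaps: "\<And>(T::real) n0. \<exists>n\<ge>n0. T * q n * ln (q n) \<le> q (Suc n)"
  shows "\<exists>t0. AE x in circle. \<exists>i. Y x = pt x i \<and> V x + bs i x = t0"
proof -
  define S where "S c = {x. \<exists>i. Y x = pt x i \<and> V x + bs i x \<le> c}" for c
  have S: "S c \<in> sets borel" for c
  proof -
    have "{x. V x + bs i x \<le> c} \<in> sets borel" for i
      using borel_measurable_add[OF V_meas bs_measurable[OF f_meas, of i]] by measurable
    then have "(\<Union>i. {x. Y x = pt x i} \<inter> {x. V x + bs i x \<le> c}) \<in> sets borel"
      by (intro sets.countable_UN' sets.Int Y_eq_pt_measurable) auto
    also have "(\<Union>i. {x. Y x = pt x i} \<inter> {x. V x + bs i x \<le> c}) = S c" by (auto simp: S_def)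
    finally show ?thesis .
  qed
  \<comment> \<open>When \<open>x\<close> advances by one step and \<open>Y x\<close> by
    \<open>k\<close>, the relative index changes by \<open>k - 1\<close>, and the cocycle relation
    leaves the elapsed time unchanged.\<close>
  have step: "Y (pt x 1) = pt (pt x 1) (i + k - 1) \<and> V (pt x 1) + bs (i + k - 1) (pt x 1) = V x + bs i x"
    if k: "Y (pt x 1) = pt (Y x) k" "V (pt x 1) = V x + bs 1 x - bs k (Y x)" and i: "Y x = pt x i" for x i k
  proof
    show "Y (pt x 1) = pt (pt x 1) (i + k - 1)" by (simp add: k i pt_pt)
    have "bs (i + k) x = bs 1 x + bs (i + k - 1) (pt x 1)"
      using bs_cocycle[of 1 "i + k - 1" x] by (simp add: bs_pt)
    moreover have "bs (i + k) x = bs i x + bs k (Y x)" by (simp add: i bs_pt bs_cocycle)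
    ultimately show "V (pt x 1) + bs (i + k - 1) (pt x 1) = V x + bs i x" using k by linarith
  qed
  have inv: "AE x in circle. x \<in> S c \<longleftrightarrow> frac (x + \<alpha>) \<in> S c" for c
    using cocycle
  proof eventually_elim
    fix x assume "\<forall>m. \<exists>k. Y (pt x m) = pt (Y x) k \<and> V (pt x m) = V x + bs m x - bs k (Y x)"
    then obtain k where k: "Y (pt x 1) = pt (Y x) k" "V (pt x 1) = V x + bs 1 x - bs k (Y x)" by blast
    have "frac (x + \<alpha>) = pt x 1" by (simp add: pt_def)
    moreover have "x \<in> S c \<longleftrightarrow> pt x 1 \<in> S c"
    proof
      assume "x \<in> S c"
      then show "pt x 1 \<in> S c" unfolding S_def using step[OF k] by force
    next
      assume "pt x 1 \<in> S c"
      then obtain i where i: "Y (pt x 1) = pt (pt x 1) i" "V (pt x 1) + bs i (pt x 1) \<le> c" unfolding S_def by blast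
      have "frac (Y x) = Y x" using Y_range by (simp add: frac_eq)
      then have "Y x = pt (pt (Y x) k) (- k)" by (simp add: pt_pt) (simp add: pt_def)
      also have "\<dots> = pt x (1 + i - k)" unfolding k(1)[symmetric] i(1) by (simp add: pt_pt)
      finally have Yx: "Y x = pt x (1 + i - k)" .
      from step[OF k Yx] i show "x \<in> S c" unfolding S_def using Yx by auto
    qed
    ultimately show "x \<in> S c \<longleftrightarrow> frac (x + \<alpha>) \<in> S c" by simp
  qed
  have zero_one: "(AE x in circle. x \<notin> S c) \<or> (AE x in circle. x \<in> S c)" for c
    using rotation_ergodic[OF S inv[of c]] AE_circle_iff[OF S, of c] AE_circle_iff[of "UNIV - S c"] S[of c] by auto
  \<comment> \<open>The constant value of the time is the threshold at which \<open>S c\<close>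
    passes from null to full.\<close>
  define C where "C = {c. AE x in circle. x \<in> S c}"
  have not_both: "\<not> ((AE x in circle. x \<notin> A) \<and> (AE x in circle. x \<in> A))" for A
  proof
    assume "(AE x in circle. x \<notin> A) \<and> (AE x in circle. x \<in> A)"
    then have "AE x in circle. False" by auto
    then show False using AE_circle_iff[of UNIV] measure_circle_UNIV by simp
  qed
  have "\<exists>n::nat. real n \<in> C"
  proof (rule ccontr)
    assume "\<not> ?thesis"
    then have "\<forall>n::nat. AE x in circle. x \<notin> S (real n)" using zero_one unfolding C_def by blast
    then have "AE x in circle. \<forall>n::nat. x \<notin> S (real n)" by (simp add: AE_all_countable)
    moreover have "(\<forall>n::nat. x \<notin> S (real n)) \<Longrightarrow> \<not> matched x" for x
      unfolding S_def matched_def using real_arch_simple by blast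
    ultimately have "AE x in circle. x \<notin> {x. matched x}" by auto
    then show False using AE_circle_iff[OF matched_measurable] matched_positive[OF gaps] by simp
  qed
  then have Cne: "C \<noteq> {}" by blast
  have mono: "x \<in> S c'" if "x \<in> S c" "c \<le> c'" for x c c' using that unfolding S_def by force
  have "\<exists>n::nat. - real n \<notin> C"
  proof (rule ccontr)
    assume "\<not> ?thesis"
    then have "\<forall>n::nat. AE x in circle. x \<in> S (- real n)" unfolding C_def by blast
    then have "AE x in circle. \<forall>n::nat. x \<in> S (- real n)" by (simp add: AE_all_countable)
    moreover have "\<not> (\<forall>n::nat. x \<in> S (- real n))" for x
    proof
      assume a: "\<forall>n::nat. x \<in> S (- real n)"
      then obtain i where i: "Y x = pt x i" unfolding S_def by blast
      obtain n :: nat where "- (V x + bs i x) < real n" using reals_Archimedean2 by blast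
      moreover obtain j where j: "Y x = pt x j" "V x + bs j x \<le> - real n" using a unfolding S_def by blast
      moreover have "i = j" using i j(1) pt_inject by metis
      ultimately show False by simp
    qed
    ultimately have "AE x in circle. False" by auto
    then show False using not_both[of UNIV] by auto
  qed
  then obtain n0 :: nat where n0: "- real n0 \<notin> C" by blast
  have Cup: "c' \<in> C" if "c \<in> C" "c \<le> c'" for c c'
    using that mono unfolding C_def by (auto elim: eventually_mono)
  have bdd: "bdd_below C" by (rule bdd_belowI[of _ "- real n0"]) (use Cup n0 in \<open>meson linorder_le_cases\<close>)
  define t0 where "t0 = Inf C"
  have up: "AE x in circle. x \<in> S (t0 + 1 / real (Suc n))" for n
  proof -
    obtain c where "c \<in> C" "c < t0 + 1 / real (Suc n)"
      using cInf_lessD[OF Cne, of "t0 + 1 / real (Suc n)"] unfolding t0_def by auto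
    then show ?thesis using Cup[of c] unfolding C_def by auto
  qed
  have low: "AE x in circle. x \<notin> S (t0 - 1 / real (Suc n))" for n
  proof -
    have "t0 - 1 / real (Suc n) \<notin> C"
    proof
      assume "t0 - 1 / real (Suc n) \<in> C"
      from cInf_lower[OF this bdd] show False by (simp add: t0_def)
    qed
    then show ?thesis using zero_one unfolding C_def by blast
  qed
  have "AE x in circle. \<forall>n. x \<in> S (t0 + 1 / real (Suc n)) \<and> x \<notin> S (t0 - 1 / real (Suc n))"
    using up low by (simp add: AE_all_countable)
  then have "AE x in circle. \<exists>i. Y x = pt x i \<and> V x + bs i x = t0"
  proof eventually_elim
    fix x assume x: "\<forall>n. x \<in> S (t0 + 1 / real (Suc n)) \<and> x \<notin> S (t0 - 1 / real (Suc n))"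
    then obtain i where i: "Y x = pt x i" unfolding S_def by blast
    have 1: "V x + bs i x \<le> t0 + 1 / real (Suc n)" for n
    proof -
      obtain j where j: "Y x = pt x j" "V x + bs j x \<le> t0 + 1 / real (Suc n)" using x unfolding S_def by blast
      have "i = j" using i j(1) pt_inject by metis
      then show ?thesis using j by simp
    qed
    have 2: "t0 - 1 / real (Suc n) < V x + bs i x" for n
    proof -
      have "\<not> V x + bs i x \<le> t0 - 1 / real (Suc n)" using x i unfolding S_def by blast
      then show ?thesis by linarith
    qed
    have "V x + bs i x = t0"
    proof (rule ccontr)
      assume "V x + bs i x \<noteq> t0"
      then have "0 < \<bar>V x + bs i x - t0\<bar>" by simp
      then obtain n where "inverse (real (Suc n)) < \<bar>V x + bs i x - t0\<bar>" using reals_Archimedean by blast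
      then show False using 1[of n] 2[of n] by (simp add: inverse_eq_divide abs_if split: if_splits)
    qed
    then show "\<exists>i. Y x = pt x i \<and> V x + bs i x = t0" using i by blast
  qed
  then show ?thesis by blast
qed

end

section \<open>The special flow\<close>

lemma nn_integral_lborel_shift:
  fixes h :: "real \<Rightarrow> ennreal"
  assumes "h \<in> borel_measurable borel"
  shows "(\<integral>\<^sup>+u. h (u + t) \<partial>lborel) = (\<integral>\<^sup>+u. h u \<partial>lborel)"
  using nn_integral_real_affine[OF assms, of 1 t] by (simp add: add.commute)

lemma sets_borel_pair: "sets (borel \<Otimes>\<^sub>M borel) = sets (lborel :: (real \<times> real) measure)"
  by (simp only: borel_prod sets_lborel)

text \<open>Measurability is stated for \<open>f (frac x)\<close> because the values of
  \<open>f\<close> outside \<open>{0..<1}\<close> are unrestricted.\<close>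

locale arnold_flow = arnold_roof_flow +
  assumes f_meas: "(\<lambda>x. f (frac x)) \<in> borel_measurable borel"
    and f_int: "(\<integral>\<^sup>+x. ennreal (f (frac x)) \<partial>circle) = 1"
begin

abbreviation X :: "(real \<times> real) set" where "X \<equiv> special_flow_space f"

definition idx :: "real \<Rightarrow> real \<Rightarrow> int" where
  "idx x u = (THE m. bs m x \<le> u \<and> u < bs (m + 1) x)"

text \<open>The flow applied to \<open>(x, 0)\<close> for time \<open>u\<close>, with any real
  \<open>x\<close>. In this coordinate the flow is a translation of \<open>u\<close>, and
  \<open>orbit_pt_pt\<close> gives the identifications between different base points.\<close>

definition orbit_pt :: "real \<Rightarrow> real \<Rightarrow> real \<times> real" where
  "orbit_pt x u = (pt x (idx x u), u - bs (idx x u) x)"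

lemma idx_eqI: "bs m x \<le> u \<Longrightarrow> u < bs (m + 1) x \<Longrightarrow> idx x u = m"
  unfolding idx_def
proof (rule the_equality)
  fix k assume m: "bs m x \<le> u" "u < bs (m + 1) x" and k: "bs k x \<le> u \<and> u < bs (k + 1) x"
  have "bs m x < bs (k + 1) x" "bs k x < bs (m + 1) x" using m k by linarith+
  then show "k = m" unfolding bs_less_iff by linarith
qed simp

text \<open>Since the roof is at least \<open>a\<close>, about \<open>u / a\<close> steps pass
  \<open>u\<close> in the relevant direction; the index sought is the last one in this finite range
  whose sum does not exceed \<open>u\<close>.\<close>

lemma idx_exists: "\<exists>m. bs m x \<le> u \<and> u < bs (m + 1) x"
proof -
  define l where "l = min 0 \<lfloor>u / a\<rfloor>"
  define h where "h = max 0 (\<lfloor>u / a\<rfloor> + 1)"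
  have "a * of_int (0 - l) \<le> bs 0 x - bs l x" by (rule bs_mono_diff) (simp add: l_def)
  moreover have "u \<ge> a * of_int l \<or> l = 0 \<and> 0 \<le> u"
    using a_pos floor_divide_lower[OF a_pos, of u] by (auto simp: l_def min_def mult.commute zero_le_divide_iff)
  ultimately have l: "bs l x \<le> u" by (auto simp: bs_0)
  have "a * of_int (h - 0) \<le> bs h x - bs 0 x" by (rule bs_mono_diff) (simp add: h_def)
  moreover have "u < a * of_int h"
  proof -
    have "u / a < of_int h" unfolding h_def by linarith
    then show ?thesis using a_pos by (simp add: field_simps)
  qed
  ultimately have h: "u < bs h x" by (simp add: bs_0)
  define m where "m = Max {m\<in>{l..h}. bs m x \<le> u}"
  have fin: "finite {m\<in>{l..h}. bs m x \<le> u}" by (rule finite_subset[of _ "{l..h}"]) auto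
  have "l \<in> {m\<in>{l..h}. bs m x \<le> u}" using l by (auto simp: l_def h_def)
  then have m: "m \<in> {m\<in>{l..h}. bs m x \<le> u}" unfolding m_def by (intro Max_in fin) auto
  moreover have "\<not> bs (m + 1) x \<le> u"
  proof
    assume c: "bs (m + 1) x \<le> u"
    have "m \<noteq> h" using m h by auto
    then have "m + 1 \<in> {m\<in>{l..h}. bs m x \<le> u}" using m c by auto
    from Max_ge[OF fin this] show False by (simp add: m_def)
  qed
  ultimately show ?thesis by (intro exI[of _ m]) auto
qed

lemma idx_bounds: "bs (idx x u) x \<le> u" "u < bs (idx x u + 1) x"
proof -
  obtain m where "bs m x \<le> u" "u < bs (m + 1) x" using idx_exists by blast
  then show "bs (idx x u) x \<le> u" "u < bs (idx x u + 1) x" using idx_eqI by auto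
qed

lemma orbit_pt_eq: "bs m x \<le> u \<Longrightarrow> u < bs (m + 1) x \<Longrightarrow> orbit_pt x u = (pt x m, u - bs m x)"
  using idx_eqI by (simp add: orbit_pt_def)

lemma special_flow_eq: "special_flow \<alpha> f t (x, s) = orbit_pt x (s + t)"
  by (simp add: special_flow_def orbit_pt_def idx_def bs_eq rotation_pow_def rotation_def pt_def Let_def)

lemma orbit_pt_in: "orbit_pt x u \<in> X"
  using idx_bounds[where x = x and u = u] pt_range bs_Suc[of "idx x u" x]
  by (auto simp: orbit_pt_def special_flow_space_def)

lemma orbit_pt_id: "(x, s) \<in> X \<Longrightarrow> orbit_pt x s = (x, s)"
proof -
  assume "(x, s) \<in> X"
  then have x: "0 \<le> x" "x < 1" "0 \<le> s" "s < f x" by (auto simp: special_flow_space_def)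
  have p: "pt x 0 = x" using x by (simp add: pt_def frac_eq)
  have "orbit_pt x s = (pt x 0, s - bs 0 x)"
    by (rule orbit_pt_eq) (use x p bs_1[of x] in \<open>auto simp: bs_0\<close>)
  then show ?thesis by (simp add: p bs_0)
qed

lemma orbit_pt_pt: "orbit_pt (pt x m) v = orbit_pt x (v + bs m x)"
proof -
  define k where "k = idx (pt x m) v"
  have c: "bs (m + j) x = bs m x + bs j (pt x m)" for j by (simp add: bs_pt bs_cocycle)
  have "orbit_pt x (v + bs m x) = (pt x (m + k), v + bs m x - bs (m + k) x)"
    by (rule orbit_pt_eq) (use idx_bounds[where x = "pt x m" and u = v] c[of k] c[of "k + 1"] in \<open>auto simp: k_def add.assoc\<close>)
  then show ?thesis by (simp add: c) (simp add: orbit_pt_def k_def pt_pt)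
qed

lemma flow_orbit_pt: "special_flow \<alpha> f t (orbit_pt x u) = orbit_pt x (u + t)"
proof -
  have "special_flow \<alpha> f t (orbit_pt x u) = orbit_pt (pt x (idx x u)) (u - bs (idx x u) x + t)"
    by (simp add: orbit_pt_def[of x u] special_flow_eq)
  then show ?thesis by (simp add: orbit_pt_pt algebra_simps)
qed

lemma flow_flow: "w \<in> X \<Longrightarrow> special_flow \<alpha> f t (special_flow \<alpha> f s w) = special_flow \<alpha> f (s + t) w"
  by (cases w) (simp add: special_flow_eq[of s] flow_orbit_pt, simp add: special_flow_eq add.assoc)

lemma flow_in: "special_flow \<alpha> f t w \<in> X"
  by (cases w) (simp add: special_flow_eq orbit_pt_in)

lemma flow_0: "w \<in> X \<Longrightarrow> special_flow \<alpha> f 0 w = w"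
  by (cases w) (simp add: special_flow_eq orbit_pt_id)

lemma orbit_pt_1: "orbit_pt (frac (x + \<alpha>)) v = orbit_pt x (v + f (frac x))"
  using orbit_pt_pt[of x 1 v] by (simp add: bs_1 pt_def)

text \<open>The index is a measurable function with countably many values, so the map is glued from
  countably many measurable maps.\<close>

lemma orbit_pt_measurable [measurable]:
  "(\<lambda>p. orbit_pt (fst p) (snd p)) \<in> borel \<Otimes>\<^sub>M borel \<rightarrow>\<^sub>M borel \<Otimes>\<^sub>M borel"
proof -
  have b: "(\<lambda>p. bs m (fst p)) \<in> borel_measurable (borel \<Otimes>\<^sub>M borel)" for m
    by (rule measurable_compose[OF measurable_fst bs_measurable[OF f_meas]])
  have i: "(\<lambda>p. idx (fst p) (snd p)) \<in> borel \<Otimes>\<^sub>M borel \<rightarrow>\<^sub>M count_space UNIV"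
  proof (rule measurableI)
    fix A :: "int set"
    have "(\<lambda>p. idx (fst p) (snd p)) -` A \<inter> space (borel \<Otimes>\<^sub>M borel) =
      (\<Union>m\<in>A. {p. bs m (fst p) \<le> snd p} \<inter> {p. snd p < bs (m + 1) (fst p)})"
      using idx_bounds idx_eqI by (auto simp: space_pair_measure)
    also have "\<dots> \<in> sets (borel \<Otimes>\<^sub>M borel)"
    proof (intro sets.countable_UN'' sets.Int)
      fix m
      show "{p. bs m (fst p) \<le> snd p} \<in> sets (borel \<Otimes>\<^sub>M borel)" "{p. snd p < bs (m + 1) (fst p)} \<in> sets (borel \<Otimes>\<^sub>M borel)"
        using borel_measurable_le[OF b[of m] measurable_snd] borel_measurable_less[OF measurable_snd b[of "m + 1"]]
        by (simp_all add: space_pair_measure)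
    qed auto
    finally show "(\<lambda>p. idx (fst p) (snd p)) -` A \<inter> space (borel \<Otimes>\<^sub>M borel) \<in> sets (borel \<Otimes>\<^sub>M borel)" .
  qed simp
  have "(\<lambda>p. (pt (fst p) m, snd p - bs m (fst p))) \<in> borel \<Otimes>\<^sub>M borel \<rightarrow>\<^sub>M borel \<Otimes>\<^sub>M borel" for m
    by (intro measurable_Pair borel_measurable_diff b measurable_snd measurable_compose[OF measurable_fst pt_measurable])
  from measurable_compose_countable[OF this i] show ?thesis by (simp add: orbit_pt_def)
qed

lemma X_eq: "X = {p. 0 \<le> fst p \<and> fst p < 1 \<and> 0 \<le> snd p \<and> snd p < f (frac (fst p))}"
  by (auto simp: special_flow_space_def frac_eq)

lemma X_borel [measurable]: "X \<in> sets (borel \<Otimes>\<^sub>M borel)"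
proof -
  have b: "(\<lambda>p. f (frac (fst p))) \<in> borel_measurable (borel \<Otimes>\<^sub>M borel)"
    by (rule measurable_compose[OF measurable_fst f_meas])
  have "X = {p \<in> space (borel \<Otimes>\<^sub>M borel). 0 \<le> fst p} \<inter> {p \<in> space (borel \<Otimes>\<^sub>M borel). fst p < 1} \<inter>
      {p \<in> space (borel \<Otimes>\<^sub>M borel). 0 \<le> snd p} \<inter> {p \<in> space (borel \<Otimes>\<^sub>M borel). snd p < f (frac (fst p))}"
    unfolding X_eq by (auto simp: space_pair_measure)
  also have "\<dots> \<in> sets (borel \<Otimes>\<^sub>M borel)"
    by (intro sets.Int borel_measurable_less borel_measurable_le b measurable_fst measurable_snd measurable_const) auto
  finally show ?thesis .
qed

lemma flow_measurable [measurable]: "special_flow \<alpha> f t \<in> borel \<Otimes>\<^sub>M borel \<rightarrow>\<^sub>M borel \<Otimes>\<^sub>M borel"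
proof -
  have "(\<lambda>p. (fst p, snd p + t)) \<in> borel \<Otimes>\<^sub>M borel \<rightarrow>\<^sub>M (borel :: real measure) \<Otimes>\<^sub>M (borel :: real measure)" by measurable
  from measurable_compose[OF this orbit_pt_measurable]
  show ?thesis by (simp add: special_flow_eq[abs_def] case_prod_beta' flip: special_flow_eq)
qed

lemma nn_integral_X:
  assumes [measurable]: "h \<in> borel_measurable (borel \<Otimes>\<^sub>M borel)"
  shows "(\<integral>\<^sup>+p. h p * indicator X p \<partial>lborel) = (\<integral>\<^sup>+x. (\<integral>\<^sup>+s. h (x, s) * indicator {0..<f (frac x)} s \<partial>lborel) \<partial>circle)"
proof -
  note [measurable] = f_meas
  have "(\<lambda>p. h p * indicator X p) \<in> borel_measurable (lborel \<Otimes>\<^sub>M lborel)" by measurable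
  from lborel.nn_integral_fst[OF this]
  have "(\<integral>\<^sup>+p. h p * indicator X p \<partial>lborel) = (\<integral>\<^sup>+x. \<integral>\<^sup>+s. h (x, s) * indicator X (x, s) \<partial>lborel \<partial>lborel)"
    by (simp add: lborel_prod)
  also have "\<dots> = (\<integral>\<^sup>+x. (\<integral>\<^sup>+s. h (x, s) * indicator {0..<f (frac x)} s \<partial>lborel) * indicator {0..<1} x \<partial>lborel)"
    by (intro nn_integral_cong) (auto simp: X_eq indicator_def intro!: nn_integral_cong)
  also have "\<dots> = (\<integral>\<^sup>+x. (\<integral>\<^sup>+s. h (x, s) * indicator {0..<f (frac x)} s \<partial>lborel) \<partial>circle)"
  proof (rule nn_integral_circle[symmetric])
    have "(\<lambda>p. h p * indicator {p. 0 \<le> snd p \<and> snd p < f (frac (fst p))} p) \<in> borel_measurable (borel \<Otimes>\<^sub>M lborel)"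
    proof -
      have b: "(\<lambda>p. f (frac (fst p))) \<in> borel_measurable (borel \<Otimes>\<^sub>M borel)"
        by (rule measurable_compose[OF measurable_fst f_meas])
      have "{p. 0 \<le> snd p \<and> snd p < f (frac (fst p))} = {p \<in> space (borel \<Otimes>\<^sub>M borel). 0 \<le> snd p} \<inter> {p \<in> space (borel \<Otimes>\<^sub>M borel). snd p < f (frac (fst p))}"
        by (auto simp: space_pair_measure)
      also have "\<dots> \<in> sets (borel \<Otimes>\<^sub>M borel)"
        by (intro sets.Int borel_measurable_less borel_measurable_le b measurable_snd measurable_const) auto
      finally have [measurable]: "{p. 0 \<le> snd p \<and> snd p < f (frac (fst p))} \<in> sets (borel \<Otimes>\<^sub>M borel)" .
      show ?thesis by measurable
    qed
    from lborel.borel_measurable_nn_integral_fst[OF this]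
    show "(\<lambda>x. \<integral>\<^sup>+s. h (x, s) * indicator {0..<f (frac x)} s \<partial>lborel) \<in> borel_measurable borel"
      by (simp add: indicator_def)
  qed
  finally show ?thesis .
qed

text \<open>With \<open>F\<close> the indicator of \<open>B\<close> along orbits, the integral over
  times from 0 to \<open>t + f\<close> is split once at \<open>t\<close> and once at
  \<open>f\<close>. The pieces of length \<open>t\<close> at the two ends agree after integration
  over the circle, by \<open>orbit_pt_1\<close> and rotation invariance; being finite, they
  cancel.\<close>

lemma emeasure_flow_nonneg:
  assumes B: "B \<in> sets (borel \<Otimes>\<^sub>M borel)" and t: "0 \<le> t"
  shows "emeasure lborel {w\<in>X. special_flow \<alpha> f t w \<in> B} = emeasure lborel (X \<inter> B)"
proof -
  define F :: "real \<Rightarrow> real \<Rightarrow> ennreal" where "F x u = indicator B (orbit_pt x u)" for x u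
  have Fm: "(\<lambda>w. F (fst w) (snd w)) \<in> borel_measurable (borel \<Otimes>\<^sub>M borel)"
    unfolding F_def by (rule measurable_compose[OF orbit_pt_measurable]) (use B in measurable)
  have Fu[measurable]: "F x \<in> borel_measurable borel" for x
    using measurable_compose[OF measurable_Pair1' Fm, of x] by simp
  have Fs: "F (frac (x + \<alpha>)) u = F x (u + f (frac x))" for x u by (simp add: F_def orbit_pt_1)
  define I where "I l r = (\<integral>\<^sup>+x. (\<integral>\<^sup>+u. F x u * indicator {l x..<r x} u \<partial>lborel) \<partial>circle)" for l r :: "real \<Rightarrow> real"
  have Im: "(\<lambda>x. \<integral>\<^sup>+u. F x u * indicator {l x..<r x} u \<partial>lborel) \<in> borel_measurable circle"
    if l: "l \<in> borel_measurable borel" and r: "r \<in> borel_measurable borel" for l r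
  proof -
    have "{w \<in> space (borel \<Otimes>\<^sub>M borel). l (fst w) \<le> snd w} \<inter> {w \<in> space (borel \<Otimes>\<^sub>M borel). snd w < r (fst w)} \<in> sets (borel \<Otimes>\<^sub>M borel)"
      by (intro sets.Int borel_measurable_less borel_measurable_le measurable_compose[OF measurable_fst l] measurable_compose[OF measurable_fst r] measurable_snd)
    then have "(\<lambda>w. F (fst w) (snd w) * indicator ({w \<in> space (borel \<Otimes>\<^sub>M borel). l (fst w) \<le> snd w} \<inter> {w \<in> space (borel \<Otimes>\<^sub>M borel). snd w < r (fst w)}) w) \<in> borel_measurable (borel \<Otimes>\<^sub>M borel)"
      by (intro borel_measurable_times_ennreal Fm borel_measurable_indicator)
    also have "borel_measurable (borel \<Otimes>\<^sub>M borel) = borel_measurable ((borel::real measure) \<Otimes>\<^sub>M (lborel::real measure))"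
      by (intro measurable_cong_sets sets_pair_measure_cong) auto
    finally have m: "(\<lambda>w. F (fst w) (snd w) * indicator ({w \<in> space (borel \<Otimes>\<^sub>M borel). l (fst w) \<le> snd w} \<inter> {w \<in> space (borel \<Otimes>\<^sub>M borel). snd w < r (fst w)}) w) \<in> borel_measurable ((borel::real measure) \<Otimes>\<^sub>M (lborel::real measure))" .
    have "(\<lambda>x. \<integral>\<^sup>+u. F x u * indicator ({w \<in> space (borel \<Otimes>\<^sub>M borel). l (fst w) \<le> snd w} \<inter> {w \<in> space (borel \<Otimes>\<^sub>M borel). snd w < r (fst w)}) (x, u) \<partial>lborel) \<in> borel_measurable borel"
      using lborel.borel_measurable_nn_integral_fst[OF m] by (simp only: fst_conv snd_conv)
    moreover have "indicator ({w \<in> space (borel \<Otimes>\<^sub>M borel). l (fst w) \<le> snd w} \<inter> {w \<in> space (borel \<Otimes>\<^sub>M borel). snd w < r (fst w)}) (x, u) = (indicator {l x..<r x} u :: ennreal)" for x u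
      by (simp add: indicator_def space_pair_measure)
    ultimately show ?thesis by simp
  qed
  have Iadd: "I (\<lambda>x. 0) (\<lambda>x. t) + I (\<lambda>x. t) (\<lambda>x. t + f (frac x)) = I (\<lambda>x. f (frac x)) (\<lambda>x. f (frac x) + t) + I (\<lambda>x. 0) (\<lambda>x. f (frac x))"
  proof -
    have "I (\<lambda>x. 0) (\<lambda>x. t) + I (\<lambda>x. t) (\<lambda>x. t + f (frac x)) =
      (\<integral>\<^sup>+x. (\<integral>\<^sup>+u. F x u * indicator {0..<t} u \<partial>lborel) + (\<integral>\<^sup>+u. F x u * indicator {t..<t + f (frac x)} u \<partial>lborel) \<partial>circle)"
      unfolding I_def by (intro nn_integral_add[symmetric] Im) (use f_meas in auto)
    also have "\<dots> = (\<integral>\<^sup>+x. (\<integral>\<^sup>+u. F x u * indicator {f (frac x)..<f (frac x) + t} u \<partial>lborel) + (\<integral>\<^sup>+u. F x u * indicator {0..<f (frac x)} u \<partial>lborel) \<partial>circle)"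
    proof (intro nn_integral_cong)
      fix x
      have f0: "0 \<le> f (frac x)" using f_ge[of "frac x"] a_pos by (auto simp: frac_lt_1)
      have "(\<integral>\<^sup>+u. F x u * indicator {0..<t} u \<partial>lborel) + (\<integral>\<^sup>+u. F x u * indicator {t..<t + f (frac x)} u \<partial>lborel)
        = (\<integral>\<^sup>+u. F x u * indicator {0..<t} u + F x u * indicator {t..<t + f (frac x)} u \<partial>lborel)"
        by (intro nn_integral_add[symmetric]) auto
      also have "\<dots> = (\<integral>\<^sup>+u. F x u * indicator {f (frac x)..<f (frac x) + t} u + F x u * indicator {0..<f (frac x)} u \<partial>lborel)"
        using t f0 by (intro nn_integral_cong) (auto simp: indicator_def)
      also have "\<dots> = (\<integral>\<^sup>+u. F x u * indicator {f (frac x)..<f (frac x) + t} u \<partial>lborel) + (\<integral>\<^sup>+u. F x u * indicator {0..<f (frac x)} u \<partial>lborel)"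
        by (intro nn_integral_add) auto
      finally show "(\<integral>\<^sup>+u. F x u * indicator {0..<t} u \<partial>lborel) + (\<integral>\<^sup>+u. F x u * indicator {t..<t + f (frac x)} u \<partial>lborel)
        = (\<integral>\<^sup>+u. F x u * indicator {f (frac x)..<f (frac x) + t} u \<partial>lborel) + (\<integral>\<^sup>+u. F x u * indicator {0..<f (frac x)} u \<partial>lborel)" .
    qed
    also have "\<dots> = I (\<lambda>x. f (frac x)) (\<lambda>x. f (frac x) + t) + I (\<lambda>x. 0) (\<lambda>x. f (frac x))"
      unfolding I_def by (intro nn_integral_add Im) (use f_meas in auto)
    finally show ?thesis .
  qed
  have Ieq: "I (\<lambda>x. f (frac x)) (\<lambda>x. f (frac x) + t) = I (\<lambda>x. 0) (\<lambda>x. t)"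
  proof -
    have "(\<integral>\<^sup>+u. F x u * indicator {f (frac x)..<f (frac x) + t} u \<partial>lborel) = (\<integral>\<^sup>+u. F (frac (x + \<alpha>)) u * indicator {0..<t} u \<partial>lborel)" for x
    proof -
      have "(\<integral>\<^sup>+u. F x u * indicator {f (frac x)..<f (frac x) + t} u \<partial>lborel) =
        (\<integral>\<^sup>+u. F x (u + f (frac x)) * indicator {f (frac x)..<f (frac x) + t} (u + f (frac x)) \<partial>lborel)"
        by (intro nn_integral_lborel_shift[symmetric] borel_measurable_times_ennreal Fu borel_measurable_indicator) auto
      also have "\<dots> = (\<integral>\<^sup>+u. F (frac (x + \<alpha>)) u * indicator {0..<t} u \<partial>lborel)"
        by (intro nn_integral_cong) (auto simp: Fs indicator_def)
      finally show ?thesis .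
    qed
    then have "I (\<lambda>x. f (frac x)) (\<lambda>x. f (frac x) + t) = (\<integral>\<^sup>+x. (\<integral>\<^sup>+u. F (frac (x + \<alpha>)) u * indicator {0..<t} u \<partial>lborel) \<partial>circle)"
      by (simp add: I_def)
    also have "\<dots> = I (\<lambda>x. 0) (\<lambda>x. t)"
      unfolding I_def
      by (rule nn_integral_circle_rotation[where h = "\<lambda>x. \<integral>\<^sup>+u. F x u * indicator {0..<t} u \<partial>lborel"]) (use Im[of "\<lambda>x. 0" "\<lambda>x. t"] in simp)
    finally show ?thesis .
  qed
  have Ifin: "I (\<lambda>x. 0) (\<lambda>x. t) \<noteq> \<infinity>"
  proof -
    have "(\<integral>\<^sup>+u. F x u * indicator {0..<t} u \<partial>lborel) \<le> ennreal t" for x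
    proof -
      have "(\<integral>\<^sup>+u. F x u * indicator {0..<t} u \<partial>lborel) \<le> (\<integral>\<^sup>+u. indicator {0..<t} u \<partial>lborel)"
        by (intro nn_integral_mono) (auto simp: F_def indicator_def)
      then show ?thesis using t by simp
    qed
    then have "I (\<lambda>x. 0) (\<lambda>x. t) \<le> (\<integral>\<^sup>+x. ennreal t \<partial>circle)" unfolding I_def by (intro nn_integral_mono) auto
    also have "\<dots> = ennreal t" by (simp add: emeasure_circle_UNIV)
    finally show ?thesis by (auto simp: top_unique)
  qed
  have main: "I (\<lambda>x. t) (\<lambda>x. t + f (frac x)) = I (\<lambda>x. 0) (\<lambda>x. f (frac x))"
    using Iadd Ifin unfolding Ieq ennreal_add_left_cancel by auto
  have em: "emeasure lborel (X \<inter> A) = (\<integral>\<^sup>+x. (\<integral>\<^sup>+s. indicator A (x, s) * indicator {0..<f (frac x)} s \<partial>lborel) \<partial>circle)"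
    if A: "A \<in> sets (borel \<Otimes>\<^sub>M borel)" for A
  proof -
    have "X \<inter> A \<in> sets lborel" using sets.Int[OF X_borel A] unfolding sets_borel_pair .
    then have "emeasure lborel (X \<inter> A) = (\<integral>\<^sup>+w. indicator (X \<inter> A) w \<partial>lborel)" by simp
    also have "\<dots> = (\<integral>\<^sup>+w. indicator A w * indicator X w \<partial>lborel)" by (intro nn_integral_cong) (auto simp: indicator_def)
    also have "\<dots> = (\<integral>\<^sup>+x. (\<integral>\<^sup>+s. indicator A (x, s) * indicator {0..<f (frac x)} s \<partial>lborel) \<partial>circle)"
      by (rule nn_integral_X) (use A in measurable)
    finally show ?thesis .
  qed
  define A where "A = {w. special_flow \<alpha> f t w \<in> B}"
  have A: "A \<in> sets (borel \<Otimes>\<^sub>M borel)"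
    using measurable_sets[OF flow_measurable B, of t] by (simp add: A_def vimage_def space_pair_measure)
  have "{w\<in>X. special_flow \<alpha> f t w \<in> B} = X \<inter> A" by (auto simp: A_def)
  also have "emeasure lborel (X \<inter> A) = I (\<lambda>x. t) (\<lambda>x. t + f (frac x))"
    unfolding em[OF A] I_def
  proof (rule nn_integral_cong)
    fix x
    have "(\<integral>\<^sup>+u. F x u * indicator {t..<t + f (frac x)} u \<partial>lborel) = (\<integral>\<^sup>+u. F x (u + t) * indicator {t..<t + f (frac x)} (u + t) \<partial>lborel)"
      by (intro nn_integral_lborel_shift[symmetric] borel_measurable_times_ennreal Fu borel_measurable_indicator) auto
    also have "\<dots> = (\<integral>\<^sup>+s. indicator A (x, s) * indicator {0..<f (frac x)} s \<partial>lborel)"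
      by (intro nn_integral_cong) (auto simp: F_def A_def special_flow_eq indicator_def)
    finally show "(\<integral>\<^sup>+s. indicator A (x, s) * indicator {0..<f (frac x)} s \<partial>lborel) = (\<integral>\<^sup>+u. F x u * indicator {t..<t + f (frac x)} u \<partial>lborel)" ..
  qed
  also have "\<dots> = I (\<lambda>x. 0) (\<lambda>x. f (frac x))" by (rule main)
  also have "\<dots> = emeasure lborel (X \<inter> B)"
  proof -
    have "AE x in circle. (\<integral>\<^sup>+u. F x u * indicator {0..<f (frac x)} u \<partial>lborel) = (\<integral>\<^sup>+s. indicator B (x, s) * indicator {0..<f (frac x)} s \<partial>lborel)"
    proof -
      have fibre: "(\<integral>\<^sup>+u. F x u * indicator {0..<f (frac x)} u \<partial>lborel) = (\<integral>\<^sup>+s. indicator B (x, s) * indicator {0..<f (frac x)} s \<partial>lborel)"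
        if x: "0 \<le> x" "x < 1" for x
      proof (intro nn_integral_cong)
        fix u
        show "F x u * indicator {0..<f (frac x)} u = indicator B (x, u) * indicator {0..<f (frac x)} u"
        proof (cases "u \<in> {0..<f (frac x)}")
          case True
          then have "orbit_pt x u = (x, u)" using x by (intro orbit_pt_id) (auto simp: X_eq)
          then show ?thesis by (simp add: F_def)
        qed simp
      qed
      have "AE x in circle. x \<in> {0..<1}"
        unfolding circle_def by (subst AE_density) (auto simp: indicator_def)
      then show ?thesis by (rule eventually_mono) (rule fibre, auto)
    qed
    then show ?thesis unfolding em[OF B] I_def by (intro nn_integral_cong_AE)
  qed
  finally show ?thesis .
qed

lemma emeasure_flow:
  assumes B: "B \<in> sets (borel \<Otimes>\<^sub>M borel)"
  shows "emeasure lborel {w\<in>X. special_flow \<alpha> f t w \<in> B} = emeasure lborel (X \<inter> B)"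
proof (cases "0 \<le> t")
  case True
  then show ?thesis by (rule emeasure_flow_nonneg[OF B])
next
  case False
  define A where "A = {w. special_flow \<alpha> f t w \<in> B}"
  have A: "A \<in> sets (borel \<Otimes>\<^sub>M borel)"
    using measurable_sets[OF flow_measurable B, of t] by (simp add: A_def vimage_def space_pair_measure)
  have "{w\<in>X. special_flow \<alpha> f (- t) w \<in> A} = X \<inter> B"
    by (auto simp: A_def flow_flow flow_0)
  then have "emeasure lborel (X \<inter> B) = emeasure lborel (X \<inter> A)"
    using emeasure_flow_nonneg[OF A, of "- t"] False by simp
  also have "X \<inter> A = {w\<in>X. special_flow \<alpha> f t w \<in> B}" by (auto simp: A_def)
  finally show ?thesis ..
qed

lemma X_lebesgue: "X \<in> sets lebesgue"
  using X_borel unfolding sets_borel_pair by (rule sets_completionI_sets)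

lemma AE_X: "(AE w in special_flow_measure f. P w) \<longleftrightarrow> (AE w in lborel. w \<in> X \<longrightarrow> P w)"
  unfolding special_flow_measure_def using X_lebesgue
  by (subst AE_restrict_space_iff) (auto simp: AE_completion_iff)

lemma sets_X: "A \<in> sets (special_flow_measure f) \<longleftrightarrow> A \<subseteq> X \<and> A \<in> sets lebesgue"
  unfolding special_flow_measure_def using X_lebesgue by (auto simp: sets_restrict_space_iff)

lemma space_X: "space (special_flow_measure f) = X"
  by (simp add: special_flow_measure_def)

lemma emeasure_X: "A \<subseteq> X \<Longrightarrow> emeasure (special_flow_measure f) A = emeasure lebesgue A"
  unfolding special_flow_measure_def using X_lebesgue by (intro emeasure_restrict_space) auto

text \<open>Extends invariance to the completed measure: a Lebesgue set is a Borel set up to a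
  subset of a Borel null set, and preimages of Borel null sets under the flow are null.\<close>

lemma flow_preimage:
  assumes A: "A \<in> sets (special_flow_measure f)"
  shows "special_flow \<alpha> f t -` A \<inter> X \<in> sets lebesgue \<and> emeasure lebesgue (special_flow \<alpha> f t -` A \<inter> X) = emeasure lebesgue A"
proof -
  obtain S N N' where SN: "A = S \<union> N" "N \<subseteq> N'" "N' \<in> null_sets lborel" "S \<in> sets lborel"
    using A sets_completionE[of A lborel] unfolding sets_X by blast
  define T where "T B = {w\<in>X. special_flow \<alpha> f t w \<in> B}" for B
  have T: "T B \<in> sets lborel" if "B \<in> sets lborel" for B
  proof -
    have B: "B \<in> sets (borel \<Otimes>\<^sub>M borel)" using that unfolding sets_borel_pair .
    have "T B = X \<inter> (special_flow \<alpha> f t -` B \<inter> space (borel \<Otimes>\<^sub>M borel))" by (auto simp: T_def space_pair_measure)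
    also have "\<dots> \<in> sets (borel \<Otimes>\<^sub>M borel)" by (rule sets.Int[OF X_borel measurable_sets[OF flow_measurable B]])
    finally show ?thesis unfolding sets_borel_pair .
  qed
  have eT: "emeasure lborel (T B) = emeasure lborel (X \<inter> B)" if "B \<in> sets lborel" for B
    unfolding T_def by (rule emeasure_flow[unfolded sets_borel_pair, OF that])
  have nullT: "T N' \<in> null_sets lborel"
  proof -
    have "N' \<in> sets lborel" using SN by auto
    moreover have "emeasure lborel (X \<inter> N') \<le> emeasure lborel N'" by (rule emeasure_mono) (use SN in auto)
    then have "emeasure lborel (X \<inter> N') = 0" using SN(3) by (simp add: null_sets_def)
    ultimately show ?thesis using T eT by (auto simp: null_sets_def)
  qed
  have TN: "T N \<in> null_sets lebesgue" "N \<in> null_sets lebesgue"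
    using null_sets_completion_subset[of "T N" "T N'" lborel] null_sets_completion_subset[of N N' lborel] nullT SN
      null_sets_completionI[of N' lborel] null_sets_completionI[of "T N'" lborel] by (auto simp: T_def)
  have eq: "special_flow \<alpha> f t -` A \<inter> X = T S \<union> T N" using SN(1) by (auto simp: T_def)
  have SX: "X \<inter> S = S" using A SN(1) unfolding sets_X by auto
  have TS: "T S \<in> sets lebesgue" using T SN(4) by auto
  have "emeasure lebesgue (T S \<union> T N) = emeasure lebesgue (T S)" by (rule emeasure_Un_null_set[OF TS TN(1)])
  also have "\<dots> = emeasure lborel (T S)" using T SN(4) by simp
  also have "\<dots> = emeasure lborel S" using eT[OF SN(4)] SX by simp
  also have "\<dots> = emeasure lebesgue S" using SN(4) by simp
  also have "\<dots> = emeasure lebesgue (S \<union> N)" using SN(4) TN(2) by (intro emeasure_Un_null_set[symmetric]) auto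
  finally have e: "emeasure lebesgue (T S \<union> T N) = emeasure lebesgue A" by (simp add: SN(1))
  have "T S \<union> T N \<in> sets lebesgue" by (intro sets.Un TS null_setsD2[OF TN(1)])
  then show ?thesis using e unfolding eq by blast
qed

lemma flow_measurable_lebesgue: "special_flow \<alpha> f t \<in> measurable (special_flow_measure f) (special_flow_measure f)"
proof (rule measurableI)
  show "special_flow \<alpha> f t w \<in> space (special_flow_measure f)" for w by (simp add: space_X flow_in)
  fix A assume "A \<in> sets (special_flow_measure f)"
  then show "special_flow \<alpha> f t -` A \<inter> space (special_flow_measure f) \<in> sets (special_flow_measure f)"
    using flow_preimage[of A t] by (simp add: sets_X space_X)
qed

lemma flow_distr: "distr (special_flow_measure f) (special_flow_measure f) (special_flow \<alpha> f t) = special_flow_measure f"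
proof (rule measure_eqI)
  fix A assume "A \<in> sets (distr (special_flow_measure f) (special_flow_measure f) (special_flow \<alpha> f t))"
  then have A: "A \<in> sets (special_flow_measure f)" by simp
  then have "A \<subseteq> X" by (simp add: sets_X)
  then show "emeasure (distr (special_flow_measure f) (special_flow_measure f) (special_flow \<alpha> f t)) A = emeasure (special_flow_measure f) A"
    using flow_preimage[OF A, of t] by (simp add: emeasure_distr[OF flow_measurable_lebesgue A] space_X emeasure_X)
qed simp

lemma flow_in_centralizer: "special_flow \<alpha> f t0 \<in> centralizer (special_flow_measure f) (special_flow \<alpha> f)"
proof -
  have inv: "special_flow \<alpha> f (- t) (special_flow \<alpha> f t w) = w" if "w \<in> X" for w t
    using that by (simp add: flow_flow flow_0)
  have "AE w in special_flow_measure f. special_flow \<alpha> f (- t) (special_flow \<alpha> f t w) = w" for t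
    unfolding AE_X using inv by auto
  from this[of t0] this[of "- t0"] have "automorphism (special_flow_measure f) (special_flow \<alpha> f t0)"
    unfolding automorphism_def by (intro conjI flow_measurable_lebesgue flow_distr bexI[OF _ flow_measurable_lebesgue[of "- t0"]]) auto
  moreover have "AE w in special_flow_measure f. special_flow \<alpha> f t0 (special_flow \<alpha> f t w) = special_flow \<alpha> f t (special_flow \<alpha> f t0 w)" for t
    unfolding AE_X by (auto simp: flow_flow add.commute)
  ultimately show ?thesis unfolding centralizer_def by blast
qed

end

section \<open>Reduction of the centralizer to the base\<close>

lemma sets_eq_fun:
  fixes h k :: "'a \<Rightarrow> real"
  assumes "h \<in> borel_measurable M" "k \<in> borel_measurable M"
  shows "{w \<in> space M. h w = k w} \<in> sets M"
proof -
  have "{w \<in> space M. h w = k w} = {w \<in> space M. h w \<le> k w} \<inter> {w \<in> space M. k w \<le> h w}" by auto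
  also have "\<dots> \<in> sets M" by (intro sets.Int borel_measurable_le assms)
  finally show ?thesis .
qed

lemma sets_eq_pair_fun:
  fixes h k :: "'a \<Rightarrow> real \<times> real"
  assumes "h \<in> M \<rightarrow>\<^sub>M borel \<Otimes>\<^sub>M borel" "k \<in> M \<rightarrow>\<^sub>M borel \<Otimes>\<^sub>M borel"
  shows "{w \<in> space M. h w = k w} \<in> sets M"
proof -
  have "{w \<in> space M. h w = k w} = {w \<in> space M. fst (h w) = fst (k w)} \<inter> {w \<in> space M. snd (h w) = snd (k w)}"
    by (auto simp: prod_eq_iff)
  also have "\<dots> \<in> sets M"
    by (intro sets.Int sets_eq_fun measurable_compose[OF assms(1) measurable_fst] measurable_compose[OF assms(2) measurable_fst]
        measurable_compose[OF assms(1) measurable_snd] measurable_compose[OF assms(2) measurable_snd])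
  finally show ?thesis .
qed

lemma AE_circle: "(AE x in circle. P x) \<longleftrightarrow> (AE x in lborel. x \<in> {0..<1} \<longrightarrow> P x)"
  unfolding circle_def by (subst AE_density) (auto simp: indicator_def)

lemma AE_circle_rotation:
  assumes "AE x in circle. P x" shows "AE x in circle. P (frac (x + t))"
proof -
  obtain N where N: "{x. \<not> P x} \<subseteq> N" "emeasure circle N = 0" "N \<in> sets borel"
    using assms by (auto elim!: AE_E)
  have "{x. frac (x + t) \<in> N} \<in> sets borel"
    using measurable_sets_borel[of "\<lambda>x. frac (x + t)" borel N] N(3) by (simp add: vimage_def)
  then have "{x. frac (x + t) \<in> N} \<in> null_sets circle"
    using emeasure_circle_rotation[OF N(3), of t] N(2) by (auto simp: null_sets_def)
  then show ?thesis by (rule AE_I') (use N(1) in auto)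
qed

lemma AE_lborel_shift:
  fixes c :: real
  assumes "AE u in lborel. P u" shows "AE u in lborel. P (u + c)"
proof -
  obtain N where N: "{x. \<not> P x} \<subseteq> N" "emeasure lborel N = 0" "N \<in> sets borel"
    using assms by (auto elim!: AE_E)
  have "{x. x + c \<in> N} \<in> sets borel"
    using measurable_sets_borel[of "\<lambda>x. x + c" borel N] N(3) by (simp add: vimage_def)
  then have "{x. x + c \<in> N} \<in> null_sets lborel"
    using emeasure_lborel_translate[OF N(3), of c] N(2) by (auto simp: null_sets_def)
  then show ?thesis by (rule AE_I') (use N(1) in auto)
qed

lemma AE_lborel_ex:
  fixes l r :: real
  assumes "AE u in lborel. P u" "l < r" shows "\<exists>u. l < u \<and> u < r \<and> P u"
proof (rule ccontr)
  assume "\<not> ?thesis"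
  then have "AE u in lborel. u \<notin> {l<..<r}" using assms(1) by (auto elim: eventually_mono)
  then have "emeasure lborel {l<..<r} = 0" by (subst (asm) AE_iff_null_sets[symmetric]) (auto simp: null_sets_def)
  then show False using assms(2) by simp
qed

context arnold_flow
begin

text \<open>Truncate the roof at a level \<open>n\<close> above which its excess has integral at
  most \<open>e / 2\<close>; on a set of the chosen measure the truncated part contributes at most
  the other half.\<close>

lemma f_absolutely_continuous:
  assumes e: "0 < e"
  shows "\<exists>d>0. \<forall>E\<in>sets borel. measure circle E \<le> d \<longrightarrow> (\<integral>\<^sup>+x. ennreal (f (frac x)) * indicator E x \<partial>circle) \<le> ennreal e"
proof -
  define h where "h n x = ennreal (min (f (frac x)) (real n))" for n :: nat and x
  define k where "k n x = ennreal (f (frac x) - min (f (frac x)) (real n))" for n :: nat and x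
  have m1: "(\<lambda>x. min (f (frac x)) (real n)) \<in> borel_measurable borel" for n
    by (intro borel_measurable_min f_meas borel_measurable_const)
  have hm: "h n \<in> borel_measurable borel" for n unfolding h_def by (intro measurable_compose[OF m1 measurable_ennreal])
  have km: "k n \<in> borel_measurable borel" for n unfolding k_def
    by (intro measurable_compose[OF borel_measurable_diff[OF f_meas m1] measurable_ennreal])
  have f0: "0 \<le> f (frac x)" for x using f_ge[of "frac x"] a_pos by (simp add: frac_lt_1 order.trans[OF less_imp_le])
  have hk: "h n x + k n x = ennreal (f (frac x))" for n x
    unfolding h_def k_def by (subst ennreal_plus[symmetric]) (use f0[of x] in auto)
  have "(SUP n. h n x) = ennreal (f (frac x))" for x
  proof (rule antisym)
    show "(SUP n. h n x) \<le> ennreal (f (frac x))" by (intro SUP_least) (auto simp: h_def intro!: ennreal_leI)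
    obtain n :: nat where "f (frac x) \<le> real n" using real_arch_simple by blast
    then have "h n x = ennreal (f (frac x))" by (simp add: h_def min_absorb1)
    then show "ennreal (f (frac x)) \<le> (SUP n. h n x)" by (metis SUP_upper UNIV_I)
  qed
  then have "(\<integral>\<^sup>+x. (SUP n. h n x) \<partial>circle) = 1" by (simp only: f_int)
  moreover have "(\<integral>\<^sup>+x. (SUP n. h n x) \<partial>circle) = (SUP n. \<integral>\<^sup>+x. h n x \<partial>circle)"
  proof (rule nn_integral_monotone_convergence_SUP)
    show "incseq h" by (auto simp: incseq_def le_fun_def h_def intro!: ennreal_leI)
  qed (use hm in simp)
  ultimately have sup1: "(SUP n. \<integral>\<^sup>+x. h n x \<partial>circle) = 1" by simp
  have "ennreal (1 - e / 2) < ennreal 1" by (rule ennreal_lessI) (use e in auto)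
  then have "\<exists>n. ennreal (1 - e / 2) < (\<integral>\<^sup>+x. h n x \<partial>circle)"
    unfolding ennreal_1 sup1[symmetric] less_SUP_iff by blast
  then obtain n where n: "ennreal (1 - e / 2) < (\<integral>\<^sup>+x. h n x \<partial>circle)" by blast
  have sum: "(\<integral>\<^sup>+x. h n x \<partial>circle) + (\<integral>\<^sup>+x. k n x \<partial>circle) = 1"
    using nn_integral_add[of "h n" circle "k n"] hm km f_int by (simp add: hk)
  have k2: "(\<integral>\<^sup>+x. k n x \<partial>circle) \<le> ennreal (e / 2)"
  proof (rule ccontr)
    assume "\<not> ?thesis"
    then have k: "ennreal (e / 2) \<le> (\<integral>\<^sup>+x. k n x \<partial>circle)" by simp
    have "1 \<le> ennreal (e / 2) + ennreal (1 - e / 2)"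
    proof (cases "e \<le> 2")
      case True
      then show ?thesis using e by (subst ennreal_plus[symmetric]) auto
    next
      case False
      then have "ennreal 1 \<le> ennreal (e / 2)" by (intro ennreal_leI) auto
      then show ?thesis by (simp add: add_increasing2)
    qed
    also have "\<dots> < ennreal (e / 2) + (\<integral>\<^sup>+x. h n x \<partial>circle)" unfolding ennreal_add_left_cancel_less using n by simp
    also have "\<dots> \<le> (\<integral>\<^sup>+x. k n x \<partial>circle) + (\<integral>\<^sup>+x. h n x \<partial>circle)" by (rule add_right_mono[OF k])
    finally show False using sum by (simp add: add.commute)
  qed
  show ?thesis
  proof (intro exI[of _ "e / (2 * (real n + 1))"] conjI ballI impI)
    show "0 < e / (2 * (real n + 1))" using e by simp
    fix E :: "real set" assume E: "E \<in> sets borel" "measure circle E \<le> e / (2 * (real n + 1))"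
    have "(\<integral>\<^sup>+x. ennreal (f (frac x)) * indicator E x \<partial>circle) \<le> (\<integral>\<^sup>+x. k n x + ennreal (real n) * indicator E x \<partial>circle)"
    proof (rule nn_integral_mono)
      fix x
      have "h n x \<le> ennreal (real n)" by (auto simp: h_def intro!: ennreal_leI)
      then show "ennreal (f (frac x)) * indicator E x \<le> k n x + ennreal (real n) * indicator E x"
        unfolding hk[of n x, symmetric] by (auto simp: indicator_def add.commute intro: add_left_mono)
    qed
    also have "\<dots> = (\<integral>\<^sup>+x. k n x \<partial>circle) + ennreal (real n) * emeasure circle E"
      using km E by (subst nn_integral_add) (auto simp: nn_integral_cmult_indicator)
    also have "\<dots> \<le> ennreal (e / 2) + ennreal (real n) * ennreal (e / (2 * (real n + 1)))"
      using E by (intro add_mono k2 mult_left_mono) (auto simp: circle.emeasure_eq_measure intro!: ennreal_leI)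
    also have "\<dots> = ennreal (e / 2 + real n * (e / (2 * (real n + 1))))"
    proof -
      have p: "0 \<le> e / (2 * (real n + 1))" using e by simp
      show ?thesis
        unfolding ennreal_mult[OF of_nat_0_le_iff p, symmetric]
        by (rule ennreal_plus[symmetric]) (use mult_nonneg_nonneg[OF of_nat_0_le_iff p] e in auto)
    qed
    also have "\<dots> \<le> ennreal e"
    proof (rule ennreal_leI)
      have "real n * (e / (2 * (real n + 1))) \<le> e / 2" using e by (simp add: field_simps)
      then show "e / 2 + real n * (e / (2 * (real n + 1))) \<le> e" by linarith
    qed
    finally show "(\<integral>\<^sup>+x. ennreal (f (frac x)) * indicator E x \<partial>circle) \<le> ennreal e" .
  qed
qed

lemma AE_flow:
  assumes "AE w in lborel. w \<in> X \<longrightarrow> P w" shows "AE w in lborel. w \<in> X \<longrightarrow> P (special_flow \<alpha> f t w)"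
proof -
  obtain N where N: "{w. \<not> (w \<in> X \<longrightarrow> P w)} \<subseteq> N" "emeasure lborel N = 0" "N \<in> sets lborel"
    using assms by (auto elim!: AE_E)
  have Nb: "N \<in> sets (borel \<Otimes>\<^sub>M borel)" using N(3) unfolding sets_borel_pair .
  have s: "{w\<in>X. special_flow \<alpha> f t w \<in> N} \<in> sets lborel"
  proof -
    have "{w\<in>X. special_flow \<alpha> f t w \<in> N} = X \<inter> (special_flow \<alpha> f t -` N \<inter> space (borel \<Otimes>\<^sub>M borel))" by (auto simp: space_pair_measure)
    also have "\<dots> \<in> sets (borel \<Otimes>\<^sub>M borel)" by (rule sets.Int[OF X_borel measurable_sets[OF flow_measurable Nb]])
    finally show ?thesis unfolding sets_borel_pair .
  qed
  have "emeasure lborel (X \<inter> N) \<le> emeasure lborel N" by (rule emeasure_mono) (use N in auto)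
  then have "{w\<in>X. special_flow \<alpha> f t w \<in> N} \<in> null_sets lborel"
    using emeasure_flow[OF Nb, of t] N(2) s by (auto simp: null_sets_def)
  then show ?thesis by (rule AE_I') (use N(1) flow_in in auto)
qed

lemma flow_fst_snd: "special_flow \<alpha> f t w = orbit_pt (fst w) (snd w + t)"
  by (cases w) (simp add: special_flow_eq)

text \<open>An automorphism is measurable for the completed measure only, while Fubini arguments and
  compositions with sections need Borel maps. Each coordinate agrees with a Borel function off a
  null set.\<close>

lemma borel_version:
  assumes \<phi>: "\<phi> \<in> measurable (special_flow_measure f) (special_flow_measure f)"
  shows "\<exists>\<phi>0 \<in> borel \<Otimes>\<^sub>M borel \<rightarrow>\<^sub>M borel \<Otimes>\<^sub>M borel. AE w in lborel. w \<in> X \<longrightarrow> \<phi> w = \<phi>0 w"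
proof -
  have co: "\<exists>h0 \<in> borel_measurable lborel. AE w in lborel. w \<in> X \<longrightarrow> h (\<phi> w) = h0 w"
    if h: "h \<in> borel_measurable lborel" for h :: "real \<times> real \<Rightarrow> real"
  proof -
    have "h \<in> borel_measurable (special_flow_measure f)"
      unfolding special_flow_measure_def by (intro measurable_restrict_space1 measurable_completion h)
    from measurable_compose[OF \<phi> this] have "(\<lambda>w. h (\<phi> w)) \<in> borel_measurable (lebesgue_on X)"
      unfolding special_flow_measure_def .
    from borel_measurable_if_I[OF this X_lebesgue]
    obtain h0 where h0: "h0 \<in> borel_measurable lborel" "AE w in lborel. (if w \<in> X then h (\<phi> w) else 0) = h0 w"
      using completion_ex_borel_measurable_real by blast
    from h0(2) have "AE w in lborel. w \<in> X \<longrightarrow> h (\<phi> w) = h0 w" by eventually_elim auto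
    then show ?thesis using h0(1) by blast
  qed
  have "fst \<in> borel_measurable (lborel :: (real \<times> real) measure)" "snd \<in> borel_measurable (lborel :: (real \<times> real) measure)"
    by (simp_all add: borel_measurable_continuous_onI continuous_on_fst continuous_on_snd)
  from co[OF this(1)] co[OF this(2)] obtain h1 h2 where h: "h1 \<in> borel_measurable lborel" "h2 \<in> borel_measurable lborel"
    "AE w in lborel. w \<in> X \<longrightarrow> fst (\<phi> w) = h1 w" "AE w in lborel. w \<in> X \<longrightarrow> snd (\<phi> w) = h2 w" by blast
  have c: "borel_measurable (lborel :: (real \<times> real) measure) = borel_measurable ((borel :: real measure) \<Otimes>\<^sub>M (borel :: real measure))"
    by (intro measurable_cong_sets sets_borel_pair[symmetric] refl)
  have "(\<lambda>w. (h1 w, h2 w)) \<in> borel \<Otimes>\<^sub>M borel \<rightarrow>\<^sub>M borel \<Otimes>\<^sub>M borel"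
    using h(1,2) unfolding c by (rule measurable_Pair)
  moreover have "AE w in lborel. w \<in> X \<longrightarrow> \<phi> w = (h1 w, h2 w)"
    using h(3,4) by eventually_elim (auto simp: prod_eq_iff)
  ultimately show ?thesis by (intro bexI[of _ "\<lambda>w. (h1 w, h2 w)"])
qed

text \<open>The base is a null set, so the value of the map at \<open>(x, 0)\<close> carries no
  information. By Fubini there is one height \<open>s0\<close> such that, for almost all
  \<open>x\<close>, commutation at \<open>(x, s0)\<close> holds for almost all times; flowing the
  image back by \<open>s0\<close> defines \<open>P0 x\<close>, which stands for the image of
  \<open>(x, 0)\<close>.\<close>

lemma commute_along_orbits:
  assumes \<phi>0: "\<phi>0 \<in> borel \<Otimes>\<^sub>M borel \<rightarrow>\<^sub>M borel \<Otimes>\<^sub>M borel"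
    and com: "\<And>t. AE w in lborel. w \<in> X \<longrightarrow> \<phi>0 (special_flow \<alpha> f t w) = special_flow \<alpha> f t (\<phi>0 w)"
  shows "\<exists>P0 \<in> borel \<rightarrow>\<^sub>M borel \<Otimes>\<^sub>M borel. (\<forall>x. P0 x \<in> X) \<and>
    (AE x in circle. AE u in lborel. \<phi>0 (orbit_pt x u) = special_flow \<alpha> f u (P0 x))"
proof -
  define M where "M = (lborel :: real measure) \<Otimes>\<^sub>M (lborel :: (real \<times> real) measure)"
  have setsM: "sets M = sets ((borel :: real measure) \<Otimes>\<^sub>M (borel \<Otimes>\<^sub>M borel :: (real \<times> real) measure))"
    unfolding M_def by (intro sets_pair_measure_cong sets_borel_pair[symmetric]) simp
  have spM: "space M = UNIV" by (simp add: M_def space_pair_measure)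
  have t: "fst \<in> borel_measurable M" and w: "snd \<in> M \<rightarrow>\<^sub>M borel \<Otimes>\<^sub>M borel"
    using measurable_fst[of borel "borel \<Otimes>\<^sub>M borel"] measurable_snd[of borel "borel \<Otimes>\<^sub>M borel"]
    by (simp_all add: measurable_cong_sets[OF setsM refl])
  note w1 = measurable_compose[OF w measurable_fst] and w2 = measurable_compose[OF w measurable_snd]
  have flm: "(\<lambda>z. special_flow \<alpha> f (fst z) (h z)) \<in> M \<rightarrow>\<^sub>M borel \<Otimes>\<^sub>M borel" if h: "h \<in> M \<rightarrow>\<^sub>M borel \<Otimes>\<^sub>M borel" for h
  proof -
    have "(\<lambda>z. (fst (h z), snd (h z) + fst z)) \<in> M \<rightarrow>\<^sub>M borel \<Otimes>\<^sub>M borel"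
      by (intro measurable_Pair borel_measurable_add t measurable_compose[OF h measurable_fst] measurable_compose[OF h measurable_snd])
    from measurable_compose[OF this orbit_pt_measurable] show ?thesis by (simp add: flow_fst_snd)
  qed
  have D: "{z \<in> space M. \<phi>0 (special_flow \<alpha> f (fst z) (snd z)) = special_flow \<alpha> f (fst z) (\<phi>0 (snd z))} \<in> sets M"
    by (intro sets_eq_pair_fun flm measurable_compose[OF flm[OF w] \<phi>0] measurable_compose[OF w \<phi>0])
  have XM: "{z \<in> space M. snd z \<in> X} \<in> sets M"
    using measurable_sets[OF w X_borel] by (simp add: vimage_def Int_def conj_commute)
  have "{z \<in> space M. snd z \<in> X \<longrightarrow> \<phi>0 (special_flow \<alpha> f (fst z) (snd z)) = special_flow \<alpha> f (fst z) (\<phi>0 (snd z))} =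
     (space M - {z \<in> space M. snd z \<in> X}) \<union> {z \<in> space M. \<phi>0 (special_flow \<alpha> f (fst z) (snd z)) = special_flow \<alpha> f (fst z) (\<phi>0 (snd z))}"
    by auto
  also have "\<dots> \<in> sets M" by (intro sets.Un sets.compl_sets D XM)
  finally have "{z \<in> space M. snd z \<in> X \<longrightarrow> \<phi>0 (special_flow \<alpha> f (fst z) (snd z)) = special_flow \<alpha> f (fst z) (\<phi>0 (snd z))} \<in> sets M" .
  from lborel_pair.AE_commute[OF this[unfolded M_def]]
  have "AE w in lborel. AE t in lborel. w \<in> X \<longrightarrow> \<phi>0 (special_flow \<alpha> f t w) = special_flow \<alpha> f t (\<phi>0 w)"
    using com by simp
  then obtain N where N: "{w. \<not> (AE t in lborel. w \<in> X \<longrightarrow> \<phi>0 (special_flow \<alpha> f t w) = special_flow \<alpha> f t (\<phi>0 w))} \<subseteq> N"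
      "emeasure lborel N = 0" "N \<in> sets lborel"
    by (auto elim!: AE_E)
  have "AE w in (lborel :: (real \<times> real) measure). w \<notin> N" by (rule AE_not_in) (use N in \<open>auto simp: null_sets_def\<close>)
  then have "AE w in (lborel :: real measure) \<Otimes>\<^sub>M (lborel :: real measure). w \<notin> N" unfolding lborel_prod .
  from lborel_pair.AE_pair[OF this] have "AE x in lborel. AE s in lborel. (x, s) \<notin> N" .
  moreover have "{w \<in> space ((lborel :: real measure) \<Otimes>\<^sub>M (lborel :: real measure)). (fst w, snd w) \<notin> N} \<in> sets (lborel \<Otimes>\<^sub>M lborel)"
  proof -
    have "{w \<in> space ((lborel :: real measure) \<Otimes>\<^sub>M (lborel :: real measure)). (fst w, snd w) \<notin> N} = space lborel - N"
      unfolding lborel_prod by auto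
    then show ?thesis unfolding lborel_prod using N(3) by auto
  qed
  ultimately have "AE s in lborel. AE x in lborel. (x, s) \<notin> N" using lborel_pair.AE_commute[of "\<lambda>x s. (x, s) \<notin> N"] by blast
  \<comment> \<open>A height below \<open>a\<close> lies under the roof over every base
    point.\<close>
  from AE_lborel_ex[OF this a_pos] obtain s0 where s0: "0 < s0" "s0 < a" "AE x in lborel. (x, s0) \<notin> N" by blast
  define P0 where "P0 x = orbit_pt (fst (\<phi>0 (x, s0))) (snd (\<phi>0 (x, s0)) + (- s0))" for x
  have Pm: "P0 \<in> borel \<rightarrow>\<^sub>M borel \<Otimes>\<^sub>M borel"
  proof -
    have "(\<lambda>x. (x, s0)) \<in> borel \<rightarrow>\<^sub>M (borel \<Otimes>\<^sub>M borel)" by (intro measurable_Pair measurable_ident measurable_const) auto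
    from measurable_compose[OF measurable_compose[OF this \<phi>0] flow_measurable[of "- s0"]]
    show ?thesis by (simp add: P0_def[abs_def] flow_fst_snd)
  qed
  have "AE x in circle. AE u in lborel. \<phi>0 (orbit_pt x u) = special_flow \<alpha> f u (P0 x)"
    unfolding AE_circle using s0(3)
  proof eventually_elim
    fix x assume x: "(x, s0) \<notin> N"
    show "x \<in> {0..<1} \<longrightarrow> (AE u in lborel. \<phi>0 (orbit_pt x u) = special_flow \<alpha> f u (P0 x))"
    proof
      assume x1: "x \<in> {0..<1}"
      then have "(x, s0) \<in> X" using s0 f_ge[of x] by (auto simp: special_flow_space_def)
      then have "AE t in lborel. \<phi>0 (special_flow \<alpha> f t (x, s0)) = special_flow \<alpha> f t (\<phi>0 (x, s0))"
        using N(1) x by auto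
      from AE_lborel_shift[OF this, of "- s0"]
      show "AE u in lborel. \<phi>0 (orbit_pt x u) = special_flow \<alpha> f u (P0 x)"
        by eventually_elim (simp add: special_flow_eq P0_def flow_orbit_pt, simp add: flow_fst_snd algebra_simps)
    qed
  qed
  then show ?thesis using Pm orbit_pt_in by (intro bexI[OF _ Pm]) (auto simp: P0_def)
qed

text \<open>The image of one orbit is parametrised from \<open>x\<close> and from
  \<open>pt x m\<close>, with times differing by \<open>bs m x\<close>. The parametrisations agree
  for almost all times, hence for one time \<open>u\<close>, and flowing back by \<open>u\<close>
  gives the equality.\<close>

lemma orbit_cocycle:
  assumes P: "\<And>x. P0 x \<in> X"
    and K: "AE x in circle. AE u in lborel. \<phi>0 (orbit_pt x u) = special_flow \<alpha> f u (P0 x)"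
  shows "AE x in circle. \<forall>m. P0 (pt x m) = special_flow \<alpha> f (bs m x) (P0 x)"
proof -
  have "AE x in circle. \<forall>m. AE u in lborel. \<phi>0 (orbit_pt (pt x m) u) = special_flow \<alpha> f u (P0 (pt x m))"
    unfolding AE_all_countable pt_def using AE_circle_rotation[OF K] by blast
  with K show ?thesis
  proof eventually_elim
    fix x assume 1: "AE u in lborel. \<phi>0 (orbit_pt x u) = special_flow \<alpha> f u (P0 x)"
      and 2: "\<forall>m. AE u in lborel. \<phi>0 (orbit_pt (pt x m) u) = special_flow \<alpha> f u (P0 (pt x m))"
    show "\<forall>m. P0 (pt x m) = special_flow \<alpha> f (bs m x) (P0 x)"
    proof
      fix m
      have "AE u in lborel. \<phi>0 (orbit_pt x (u + bs m x)) = special_flow \<alpha> f (u + bs m x) (P0 x)"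
        using AE_lborel_shift[OF 1] .
      moreover have "AE u in lborel. \<phi>0 (orbit_pt (pt x m) u) = special_flow \<alpha> f u (P0 (pt x m))" using 2 by blast
      ultimately have "AE u in lborel. special_flow \<alpha> f u (P0 (pt x m)) = special_flow \<alpha> f (u + bs m x) (P0 x)"
        by eventually_elim (simp add: orbit_pt_pt)
      from AE_lborel_ex[OF this, of 0 1] obtain u where
        "special_flow \<alpha> f u (P0 (pt x m)) = special_flow \<alpha> f (u + bs m x) (P0 x)" by auto
      then have "special_flow \<alpha> f (- u) (special_flow \<alpha> f u (P0 (pt x m))) = special_flow \<alpha> f (- u) (special_flow \<alpha> f (u + bs m x) (P0 x))" by simp
      then show "P0 (pt x m) = special_flow \<alpha> f (bs m x) (P0 x)" by (simp add: flow_flow flow_0 P)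
    qed
  qed
qed

text \<open>Within time less than \<open>a\<close> a point crosses the roof at most once, so if
  \<open>fst (P0 x)\<close> lies in \<open>E\<close>, the part of the fibre over \<open>x\<close>
  below \<open>a\<close> is mapped over \<open>E\<close> or its rotation by \<open>\<alpha>\<close>.
  By preservation of the measure, \<open>a\<close> times the measure of such \<open>x\<close> is at
  most the integral of the roof over \<open>E'\<close>, which is small.\<close>

lemma fibre_ac:
  assumes P: "P0 \<in> borel \<rightarrow>\<^sub>M borel \<Otimes>\<^sub>M borel" "\<And>x. P0 x \<in> X"
    and \<phi>0: "\<phi>0 \<in> borel \<Otimes>\<^sub>M borel \<rightarrow>\<^sub>M borel \<Otimes>\<^sub>M borel"
    and pres: "\<And>A. A \<in> sets (borel \<Otimes>\<^sub>M borel) \<Longrightarrow> emeasure lborel {w\<in>X. \<phi>0 w \<in> A} = emeasure lborel (X \<inter> A)"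
    and K: "AE x in circle. AE u in lborel. \<phi>0 (orbit_pt x u) = special_flow \<alpha> f u (P0 x)"
    and \<eta>: "0 < \<eta>"
  shows "\<exists>\<kappa>>0. \<forall>E\<in>sets borel. measure circle E \<le> \<kappa> \<longrightarrow> measure circle {x. fst (P0 x) \<in> E} \<le> \<eta>"
proof -
  obtain d where d: "0 < d" "\<And>E. E \<in> sets borel \<Longrightarrow> measure circle E \<le> d \<Longrightarrow>
      (\<integral>\<^sup>+x. ennreal (f (frac x)) * indicator E x \<partial>circle) \<le> ennreal (a * \<eta>)"
    using f_absolutely_continuous[of "a * \<eta>"] a_pos \<eta> by auto
  have "measure circle {x. fst (P0 x) \<in> E} \<le> \<eta>" if E: "E \<in> sets borel" "measure circle E \<le> d / 2" for E
  proof -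
    define E1 where "E1 = {y. frac (y + - \<alpha>) \<in> E}"
    define E' where "E' = E \<union> E1"
    have E1: "E1 \<in> sets borel" unfolding E1_def
      using measurable_sets_borel[of "\<lambda>y. frac (y + - \<alpha>)" borel E] E(1) by (simp add: vimage_def)
    have E': "E' \<in> sets borel" unfolding E'_def using E(1) E1 by auto
    have mE1: "measure circle E1 = measure circle E" unfolding E1_def by (rule measure_circle_rotation[OF E(1)])
    have "measure circle E' \<le> measure circle E + measure circle E1"
      unfolding E'_def by (rule measure_Un_le) (use E E1 in auto)
    then have mE': "measure circle E' \<le> d" using E(2) mE1 by simp
    have YE: "{x. fst (P0 x) \<in> E} \<in> sets borel"
      using measurable_sets_borel[OF measurable_compose[OF P(1) measurable_fst] E(1)] by (simp add: vimage_def)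
    have A: "fst -` E' \<in> sets (borel \<Otimes>\<^sub>M (borel :: real measure))"
      using measurable_sets[OF measurable_fst E', of borel] by (simp add: space_pair_measure)
    have m: "(\<lambda>w. indicator (fst -` E') (\<phi>0 w) :: ennreal) \<in> borel_measurable (borel \<Otimes>\<^sub>M borel)"
      by (rule measurable_compose[OF \<phi>0 borel_measurable_indicator[OF A]])
    have "ennreal a * emeasure circle {x. fst (P0 x) \<in> E} = (\<integral>\<^sup>+x. ennreal a * indicator {x. fst (P0 x) \<in> E} x \<partial>circle)"
      using YE by (simp add: nn_integral_cmult_indicator)
    also have "\<dots> \<le> (\<integral>\<^sup>+x. (\<integral>\<^sup>+s. indicator (fst -` E') (\<phi>0 (x, s)) * indicator {0..<f (frac x)} s \<partial>lborel) \<partial>circle)"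
    proof (rule nn_integral_mono_AE)
      have "AE x in circle. x \<in> {0..<1}" unfolding AE_circle by simp
      with K show "AE x in circle. ennreal a * indicator {x. fst (P0 x) \<in> E} x \<le> (\<integral>\<^sup>+s. indicator (fst -` E') (\<phi>0 (x, s)) * indicator {0..<f (frac x)} s \<partial>lborel)"
      proof eventually_elim
        fix x assume K: "AE u in lborel. \<phi>0 (orbit_pt x u) = special_flow \<alpha> f u (P0 x)" and x: "x \<in> {0..<1}"
        show "ennreal a * indicator {x. fst (P0 x) \<in> E} x \<le> (\<integral>\<^sup>+s. indicator (fst -` E') (\<phi>0 (x, s)) * indicator {0..<f (frac x)} s \<partial>lborel)"
        proof (cases "fst (P0 x) \<in> E")
          case True
          have "ennreal a * indicator {x. fst (P0 x) \<in> E} x = (\<integral>\<^sup>+s. indicator {0..<a} s \<partial>lborel)" using True a_pos by simp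
          also have "\<dots> \<le> (\<integral>\<^sup>+s. indicator (fst -` E') (\<phi>0 (x, s)) * indicator {0..<f (frac x)} s \<partial>lborel)"
          proof (rule nn_integral_mono_AE)
            show "AE s in lborel. indicator {0..<a} s \<le> (indicator (fst -` E') (\<phi>0 (x, s)) * indicator {0..<f (frac x)} s :: ennreal)"
              using K
            proof eventually_elim
              fix s assume s: "\<phi>0 (orbit_pt x s) = special_flow \<alpha> f s (P0 x)"
              show "indicator {0..<a} s \<le> (indicator (fst -` E') (\<phi>0 (x, s)) * indicator {0..<f (frac x)} s :: ennreal)"
              proof (cases "s \<in> {0..<a}")
                case True
                have fa: "a \<le> f (frac x)" using f_ge[of "frac x"] by (simp add: frac_lt_1)
                have "orbit_pt x s = (x, s)" using True fa x by (intro orbit_pt_id) (auto simp: X_eq)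
                define y v where "y = fst (P0 x)" and "v = snd (P0 x)"
                have yv: "0 \<le> y" "y < 1" "0 \<le> v" "v < f y" using P(2)[of x] by (auto simp: y_def v_def special_flow_space_def)
                have py: "pt y 0 = y" using yv by (simp add: pt_def frac_eq)
                have b: "bs 0 y = 0" "bs 1 y = f y" "bs 2 y \<ge> f y + a"
                  using bs_Suc[of 1 y] f_pt_ge[of y 1] by (auto simp: bs_0 bs_1 py)
                have "\<phi>0 (x, s) = orbit_pt y (v + s)" using s \<open>orbit_pt x s = (x, s)\<close> by (simp add: flow_fst_snd y_def v_def)
                moreover have "orbit_pt y (v + s) = (pt y 0, v + s - bs 0 y) \<or> orbit_pt y (v + s) = (pt y 1, v + s - bs 1 y)"
                proof (cases "v + s < f y")
                  case True
                  then show ?thesis using b yv \<open>s \<in> {0..<a}\<close> by (intro disjI1 orbit_pt_eq) auto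
                next
                  case False
                  then show ?thesis using b yv \<open>s \<in> {0..<a}\<close> by (intro disjI2 orbit_pt_eq) auto
                qed
                moreover have "y \<in> E'" using \<open>fst (P0 x) \<in> E\<close> by (simp add: E'_def y_def)
                moreover have "pt y 1 \<in> E'"
                proof -
                  have "frac (pt y 1 + - \<alpha>) = pt (pt y 1) (- 1)" by (simp add: pt_def)
                  also have "\<dots> = y" by (simp add: pt_pt py)
                  finally show ?thesis using \<open>fst (P0 x) \<in> E\<close> by (simp add: E'_def E1_def y_def)
                qed
                ultimately have "fst (\<phi>0 (x, s)) \<in> E'" using py by auto
                then show ?thesis using True fa by simp
              qed simp
            qed
          qed
          finally show ?thesis .
        qed simp
      qed
    qed
    also have "\<dots> = (\<integral>\<^sup>+w. indicator (fst -` E') (\<phi>0 w) * indicator X w \<partial>lborel)"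
      using nn_integral_X[OF m] by simp
    also have "\<dots> = emeasure lborel {w\<in>X. \<phi>0 w \<in> fst -` E'}"
    proof -
      have "{w\<in>X. \<phi>0 w \<in> fst -` E'} = X \<inter> (\<phi>0 -` (fst -` E') \<inter> space (borel \<Otimes>\<^sub>M borel))" by (auto simp: space_pair_measure)
      also have "\<dots> \<in> sets (borel \<Otimes>\<^sub>M borel)" by (rule sets.Int[OF X_borel measurable_sets[OF \<phi>0 A]])
      finally have "{w\<in>X. \<phi>0 w \<in> fst -` E'} \<in> sets lborel" unfolding sets_borel_pair .
      then have "emeasure lborel {w\<in>X. \<phi>0 w \<in> fst -` E'} = (\<integral>\<^sup>+w. indicator {w\<in>X. \<phi>0 w \<in> fst -` E'} w \<partial>lborel)"
        by (rule nn_integral_indicator[symmetric])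
      also have "\<dots> = (\<integral>\<^sup>+w. indicator (fst -` E') (\<phi>0 w) * indicator X w \<partial>lborel)"
        by (intro nn_integral_cong) (auto simp: indicator_def)
      finally show ?thesis ..
    qed
    also have "\<dots> = emeasure lborel (X \<inter> fst -` E')" by (rule pres[OF A])
    also have "\<dots> = (\<integral>\<^sup>+w. indicator (fst -` E') w * indicator X w \<partial>lborel)"
    proof -
      have "X \<inter> fst -` E' \<in> sets lborel" using sets.Int[OF X_borel A] unfolding sets_borel_pair .
      then have "emeasure lborel (X \<inter> fst -` E') = (\<integral>\<^sup>+w. indicator (X \<inter> fst -` E') w \<partial>lborel)"
        by (rule nn_integral_indicator[symmetric])
      also have "\<dots> = (\<integral>\<^sup>+w. indicator (fst -` E') w * indicator X w \<partial>lborel)"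
        by (intro nn_integral_cong) (auto simp: indicator_def)
      finally show ?thesis .
    qed
    also have "\<dots> = (\<integral>\<^sup>+x. (\<integral>\<^sup>+s. indicator (fst -` E') (x, s) * indicator {0..<f (frac x)} s \<partial>lborel) \<partial>circle)"
      by (rule nn_integral_X[OF borel_measurable_indicator[OF A]])
    also have "\<dots> = (\<integral>\<^sup>+x. ennreal (f (frac x)) * indicator E' x \<partial>circle)"
    proof (rule nn_integral_cong)
      fix x
      have "0 \<le> f (frac x)" using f_ge[of "frac x"] a_pos by (simp add: frac_lt_1 order.trans[OF less_imp_le])
      then show "(\<integral>\<^sup>+s. indicator (fst -` E') (x, s) * indicator {0..<f (frac x)} s \<partial>lborel) = ennreal (f (frac x)) * indicator E' x"
        by (cases "x \<in> E'") auto
    qed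
    also have "\<dots> \<le> ennreal (a * \<eta>)" by (rule d(2)[OF E' mE'])
    finally have "ennreal (a * measure circle {x. fst (P0 x) \<in> E}) \<le> ennreal (a * \<eta>)"
      using a_pos by (simp add: circle.emeasure_eq_measure ennreal_mult)
    then have "a * measure circle {x. fst (P0 x) \<in> E} \<le> a * \<eta>"
      using a_pos \<eta> by (subst (asm) ennreal_le_iff) auto
    then show ?thesis using a_pos by simp
  qed
  then show ?thesis using d(1) by (intro exI[of _ "d / 2"]) auto
qed

text \<open>Carries the result about the base map back to the flow: \<open>P0 x\<close> is
  \<open>(x, 0)\<close> moved for time \<open>t0\<close>, and on almost every fibre the map is the
  flow applied to \<open>P0 x\<close>; Fubini then gives agreement almost everywhere.\<close>

theorem centralizer_flow:
  assumes growth: "\<And>n. real (q (Suc n)) \<le> Cg * (real (q n))\<^sup>2"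
    and gaps: "\<And>(T::real) n0. \<exists>n\<ge>n0. T * q n * ln (q n) \<le> q (Suc n)"
    and \<phi>: "\<phi> \<in> centralizer (special_flow_measure f) (special_flow \<alpha> f)"
  shows "\<exists>t0. AE w in special_flow_measure f. \<phi> w = special_flow \<alpha> f t0 w"
proof -
  have \<phi>m: "\<phi> \<in> measurable (special_flow_measure f) (special_flow_measure f)"
    and \<phi>d: "distr (special_flow_measure f) (special_flow_measure f) \<phi> = special_flow_measure f"
    and \<phi>c: "\<And>t. AE w in lborel. w \<in> X \<longrightarrow> \<phi> (special_flow \<alpha> f t w) = special_flow \<alpha> f t (\<phi> w)"
    using \<phi> unfolding centralizer_def automorphism_def AE_X by auto
  obtain \<phi>0 where \<phi>0: "\<phi>0 \<in> borel \<Otimes>\<^sub>M borel \<rightarrow>\<^sub>M borel \<Otimes>\<^sub>M borel" and eq: "AE w in lborel. w \<in> X \<longrightarrow> \<phi> w = \<phi>0 w"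
    using borel_version[OF \<phi>m] by blast
  have com: "AE w in lborel. w \<in> X \<longrightarrow> \<phi>0 (special_flow \<alpha> f t w) = special_flow \<alpha> f t (\<phi>0 w)" for t
    using \<phi>c[of t] eq AE_flow[OF eq, of t] by eventually_elim auto
  have pres: "emeasure lborel {w\<in>X. \<phi>0 w \<in> A} = emeasure lborel (X \<inter> A)" if A: "A \<in> sets (borel \<Otimes>\<^sub>M borel)" for A
  proof -
    have XA: "X \<inter> A \<in> sets lborel" using sets.Int[OF X_borel A] unfolding sets_borel_pair .
    then have XA': "X \<inter> A \<in> sets (special_flow_measure f)" by (auto simp: sets_X)
    have "{w\<in>X. \<phi>0 w \<in> A} = X \<inter> (\<phi>0 -` A \<inter> space (borel \<Otimes>\<^sub>M borel))" by (auto simp: space_pair_measure)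
    also have "\<dots> \<in> sets (borel \<Otimes>\<^sub>M borel)" by (rule sets.Int[OF X_borel measurable_sets[OF \<phi>0 A]])
    finally have s0: "{w\<in>X. \<phi>0 w \<in> A} \<in> sets lborel" unfolding sets_borel_pair .
    have \<phi>X: "\<phi> w \<in> X" if "w \<in> X" for w using measurable_space[OF \<phi>m, of w] that by (simp add: space_X)
    have pre: "\<phi> -` (X \<inter> A) \<inter> X = {w\<in>X. \<phi> w \<in> A}" using \<phi>X by auto
    have s: "{w\<in>X. \<phi> w \<in> A} \<in> sets lebesgue" using measurable_sets[OF \<phi>m XA'] unfolding space_X pre sets_X by blast
    have "emeasure lborel (X \<inter> A) = emeasure (special_flow_measure f) (X \<inter> A)" using XA by (simp add: emeasure_X)
    also have "\<dots> = emeasure (distr (special_flow_measure f) (special_flow_measure f) \<phi>) (X \<inter> A)" by (simp add: \<phi>d)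
    also have "\<dots> = emeasure lebesgue {w\<in>X. \<phi> w \<in> A}"
      unfolding emeasure_distr[OF \<phi>m XA'] space_X pre by (rule emeasure_X) auto
    also have "\<dots> = emeasure lebesgue {w\<in>X. \<phi>0 w \<in> A}"
    proof (rule emeasure_eq_AE)
      show "AE w in lebesgue. w \<in> {w\<in>X. \<phi> w \<in> A} \<longleftrightarrow> w \<in> {w\<in>X. \<phi>0 w \<in> A}"
        unfolding AE_completion_iff using eq by eventually_elim auto
    qed (use s s0 in auto)
    also have "\<dots> = emeasure lborel {w\<in>X. \<phi>0 w \<in> A}" using s0 by simp
    finally show ?thesis ..
  qed
  obtain P0 where Pm: "P0 \<in> borel \<rightarrow>\<^sub>M borel \<Otimes>\<^sub>M borel" and PX: "\<And>x. P0 x \<in> X"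
    and K: "AE x in circle. AE u in lborel. \<phi>0 (orbit_pt x u) = special_flow \<alpha> f u (P0 x)"
    using commute_along_orbits[OF \<phi>0 com] by blast
  define Y where "Y x = fst (P0 x)" for x
  define V where "V x = snd (P0 x)" for x
  have YV: "0 \<le> Y x" "Y x < 1" "0 \<le> V x" "V x < f (Y x)" for x
    using PX[of x] by (auto simp: Y_def V_def special_flow_space_def)
  interpret base_map \<alpha> f am ap G a g g1 g2 Y V Cg
  proof unfold_locales
    show "Y \<in> borel_measurable borel" "V \<in> borel_measurable borel"
      using measurable_compose[OF Pm measurable_fst] measurable_compose[OF Pm measurable_snd] by (simp_all add: Y_def[abs_def] V_def[abs_def])
    show "0 \<le> Y x \<and> Y x < 1" "0 \<le> V x \<and> V x < f (Y x)" for x using YV by auto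
    show "AE x in circle. \<forall>m. \<exists>k. Y (pt x m) = pt (Y x) k \<and> V (pt x m) = V x + bs m x - bs k (Y x)"
      using orbit_cocycle[OF PX K]
    proof eventually_elim
      fix x assume x: "\<forall>m. P0 (pt x m) = special_flow \<alpha> f (bs m x) (P0 x)"
      show "\<forall>m. \<exists>k. Y (pt x m) = pt (Y x) k \<and> V (pt x m) = V x + bs m x - bs k (Y x)"
      proof
        fix m
        have "P0 (pt x m) = orbit_pt (Y x) (V x + bs m x)" using x by (simp add: flow_fst_snd Y_def V_def)
        then show "\<exists>k. Y (pt x m) = pt (Y x) k \<and> V (pt x m) = V x + bs m x - bs k (Y x)"
          by (intro exI[of _ "idx (Y x) (V x + bs m x)"]) (simp add: Y_def V_def orbit_pt_def)
      qed
    qed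
    show "\<exists>\<kappa>>0. \<forall>E\<in>sets borel. measure circle E \<le> \<kappa> \<longrightarrow> measure circle {x. Y x \<in> E} \<le> \<eta>" if "0 < \<eta>" for \<eta>
      unfolding Y_def by (rule fibre_ac[OF Pm PX \<phi>0 pres K that])
  qed (use f_meas f_int growth in auto)
  obtain t0 where t0: "AE x in circle. \<exists>i. Y x = pt x i \<and> V x + bs i x = t0" using flow_shift[OF gaps] by blast
  have "AE x in circle. AE s in lborel. (x, s) \<in> X \<longrightarrow> \<phi>0 (x, s) = special_flow \<alpha> f t0 (x, s)"
    using t0 K
  proof eventually_elim
    fix x assume "\<exists>i. Y x = pt x i \<and> V x + bs i x = t0"
      and K: "AE u in lborel. \<phi>0 (orbit_pt x u) = special_flow \<alpha> f u (P0 x)"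
    then obtain i where i: "Y x = pt x i" "V x + bs i x = t0" by blast
    have "orbit_pt x t0 = (pt x i, t0 - bs i x)"
      by (rule orbit_pt_eq) (use i YV[of x] bs_Suc[of i x] in auto)
    then have P: "P0 x = orbit_pt x t0" using i by (simp add: Y_def V_def prod_eq_iff)
    from K show "AE s in lborel. (x, s) \<in> X \<longrightarrow> \<phi>0 (x, s) = special_flow \<alpha> f t0 (x, s)"
    proof eventually_elim
      fix s assume s: "\<phi>0 (orbit_pt x s) = special_flow \<alpha> f s (P0 x)"
      show "(x, s) \<in> X \<longrightarrow> \<phi>0 (x, s) = special_flow \<alpha> f t0 (x, s)"
      proof
        assume "(x, s) \<in> X"
        then show "\<phi>0 (x, s) = special_flow \<alpha> f t0 (x, s)"
          using s by (simp add: orbit_pt_id P flow_orbit_pt special_flow_eq add.commute)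
      qed
    qed
  qed
  then have ae: "AE x in lborel. AE s in lborel. (x, s) \<in> X \<longrightarrow> \<phi>0 (x, s) = special_flow \<alpha> f t0 (x, s)"
    unfolding AE_circle
  proof eventually_elim
    fix x assume "x \<in> {0..<1} \<longrightarrow> (AE s in lborel. (x, s) \<in> X \<longrightarrow> \<phi>0 (x, s) = special_flow \<alpha> f t0 (x, s))"
    then show "AE s in lborel. (x, s) \<in> X \<longrightarrow> \<phi>0 (x, s) = special_flow \<alpha> f t0 (x, s)"
      by (cases "x \<in> {0..<1}") (auto simp: special_flow_space_def)
  qed
  have "AE w in (lborel :: real measure) \<Otimes>\<^sub>M (lborel :: real measure). w \<in> X \<longrightarrow> \<phi>0 w = special_flow \<alpha> f t0 w"
  proof (rule lborel_pair.AE_pair_measure[OF _ ae])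
    have "{w \<in> space (borel \<Otimes>\<^sub>M borel). w \<in> X \<longrightarrow> \<phi>0 w = special_flow \<alpha> f t0 w} =
      (space (borel \<Otimes>\<^sub>M borel) - X) \<union> {w \<in> space (borel \<Otimes>\<^sub>M borel). \<phi>0 w = special_flow \<alpha> f t0 w}" by auto
    also have "\<dots> \<in> sets (borel \<Otimes>\<^sub>M borel)"
      by (intro sets.Un sets.compl_sets X_borel sets_eq_pair_fun \<phi>0 flow_measurable)
    finally have "{w. w \<in> X \<longrightarrow> \<phi>0 w = special_flow \<alpha> f t0 w} \<in> sets (borel \<Otimes>\<^sub>M borel)" by (simp add: space_pair_measure)
    then have "{w. w \<in> X \<longrightarrow> \<phi>0 w = special_flow \<alpha> f t0 w} \<in> sets lborel" unfolding sets_borel_pair .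
    then show "{w \<in> space (lborel \<Otimes>\<^sub>M lborel). w \<in> X \<longrightarrow> \<phi>0 w = special_flow \<alpha> f t0 w} \<in> sets ((lborel :: real measure) \<Otimes>\<^sub>M (lborel :: real measure))"
      unfolding lborel_prod by simp
  qed
  then have "AE w in lborel. w \<in> X \<longrightarrow> \<phi>0 w = special_flow \<alpha> f t0 w" unfolding lborel_prod .
  with eq have "AE w in lborel. w \<in> X \<longrightarrow> \<phi> w = special_flow \<alpha> f t0 w" by eventually_elim auto
  then show ?thesis unfolding AE_X by blast
qed

end

section \<open>The class of rotation numbers and the roof\<close>

lemma ln_powr_le_linear:
  assumes "2 \<le> (x::real)" shows "ln x powr (3/2) \<le> (3/2) powr (3/2) * x"
  using ln_powr_bound2[of x "3/2"] assms by simp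

context irrational_rotation
begin

text \<open>The power of the logarithm is at most linear. The summands \<open>q 1\<close> and
  \<open>q 2\<close> cover the indices with \<open>q n = 1\<close>, which are at most 1 and on which
  the class imposes nothing.\<close>

lemma quadratic_growth:
  assumes C: "\<And>n. 2 \<le> q n \<Longrightarrow> real (q (Suc n)) < C * real (q n) * ln (real (q n)) powr (3/2)"
  shows "\<exists>Cg. \<forall>n. real (q (Suc n)) \<le> Cg * (real (q n))\<^sup>2"
proof -
  define Cg where "Cg = \<bar>C\<bar> * (3/2) powr (3/2) + real (q 1) + real (q 2)"
  have "real (q (Suc n)) \<le> Cg * (real (q n))\<^sup>2" for n
  proof (cases "2 \<le> q n")
    case True
    have "real (q (Suc n)) \<le> C * real (q n) * ln (real (q n)) powr (3/2)" using C[OF True] by simp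
    also have "\<dots> \<le> \<bar>C\<bar> * real (q n) * ln (real (q n)) powr (3/2)" by (intro mult_right_mono) auto
    also have "\<dots> \<le> \<bar>C\<bar> * real (q n) * ((3/2) powr (3/2) * real (q n))"
      using ln_powr_le_linear[of "real (q n)"] True by (intro mult_left_mono) auto
    also have "\<dots> = (\<bar>C\<bar> * (3/2) powr (3/2)) * (real (q n))\<^sup>2" by (simp add: power2_eq_square)
    also have "\<dots> \<le> Cg * (real (q n))\<^sup>2" unfolding Cg_def by (intro mult_right_mono) auto
    finally show ?thesis .
  next
    case False
    then have q1: "q n = 1" using q_pos[of n] by linarith
    then have "n \<le> 1" using q_ge[of n] by linarith
    then have "Suc n = 1 \<or> Suc n = 2" by linarith
    then have "real (q (Suc n)) \<le> real (q 1) + real (q 2)" by (metis le_add_same_cancel1 le_add_same_cancel2 of_nat_0_le_iff)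
    also have "\<dots> \<le> Cg" by (simp add: Cg_def)
    finally show ?thesis by (simp add: q1)
  qed
  then show ?thesis by blast
qed

text \<open>The factor \<open>ln (ln (q n))\<close> eventually exceeds any \<open>T\<close>;
  \<open>M\<close> is the double exponential at which this happens. Taking the maximum with 1 also
  gives \<open>2 \<le> q n\<close>, so that the condition \<open>k\<close> is in force.\<close>

lemma large_gaps:
  fixes nk :: "nat \<Rightarrow> nat" and T :: real
  assumes nk: "strict_mono nk" and k: "\<And>k. 2 \<le> q (nk k) \<Longrightarrow>
      real (q (Suc (nk k))) \<ge> real (q (nk k)) * ln (real (q (nk k))) * ln (ln (real (q (nk k))))"
  shows "\<exists>n\<ge>n0. T * q n * ln (q n) \<le> q (Suc n)"
proof -
  define M where "M = exp (exp (max T 1))"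
  define j where "j = max n0 (nat \<lceil>M\<rceil>)"
  define n where "n = nk j"
  have jn: "j \<le> n" unfolding n_def by (rule strict_mono_imp_increasing[OF nk])
  have M: "M \<le> real (q n)" using q_ge[of n] jn unfolding j_def by linarith
  have "2 \<le> M"
  proof -
    have "1 \<le> max T 1" by simp
    then have "2 \<le> exp (max T 1)" using exp_ge_add_one_self[of "max T 1"] by linarith
    then show ?thesis using exp_ge_add_one_self[of "exp (max T 1)"] unfolding M_def by linarith
  qed
  then have q2: "2 \<le> q n" using M by linarith
  have "ln M \<le> ln (real (q n))" using M \<open>2 \<le> M\<close> by (subst ln_le_cancel_iff) auto
  then have l1: "exp (max T 1) \<le> ln (real (q n))" by (simp add: M_def)
  then have l0: "0 < ln (real (q n))" using exp_gt_zero[of "max T 1"] by linarith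
  have "ln (exp (max T 1)) \<le> ln (ln (real (q n)))" using l1 l0 by (subst ln_le_cancel_iff) auto
  then have "T \<le> ln (ln (real (q n)))" by simp
  then have "T * (q n * ln (q n)) \<le> ln (ln (real (q n))) * (q n * ln (q n))" using l0 by (intro mult_right_mono) auto
  also have "\<dots> \<le> q (Suc n)" using k[of j] q2 by (simp add: n_def mult_ac)
  finally show ?thesis using jn by (intro exI[of _ n]) (auto simp: j_def mult_ac)
qed

end

lemma C2_circle_bounded:
  assumes "C2_circle g"
  shows "\<exists>g1 g2 G. (\<forall>x. (g has_real_derivative g1 x) (at x)) \<and> (\<forall>x. (g1 has_real_derivative g2 x) (at x)) \<and>
    (\<forall>x\<in>{0..1}. \<bar>g x\<bar> \<le> G \<and> \<bar>g1 x\<bar> \<le> G \<and> \<bar>g2 x\<bar> \<le> G)"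
proof -
  obtain g1 g2 where g: "\<And>x. (g has_real_derivative g1 x) (at x)" "\<And>x. (g1 has_real_derivative g2 x) (at x)"
    "continuous_on UNIV g2" using assms unfolding C2_circle_def by blast
  have bd: "\<exists>B. \<forall>x\<in>{0..1}. \<bar>h x\<bar> \<le> B" if "continuous_on {0..1} h" for h :: "real \<Rightarrow> real"
    using compact_imp_bounded[OF compact_continuous_image[OF that compact_Icc]] by (auto simp: bounded_iff)
  have "continuous_on {0..1} g" "continuous_on {0..1} g1" "continuous_on {0..1} g2"
    using g by (auto intro!: DERIV_continuous_on continuous_on_subset[OF g(3)] intro: has_field_derivative_at_within)
  then obtain B0 B1 B2 where B: "\<forall>x\<in>{0..1}. \<bar>g x\<bar> \<le> B0" "\<forall>x\<in>{0..1}. \<bar>g1 x\<bar> \<le> B1" "\<forall>x\<in>{0..1}. \<bar>g2 x\<bar> \<le> B2"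
    using bd by meson
  have "\<forall>x\<in>{0..1}. \<bar>g x\<bar> \<le> max B0 (max B1 B2) \<and> \<bar>g1 x\<bar> \<le> max B0 (max B1 B2) \<and> \<bar>g2 x\<bar> \<le> max B0 (max B1 B2)"
    using B by (auto simp: le_max_iff_disj)
  then show ?thesis using g by blast
qed

lemma roof_periodic_integral:
  assumes int: "(LINT x:{0..<1}|lborel. f x) = (1::real)" and pos: "\<And>x. 0 \<le> x \<Longrightarrow> x < 1 \<Longrightarrow> (0::real) \<le> f x"
  shows "(\<lambda>x. f (frac x)) \<in> borel_measurable borel \<and> (\<integral>\<^sup>+x. ennreal (f (frac x)) \<partial>circle) = 1"
proof -
  define h where "h x = indicator {0..<1} x *\<^sub>R f x" for x :: real
  have h1: "integral\<^sup>L lborel h = 1" using int by (simp add: h_def[abs_def] set_lebesgue_integral_def)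
  \<comment> \<open>A non-integrable function would have the default integral 0 instead of
    1.\<close>
  then have ih: "integrable lborel h" using not_integrable_integral_eq[of lborel h] by fastforce
  then have hm: "h \<in> borel_measurable borel" by simp
  have fh: "f (frac x) = h (frac x)" for x by (simp add: h_def frac_lt_1)
  have fm: "(\<lambda>x. f (frac x)) \<in> borel_measurable borel"
    unfolding fh by (rule measurable_compose[OF frac_measurable hm])
  have "(\<integral>\<^sup>+x. ennreal (f (frac x)) \<partial>circle) = (\<integral>\<^sup>+x. ennreal (f (frac x)) * indicator {0..<1} x \<partial>lborel)"
    by (rule nn_integral_circle[OF measurable_compose[OF fm measurable_ennreal]])
  also have "\<dots> = (\<integral>\<^sup>+x. ennreal (h x) \<partial>lborel)"
    by (intro nn_integral_cong) (auto simp: h_def indicator_def frac_eq)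
  also have "\<dots> = ennreal (integral\<^sup>L lborel h)"
    by (rule nn_integral_eq_integral[OF ih]) (auto simp: h_def indicator_def pos)
  finally show ?thesis using fm h1 by simp
qed

theorem theorem4p2:
  fixes \<alpha> :: real and f :: "real \<Rightarrow> real"
  assumes "\<alpha> \<in> class_D" and "arnold_roof f"
  shows "(\<forall>t0. special_flow \<alpha> f t0 \<in> centralizer (special_flow_measure f) (special_flow \<alpha> f)) \<and>
    (\<forall>\<phi> \<in> centralizer (special_flow_measure f) (special_flow \<alpha> f).
       \<exists>t0. AE p in special_flow_measure f. \<phi> p = special_flow \<alpha> f t0 p)"
proof -
  obtain C and nk :: "nat \<Rightarrow> nat" where \<alpha>: "0 < \<alpha>" "\<alpha> < 1" "\<alpha> \<notin> \<rat>"
    and C: "\<And>n. 2 \<le> cf_denom \<alpha> n \<Longrightarrow> real (cf_denom \<alpha> (Suc n)) < C * real (cf_denom \<alpha> n) * ln (real (cf_denom \<alpha> n)) powr (3/2)"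
    and nk: "strict_mono nk" "\<And>k. 2 \<le> cf_denom \<alpha> (nk k) \<Longrightarrow> real (cf_denom \<alpha> (Suc (nk k)))
          \<ge> real (cf_denom \<alpha> (nk k)) * ln (real (cf_denom \<alpha> (nk k))) * ln (ln (real (cf_denom \<alpha> (nk k))))"
    using assms(1) unfolding class_D_def by auto
  obtain am ap g a where A: "ap < am" "0 \<le> ap" "C2_circle g" "\<forall>x\<in>{0<..<1}. f x = - am * ln x - ap * ln (1 - x) + g x"
    "0 < a" "\<forall>x\<in>{0..<1}. a \<le> f x" "(LINT x:{0..<1}|lborel. f x) = 1"
    using assms(2) unfolding arnold_roof_def by auto
  obtain g1 g2 G where g: "\<And>x. (g has_real_derivative g1 x) (at x)" "\<And>x. (g1 has_real_derivative g2 x) (at x)"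
    "\<And>x. 0 \<le> x \<Longrightarrow> x \<le> 1 \<Longrightarrow> \<bar>g x\<bar> \<le> G \<and> \<bar>g1 x\<bar> \<le> G \<and> \<bar>g2 x\<bar> \<le> G"
    using C2_circle_bounded[OF A(3)] by fastforce
  have pos: "0 \<le> f x" if "0 \<le> x" "x < 1" for x
  proof -
    have "a \<le> f x" using A(6) that by auto
    then show ?thesis using A(5) by linarith
  qed
  note fm = roof_periodic_integral[OF A(7) pos]
  interpret arnold_flow \<alpha> f am ap G a g g1 g2
    by unfold_locales (use \<alpha> A g fm in auto)
  \<comment> \<open>Clause (2) of the class supplies the polynomial growth, and clause (3) the gaps
    passed to \<open>centralizer_flow\<close>.\<close>
  obtain Cg where Cg: "\<And>n. real (cf_denom \<alpha> (Suc n)) \<le> Cg * (real (cf_denom \<alpha> n))\<^sup>2"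
    using quadratic_growth[OF C] by blast
  show ?thesis
    using flow_in_centralizer centralizer_flow[OF Cg large_gaps[OF nk]] by blast
qed

end
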